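(* Fix a constant $\epsilon>0$. The expected runtime (including preprocessing) of the algorithm "Sampler for Pólya trees" described in the context, run with parameter $n\ge2$, is $O(n)$ in the unit-cost real-arithmetic computational model described in the context.
   Context: Computational model. Unit-cost real-arithmetic RAM: arithmetic operations, comparisons, and evaluations of $\exp$, $\log$, $\cosh$ have unit cost; so does the generation of independent $\mathrm{Uniform}([0,1])$ and $\mathrm{Poisson}(1)$ random variables, fixed-parameter geometric random variables, and uniform integers from intervals. Basics. A Pólya tree is a rooted unordered unlabelled tree, i.e. a rooted tree considered up to isomorphism; $|T|$ is its number of vertices. A forest is a finite multiset of Pólya trees (possibly empty, $\emptyset$); $|f|$ is the total number of vertices of a forest $f$. Let $a_k$ be the number of Pólya trees with $k$ vertices, $A(z)=\sum_{k\ge1}a_kz^k$, and let $\rho\approx0.338321$ be the radius of convergence of $A$; it is known that $A(\rho)=1$, that $a_n\sim c_An^{-3/2}\rho^{-n}$ for a constant $c_A>0$, and that $\rho$ can be approximated up to $2^{-k}$ with a number of arithmetic operations polynomial in $k$. Set $\Phi(z)=\exp\big(\sum_{i\ge2}A(z^i)/i\big)$, which has radius of convergence $\sqrt\rho$. $\mathbb N=\{1,2,\dots\}$, $\mathbb N_0=\{0,1,2,\dots\}$. Elementary samplers (every call uses fresh independent randomness). A $\mathrm{Bernoulli}(p)$ variable is generated by comparing a uniform variable with successively refined approximations of $p$ until the comparison is decided. $\mathrm{Poisson}(x)$ samples a Poisson variable with mean $x$: with a fixed integer $M_0$ exceeding all parameters $x$ used, draw $N'$ as a sum of $M_0$ independent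 $\mathrm{Poisson}(1)$ variables and return the sum of $N'$ independent $\mathrm{Bernoulli}(x/M_0)$ variables. $\mathrm{Poisson}_{\ge1}(x)$, $0<x\le1$, samples a Poisson variable with mean $x$ conditioned to be positive: repeat drawing $Z=1+\mathrm{Poisson}(x)$ until it is accepted, where $Z$ is accepted with probability $1/Z$. $\mathrm{MAXINDEX}(s)$, $0<s\le\rho^{3/4}$, samples $K\in\mathbb N_0$ with $\mathbb P(K\le k)=\Phi(s)^{-1}\exp\big(\sum_{i=2}^kA(s^i)/i\big)$ for $k\in\mathbb N_0$ (empty sum $=0$): with a fixed $q\in(\rho^{3/4},1)$ and a fixed integer $B\ge1$ such that $\frac{q^2}{\rho(1-\sqrt\rho)\,2B(1-q)}<1$, draw $N'$ from $\mathrm{Poisson}(B)$ (a sum of $B$ independent $\mathrm{Poisson}(1)$ variables); for $1\le r\le N'$ draw independently $J_r\ge2$ with $\mathbb P(J_r=j)=(1-q)q^{j-2}$ and accept $J_r$ with probability $p_{s,J_r}$, where $p_{s,j}=\frac{A(s^j)}{Bj(1-q)q^{j-2}}$; return the largest accepted integer, or $0$ if there is none. Approximations of $A(t)$ for $t<\rho$ are by Taylor polynomials. Boltzmann samplers. $\Gamma A(t)$, $0<t\le\rho$: start with a root vertex $v$; draw $X_t$ from $\mathrm{Poisson}(A(t))$; draw $T_1,\dots,T_{X_t}$ by independent recursive calls of $\Gamma A(t)$; draw $F$ by $\Gamma B(t)$; join $v$ by an edge to the root of each $T_i$ and of each tree in $F$; return the resulting tree rooted at $v$. $\Gamma B(s)$,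 $0<s<\sqrt\rho$: start with an empty forest $F$; draw $I$ by $\mathrm{MAXINDEX}(s)$; for $2\le i\le I-1$ draw $M_i$ by $\mathrm{Poisson}(A(s^i)/i)$; if $I\ge2$ draw $M_I$ by $\mathrm{Poisson}_{\ge1}(A(s^I)/I)$; for each $2\le i\le I$ and $1\le j\le M_i$ draw $T_{i,j}$ by $\Gamma A(s^i)$ and add $i$ identical copies of $T_{i,j}$ to $F$; return $F$. Parameters. Put $N=n-1$, $\lambda=\min\big(\epsilon/\sqrt N,\tfrac14\log(1/\rho)\big)$, so $\rho e^{\lambda}\le\rho^{3/4}$. For $\sigma\in\{+,-\}$ put $C_\sigma=\exp(e^{\sigma\lambda}-1)\,\Phi(\rho e^{\sigma\lambda})/\Phi(\rho)-\rho$, and $B_N=(C_++C_-)/2$. For $1\le k\le N$ let $c_k=\lfloor N/k\rfloor$, $r_k=N-kc_k$, $D_N(k)=\cosh(\lambda c_k)^{-(k-r_k)}\cosh(\lambda(c_k+1))^{-r_k}$. For $0\le m\le N$ let $s(k,m)=B_N^k\rho^m\frac{(k+m-1)!}{k!\,m!}D_N(k)$ and $\widehat M_N=\max_{1\le k\le N,\,0\le m\le N}s(k,m)$. Preprocessing: $C_+,C_-,B_N$ are computed once from their definitions; a table of $\log(j!)$, $0\le j\le2N$, is computed; $\widehat M_N$ is found by evaluating, for each $k$, $\log s(k,m)$ only at $m=0$, $m=N$ and the integers $m\in[0,N]$ in $\big[\frac{\rho k-1}{1-\rho},\frac{\rho k-1}{1-\rho}+1\big]$. Sampler Q. (1) Choose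 $\sigma_0\in\{+,-\}$ with $\mathbb P(\sigma_0=\pm)=C_\pm/(C_++C_-)$. (2) Independently sample $X$ from $\mathrm{Poisson}(e^{\sigma_0\lambda})$ and $F$ from $\Gamma B(\rho e^{\sigma_0\lambda})$; put $Y=|F|$. (3) If $(X,Y)=(0,0)$, resample $(X,Y,F)$ with the same $\sigma_0$ until $(X,Y)\ne(0,0)$. (4) Return $(X,Y,F)$. Bridge sampler. Repeat the following attempt until it is accepted. (1) Sample independent triples $(X_i,Y_i,F_i)$, $i=1,2,\dots$, by Sampler Q until $S_j=\sum_{i=1}^j(X_i+Y_i)$ satisfies $S_j\ge N$. (2) If $S_j>N$, reject and restart. If $S_j=N$, put $K=j$ and $M=1+\sum_{i=1}^K(X_i-1)$; if $M<0$, reject and restart. (3) Perform a Bernoulli test with success probability $R=\widehat M_N^{-1}B_N^K\rho^M\frac{(K+M-1)!}{K!\,M!}\prod_{i=1}^K\cosh(\lambda(X_i+Y_i))^{-1}\in[0,1]$ (implemented by comparing $\log U$ with $\log R$ for a uniform $U$ on $[0,1]$, using the precomputed table); if it fails, reject and restart. (4) Let $L=K+M$; choose a uniformly random $K$-element subset of $\{1,\dots,L\}$, insert $(X_1,Y_1,F_1),\dots,(X_K,Y_K,F_K)$ in these positions preserving order, and fill the other positions with $(0,0,\emptyset)$, giving a list $(\xi_1,\zeta_1,\tau_1),\dots,(\xi_L,\zeta_L,\tau_L)$. (5) Return this list. Sampler for Pólya trees. (1) Sample $(\xi_i,\zeta_i,\tau_i)_{1\le i\le L}$ by the Bridge sampler.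 (2) Let $H_j=\sum_{i=1}^j(\xi_i-1)$, $1\le j\le L$, and let $s\ge1$ be the first index at which $H_j$ is minimal; cyclically rotate the list of triples so that its first-coordinate sequence is $(\xi_{s+1},\dots,\xi_L,\xi_1,\dots,\xi_s)$. (3) Interpret this sequence as the depth-first-search ordered list of outdegrees of the vertices $v_{s+1},\dots,v_L,v_1,\dots,v_s$ of a plane tree $\tau$. (4) For each $1\le i\le L$ attach the forest $\tau_i$ to $v_i$ by adding an edge between $v_i$ and the root of each tree in $\tau_i$; forget the plane ordering and the vertex labels. (5) Return the resulting tree.
   Formalization: C_±, B_N and ρ cannot be computed exactly in finitely many operations; preprocessing is charged for approximating ρ and for Taylor approximations of Φ at an arbitrary working order O(log n), after which these numbers are treated as exact and rounding is ignored. *)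

theory Defs
  imports "HOL-Probability.Probability" "HOL-Library.Monad_Syntax" "HOL-Library.Landau_Symbols"
begin

section \<open>Polya trees and their generating function\<close>

text \<open>Nesting the datatype through finite multisets identifies isomorphic rooted trees:
  each value is exactly one isomorphism class of rooted unordered unlabelled trees.
  Forests are finite multisets of such trees.\<close>

datatype polya = Node "polya multiset"

type_synonym forest = "polya multiset"

primrec tsize :: "polya \<Rightarrow> nat" where
  "tsize (Node F) = Suc (\<Sum>\<^sub># (image_mset tsize F))"

definition fsize :: "forest \<Rightarrow> nat" where
  "fsize F = (\<Sum>T\<in>#F. tsize T)"

definition a_coeff :: "nat \<Rightarrow> nat" where
  "a_coeff k = card {T. tsize T = k}"

definition A_gf :: "real \<Rightarrow> real" where
  "A_gf z = (\<Sum>k. real (a_coeff k) * z ^ k)"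

definition rho :: real where
  "rho = real_of_ereal (conv_radius (\<lambda>k. real (a_coeff k)))"

definition Phi :: "real \<Rightarrow> real" where
  "Phi z = exp (\<Sum>i. A_gf (z ^ (i + 2)) / real (i + 2))"

definition lam :: "real \<Rightarrow> nat \<Rightarrow> real" where
  "lam \<epsilon> N = min (\<epsilon> / sqrt (real N)) (ln (1 / rho) / 4)"


section \<open>Randomised programs with unit-cost accounting\<close>

text \<open>The source of randomness is a sequence of independent cells. A cell carries a
  Uniform([0,1]), a Poisson(1) and a geometric variable, mutually independent; every random
  instruction consumes a whole cell and looks at one component only, so distinct instructions
  use independent randomness. A program maps the tape to its result, its cost and the unread
  rest of the tape; it is undefined on a tape on which it does not terminate.\<close>

type_synonym cell = "real \<times> nat \<times> nat"
type_synonym tape = "cell stream"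
type_synonym 'a prog = "tape \<Rightarrow> ('a \<times> nat \<times> tape) option"

definition cell_measure :: "real \<Rightarrow> cell measure" where
  "cell_measure q = uniform_measure lborel {0..1} \<Otimes>\<^sub>M
     (measure_pmf (poisson_pmf 1) \<Otimes>\<^sub>M measure_pmf (geometric_pmf (1 - q)))"

definition tape_measure :: "real \<Rightarrow> tape measure" where
  "tape_measure q = stream_space (cell_measure q)"

definition runtime :: "'a prog \<Rightarrow> tape \<Rightarrow> ennreal" where
  "runtime p \<omega> = (case p \<omega> of None \<Rightarrow> \<infinity> | Some (x, c, \<omega>') \<Rightarrow> of_nat c)"

definition expected_runtime :: "real \<Rightarrow> 'a prog \<Rightarrow> ennreal" where
  "expected_runtime q p = (\<integral>\<^sup>+ \<omega>. runtime p \<omega> \<partial>tape_measure q)"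

definition ret :: "'a \<Rightarrow> 'a prog" where
  "ret x = (\<lambda>\<omega>. Some (x, 0, \<omega>))"

definition pbind :: "'a prog \<Rightarrow> ('a \<Rightarrow> 'b prog) \<Rightarrow> 'b prog" where
  "pbind m f = (\<lambda>\<omega>. Option.bind (m \<omega>) (\<lambda>(x, c, \<omega>').
     Option.bind (f x \<omega>') (\<lambda>(y, c', \<omega>''). Some (y, c + c', \<omega>''))))"

adhoc_overloading Monad_Syntax.bind \<rightleftharpoons> pbind

definition tick :: "nat \<Rightarrow> unit prog" where
  "tick k = (\<lambda>\<omega>. Some ((), k, \<omega>))"

definition uniform :: "real prog" where
  "uniform = (\<lambda>\<omega>. Some (fst (shd \<omega>), 1, stl \<omega>))"

definition poisson1 :: "nat prog" where
  "poisson1 = (\<lambda>\<omega>. Some (fst (snd (shd \<omega>)), 1, stl \<omega>))"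

definition geometric :: "nat prog" where
  "geometric = (\<lambda>\<omega>. Some (snd (snd (shd \<omega>)), 1, stl \<omega>))"

text \<open>The minimum only matters on the null event that the uniform variable equals 1.\<close>

definition uniform_int :: "nat \<Rightarrow> nat \<Rightarrow> nat prog" where
  "uniform_int i j = (\<lambda>\<omega>.
     Some (min j (i + nat \<lfloor>fst (shd \<omega>) * real (j + 1 - i)\<rfloor>), 1, stl \<omega>))"

text \<open>Real arithmetic is written as an expression over already available register contents
  \<open>V x\<close>; each operation in the expression costs one unit. Loops charge the increment and the
  test of their counter, array and pointer operations are charged explicitly by
  \<^const>\<open>tick\<close>.\<close>

datatype rexp =
    V real
  | Add rexp rexp (infixl \<open>\<^bold>+\<close> 65)
  | Sub rexp rexp (infixl \<open>\<^bold>-\<close> 65)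
  | Mul rexp rexp (infixl \<open>\<^bold>*\<close> 70)
  | Div rexp rexp (infixl \<open>\<^bold>'/\<close> 70)
  | Exp rexp
  | Log rexp
  | Cosh rexp

primrec rval :: "rexp \<Rightarrow> real" where
  "rval (V x) = x"
| "rval (e \<^bold>+ f) = rval e + rval f"
| "rval (e \<^bold>- f) = rval e - rval f"
| "rval (e \<^bold>* f) = rval e * rval f"
| "rval (e \<^bold>/ f) = rval e / rval f"
| "rval (Exp e) = exp (rval e)"
| "rval (Log e) = ln (rval e)"
| "rval (Cosh e) = cosh (rval e)"

primrec rcost :: "rexp \<Rightarrow> nat" where
  "rcost (V x) = 0"
| "rcost (e \<^bold>+ f) = rcost e + rcost f + 1"
| "rcost (e \<^bold>- f) = rcost e + rcost f + 1"
| "rcost (e \<^bold>* f) = rcost e + rcost f + 1"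
| "rcost (e \<^bold>/ f) = rcost e + rcost f + 1"
| "rcost (Exp e) = rcost e + 1"
| "rcost (Log e) = rcost e + 1"
| "rcost (Cosh e) = rcost e + 1"

definition calc :: "rexp \<Rightarrow> real prog" where
  "calc e = do { tick (rcost e); ret (rval e) }"

definition test_less :: "rexp \<Rightarrow> rexp \<Rightarrow> bool prog" where
  "test_less e f = do { tick (rcost e + rcost f + 1); ret (rval e < rval f) }"

definition get :: "'a list \<Rightarrow> nat \<Rightarrow> 'a prog" where
  "get xs i = do { tick 1; ret (xs ! i) }"

definition push :: "'a list \<Rightarrow> 'a \<Rightarrow> 'a list prog" where
  "push xs x = do { tick 1; ret (xs @ [x]) }"

text \<open>\<open>for_loop k i f\<close> executes the body for the counter values \<open>i, \<dots>, i + k - 1\<close>.\<close>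

primrec for_loop :: "nat \<Rightarrow> nat \<Rightarrow> (nat \<Rightarrow> 's \<Rightarrow> 's prog) \<Rightarrow> 's \<Rightarrow> 's prog" where
  "for_loop 0 i f s = do { tick 1; ret s }"
| "for_loop (Suc k) i f s = do { tick 2; s' \<leftarrow> f i s; for_loop k (Suc i) f s' }"

primrec for_each :: "'a list \<Rightarrow> ('a \<Rightarrow> 's \<Rightarrow> 's prog) \<Rightarrow> 's \<Rightarrow> 's prog" where
  "for_each [] f s = do { tick 1; ret s }"
| "for_each (x # xs) f s = do { tick 2; s' \<leftarrow> f x s; for_each xs f s' }"

lemma pbind_mono [partial_function_mono]:
  assumes m: "\<And>\<omega>. mono_option (\<lambda>f. m f \<omega>)"
    and k: "\<And>x \<omega>. mono_option (\<lambda>f. k f x \<omega>)"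
  shows "mono_option (\<lambda>f. pbind (m f) (k f) \<omega>)"
  unfolding pbind_def
  by (intro bind_mono m) (auto simp: split_beta intro!: bind_mono k option.const_mono)

lemma case_sum_mono [partial_function_mono]:
  assumes "\<And>x. mono_option (\<lambda>f. g f x \<omega>)" and "\<And>y. mono_option (\<lambda>f. h f y \<omega>)"
  shows "mono_option (\<lambda>f. (case z of Inl x \<Rightarrow> g f x | Inr y \<Rightarrow> h f y) \<omega>)"
  using assms by (cases z) auto

lemma for_loop_mono [partial_function_mono]:
  assumes "\<And>i s \<omega>. mono_option (\<lambda>f. b f i s \<omega>)"
  shows "mono_option (\<lambda>f. for_loop k i (b f) s \<omega>)"
proof (induction k arbitrary: i s \<omega>)
  case 0
  show ?case by (simp add: option.const_mono)
next
  case (Suc k)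
  show ?case unfolding for_loop.simps
    by (intro pbind_mono option.const_mono assms Suc.IH)
qed

text \<open>Unbounded loops: \<open>Inl\<close> continues with a new state, \<open>Inr\<close> leaves the loop.\<close>

partial_function (option) loop :: "('s \<Rightarrow> ('s + 'r) prog) \<Rightarrow> 's \<Rightarrow> 'r prog" where
  "loop body s \<omega> =
     (do { r \<leftarrow> body s;
           case r of Inl s' \<Rightarrow> do { tick 1; loop body s' } | Inr x \<Rightarrow> ret x }) \<omega>"


section \<open>Approximation by Taylor polynomials\<close>

text \<open>The recurrence \<open>m * a_coeff (m+1) = (\<Sum>k=1..m. b k * a_coeff (m+1-k))\<close> with
  \<open>b k = (\<Sum>e | e dvd k. e * a_coeff e)\<close> is the coefficient form of the logarithmic derivative of
  \<open>A_gf z = z * exp (\<Sum>i\<ge>1. A_gf (z^i) / i)\<close>. The result is the array \<open>a_coeff 0, \<dots>, a_coeff d\<close> (d \<ge> 1).\<close>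

definition coeffs :: "nat \<Rightarrow> real list prog" where
  "coeffs d = do {
     tick 3;
     (as, bs) \<leftarrow> for_loop (d - 1) 1 (\<lambda>m (as, bs). do {
         b \<leftarrow> for_loop m 1 (\<lambda>e b. do {
              tick 2;
              if e dvd m then do { x \<leftarrow> get as e; calc (V b \<^bold>+ V (real e) \<^bold>* V x) } else ret b }) 0;
         bs \<leftarrow> push bs b;
         c \<leftarrow> for_loop m 1 (\<lambda>k c. do {
              tick 2;
              y \<leftarrow> get bs k; x \<leftarrow> get as (m + 1 - k); calc (V c \<^bold>+ V y \<^bold>* V x) }) 0;
         x \<leftarrow> calc (V c \<^bold>/ V (real m));
         as \<leftarrow> push as x;
         ret (as, bs) }) ([0, 1], [0]);
     ret as }"

text \<open>An approximation procedure delivers, for \<open>d = 1, 2, \<dots>\<close>, an interval that contains the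
  number and shrinks to it.\<close>

type_synonym approx = "nat \<Rightarrow> (real \<times> real) prog"

definition exact :: "real \<Rightarrow> approx" where
  "exact x d = ret (x, x)"

definition scaled :: "real \<Rightarrow> approx \<Rightarrow> approx" where
  "scaled c f d = do {
     (l, h) \<leftarrow> f d;
     l' \<leftarrow> calc (V l \<^bold>/ V c);
     h' \<leftarrow> calc (V h \<^bold>/ V c);
     ret (l', h') }"

text \<open>Lower end: the Taylor polynomial of degree d. Upper end: since \<open>a_coeff j * rho ^ j \<le> A_gf rho = 1\<close>,
  the remainder is at most \<open>(\<Sum>j>d. (t / rho) ^ j) = (t / rho) ^ (d+1) / (1 - t / rho)\<close>.\<close>

definition approx_A :: "real \<Rightarrow> approx" where
  "approx_A t d = do {
     tick 1;
     if t = rho then ret (1, 1) else do {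
       as \<leftarrow> coeffs d;
       y0 \<leftarrow> calc (V t \<^bold>/ V rho);
       (s, x, y) \<leftarrow> for_loop d 1 (\<lambda>j (s, x, y). do {
           c \<leftarrow> get as j;
           x' \<leftarrow> calc (V x \<^bold>* V t);
           y' \<leftarrow> calc (V y \<^bold>* V y0);
           s' \<leftarrow> calc (V s \<^bold>+ V c \<^bold>* V x');
           ret (s', x', y') }) (0, 1, y0);
       h \<leftarrow> calc (V s \<^bold>+ V y \<^bold>/ (V 1 \<^bold>- V y0));
       ret (s, h) } }"

definition power_prog :: "real \<Rightarrow> nat \<Rightarrow> real prog" where
  "power_prog x k = for_loop k 1 (\<lambda>_ y. calc (V y \<^bold>* V x)) 1"

definition taylor_Phi :: "nat \<Rightarrow> real \<Rightarrow> real prog" where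
  "taylor_Phi d z = do {
     as \<leftarrow> coeffs d;
     (s, zi) \<leftarrow> for_loop (d - 1) 2 (\<lambda>i (s, zi). do {
         zi' \<leftarrow> calc (V zi \<^bold>* V z);
         (p, x) \<leftarrow> for_loop d 1 (\<lambda>j (p, x). do {
             c \<leftarrow> get as j;
             x' \<leftarrow> calc (V x \<^bold>* V zi');
             p' \<leftarrow> calc (V p \<^bold>+ V c \<^bold>* V x');
             ret (p', x') }) (0, 1);
         s' \<leftarrow> calc (V s \<^bold>+ V p \<^bold>/ V (real i));
         ret (s', zi') }) (0, z);
     calc (Exp (V s)) }"

text \<open>Values of \<^const>\<open>Phi\<close> are limits. Evaluating one is charged with the full cost of
  its Taylor approximation at a working order d; the machine number obtained is then
  identified with the limit, i.e. rounding is ignored.\<close>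

definition eval_Phi :: "nat \<Rightarrow> real \<Rightarrow> real prog" where
  "eval_Phi d z = do { _ \<leftarrow> taylor_Phi d z; ret (Phi z) }"


section \<open>Elementary samplers\<close>

definition bernoulli :: "approx \<Rightarrow> bool prog" where
  "bernoulli f = do {
     u \<leftarrow> uniform;
     loop (\<lambda>d. do {
       (l, h) \<leftarrow> f d;
       below \<leftarrow> test_less (V u) (V l);
       if below then ret (Inr True) else do {
         undecided \<leftarrow> test_less (V u) (V h);
         tick 1;
         ret (if undecided then Inl (d + 1) else Inr False) } }) 1 }"

definition poisson1_sum :: "nat \<Rightarrow> nat prog" where
  "poisson1_sum m = for_loop m 1 (\<lambda>_ s. do { z \<leftarrow> poisson1; tick 1; ret (s + z) }) 0"

text \<open>The approximation procedure describes the parameter \<open>x\<close>.\<close>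

definition poisson :: "nat \<Rightarrow> approx \<Rightarrow> nat prog" where
  "poisson M0 x = do {
     N' \<leftarrow> poisson1_sum M0;
     for_loop N' 1 (\<lambda>_ s. do {
       b \<leftarrow> bernoulli (scaled (real M0) x);
       tick 1;
       ret (if b then s + 1 else s) }) 0 }"

definition poisson_pos :: "nat \<Rightarrow> approx \<Rightarrow> nat prog" where
  "poisson_pos M0 x = loop (\<lambda>_. do {
     y \<leftarrow> poisson M0 x;
     tick 1;
     let z = y + 1;
     p \<leftarrow> calc (V 1 \<^bold>/ V (real z));
     acc \<leftarrow> bernoulli (exact p);
     ret (if acc then Inr z else Inl ()) }) ()"

definition max_index :: "nat \<Rightarrow> real \<Rightarrow> real \<Rightarrow> nat prog" where
  "max_index B q s = do {
     N' \<leftarrow> poisson1_sum B;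
     for_loop N' 1 (\<lambda>_ best. do {
       g \<leftarrow> geometric;
       tick 1;
       let j = g + 2;
       t \<leftarrow> power_prog s j;
       x \<leftarrow> power_prog q (j - 2);
       c \<leftarrow> calc (V (real B) \<^bold>* V (real j) \<^bold>* (V 1 \<^bold>- V q) \<^bold>* V x);
       acc \<leftarrow> bernoulli (scaled c (approx_A t));
       tick 1;
       ret (if acc then max best j else best) }) 0 }"


section \<open>Boltzmann samplers\<close>

text \<open>The sampler for forests, with the sampler \<open>rec\<close> for trees as a parameter. Adding \<open>i\<close>
  copies of a tree means creating \<open>i\<close> times all its vertices, and is charged accordingly.\<close>

definition gammaB_with ::
    "(real \<Rightarrow> polya prog) \<Rightarrow> nat \<Rightarrow> nat \<Rightarrow> real \<Rightarrow> real \<Rightarrow> forest prog" where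
  "gammaB_with rec M0 B q s = do {
     k \<leftarrow> max_index B q s;
     tick 1;
     (F, t) \<leftarrow> for_loop (k - 1) 2 (\<lambda>i (F, t). do {
         t' \<leftarrow> calc (V t \<^bold>* V s);
         tick 1;
         m \<leftarrow> (if i < k then poisson M0 (scaled (real i) (approx_A t'))
                else poisson_pos M0 (scaled (real i) (approx_A t')));
         F' \<leftarrow> for_loop m 1 (\<lambda>_ F. do {
             T \<leftarrow> rec t';
             tick (i * tsize T);
             ret (F + replicate_mset i T) }) F;
         ret (F', t') }) ({#}, s);
     ret F }"

lemma gammaB_with_mono [partial_function_mono]:
  assumes "\<And>t \<omega>. mono_option (\<lambda>f. r f t \<omega>)"
  shows "mono_option (\<lambda>f. gammaB_with (r f) M0 B q s \<omega>)"
  unfolding gammaB_with_def split_beta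
  by (intro pbind_mono for_loop_mono option.const_mono assms)

text \<open>Joining the root to the root of another tree costs one unit per edge.\<close>

partial_function (option) gammaA :: "nat \<Rightarrow> nat \<Rightarrow> real \<Rightarrow> real \<Rightarrow> polya prog" where
  "gammaA M0 B q t \<omega> = (do {
     tick 1;
     x \<leftarrow> poisson M0 (approx_A t);
     Ts \<leftarrow> for_loop x 1 (\<lambda>_ Ts. do { T \<leftarrow> gammaA M0 B q t; tick 1; ret (add_mset T Ts) }) {#};
     F \<leftarrow> gammaB_with (gammaA M0 B q) M0 B q t;
     tick (size F);
     ret (Node (Ts + F)) }) \<omega>"

definition gammaB :: "nat \<Rightarrow> nat \<Rightarrow> real \<Rightarrow> real \<Rightarrow> forest prog" where
  "gammaB M0 B q = gammaB_with (gammaA M0 B q) M0 B q"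


section \<open>Preprocessing\<close>

record pre =
  lam_val :: real
  Cplus :: real
  Cminus :: real
  BN :: real
  logfact :: "real list"
  logMax :: real

text \<open>\<open>sg\<close> is \<open>1\<close> or \<open>-1\<close>, \<open>w\<close> is the working order.\<close>

definition compute_C :: "nat \<Rightarrow> real \<Rightarrow> real \<Rightarrow> real prog" where
  "compute_C w sg l = do {
     e \<leftarrow> calc (Exp (V sg \<^bold>* V l));
     z \<leftarrow> calc (V rho \<^bold>* V e);
     p \<leftarrow> eval_Phi w z;
     p0 \<leftarrow> eval_Phi w rho;
     calc (Exp (V e \<^bold>- V 1) \<^bold>* V p \<^bold>/ V p0 \<^bold>- V rho) }"

text \<open>The square root is computed as \<open>exp (ln N / 2)\<close>; the result is \<open>lam \<epsilon> N\<close>.\<close>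

definition compute_lam :: "real \<Rightarrow> nat \<Rightarrow> real prog" where
  "compute_lam \<epsilon> N = do {
     x \<leftarrow> calc (V \<epsilon> \<^bold>/ Exp (Log (V (real N)) \<^bold>/ V 2));
     y \<leftarrow> calc (Log (V 1 \<^bold>/ V rho) \<^bold>/ V 4);
     b \<leftarrow> test_less (V x) (V y);
     ret (if b then x else y) }"

definition compute_logfact :: "nat \<Rightarrow> real list prog" where
  "compute_logfact n = for_loop n 1 (\<lambda>j xs. do {
     tick 1;
     x \<leftarrow> get xs (j - 1);
     y \<leftarrow> calc (V x \<^bold>+ Log (V (real j)));
     push xs y }) [0]"

text \<open>\<open>log s(k,m)\<close>, where \<open>c\<close> and \<open>r\<close> are \<open>c_k\<close> and \<open>r_k\<close>.\<close>

definition log_s :: "real \<Rightarrow> real \<Rightarrow> real list \<Rightarrow> nat \<Rightarrow> nat \<Rightarrow> nat \<Rightarrow> real prog" where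
  "log_s l b lf N k m = do {
     tick 5;
     let c = N div k;
     let r = N - k * c;
     x \<leftarrow> get lf (k + m - 1);
     y \<leftarrow> get lf k;
     z \<leftarrow> get lf m;
     calc (V (real k) \<^bold>* Log (V b) \<^bold>+ V (real m) \<^bold>* Log (V rho) \<^bold>+ V x \<^bold>- V y \<^bold>- V z
       \<^bold>- (V (real k) \<^bold>- V (real r)) \<^bold>* Log (Cosh (V l \<^bold>* V (real c)))
       \<^bold>- V (real r) \<^bold>* Log (Cosh (V l \<^bold>* (V (real c) \<^bold>+ V 1)))) }"

text \<open>The integers in the interval \<open>[w, w + 1]\<close> are \<open>\<lceil>w\<rceil>\<close> and \<open>\<lfloor>w\<rfloor> + 1\<close>, which coincide
  unless \<open>w\<close> is an integer.\<close>

definition compute_logMax :: "real \<Rightarrow> real \<Rightarrow> real list \<Rightarrow> nat \<Rightarrow> real prog" where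
  "compute_logMax l b lf N = do {
     v0 \<leftarrow> log_s l b lf N 1 0;
     for_loop N 1 (\<lambda>k best. do {
       w \<leftarrow> calc ((V rho \<^bold>* V (real k) \<^bold>- V 1) \<^bold>/ (V 1 \<^bold>- V rho));
       tick 3;
       for_each [0, int N, \<lceil>w\<rceil>, \<lfloor>w\<rfloor> + 1] (\<lambda>m best. do {
         tick 2;
         if 0 \<le> m \<and> m \<le> int N then do {
           v \<leftarrow> log_s l b lf N k (nat m);
           better \<leftarrow> test_less (V best) (V v);
           ret (if better then v else best) }
         else ret best }) best }) v0 }"

text \<open>\<open>rho_cost w\<close> is the cost of approximating \<^const>\<open>rho\<close> up to \<open>2 ^ (-w)\<close>. It is charged
  once, here; as with \<^const>\<open>eval_Phi\<close>, the machine number obtained is identified with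
  \<^const>\<open>rho\<close>.\<close>

definition preprocess :: "real \<Rightarrow> (nat \<Rightarrow> nat) \<Rightarrow> nat \<Rightarrow> nat \<Rightarrow> pre prog" where
  "preprocess \<epsilon> rho_cost w N = do {
     tick (rho_cost w);
     l \<leftarrow> compute_lam \<epsilon> N;
     cp \<leftarrow> compute_C w 1 l;
     cm \<leftarrow> compute_C w (-1) l;
     b \<leftarrow> calc ((V cp \<^bold>+ V cm) \<^bold>/ V 2);
     tick 1;
     lf \<leftarrow> compute_logfact (2 * N);
     mx \<leftarrow> compute_logMax l b lf N;
     ret \<lparr> lam_val = l, Cplus = cp, Cminus = cm, BN = b, logfact = lf, logMax = mx \<rparr> }"


section \<open>Sampler Q, bridge sampler and the sampler for Polya trees\<close>

type_synonym triple = "nat \<times> nat \<times> forest"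

definition samplerQ :: "nat \<Rightarrow> nat \<Rightarrow> real \<Rightarrow> pre \<Rightarrow> triple prog" where
  "samplerQ M0 B q c = do {
     p \<leftarrow> calc (V (Cplus c) \<^bold>/ (V (Cplus c) \<^bold>+ V (Cminus c)));
     plus \<leftarrow> bernoulli (exact p);
     let sg = (if plus then 1 else - 1);
     e \<leftarrow> calc (Exp (V sg \<^bold>* V (lam_val c)));
     z \<leftarrow> calc (V rho \<^bold>* V e);
     loop (\<lambda>_. do {
       x \<leftarrow> poisson M0 (exact e);
       F \<leftarrow> gammaB M0 B q z;
       tick (fsize F);
       let y = fsize F;
       tick 2;
       ret (if (x, y) = (0, 0) then Inl () else Inr (x, y, F)) }) () }"

definition sample_until ::
    "nat \<Rightarrow> nat \<Rightarrow> real \<Rightarrow> pre \<Rightarrow> nat \<Rightarrow> (nat \<times> triple list) prog" where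
  "sample_until M0 B q c N = loop (\<lambda>(s, ts). do {
     (x, y, F) \<leftarrow> samplerQ M0 B q c;
     ts' \<leftarrow> push ts (x, y, F);
     tick 3;
     let s' = s + x + y;
     ret (if s' < N then Inl (s', ts') else Inr (s', ts')) }) (0, [])"

definition log_R :: "pre \<Rightarrow> triple list \<Rightarrow> nat \<Rightarrow> nat \<Rightarrow> real prog" where
  "log_R c ts K M = do {
     d \<leftarrow> for_each ts (\<lambda>(x, y, F) d.
            calc (V d \<^bold>+ Log (Cosh (V (lam_val c) \<^bold>* (V (real x) \<^bold>+ V (real y)))))) 0;
     tick 2;
     f1 \<leftarrow> get (logfact c) (K + M - 1);
     f2 \<leftarrow> get (logfact c) K;
     f3 \<leftarrow> get (logfact c) M;
     calc (V (real K) \<^bold>* Log (V (BN c)) \<^bold>+ V (real M) \<^bold>* Log (V rho) \<^bold>+ V f1 \<^bold>- V f2 \<^bold>- V f3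
           \<^bold>- V d \<^bold>- V (logMax c)) }"

text \<open>Selection sampling: with \<open>k\<close> triples and \<open>L + 1 - i\<close> positions left, position \<open>i\<close> receives
  the next triple with probability \<open>k / (L + 1 - i)\<close>. The set of the positions so chosen is a
  uniformly random subset of \<open>{1..L}\<close> of size \<open>length ts\<close>.\<close>

definition insert_triples :: "triple list \<Rightarrow> nat \<Rightarrow> triple list prog" where
  "insert_triples ts L = do {
     (k, out) \<leftarrow> for_loop L 1 (\<lambda>i (k, out). do {
         tick 5;
         r \<leftarrow> uniform_int 1 (L + 1 - i);
         if r \<le> k then do {
           x \<leftarrow> get ts (length ts - k); out' \<leftarrow> push out x; ret (k - 1, out') }
         else do { out' \<leftarrow> push out (0, 0, {#}); ret (k, out') } }) (length ts, []);
     ret out }"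

definition bridge_sampler ::
    "nat \<Rightarrow> nat \<Rightarrow> real \<Rightarrow> pre \<Rightarrow> nat \<Rightarrow> triple list prog" where
  "bridge_sampler M0 B q c N = loop (\<lambda>_. do {
     (s, ts) \<leftarrow> sample_until M0 B q c N;
     tick 1;
     if s > N then ret (Inl ()) else do {
       sx \<leftarrow> for_each ts (\<lambda>(x, y, F) sx. do { tick 1; ret (sx + x) }) 0;
       let K = length ts;
       tick 4;
       if 1 + sx < K then ret (Inl ()) else do {
         let M = 1 + sx - K;
         r \<leftarrow> log_R c ts K M;
         u \<leftarrow> uniform;
         acc \<leftarrow> test_less (Log (V u)) (V r);
         if \<not> acc then ret (Inl ()) else do {
           out \<leftarrow> insert_triples ts (K + M);
           ret (Inr out) } } } }) ()"

text \<open>The first index at which the walk with steps \<open>\<xi> - 1\<close> is minimal.\<close>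

definition first_min :: "triple list \<Rightarrow> nat prog" where
  "first_min xs = do {
     (j, h, s, mn) \<leftarrow> for_each xs (\<lambda>(\<xi>, \<zeta>, \<tau>) (j, h, s, mn). do {
         tick 5;
         let j' = j + 1;
         let h' = h + int \<xi> - 1;
         ret (if j' = 1 \<or> h' < mn then (j', h', j', h') else (j', h', s, mn)) })
       (0 :: nat, 0 :: int, 0 :: nat, 0 :: int);
     ret s }"

text \<open>Reads the depth-first sequence of outdegrees from right to left: a stack holds the subtrees
  already built, leftmost on top, and a vertex of outdegree \<open>\<xi>\<close> takes the topmost \<open>\<xi>\<close> of them as its
  children in the plane tree. The trees of the forest \<open>\<tau>\<close> are attached at the same time, and
  \<^const>\<open>mset\<close> forgets the plane ordering. The cost is one unit per vertex and edge.\<close>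

definition build_tree :: "triple list \<Rightarrow> polya prog" where
  "build_tree xs = do {
     st \<leftarrow> for_each (rev xs) (\<lambda>(\<xi>, \<zeta>, \<tau>) st. do {
         tick (1 + \<xi> + size \<tau>);
         ret (Node (mset (take \<xi> st) + \<tau>) # drop \<xi> st) }) [];
     ret (hd st) }"

definition polya_sampler ::
    "nat \<Rightarrow> nat \<Rightarrow> real \<Rightarrow> real \<Rightarrow> (nat \<Rightarrow> nat) \<Rightarrow> (nat \<Rightarrow> nat) \<Rightarrow> nat \<Rightarrow> polya prog" where
  "polya_sampler M0 B q \<epsilon> rho_cost prec n = do {
     tick 1;
     let N = n - 1;
     c \<leftarrow> preprocess \<epsilon> rho_cost (prec n) N;
     xs \<leftarrow> bridge_sampler M0 B q c N;
     s \<leftarrow> first_min xs;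
     tick (length xs);
     let ys = drop s xs @ take s xs;
     build_tree ys }"

end

(* A call of GA(t), t <= rho^(3/2), makes log (A(t) / t) <= log (5/2) < 1 recursive calls of GA(t)
   on average, and the powers t^i decay geometrically, so all Boltzmann samplers and Sampler Q have
   bounded expected cost. A Bridge attempt therefore costs O(N). Tilting by exp (+-lambda) and
   weighting by 1 / cosh cancel, so the success probability of an attempt is the weight of the bridges
   of an untilted critical walk divided by the maximum of s(k, m). The former is at least c / N^(3/2)
   by Stirling and a renewal argument, the latter at most C / N^(3/2), as the cosh factors suppress small k. Hence the
   expected number of attempts is bounded. *)
theory Submission
 imports Defs "HOL-Real_Asymp.Real_Asymp"
begin

section \<open>Programs\<close>

text \<open>Result types carry no sigma-algebra, yet costs and values must be integrated along
  compositions of programs. The notion \<open>good\<close> takes the place of measurability: the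
  unread tape is a fresh tape given result and cost. It is closed under sequencing and under limits
  of chains, and holds for instructions with countably many results; hence every uniform real is
  fused with the comparison that consumes it. Loops and recursions are limits of cut-off programs,
  so expectations pass by monotone convergence. Costs are first bounded over terminating tapes only;
  termination with probability 1 is a separate statement. Laws are identified through generating
  functions, because the recursion of the samplers mirrors the functional equation of A. The facts
  \<open>rho >= 1/4\<close> and \<open>A(rho) = 1\<close>, on which all constants rest, come from a
  truncated Euler product over forests. The upper bound for the weights is proved for every
  composition of N, not just the balanced one, so a single estimate covers both the preprocessing
  and the acceptance test.\<close>

definition detp :: "'a \<Rightarrow> nat \<Rightarrow> 'a prog" where
 "detp x c = (\<lambda>tp. Some (x, c, tp))"

definition app :: "'a prog \<Rightarrow> ('a \<Rightarrow> nat \<Rightarrow> tape \<Rightarrow> ennreal) \<Rightarrow> tape \<Rightarrow> ennreal" where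
 "app p g tp = (case p tp of None \<Rightarrow> 0 | Some (x, c, tp') \<Rightarrow> g x c tp')"

section \<open>Chains of partial programs and their limits\<close>

definition prog_lim :: "(nat \<Rightarrow> 'a prog) \<Rightarrow> 'a prog \<Rightarrow> bool" where
 "prog_lim ps p \<longleftrightarrow> (\<forall>tp. (\<forall>n r. ps n tp = Some r \<longrightarrow> ps (Suc n) tp = Some r) \<and>
   (\<forall>r. p tp = Some r \<longleftrightarrow> (\<exists>n. ps n tp = Some r)))"

lemma ret_eq: "ret x = detp x 0" by (simp add: ret_def detp_def)
lemma tick_eq: "tick k = detp () k" by (simp add: tick_def detp_def)

lemma pbind_detp: "pbind (detp x c) k = (\<lambda>tp. map_option (\<lambda>(y, c', tp'). (y, c + c', tp')) (k x tp))"
 by (auto simp: pbind_def detp_def fun_eq_iff split: option.splits bind_splits)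

lemma pbind_detp_detp: "k x = detp y c' \<Longrightarrow> pbind (detp x c) k = detp y (c + c')"
 by (simp add: pbind_detp) (simp add: detp_def)

lemma pbind_assoc: "pbind (pbind m f) g = pbind m (\<lambda>x. pbind (f x) g)"
 by (auto simp: pbind_def fun_eq_iff split: option.splits bind_splits)

lemma app_pbind: "app (pbind p k) g = app p (\<lambda>x c. app (k x) (\<lambda>y c'. g y (c + c')))"
 by (auto simp: app_def pbind_def fun_eq_iff split: option.splits bind_splits)

lemma app_detp: "app (detp x c) g = g x c"
 by (auto simp: app_def detp_def)

lemma prog_lim_mono: "prog_lim ps p \<Longrightarrow> ps n tp = Some r \<Longrightarrow> n \<le> m \<Longrightarrow> ps m tp = Some r"
 unfolding prog_lim_def by (rotate_tac 2, induction m rule: dec_induct) blast+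

lemma prog_lim_Some: "prog_lim ps p \<Longrightarrow> p tp = Some r \<longleftrightarrow> (\<exists>n. ps n tp = Some r)"
 unfolding prog_lim_def by blast

lemma prog_lim_le: "prog_lim ps p \<Longrightarrow> ps n tp = Some r \<Longrightarrow> p tp = Some r"
 unfolding prog_lim_def by blast

lemma prog_lim_ex: "prog_lim ps p \<Longrightarrow> p tp = Some r \<Longrightarrow> \<exists>n. ps n tp = Some r"
 unfolding prog_lim_def by blast

lemma prog_lim_const: "prog_lim (\<lambda>_. p) p" by (auto simp: prog_lim_def)

lemma prog_limI:
 assumes "\<And>n tp r. ps n tp = Some r \<Longrightarrow> ps (Suc n) tp = Some r"
  and "\<And>n tp r. ps n tp = Some r \<Longrightarrow> p tp = Some r"
  and "\<And>tp r. p tp = Some r \<Longrightarrow> \<exists>n. ps n tp = Some r"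
 shows "prog_lim ps p"
 using assms unfolding prog_lim_def by blast

lemma pbind_Some: "pbind m k tp = Some r \<longleftrightarrow>
  (\<exists>x c tp' y c' tp''. m tp = Some (x, c, tp') \<and> k x tp' = Some (y, c', tp'') \<and> r = (y, c + c', tp''))"
 by (auto simp: pbind_def split: option.splits bind_splits)

lemma pbind_le:
 assumes "\<And>tp r. m tp = Some r \<Longrightarrow> m' tp = Some r"
  and "\<And>x tp r. k x tp = Some r \<Longrightarrow> k' x tp = Some r"
  and "pbind m k tp = Some r"
 shows "pbind m' k' tp = Some r"
proof -
 obtain x c tp' y c' tp'' where "m tp = Some (x, c, tp')" "k x tp' = Some (y, c', tp'')" "r = (y, c + c', tp'')"
  using assms(3) unfolding pbind_Some by blast
 thus ?thesis unfolding pbind_Some using assms(1,2) by blast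
qed

lemma prog_lim_pbind:
 assumes m: "prog_lim ms m" and k: "\<And>x. prog_lim (\<lambda>n. ks n x) (k x)"
 shows "prog_lim (\<lambda>n. pbind (ms n) (ks n)) (pbind m k)"
proof (rule prog_limI)
 fix n tp r assume "pbind (ms n) (ks n) tp = Some r"
 thus "pbind (ms (Suc n)) (ks (Suc n)) tp = Some r"
 proof (rule pbind_le[rotated 2])
  show "ms n tp = Some r \<Longrightarrow> ms (Suc n) tp = Some r" for tp r by (erule prog_lim_mono[OF m]) (rule le_SucI[OF order_refl])
  show "ks n x tp = Some r \<Longrightarrow> ks (Suc n) x tp = Some r" for x tp r by (erule prog_lim_mono[OF k]) (rule le_SucI[OF order_refl])
 qed
next
 fix n tp r assume "pbind (ms n) (ks n) tp = Some r"
 thus "pbind m k tp = Some r"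
 proof (rule pbind_le[rotated 2])
  show "ms n tp = Some r \<Longrightarrow> m tp = Some r" for tp r by (rule prog_lim_le[OF m])
  show "ks n x tp = Some r \<Longrightarrow> k x tp = Some r" for x tp r by (rule prog_lim_le[OF k])
 qed
next
 fix tp r assume "pbind m k tp = Some r"
 then obtain x c tp' y c' tp'' where 1: "m tp = Some (x, c, tp')" "k x tp' = Some (y, c', tp'')" "r = (y, c + c', tp'')"
  unfolding pbind_Some by blast
 obtain n1 where n1: "ms n1 tp = Some (x, c, tp')" using prog_lim_ex[OF m 1(1)] ..
 obtain n2 where n2: "ks n2 x tp' = Some (y, c', tp'')" using prog_lim_ex[OF k 1(2)] ..
 have "ms (max n1 n2) tp = Some (x, c, tp')" "ks (max n1 n2) x tp' = Some (y, c', tp'')"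
  by (auto intro: prog_lim_mono[OF m n1] prog_lim_mono[OF k n2])
 with 1 show "\<exists>n. pbind (ms n) (ks n) tp = Some r"
  unfolding pbind_Some by blast
qed

lemma prog_lim_for_loop:
 assumes "\<And>i s. prog_lim (\<lambda>n. fs n i s) (f i s)"
 shows "prog_lim (\<lambda>n. for_loop k i (fs n) s) (for_loop k i f s)"
 by (induction k arbitrary: i s) (auto intro!: prog_lim_pbind prog_lim_const assms)

text \<open>On a fixed tape the sequence is 0 up to some depth and constant from there on. This is
  the entry point for monotone convergence.\<close>

lemma prog_lim_app_SUP:
 assumes "prog_lim ps p"
 shows "app p g tp = (SUP n. app (ps n) g tp)" "incseq (\<lambda>n. app (ps n) g tp)"
proof -
 show inc: "incseq (\<lambda>n. app (ps n) g tp)"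
 proof (rule incseq_SucI)
  fix n show "app (ps n) g tp \<le> app (ps (Suc n)) g tp"
  proof (cases "ps n tp")
   case (Some r) thus ?thesis using prog_lim_mono[OF assms Some, of "Suc n"] by (simp add: app_def)
  qed (simp add: app_def)
 qed
 show "app p g tp = (SUP n. app (ps n) g tp)"
 proof (cases "p tp")
  case None
  hence "ps n tp = None" for n
   using prog_lim_le[OF assms, of n tp] by (cases "ps n tp") (simp_all only: option.distinct)
  with None show ?thesis by (simp add: app_def)
 next
  case (Some r)
  then obtain n where n: "ps n tp = Some r" using prog_lim_ex[OF assms] by blast
  hence eq: "m \<ge> n \<Longrightarrow> app (ps m) g tp = app p g tp" for m
   using prog_lim_mono[OF assms n] Some by (simp add: app_def)
  show ?thesis
  proof (rule antisym)
   show "app p g tp \<le> (SUP n. app (ps n) g tp)" using eq[of n] by (intro SUP_upper2[of n]) auto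
   show "(SUP n. app (ps n) g tp) \<le> app p g tp"
   proof (rule SUP_least)
    fix m have "app (ps m) g tp \<le> app (ps (max m n)) g tp" by (rule incseqD[OF inc]) simp
    thus "app (ps m) g tp \<le> app p g tp" by (simp add: eq)
   qed
  qed
 qed
qed

primrec loop_n :: "nat \<Rightarrow> ('s \<Rightarrow> ('s + 'r) prog) \<Rightarrow> 's \<Rightarrow> 'r prog" where
 "loop_n 0 body s = (\<lambda>_. None)"
| "loop_n (Suc n) body s = pbind (body s) (\<lambda>r. case r of
   Inl s' \<Rightarrow> pbind (tick 1) (\<lambda>_. loop_n n body s') | Inr x \<Rightarrow> ret x)"

lemma loop_simps: "loop body s = pbind (body s) (\<lambda>r. case r of
   Inl s' \<Rightarrow> pbind (tick 1) (\<lambda>_. loop body s') | Inr x \<Rightarrow> ret x)"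
 by (rule ext) (subst loop.simps, simp)

lemma prog_lim_case_sum:
 assumes "\<And>x. prog_lim (\<lambda>n. f n x) (f' x)" "\<And>x. prog_lim (\<lambda>n. g n x) (g' x)"
 shows "prog_lim (\<lambda>n. case y of Inl x \<Rightarrow> f n x | Inr x \<Rightarrow> g n x) (case y of Inl x \<Rightarrow> f' x | Inr x \<Rightarrow> g' x)"
 using assms by (cases y) auto

text \<open>The members of a chain agree wherever they are defined, so any stage that is defined on
  the tape may be picked.\<close>

definition prog_sup :: "(nat \<Rightarrow> 'a prog) \<Rightarrow> 'a prog" where
 "prog_sup ps tp = (if \<exists>n r. ps n tp = Some r then ps (SOME n. \<exists>r. ps n tp = Some r) tp else None)"

lemma prog_lim_sup:
 assumes "\<And>n tp r. ps n tp = Some r \<Longrightarrow> ps (Suc n) tp = Some r"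
 shows "prog_lim ps (prog_sup ps)"
proof -
 have mono: "n \<le> m \<Longrightarrow> ps n tp = Some r \<Longrightarrow> ps m tp = Some r" for n m tp r
  by (induction m rule: dec_induct) (auto intro: assms)
 have uniq: "ps n tp = Some r \<Longrightarrow> ps m tp = Some r' \<Longrightarrow> r = r'" for n m tp r r'
  using mono[of n "max n m" tp r] mono[of m "max n m" tp r'] by simp
 show ?thesis
 proof (rule prog_limI)
  show "\<exists>n. ps n tp = Some r" if "prog_sup ps tp = Some r" for tp r
   using that by (auto simp: prog_sup_def split: if_splits)
  show "prog_sup ps tp = Some r" if "ps n tp = Some r" for n tp r
  proof -
   have "\<exists>r'. ps (SOME n. \<exists>r. ps n tp = Some r) tp = Some r'"
    using that by (intro someI_ex[of "\<lambda>n. \<exists>r. ps n tp = Some r"]) blast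
   then obtain r' where r': "ps (SOME n. \<exists>r. ps n tp = Some r) tp = Some r'" ..
   from that have "\<exists>n r. ps n tp = Some r" by blast
   thus ?thesis using r' uniq[OF that r'] by (simp add: prog_sup_def)
  qed
 qed (rule assms)
qed

lemma prog_lim_unique: "prog_lim ps p \<Longrightarrow> prog_lim ps p' \<Longrightarrow> p = p'"
proof
 fix tp assume "prog_lim ps p" "prog_lim ps p'"
 hence eq: "p tp = Some r \<longleftrightarrow> p' tp = Some r" for r by (simp only: prog_lim_Some)
 show "p tp = p' tp"
 proof (cases "p tp")
  case None
  thus ?thesis by (cases "p' tp") (simp_all only: eq[symmetric] option.distinct)
 next
  case (Some r)
  thus ?thesis using eq[of r] by simp
 qed
qed

lemma prog_lim_Suc: "prog_lim ps p \<Longrightarrow> prog_lim (\<lambda>n. ps (Suc n)) p"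
proof (rule prog_limI)
 assume l: "prog_lim ps p"
 show "ps (Suc n) tp = Some r \<Longrightarrow> ps (Suc (Suc n)) tp = Some r" for n tp r
  by (erule prog_lim_mono[OF l]) (rule le_SucI[OF order_refl])
 show "ps (Suc n) tp = Some r \<Longrightarrow> p tp = Some r" for n tp r by (rule prog_lim_le[OF l])
 show "\<exists>n. ps (Suc n) tp = Some r" if p: "p tp = Some r" for tp r
 proof -
  obtain n where "ps n tp = Some r" using prog_lim_ex[OF l p] ..
  hence "ps (Suc n) tp = Some r" by (rule prog_lim_mono[OF l]) (rule le_SucI[OF order_refl])
  thus ?thesis ..
 qed
qed

definition prog_cont :: "(('a \<Rightarrow> 'b prog) \<Rightarrow> 'a \<Rightarrow> 'b prog) \<Rightarrow> bool" where
 "prog_cont \<Psi> \<longleftrightarrow> (\<forall>rs r. (\<forall>x. prog_lim (\<lambda>n. rs n x) (r x)) \<longrightarrow> (\<forall>x. prog_lim (\<lambda>n. \<Psi> (rs n) x) (\<Psi> r x)))"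

text \<open>A program that refines another one is the limit of a chain, so monotonicity of the
 functional is an instance of its continuity.\<close>

lemma functional_le:
 assumes cont: "prog_cont \<Psi>"
  and le: "\<And>x tp v. r x tp = Some v \<Longrightarrow> r' x tp = Some v" and e: "\<Psi> r x tp = Some v"
 shows "\<Psi> r' x tp = Some v"
proof -
 define rs where "rs n = (case n of 0 \<Rightarrow> r | Suc _ \<Rightarrow> r')" for n :: nat
 have L: "prog_lim (\<lambda>n. rs n x) (r' x)" for x
 proof (rule prog_limI)
  show "\<exists>n. rs n x tp = Some v" if "r' x tp = Some v" for tp v
   using that by (intro exI[of _ 1]) (simp add: rs_def)
 qed (auto simp: rs_def split: nat.splits intro: le)
 have "prog_lim (\<lambda>n. \<Psi> (rs n) x) (\<Psi> r' x)" using cont L unfolding prog_cont_def by blast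
 from prog_lim_le[OF this, of 0 tp v] show ?thesis using e by (simp add: rs_def)
qed

text \<open>Kleene's theorem, in a form suited to recursively defined partial programs. The supremum
  \<open>G\<close> of the iterates is a fixed point by continuity, and \<open>least\<close>, which
  fixpoint induction supplies, puts \<open>p\<close> below it; conversely every iterate is below
  \<open>p\<close> by monotonicity.\<close>

lemma prog_lim_iterate:
 assumes cont: "prog_cont \<Psi>"
  and fixp: "\<And>x. p x = \<Psi> p x"
  and least: "\<And>G x tp v. (\<And>x. G x = \<Psi> G x) \<Longrightarrow> p x tp = Some v \<Longrightarrow> G x tp = Some v"
  and it: "\<And>x. it 0 x = (\<lambda>_. None)" "\<And>n x. it (Suc n) x = \<Psi> (it n) x"
 shows "prog_lim (\<lambda>n. it n x) (p x)"
proof -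
 note le = functional_le[OF cont]
 have mono: "it n x tp = Some v \<Longrightarrow> it (Suc n) x tp = Some v" for n x tp v
 proof (induction n arbitrary: x tp v)
  case (Suc n)
  show ?case by (subst it(2)) (rule le[OF Suc.IH], assumption, rule Suc.prems[unfolded it(2)[of n]])
 qed (simp add: it(1))
 define G where "G x = prog_sup (\<lambda>n. it n x)" for x
 have G: "prog_lim (\<lambda>n. it n x) (G x)" for x unfolding G_def by (rule prog_lim_sup) (rule mono)
 have G_fix: "G x = \<Psi> G x" for x
  by (rule prog_lim_unique[OF prog_lim_Suc[OF G]]) (use cont G in \<open>simp add: prog_cont_def it(2)\<close>)
 show ?thesis
 proof (rule prog_limI)
  show "it (Suc n) x tp = Some v" if "it n x tp = Some v" for n tp v by (rule mono[OF that])
  show "p x tp = Some v" if "it n x tp = Some v" for n tp v using that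
  proof (induction n arbitrary: x tp v)
   case (Suc n)
   show ?case by (subst fixp) (rule le[OF Suc.IH], assumption, rule Suc.prems[unfolded it(2)])
  qed (simp add: it(1))
  show "\<exists>n. it n x tp = Some v" if "p x tp = Some v" for tp v
   by (rule prog_lim_ex[OF G least[OF G_fix that]])
 qed
qed

lemma prog_lim_loop: "prog_lim (\<lambda>n. loop_n n body s) (loop body s)"
proof (rule prog_lim_iterate)
 let ?F = "\<lambda>r s. pbind (body s) (\<lambda>y. case y of Inl s' \<Rightarrow> pbind (tick 1) (\<lambda>_. r s') | Inr x \<Rightarrow> ret x)"
 have L: "prog_lim (\<lambda>n. ?F (rs n) s) (?F r s)" if "\<forall>s. prog_lim (\<lambda>n. rs n s) (r s)" for rs r s
  by (intro prog_lim_pbind[OF prog_lim_const] prog_lim_case_sum prog_lim_const that[rule_format])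
 show cont: "prog_cont ?F" unfolding prog_cont_def by (intro allI impI) (rule L)
 fix G s tp v assume G: "\<And>s. G s = ?F G s" and v: "loop body s tp = Some v"
 \<comment> \<open>The loop body is an argument of the recursive function rather than a fixed
   parameter, so the induction ranges over all bodies; the equation recovers the given one.\<close>
 have "b = body \<longrightarrow> G s tp = Some v" if "loop b s tp = Some v" for b
  using that
 proof (rule loop.raw_induct[rotated], goal_cases)
  case (1 lp b s tp r)
  show ?case
  proof
   assume b: "b = body"
   show "G s tp = Some r" unfolding G[of s]
    by (rule functional_le[OF cont, where r = "lp body"], erule 1(1)[rule_format, OF _ refl], rule 1(2)[unfolded b])
  qed
 qed
 from this[OF v] show "G s tp = Some v" by blast
qed (rule loop_simps, simp_all)

section \<open>Freshness of the unread tape\<close>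

abbreviation tape_meas :: "real \<Rightarrow> (tape \<Rightarrow> ennreal) set" where "tape_meas q \<equiv> borel_measurable (tape_measure q)"
abbreviation tape_int :: "real \<Rightarrow> (tape \<Rightarrow> ennreal) \<Rightarrow> ennreal" where "tape_int q \<equiv> integral\<^sup>N (tape_measure q)"

text \<open>Independence of past and future: a continuation evaluated on the unread tape may be
  replaced by its mean over a new tape. The quantification over families \<open>g x c\<close> makes
  it possible to say this without any measurable structure on the results.\<close>

definition good :: "real \<Rightarrow> 'a prog \<Rightarrow> bool" where
 "good q p \<longleftrightarrow> (\<forall>g. (\<forall>x c. g x c \<in> tape_meas q) \<longrightarrow>
   app p g \<in> tape_meas q \<and>
   tape_int q (app p g) =
    tape_int q (app p (\<lambda>x c _. tape_int q (g x c))))"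

lemma prob_space_cell: "prob_space (cell_measure q)"
proof -
 interpret u: prob_space "uniform_measure lborel {0..1::real}"
  by (rule prob_space_uniform_measure) auto
 interpret p: prob_space "measure_pmf (poisson_pmf 1) \<Otimes>\<^sub>M measure_pmf (geometric_pmf (1 - q))"
  by (intro prob_space_pair measure_pmf.prob_space_axioms)
 show ?thesis unfolding cell_measure_def by (intro prob_space_pair u.prob_space_axioms p.prob_space_axioms)
qed

lemma prob_space_tape: "prob_space (tape_measure q)"
 unfolding tape_measure_def by (rule prob_space.prob_space_stream_space[OF prob_space_cell])

lemma measurable_shd_tape[measurable]: "shd \<in> tape_measure q \<rightarrow>\<^sub>M cell_measure q"
 unfolding tape_measure_def by measurable

lemma measurable_stl_tape[measurable]: "stl \<in> tape_measure q \<rightarrow>\<^sub>M tape_measure q"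
 unfolding tape_measure_def by measurable

lemma emeasure_tape [simp]: "emeasure (tape_measure q) (space (tape_measure q)) = 1"
 by (rule prob_space.emeasure_space_1[OF prob_space_tape])

lemma tape_const: "(\<integral>\<^sup>+ tp. c \<partial>tape_measure q) = c"
 by simp

lemma goodD:
 assumes "good q p" "\<And>x c. g x c \<in> tape_meas q"
 shows "app p g \<in> tape_meas q"
  "tape_int q (app p g) =
    tape_int q (app p (\<lambda>x c _. tape_int q (g x c)))"
 using assms unfolding good_def by blast+

lemma good_detp: "good q (detp x c)"
 unfolding good_def by (simp add: app_detp)

lemma good_ret: "good q (ret x)" and good_tick: "good q (tick k)"
 by (simp_all add: ret_eq tick_eq good_detp)

lemma good_pbind:
 assumes p: "good q p" and k: "\<And>x. good q (k x)"
 shows "good q (pbind p k)"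
 unfolding good_def app_pbind
proof (intro allI impI conjI)
 fix g :: "'b \<Rightarrow> nat \<Rightarrow> tape \<Rightarrow> ennreal"
 assume g: "\<forall>x c. g x c \<in> tape_meas q"
 have m: "app (k x) (\<lambda>y c'. g y (c + c')) \<in> tape_meas q" for x c
  by (rule goodD(1)[OF k g[rule_format]])
 show "app p (\<lambda>x c. app (k x) (\<lambda>y c'. g y (c + c'))) \<in> tape_meas q"
  by (rule goodD(1)[OF p m])
 let ?g = "\<lambda>x c _. tape_int q (g x c)"
 have m': "app (k x) (\<lambda>y c'. ?g y (c + c')) \<in> tape_meas q" for x c
  by (rule goodD(1)[OF k]) simp
 have "tape_int q (app p (\<lambda>x c. app (k x) (\<lambda>y c'. g y (c + c')))) =
  tape_int q (app p (\<lambda>x c _. tape_int q (app (k x) (\<lambda>y c'. g y (c + c')))))"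
  by (rule goodD(2)[OF p m])
 also have "... = tape_int q (app p (\<lambda>x c _. tape_int q (app (k x) (\<lambda>y c'. ?g y (c + c')))))"
  unfolding goodD(2)[OF k g[rule_format]] ..
 also have "... = tape_int q (app p (\<lambda>x c. app (k x) (\<lambda>y c'. ?g y (c + c'))))"
  by (rule goodD(2)[OF p m', symmetric])
 finally show "tape_int q (app p (\<lambda>x c. app (k x) (\<lambda>y c'. g y (c + c')))) =
  tape_int q (app p (\<lambda>x c. app (k x) (\<lambda>y c'. ?g y (c + c'))))" .
qed

text \<open>Both sides are suprema along the chain, so loops and recursions inherit freshness from
  their cut-off versions.\<close>

lemma good_lim:
 assumes l: "prog_lim ps p" and g: "\<And>n. good q (ps n)"
 shows "good q p"
 unfolding good_def
proof (intro allI impI conjI)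
 fix f :: "'a \<Rightarrow> nat \<Rightarrow> tape \<Rightarrow> ennreal"
 assume f: "\<forall>x c. f x c \<in> tape_meas q"
 have eq: "app p f = (\<lambda>tp. SUP n. app (ps n) f tp)" for f
  using prog_lim_app_SUP(1)[OF l] by (simp add: fun_eq_iff)
 have m: "(\<forall>x c. f x c \<in> tape_meas q) \<Longrightarrow> app (ps n) f \<in> tape_meas q" for n f
  by (rule goodD(1)[OF g]) blast
 have inc: "incseq (\<lambda>n. app (ps n) f)" for f
  using prog_lim_app_SUP(2)[OF l] by (auto simp: incseq_def le_fun_def)
 show "app p f \<in> tape_meas q"
  unfolding eq by (intro borel_measurable_SUP m f) auto
 have 1: "tape_int q (app p f) = (SUP n. tape_int q (app (ps n) f))"
  if "\<forall>x c. f x c \<in> tape_meas q" for f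
  unfolding eq by (rule nn_integral_monotone_convergence_SUP[OF inc m[OF that]])
 show "tape_int q (app p f) =
    tape_int q (app p (\<lambda>x c _. tape_int q (f x c)))"
  unfolding 1[OF f] goodD(2)[OF g f[rule_format]] by (rule 1[symmetric]) simp
qed

lemma good_None: "good q (\<lambda>_. None)"
proof -
 have "app (\<lambda>_. None) g = (\<lambda>_. 0)" for g :: "'a \<Rightarrow> nat \<Rightarrow> tape \<Rightarrow> ennreal" by (simp add: app_def fun_eq_iff)
 thus ?thesis unfolding good_def by simp
qed

lemma good_case_sum:
 "(\<And>x. good q (f x)) \<Longrightarrow> (\<And>y. good q (g y)) \<Longrightarrow> good q (case z of Inl x \<Rightarrow> f x | Inr y \<Rightarrow> g y)"
 by (cases z) simp_all

lemma good_loop: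
 assumes "\<And>s. good q (body s)"
 shows "good q (loop body s)"
proof (rule good_lim[OF prog_lim_loop])
 fix n show "good q (loop_n n body s)"
 proof (induction n arbitrary: s)
  case (Suc n) show ?case unfolding loop_n.simps
   by (intro good_pbind good_case_sum assms good_tick good_ret Suc)
 qed (simp add: good_None)
qed

lemma good_for_loop:
 assumes "\<And>i s. good q (f i s)"
 shows "good q (for_loop k i f s)"
 by (induction k arbitrary: i s) (auto intro!: good_pbind good_tick good_ret assms)

text \<open>An instruction that consumes exactly one cell. \<open>None\<close> is allowed so that a
  comparison cut off after finitely many rounds is also of this kind.\<close>

definition draw :: "(cell \<Rightarrow> ('a \<times> nat) option) \<Rightarrow> 'a prog" where
 "draw h = (\<lambda>tp. map_option (\<lambda>(x, c). (x, c, stl tp)) (h (shd tp)))"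

lemma nn_integral_tape:
 assumes [measurable]: "f \<in> tape_meas q"
 shows "tape_int q f = (\<integral>\<^sup>+ x. \<integral>\<^sup>+ tp. f (x ## tp) \<partial>tape_measure q \<partial>cell_measure q)"
 unfolding tape_measure_def
 by (rule prob_space.nn_integral_stream_space[OF prob_space_cell]) (use assms in \<open>simp add: tape_measure_def\<close>)

lemma app_draw: "app (draw h) g tp = (case h (shd tp) of None \<Rightarrow> 0 | Some (x, c) \<Rightarrow> g x c (stl tp))"
 by (auto simp: app_def draw_def split: option.splits)

text \<open>Countably many results split the tape space into countably many measurable pieces, on
  each of which a single \<open>g x c\<close> is applied; no joint measurability of \<open>g\<close>
  is asked for.\<close>

lemma draw_measurable:
 fixes h :: "cell \<Rightarrow> ('a::countable \<times> nat) option"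
 assumes h[measurable]: "h \<in> cell_measure q \<rightarrow>\<^sub>M count_space UNIV"
  and g: "\<And>x c. g x c \<in> tape_meas q"
 shows "app (draw h) g \<in> tape_meas q"
proof -
 have [measurable]: "(\<lambda>tp. case r of None \<Rightarrow> 0 | Some (x, c) \<Rightarrow> g x c (stl tp)) \<in> tape_meas q" for r
  using g measurable_compose[OF measurable_stl_tape g] by (cases r) auto
 have "(\<lambda>tp. case h (shd tp) of None \<Rightarrow> 0 | Some (x, c) \<Rightarrow> g x c (stl tp)) \<in> tape_meas q"
  by (rule measurable_compose_countable[of "\<lambda>r tp. case r of None \<Rightarrow> 0 | Some (x, c) \<Rightarrow> g x c (stl tp)" _ _ "\<lambda>tp. h (shd tp)"])
    measurable
 thus ?thesis by (simp add: app_draw[abs_def])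
qed

lemma nn_integral_app_draw:
 fixes h :: "cell \<Rightarrow> ('a::countable \<times> nat) option"
 assumes h[measurable]: "h \<in> cell_measure q \<rightarrow>\<^sub>M count_space UNIV"
  and g: "\<And>x c. g x c \<in> tape_meas q"
 shows "tape_int q (app (draw h) g) =
   (\<integral>\<^sup>+ z. (case h z of None \<Rightarrow> 0 | Some (x, c) \<Rightarrow> tape_int q (g x c)) \<partial>cell_measure q)"
proof (subst nn_integral_tape[OF draw_measurable[OF h g]], rule nn_integral_cong)
 fix z
 show "(\<integral>\<^sup>+ tp. app (draw h) g (z ## tp) \<partial>tape_measure q) =
   (case h z of None \<Rightarrow> 0 | Some (x, c) \<Rightarrow> tape_int q (g x c))"
  by (cases "h z") (simp_all add: app_draw split_beta)
qed

lemma good_draw: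
 fixes h :: "cell \<Rightarrow> ('a::countable \<times> nat) option"
 assumes h: "h \<in> cell_measure q \<rightarrow>\<^sub>M count_space UNIV"
 shows "good q (draw h)"
 unfolding good_def
proof (intro allI impI conjI)
 fix g :: "'a \<Rightarrow> nat \<Rightarrow> tape \<Rightarrow> ennreal"
 assume g: "\<forall>x c. g x c \<in> tape_meas q"
 show "app (draw h) g \<in> tape_meas q" by (rule draw_measurable[OF h g[rule_format]])
 show "tape_int q (app (draw h) g) =
    tape_int q (app (draw h) (\<lambda>x c _. tape_int q (g x c)))"
  unfolding nn_integral_app_draw[OF h g[rule_format]]
   nn_integral_app_draw[OF h borel_measurable_const] tape_const ..
qed

section \<open>Expectation calculus for values and costs\<close>

definition wp :: "real \<Rightarrow> 'a prog \<Rightarrow> ('a \<Rightarrow> nat \<Rightarrow> ennreal) \<Rightarrow> ennreal" where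
 "wp q p f = tape_int q (app p (\<lambda>x c _. f x c))"

definition val :: "real \<Rightarrow> 'a prog \<Rightarrow> ('a \<Rightarrow> ennreal) \<Rightarrow> ennreal" where
 "val q p f = wp q p (\<lambda>x _. f x)"

text \<open>Diverging tapes count 0 here, so cost bounds can be proved before termination is known;
  \<open>runtime_eq\<close> removes the difference afterwards.\<close>

definition cst :: "real \<Rightarrow> 'a prog \<Rightarrow> ennreal" where
 "cst q p = wp q p (\<lambda>_ c. of_nat c)"

definition post :: "'a prog \<Rightarrow> ('a \<Rightarrow> bool) \<Rightarrow> bool" where
 "post p P \<longleftrightarrow> (\<forall>tp x c tp'. p tp = Some (x, c, tp') \<longrightarrow> P x)"

lemma postD: "post p P \<Longrightarrow> p tp = Some (x, c, tp') \<Longrightarrow> P x"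
 unfolding post_def by blast

lemma post_mono: "post p P \<Longrightarrow> (\<And>x. P x \<Longrightarrow> Q x) \<Longrightarrow> post p Q"
 unfolding post_def by blast

lemma post_True: "post p (\<lambda>_. True)"
 unfolding post_def by blast

lemma post_detp: "post (detp x c) P \<longleftrightarrow> P x"
 unfolding post_def detp_def by simp

lemma post_ret: "P x \<Longrightarrow> post (ret x) P"
 by (simp add: ret_eq post_detp)

lemma post_pbind:
 assumes "post p P" "\<And>x. P x \<Longrightarrow> post (k x) Q"
 shows "post (pbind p k) Q"
 unfolding post_def
proof (intro allI impI)
 fix tp x c tp' assume "pbind p k tp = Some (x, c, tp')"
 then obtain y c1 tp1 c2 where 1: "p tp = Some (y, c1, tp1)" "k y tp1 = Some (x, c2, tp')"
  unfolding pbind_Some by blast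
 show "Q x" by (rule postD[OF assms(2)[OF postD[OF assms(1) 1(1)]] 1(2)])
qed

lemma post_pbind': "(\<And>x. post (k x) Q) \<Longrightarrow> post (pbind p k) Q"
 by (rule post_pbind[OF post_True])

lemma post_lim:
 assumes "prog_lim ps p" "\<And>n. post (ps n) P"
 shows "post p P"
 unfolding post_def
proof (intro allI impI)
 fix tp x c tp' assume "p tp = Some (x, c, tp')"
 from prog_lim_ex[OF assms(1) this] obtain n where "ps n tp = Some (x, c, tp')" ..
 thus "P x" by (rule postD[OF assms(2)])
qed

lemma post_loop:
 assumes step: "\<And>s. I s \<Longrightarrow> post (body s) (\<lambda>r. case r of Inl s' \<Rightarrow> I s' | Inr x \<Rightarrow> P x)" and "I s"
 shows "post (loop body s) P"
proof (rule post_lim[OF prog_lim_loop])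
 fix n show "post (loop_n n body s) P" using \<open>I s\<close>
 proof (induction n arbitrary: s)
  case (Suc n) show ?case unfolding loop_n.simps
  proof (rule post_pbind[OF step[OF Suc.prems]])
   fix r assume "case r of Inl s' \<Rightarrow> I s' | Inr x \<Rightarrow> P x"
   thus "post (case r of Inl s' \<Rightarrow> pbind (tick 1) (\<lambda>_. loop_n n body s') | Inr x \<Rightarrow> ret x) P"
    by (cases r) (simp_all add: post_pbind' Suc.IH post_ret)
  qed
 qed (simp add: post_def)
qed

lemma post_for_loop:
 assumes step: "\<And>j s. i \<le> j \<Longrightarrow> j < i + k \<Longrightarrow> I j s \<Longrightarrow> post (f j s) (I (Suc j))" and "I i s"
 shows "post (for_loop k i f s) (I (i + k))"
 using assms
proof (induction k arbitrary: i s)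
 case 0 thus ?case by (simp add: post_pbind' post_ret)
next
 case (Suc k) show ?case unfolding for_loop.simps
 proof (rule post_pbind')
  show "post (pbind (f i s) (\<lambda>s'. for_loop k (Suc i) f s')) (I (i + Suc k))"
   using Suc.IH[of "Suc i"] Suc.prems by (intro post_pbind[of _ "I (Suc i)"]) auto
 qed
qed

lemma wp_detp: "wp q (detp x c) f = f x c"
 by (simp add: wp_def app_detp)

lemma wp_pbind:
 assumes p: "good q p" and k: "\<And>x. good q (k x)"
 shows "wp q (pbind p k) f = wp q p (\<lambda>x c. wp q (k x) (\<lambda>y c'. f y (c + c')))"
 unfolding wp_def app_pbind
 by (rule goodD(2)[OF p]) (intro goodD(1)[OF k] borel_measurable_const)

lemma app_measurable:
 "good q p \<Longrightarrow> app p (\<lambda>x c _. f x c) \<in> tape_meas q"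
 by (erule goodD) simp

lemma wp_mono_post:
 assumes "post p P" "\<And>x c. P x \<Longrightarrow> f x c \<le> g x c"
 shows "wp q p f \<le> wp q p g"
 unfolding wp_def
proof (rule nn_integral_mono)
 fix tp show "app p (\<lambda>x c _. f x c) tp \<le> app p (\<lambda>x c _. g x c) tp"
 proof (cases "p tp")
  case (Some r)
  thus ?thesis using assms(2)[OF postD[OF assms(1)], of tp] by (cases r) (simp add: app_def)
 qed (simp add: app_def)
qed

lemma wp_mono: "(\<And>x c. f x c \<le> g x c) \<Longrightarrow> wp q p f \<le> wp q p g"
 by (rule wp_mono_post[OF post_True])

lemma wp_cong_post: "post p P \<Longrightarrow> (\<And>x c. P x \<Longrightarrow> f x c = g x c) \<Longrightarrow> wp q p f = wp q p g"
 by (intro antisym wp_mono_post[of p P]) auto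

lemma wp_add: "good q p \<Longrightarrow> wp q p (\<lambda>x c. f x c + g x c) = wp q p f + wp q p g"
 unfolding wp_def
 by (subst nn_integral_add[symmetric])
   (auto simp: app_measurable app_def intro!: nn_integral_cong split: option.split)

lemma wp_cmult: "good q p \<Longrightarrow> wp q p (\<lambda>x c. a * f x c) = a * wp q p f"
 unfolding wp_def
 by (subst nn_integral_cmult[symmetric])
   (auto simp: app_measurable app_def intro!: nn_integral_cong split: option.split)

lemma wp_suminf: "good q p \<Longrightarrow> wp q p (\<lambda>x c. \<Sum>i. f i x c) = (\<Sum>i. wp q p (f i))"
 unfolding wp_def
 by (subst nn_integral_suminf[symmetric])
   (auto simp: app_measurable app_def intro!: nn_integral_cong split: option.split)

lemma wp_lim:
 assumes l: "prog_lim ps p" and g: "\<And>n. good q (ps n)"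
 shows "wp q p f = (SUP n. wp q (ps n) f)"
 unfolding wp_def prog_lim_app_SUP(1)[OF l]
 using prog_lim_app_SUP(2)[OF l]
 by (intro nn_integral_monotone_convergence_SUP app_measurable g) (auto simp: incseq_def le_fun_def)

lemma val_detp: "val q (detp x c) f = f x"
 by (simp add: val_def wp_detp)

lemma cst_detp: "cst q (detp x c) = of_nat c"
 by (simp add: cst_def wp_detp)

lemma val_ret: "val q (ret x) f = f x" and val_tick: "val q (tick k) f' = f' ()"
 and cst_ret: "cst q (ret x) = 0" and cst_tick: "cst q (tick k) = of_nat k"
 by (simp_all add: ret_eq tick_eq val_detp cst_detp)

lemma val_pbind:
 "good q p \<Longrightarrow> (\<And>x. good q (k x)) \<Longrightarrow> val q (pbind p k) f = val q p (\<lambda>x. val q (k x) f)"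
 unfolding val_def by (rule wp_pbind)

lemma val_mono: "(\<And>x. f x \<le> g x) \<Longrightarrow> val q p f \<le> val q p g"
 unfolding val_def by (rule wp_mono)

lemma val_mono_post: "post p P \<Longrightarrow> (\<And>x. P x \<Longrightarrow> f x \<le> g x) \<Longrightarrow> val q p f \<le> val q p g"
 unfolding val_def by (rule wp_mono_post)

lemma val_cong_post: "post p P \<Longrightarrow> (\<And>x. P x \<Longrightarrow> f x = g x) \<Longrightarrow> val q p f = val q p g"
 unfolding val_def by (rule wp_cong_post)

lemma val_add: "good q p \<Longrightarrow> val q p (\<lambda>x. f x + g x) = val q p f + val q p g"
 unfolding val_def by (rule wp_add)

lemma val_cmult: "good q p \<Longrightarrow> val q p (\<lambda>x. a * f x) = a * val q p f"
 unfolding val_def by (rule wp_cmult)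

lemma val_multc: "good q p \<Longrightarrow> val q p (\<lambda>x. f x * a) = val q p f * a"
 using val_cmult[of q p a f] by (simp add: mult.commute)

lemma val_suminf: "good q p \<Longrightarrow> val q p (\<lambda>x. \<Sum>i. f i x) = (\<Sum>i. val q p (f i))"
 unfolding val_def by (rule wp_suminf)

lemma val_le_const: "(\<And>x. f x \<le> C) \<Longrightarrow> val q p f \<le> C"
proof -
 assume f: "\<And>x. f x \<le> C"
 have "val q p f \<le> (\<integral>\<^sup>+ tp. C \<partial>tape_measure q)"
  unfolding val_def wp_def using f by (intro nn_integral_mono) (auto simp: app_def split: option.split)
 thus ?thesis by simp
qed

lemma val_le_const_post: "post p P \<Longrightarrow> (\<And>x. P x \<Longrightarrow> f x \<le> C) \<Longrightarrow> val q p f \<le> C"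
 using val_mono_post[of p P f "\<lambda>_. C" q] val_le_const[of "\<lambda>_. C" C q p] by (meson order_refl order_trans)

text \<open>Only an inequality, since the cost of \<open>p\<close> is lost on tapes on which the
  continuation diverges.\<close>

lemma cst_pbind:
 assumes p: "good q p" and k: "\<And>x. good q (k x)"
 shows "cst q (pbind p k) \<le> cst q p + val q p (\<lambda>x. cst q (k x))"
proof -
 have "wp q (k x) (\<lambda>y c'. of_nat (c + c')) \<le> of_nat c + cst q (k x)" for x c
 proof -
  have "wp q (k x) (\<lambda>y c'. of_nat (c + c')) = wp q (k x) (\<lambda>y c'. of_nat c + of_nat c')" by simp
  also have "... = val q (k x) (\<lambda>_. of_nat c) + cst q (k x)"
   unfolding wp_add[OF k] val_def cst_def ..
  also have "... \<le> of_nat c + cst q (k x)" by (intro add_mono val_le_const) auto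
  finally show ?thesis .
 qed
 hence "cst q (pbind p k) \<le> wp q p (\<lambda>x c. of_nat c + cst q (k x))"
  unfolding cst_def wp_pbind[OF p k] by (intro wp_mono) (simp add: cst_def)
 also have "... = cst q p + val q p (\<lambda>x. cst q (k x))"
  unfolding wp_add[OF p] cst_def val_def ..
 finally show ?thesis .
qed

lemma cst_pbind_le:
 assumes "good q p" "\<And>x. good q (k x)" "cst q p \<le> a" "\<And>x. cst q (k x) \<le> b"
 shows "cst q (pbind p k) \<le> a + b"
 using cst_pbind[OF assms(1,2)] add_mono[OF assms(3) val_le_const[of "\<lambda>x. cst q (k x)" b q p]] assms(4)
 by (meson order_trans)

lemma cst_pbind_le_post:
 assumes "good q p" "\<And>x. good q (k x)" "cst q p \<le> a" "post p P" "\<And>x. P x \<Longrightarrow> cst q (k x) \<le> b"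
 shows "cst q (pbind p k) \<le> a + b"
 using cst_pbind[OF assms(1,2)] add_mono[OF assms(3) val_le_const_post[OF assms(4), of "\<lambda>x. cst q (k x)" b q]] assms(5)
 by (meson order_trans)

lemma val_tick_bind: "good q k \<Longrightarrow> val q (pbind (tick n) (\<lambda>_. k)) f = val q k f"
 by (simp add: val_pbind good_tick val_tick)

lemma cst_tick_bind: "good q k \<Longrightarrow> cst q (pbind (tick n) (\<lambda>_. k)) \<le> of_nat n + cst q k"
 by (rule order_trans[OF cst_pbind]) (simp_all add: good_tick cst_tick val_tick)

lemma val_detp_bind: "(\<And>x. good q (k x)) \<Longrightarrow> val q (pbind (detp x c) k) f = val q (k x) f"
 by (simp add: val_pbind good_detp val_detp)

lemma cst_detp_bind: "(\<And>x. good q (k x)) \<Longrightarrow> cst q (pbind (detp x c) k) \<le> of_nat c + cst q (k x)"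
 by (rule order_trans[OF cst_pbind]) (simp_all add: good_detp cst_detp val_detp)

lemma val_loop:
 assumes "\<And>s. good q (body s)"
 shows "val q (loop body s) f = val q (body s) (\<lambda>r. case r of Inl s' \<Rightarrow> val q (loop body s') f | Inr x \<Rightarrow> f x)"
proof -
 have g: "good q (case r of Inl s' \<Rightarrow> pbind (tick 1) (\<lambda>_. loop body s') | Inr x \<Rightarrow> ret x)" for r
  by (intro good_case_sum good_pbind good_tick good_loop good_ret assms)
 have "val q (case r of Inl s' \<Rightarrow> pbind (tick 1) (\<lambda>_. loop body s') | Inr x \<Rightarrow> ret x) f =
  (case r of Inl s' \<Rightarrow> val q (loop body s') f | Inr x \<Rightarrow> f x)" for r
  by (cases r) (simp_all add: val_tick_bind good_loop assms val_ret)
 thus ?thesis by (subst loop_simps, subst val_pbind[OF assms g]) simp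
qed

text \<open>The potential \<open>g\<close> pays for one round, the tick and the potential of the
  next state. By induction this bounds every cut-off loop, hence the limit, and termination is not
  presupposed.\<close>

lemma cst_loop:
 assumes "\<And>s. good q (body s)"
  and "\<And>s. cst q (body s) + val q (body s) (\<lambda>r. case r of Inl s' \<Rightarrow> 1 + g s' | Inr x \<Rightarrow> 0) \<le> g s"
 shows "cst q (loop body s) \<le> g s"
proof -
 have gn: "good q (loop_n n body s)" for n s
  by (induction n arbitrary: s) (auto simp only: loop_n.simps intro!: good_None good_pbind good_case_sum good_tick good_ret assms)
 have "cst q (loop_n n body s) \<le> g s" for n
 proof (induction n arbitrary: s)
  case 0
  have "app (loop_n 0 body s) (\<lambda>x c _. of_nat c) = (\<lambda>_. 0)" by (simp add: app_def fun_eq_iff)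
  thus ?case by (simp add: cst_def wp_def)
 next
  case (Suc n)
  have *: "cst q (case r of Inl s' \<Rightarrow> pbind (tick 1) (\<lambda>_. loop_n n body s') | Inr x \<Rightarrow> ret x) \<le>
    (case r of Inl s' \<Rightarrow> 1 + g s' | Inr x \<Rightarrow> 0)" for r
  proof (cases r)
   case (Inl s')
   have "cst q (pbind (tick 1) (\<lambda>_. loop_n n body s')) \<le> of_nat 1 + cst q (loop_n n body s')"
    by (rule cst_tick_bind[OF gn])
   also have "... \<le> 1 + g s'" using Suc.IH[of s'] by (auto intro: add_mono)
   finally show ?thesis using Inl by simp
  qed (simp add: cst_ret)
  have "cst q (loop_n (Suc n) body s) \<le> cst q (body s) + val q (body s)
    (\<lambda>r. cst q (case r of Inl s' \<Rightarrow> pbind (tick 1) (\<lambda>_. loop_n n body s') | Inr x \<Rightarrow> ret x))"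
   unfolding loop_n.simps
   by (intro cst_pbind assms good_case_sum good_pbind good_tick good_ret gn)
  also have "... \<le> g s"
   by (rule order_trans[OF add_left_mono[OF val_mono] assms(2)]) (rule *)
  finally show ?case .
 qed
 thus ?thesis unfolding cst_def wp_lim[OF prog_lim_loop gn] by (intro SUP_least)
qed

lemma val_for_loop_0: "val q (for_loop 0 i f s) g = g s"
 by (simp add: val_pbind good_tick good_ret val_tick val_ret)

lemma val_for_loop_Suc:
 assumes "\<And>i s. good q (f i s)"
 shows "val q (for_loop (Suc k) i f s) g = val q (f i s) (\<lambda>s'. val q (for_loop k (Suc i) f s') g)"
 by (simp add: val_pbind good_tick val_tick good_for_loop good_pbind assms del: One_nat_def)

lemma cst_for_loop_0: "cst q (for_loop 0 i f s) \<le> 1"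
 using cst_tick_bind[OF good_ret, of q 1 s] by (simp add: cst_ret)

lemma cst_for_loop_Suc:
 assumes "\<And>i s. good q (f i s)"
 shows "cst q (for_loop (Suc k) i f s) \<le> 2 + (cst q (f i s) + val q (f i s) (\<lambda>s'. cst q (for_loop k (Suc i) f s')))"
 unfolding for_loop.simps
 by (rule order_trans[OF cst_tick_bind[OF good_pbind] add_mono[OF _ cst_pbind]]) (simp_all add: assms good_for_loop)

lemma cst_for_loop_post:
 assumes g: "\<And>i s. good q (f i s)"
  and c: "\<And>j s. i \<le> j \<Longrightarrow> j < i + k \<Longrightarrow> I j s \<Longrightarrow> cst q (f j s) \<le> C j"
  and p: "\<And>j s. i \<le> j \<Longrightarrow> j < i + k \<Longrightarrow> I j s \<Longrightarrow> post (f j s) (I (Suc j))" and "I i s"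
 shows "cst q (for_loop k i f s) \<le> 1 + (\<Sum>j=i..<i+k. 2 + C j)"
 using c p \<open>I i s\<close>
proof (induction k arbitrary: i s)
 case 0 show ?case using cst_for_loop_0[of q i f s] by simp
next
 case (Suc k)
 have "val q (f i s) (\<lambda>s'. cst q (for_loop k (Suc i) f s')) \<le> 1 + (\<Sum>j=Suc i..<Suc i+k. 2 + C j)"
 proof (rule val_le_const_post[of _ "I (Suc i)"])
  show "post (f i s) (I (Suc i))" using Suc.prems by auto
  show "cst q (for_loop k (Suc i) f s') \<le> 1 + (\<Sum>j=Suc i..<Suc i+k. 2 + C j)" if "I (Suc i) s'" for s'
   by (rule Suc.IH[OF _ _ that]) (use Suc.prems in auto)
 qed
 hence "cst q (for_loop (Suc k) i f s) \<le> 2 + (C i + (1 + (\<Sum>j=Suc i..<Suc i+k. 2 + C j)))"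
  using Suc.prems by (intro order_trans[OF cst_for_loop_Suc[OF g]] add_mono) auto
 also have "... = 1 + ((2 + C i) + (\<Sum>j=Suc i..<i+Suc k. 2 + C j))" by (simp add: algebra_simps)
 also have "... = 1 + (\<Sum>j=i..<i+Suc k. 2 + C j)"
  by (subst sum.atLeast_Suc_lessThan[of i "i + Suc k"]) auto
 finally show ?case .
qed

lemma cst_for_loop_const:
 assumes "\<And>i s. good q (f i s)" "\<And>i s. cst q (f i s) \<le> C"
 shows "cst q (for_loop k i f s) \<le> 1 + of_nat k * (2 + C)"
 using cst_for_loop_post[of q f i k "\<lambda>_ _. True" "\<lambda>_. C" s, OF assms(1) assms(2) post_True TrueI] by simp

text \<open>Mass 1 makes the tapes with infinite runtime a null set, and off that set runtime and
  terminating cost coincide.\<close>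

lemma runtime_eq:
 assumes g: "good q p"
 shows "runtime p \<in> tape_meas q"
  and "val q p (\<lambda>_. 1) = 1 \<Longrightarrow> expected_runtime q p = cst q p"
proof -
 let ?a = "app p (\<lambda>x c _. of_nat c)" and ?b = "app p (\<lambda>x c _. 1)"
 have [measurable]: "?a \<in> tape_meas q" "?b \<in> tape_meas q"
  by (rule app_measurable[OF g])+
 \<comment> \<open>\<open>?a\<close> alone cannot tell divergence from cost 0; the indicator
   \<open>?b\<close> of termination can, and both are measurable.\<close>
 have eq: "runtime p = (\<lambda>tp. if ?b tp = 0 then \<infinity> else ?a tp)"
  by (auto simp: runtime_def app_def fun_eq_iff split: option.split)
 show "runtime p \<in> tape_meas q" unfolding eq by measurable
 assume 1: "val q p (\<lambda>_. 1) = 1"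
 have b1: "?b tp \<le> 1" for tp by (auto simp: app_def split: option.split)
 have "(\<integral>\<^sup>+ tp. 1 - ?b tp \<partial>tape_measure q) = (\<integral>\<^sup>+ tp. 1 \<partial>tape_measure q) - tape_int q ?b"
  using 1 b1 by (intro nn_integral_diff) (auto simp: val_def wp_def)
 also have "... = 0" using 1 by (simp add: val_def wp_def)
 finally have "AE tp in tape_measure q. 1 - ?b tp = 0"
  by (subst (asm) nn_integral_0_iff_AE) auto
 hence "AE tp in tape_measure q. runtime p tp = ?a tp"
  by eventually_elim (auto simp: eq)
 thus "expected_runtime q p = cst q p"
  unfolding expected_runtime_def cst_def wp_def by (rule nn_integral_cong_AE)
qed

lemma wp_draw:
 fixes h :: "cell \<Rightarrow> ('a::countable \<times> nat) option"
 assumes h: "h \<in> cell_measure q \<rightarrow>\<^sub>M count_space UNIV"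
 shows "wp q (draw h) f = (\<integral>\<^sup>+ z. (case h z of None \<Rightarrow> 0 | Some (x, c) \<Rightarrow> f x c) \<partial>cell_measure q)"
 unfolding wp_def nn_integral_app_draw[OF h borel_measurable_const] tape_const ..

abbreviation "unif \<equiv> uniform_measure lborel {0..1::real}"

lemma cell_components [measurable]:
 "fst \<in> cell_measure q \<rightarrow>\<^sub>M borel"
 "(\<lambda>z. fst (snd z)) \<in> cell_measure q \<rightarrow>\<^sub>M count_space UNIV"
 "(\<lambda>z. snd (snd z)) \<in> cell_measure q \<rightarrow>\<^sub>M count_space UNIV"
proof -
 show "fst \<in> cell_measure q \<rightarrow>\<^sub>M borel" unfolding cell_measure_def by measurable
 have 1: "(\<lambda>z. fst (snd z)) \<in> cell_measure q \<rightarrow>\<^sub>M measure_pmf (poisson_pmf 1)"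
  "(\<lambda>z. snd (snd z)) \<in> cell_measure q \<rightarrow>\<^sub>M measure_pmf (geometric_pmf (1 - q))"
  unfolding cell_measure_def by measurable
 thus "(\<lambda>z. fst (snd z)) \<in> cell_measure q \<rightarrow>\<^sub>M count_space UNIV"
 "(\<lambda>z. snd (snd z)) \<in> cell_measure q \<rightarrow>\<^sub>M count_space UNIV"
  by (simp_all add: measurable_def)
qed

lemma nn_integral_cell:
 assumes "f \<in> borel_measurable borel"
 shows "(\<integral>\<^sup>+ z. f (fst z) \<partial>cell_measure q) = (\<integral>\<^sup>+ u. f u \<partial>unif)"
  and "(\<integral>\<^sup>+ z. g (fst (snd z)) \<partial>cell_measure q) = (\<integral>\<^sup>+ n. g n \<partial>measure_pmf (poisson_pmf 1))"
  and "(\<integral>\<^sup>+ z. g (snd (snd z)) \<partial>cell_measure q) = (\<integral>\<^sup>+ n. g n \<partial>measure_pmf (geometric_pmf (1 - q)))"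
proof -
 let ?P = "measure_pmf (poisson_pmf 1)" and ?G = "measure_pmf (geometric_pmf (1 - q))"
 interpret u: prob_space unif by (rule prob_space_uniform_measure) auto
 interpret p: prob_space "?P \<Otimes>\<^sub>M ?G"
  by (intro prob_space_pair measure_pmf.prob_space_axioms)
 have [measurable]: "f \<in> borel_measurable borel" by fact
 have [measurable]: "h \<in> borel_measurable ?P" "h \<in> borel_measurable ?G" for h :: "nat \<Rightarrow> ennreal" by auto
 show "(\<integral>\<^sup>+ z. f (fst z) \<partial>cell_measure q) = (\<integral>\<^sup>+ u. f u \<partial>unif)"
  unfolding cell_measure_def by (subst p.nn_integral_fst[symmetric]) (auto simp: p.emeasure_space_1)
 have [measurable]: "fst \<in> ?P \<Otimes>\<^sub>M ?G \<rightarrow>\<^sub>M ?P" "snd \<in> ?P \<Otimes>\<^sub>M ?G \<rightarrow>\<^sub>M ?G" by measurable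
 have m: "(\<lambda>z. g (fst (snd z))) \<in> borel_measurable (unif \<Otimes>\<^sub>M (?P \<Otimes>\<^sub>M ?G))"
  "(\<lambda>z. g (snd (snd z))) \<in> borel_measurable (unif \<Otimes>\<^sub>M (?P \<Otimes>\<^sub>M ?G))"
  "(\<lambda>z. g (fst z)) \<in> borel_measurable (?P \<Otimes>\<^sub>M ?G)" "(\<lambda>z. g (snd z)) \<in> borel_measurable (?P \<Otimes>\<^sub>M ?G)"
  by measurable
 show "(\<integral>\<^sup>+ z. g (fst (snd z)) \<partial>cell_measure q) = (\<integral>\<^sup>+ n. g n \<partial>?P)"
  unfolding cell_measure_def
  using p.nn_integral_fst[OF m(1)] measure_pmf.nn_integral_fst[OF m(3)]
  by (simp add: u.emeasure_space_1 measure_pmf.emeasure_space_1 del: space_measure_pmf)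
 show "(\<integral>\<^sup>+ z. g (snd (snd z)) \<partial>cell_measure q) = (\<integral>\<^sup>+ n. g n \<partial>?G)"
  unfolding cell_measure_def
  using p.nn_integral_fst[OF m(2)] measure_pmf.nn_integral_fst[OF m(4)]
  by (simp add: u.emeasure_space_1 measure_pmf.emeasure_space_1 del: space_measure_pmf)
qed

section \<open>Polya trees\<close>

lemma tsize_Node: "tsize (Node F) = Suc (fsize F)"
 by (simp add: fsize_def)

declare tsize.simps [simp del]
declare tsize_Node [simp]

lemma tsize_pos: "0 < tsize T"
 by (cases T) simp

lemma tsize_neq_0 [simp]: "tsize T \<noteq> 0"
 using tsize_pos[of T] by simp

lemma fsize_empty [simp]: "fsize {#} = 0"
 and fsize_add_mset [simp]: "fsize (add_mset T F) = tsize T + fsize F"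
 and fsize_union [simp]: "fsize (F + G) = fsize F + fsize G"
 by (simp_all add: fsize_def)

lemma fsize_replicate [simp]: "fsize (replicate_mset j T) = j * tsize T"
 by (induction j) simp_all

lemma size_le_fsize: "size F \<le> fsize F"
proof (induction F)
 case (add T F) thus ?case using tsize_pos[of T] by simp
qed simp

lemma tsize_le_fsize: "T \<in># F \<Longrightarrow> tsize T \<le> fsize F"
 by (metis fsize_add_mset insert_DiffM le_add1)

lemma fsize_count:
 assumes "finite U" "set_mset F \<subseteq> U"
 shows "fsize F = (\<Sum>T\<in>U. count F T * tsize T)"
 using assms(2)
proof (induction F)
 case (add T F)
 have "(\<Sum>T'\<in>U. count (add_mset T F) T' * tsize T') =
  (\<Sum>T'\<in>U. count F T' * tsize T' + (if T' = T then tsize T else 0))"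
  by (rule sum.cong) auto
 with add show ?case using assms(1) by (simp add: sum.distrib)
qed simp

lemma tsize_eq_image: "{T. tsize T = Suc m} = Node ` {F. fsize F = m}"
proof (intro set_eqI iffI)
 fix T assume "T \<in> {T. tsize T = Suc m}"
 thus "T \<in> Node ` {F. fsize F = m}" by (cases T) auto
qed auto

lemma finite_forests: "finite {F. fsize F = m}"
proof (induction m rule: less_induct)
 case (less m)
 have T: "finite {T. tsize T \<le> m}"
 proof -
  have "{T. tsize T \<le> m} \<subseteq> (\<Union>k<m. Node ` {F. fsize F = k})"
  proof
   fix T assume "T \<in> {T. tsize T \<le> m}"
   thus "T \<in> (\<Union>k<m. Node ` {F. fsize F = k})" by (cases T) auto
  qed
  thus ?thesis by (rule finite_subset) (use less in auto)
 qed
 have "{F. fsize F = m} \<subseteq> (\<Union>s\<le>m. {F. set_mset F \<subseteq> {T. tsize T \<le> m} \<and> size F = s})"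
  using size_le_fsize tsize_le_fsize by force
 moreover have "finite (\<Union>s\<le>m. {F. set_mset F \<subseteq> {T. tsize T \<le> m} \<and> size F = s})"
  using finite_multisets_of_size[OF T] by (auto simp: multisets_of_size_def)
 ultimately show ?case by (rule finite_subset)
qed

lemma finite_trees: "finite {T. tsize T = k}"
proof (cases k)
 case 0
 thus ?thesis by simp
next
 case (Suc m) thus ?thesis by (simp add: tsize_eq_image finite_forests)
qed

lemma finite_trees_le: "finite {T. tsize T \<le> k}"
proof -
 have "{T. tsize T \<le> k} = (\<Union>i\<le>k. {T. tsize T = i})" by auto
 thus ?thesis using finite_trees by simp
qed

lemma a_coeff_0 [simp]: "a_coeff 0 = 0"
 by (simp add: a_coeff_def)

lemma a_coeff_Suc: "a_coeff (Suc m) = card {F. fsize F = m}"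
 unfolding a_coeff_def tsize_eq_image by (rule card_image) (auto simp: inj_on_def)

lemma a_coeff_1 [simp]: "a_coeff (Suc 0) = 1"
proof -
 have "{F. fsize F = 0} = {{#}}"
  using size_le_fsize by (auto, metis le_zero_eq size_eq_0_iff_empty)
 thus ?thesis by (simp add: a_coeff_Suc)
qed

text \<open>Removing \<open>j\<close> copies of \<open>T\<close> is a bijection onto smaller
  forests, and forests are counted by the trees obtained by adding a root.\<close>

lemma card_forests_count_ge:
 "card {F. fsize F = m \<and> j \<le> count F T} = (if j * tsize T \<le> m then a_coeff (Suc (m - j * tsize T)) else 0)"
proof (cases "j * tsize T \<le> m")
 case True
 have "bij_betw (\<lambda>F. F + replicate_mset j T) {F. fsize F = m - j * tsize T} {F. fsize F = m \<and> j \<le> count F T}"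
  by (rule bij_betw_byWitness[where f' = "\<lambda>F. F - replicate_mset j T"])
    (use True in \<open>auto simp: count_le_replicate_mset_subset_eq\<close>,
    metis add_diff_cancel_right' fsize_replicate fsize_union subset_mset.diff_add)
 thus ?thesis using True by (simp add: a_coeff_Suc bij_betw_same_card)
next
 case False
 have "{F. fsize F = m \<and> j \<le> count F T} = {}"
 proof safe
  fix F assume "j \<le> count F T" "m = fsize F"
  then obtain G where "F = replicate_mset j T + G"
   by (metis count_le_replicate_mset_subset_eq subset_mset.le_iff_add)
  with False \<open>m = fsize F\<close> show "F \<in> {}" by simp
 qed
 thus ?thesis using False by (metis card.empty)
qed

lemma sum_over_trees: "(\<Sum>T | tsize T \<le> n. g (tsize T)) = (\<Sum>k\<le>n. of_nat (a_coeff k) * g k)"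
 for g :: "nat \<Rightarrow> 'b::comm_semiring_1"
proof -
 have "(\<Sum>T | tsize T \<le> n. g (tsize T)) = (\<Sum>k\<le>n. \<Sum>T\<in>{T. T \<in> {T. tsize T \<le> n} \<and> tsize T = k}. g (tsize T))"
  by (rule sum.group[symmetric]) (auto simp: finite_trees_le)
 also have "... = (\<Sum>k\<le>n. of_nat (a_coeff k) * g k)"
 proof (rule sum.cong[OF refl])
  fix k assume "k \<in> {..n}"
  hence "{T. T \<in> {T. tsize T \<le> n} \<and> tsize T = k} = {T. tsize T = k}" by auto
  thus "(\<Sum>T\<in>{T. T \<in> {T. tsize T \<le> n} \<and> tsize T = k}. g (tsize T)) = of_nat (a_coeff k) * g k"
   by (simp add: a_coeff_def)
 qed
 finally show ?thesis .
qed

definition b_coeff :: "nat \<Rightarrow> nat" where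
 "b_coeff k = (\<Sum>e | e dvd k. e * a_coeff e)"

text \<open>Double counting of the pairs of a forest with m vertices and a marked vertex of it.\<close>

lemma a_coeff_rec: "m * a_coeff (Suc m) = (\<Sum>k=1..m. b_coeff k * a_coeff (Suc m - k))"
proof -
 let ?S = "{F. fsize F = m}" and ?U = "{T. tsize T \<le> m}"
 have "m * a_coeff (Suc m) = (\<Sum>F\<in>?S. fsize F)" by (simp add: a_coeff_Suc)
 also have "... = (\<Sum>F\<in>?S. \<Sum>T\<in>?U. \<Sum>j=1..m. if j \<le> count F T then tsize T else 0)"
 proof (rule sum.cong[OF refl])
  fix F assume F: "F \<in> ?S"
  have "fsize F = (\<Sum>T\<in>?U. count F T * tsize T)"
   by (rule fsize_count) (use F tsize_le_fsize finite_trees_le in auto)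
  also have "... = (\<Sum>T\<in>?U. \<Sum>j=1..m. if j \<le> count F T then tsize T else 0)"
  proof (rule sum.cong[OF refl])
   fix T
   have "count F T \<le> size F" by (rule count_le_size)
   hence "count F T \<le> m" using size_le_fsize[of F] F by simp
   hence "{j \<in> {1..m}. j \<le> count F T} = {1..count F T}" by auto
   thus "count F T * tsize T = (\<Sum>j=1..m. if j \<le> count F T then tsize T else 0)"
    by (simp add: sum.If_cases Int_def)
  qed
  finally show "fsize F = (\<Sum>T\<in>?U. \<Sum>j=1..m. if j \<le> count F T then tsize T else 0)" .
 qed
 also have "... = (\<Sum>T\<in>?U. \<Sum>j=1..m. \<Sum>F\<in>?S. if j \<le> count F T then tsize T else 0)"
  by (subst sum.swap, rule sum.cong[OF refl], rule sum.swap)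
 also have "... = (\<Sum>T\<in>?U. \<Sum>j=1..m. tsize T * (if j * tsize T \<le> m then a_coeff (Suc (m - j * tsize T)) else 0))"
  unfolding card_forests_count_ge[symmetric]
  by (intro sum.cong refl) (simp add: sum.If_cases finite_forests Collect_conj_eq Int_commute)
 also have "... = (\<Sum>e\<le>m. of_nat (a_coeff e) * (\<Sum>j=1..m. e * (if j * e \<le> m then a_coeff (Suc (m - j * e)) else 0)))"
  by (rule sum_over_trees)
 also have "... = (\<Sum>e=1..m. \<Sum>j=1..m. if j * e \<le> m then e * a_coeff e * a_coeff (Suc m - j * e) else 0)"
 proof -
  have "(\<Sum>e\<le>m. of_nat (a_coeff e) * (\<Sum>j=1..m. e * (if j * e \<le> m then a_coeff (Suc (m - j * e)) else 0)))
   = (\<Sum>e=1..m. of_nat (a_coeff e) * (\<Sum>j=1..m. e * (if j * e \<le> m then a_coeff (Suc (m - j * e)) else 0)))"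
   by (rule sum.mono_neutral_right) (auto simp: not_less_eq_eq)
  also have "... = (\<Sum>e=1..m. \<Sum>j=1..m. if j * e \<le> m then e * a_coeff e * a_coeff (Suc m - j * e) else 0)"
   by (auto simp: sum_distrib_left Suc_diff_le intro!: sum.cong)
  finally show ?thesis .
 qed
 also have "... = (\<Sum>e=1..m. \<Sum>k=1..m. if e dvd k then e * a_coeff e * a_coeff (Suc m - k) else 0)"
 proof (rule sum.cong[OF refl])
  fix e assume e: "e \<in> {1..m}"
  have "(\<Sum>j=1..m. if j * e \<le> m then e * a_coeff e * a_coeff (Suc m - j * e) else 0) =
   (\<Sum>j\<in>{j\<in>{1..m}. j * e \<le> m}. e * a_coeff e * a_coeff (Suc m - j * e))"
   by (rule sum.inter_filter[symmetric]) simp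
  also have "... = (\<Sum>k\<in>{k\<in>{1..m}. e dvd k}. e * a_coeff e * a_coeff (Suc m - k))"
  proof (rule sum.reindex_bij_betw[of "\<lambda>j. j * e"], rule bij_betw_byWitness[where f' = "\<lambda>k. k div e"])
   show "\<forall>j\<in>{j \<in> {1..m}. j * e \<le> m}. j * e div e = j" using e by simp
   show "\<forall>k\<in>{k \<in> {1..m}. e dvd k}. k div e * e = k" by simp
   show "(\<lambda>j. j * e) ` {j \<in> {1..m}. j * e \<le> m} \<subseteq> {k \<in> {1..m}. e dvd k}" using e by auto
   show "(\<lambda>k. k div e) ` {k \<in> {1..m}. e dvd k} \<subseteq> {j \<in> {1..m}. j * e \<le> m}"
   proof
    fix j assume "j \<in> (\<lambda>k. k div e) ` {k \<in> {1..m}. e dvd k}"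
    then obtain k where k: "k \<in> {1..m}" "e dvd k" "j = k div e" by blast
    hence j: "j * e = k" "j \<le> k" by simp_all
    hence "1 \<le> j" "j \<le> m" using k(1) by (cases j, auto)
    thus "j \<in> {j \<in> {1..m}. j * e \<le> m}" using k(1) j(1) by simp
   qed
  qed
  also have "... = (\<Sum>k=1..m. if e dvd k then e * a_coeff e * a_coeff (Suc m - k) else 0)"
   by (rule sum.inter_filter) simp
  finally show "(\<Sum>j=1..m. if j * e \<le> m then e * a_coeff e * a_coeff (Suc m - j * e) else 0) =
   (\<Sum>k=1..m. if e dvd k then e * a_coeff e * a_coeff (Suc m - k) else 0)" .
 qed
 also have "... = (\<Sum>k=1..m. \<Sum>e=1..m. if e dvd k then e * a_coeff e * a_coeff (Suc m - k) else 0)"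
  by (rule sum.swap)
 also have "... = (\<Sum>k=1..m. b_coeff k * a_coeff (Suc m - k))"
 proof (rule sum.cong[OF refl])
  fix k assume k: "k \<in> {1..m}"
  have "(\<Sum>e=1..m. if e dvd k then e * a_coeff e * a_coeff (Suc m - k) else 0) =
   (\<Sum>e\<in>{e\<in>{1..m}. e dvd k}. e * a_coeff e * a_coeff (Suc m - k))"
   by (rule sum.inter_filter[symmetric]) simp
  also have "{e\<in>{1..m}. e dvd k} = {e. e dvd k}" using k by (auto dest: dvd_imp_le intro: Suc_leI dvd_pos_nat)
  finally show "(\<Sum>e=1..m. if e dvd k then e * a_coeff e * a_coeff (Suc m - k) else 0) = b_coeff k * a_coeff (Suc m - k)"
   by (simp add: b_coeff_def sum_distrib_right)
 qed
 finally show ?thesis .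
qed

lemma count_space_bij:
 assumes "bij_betw h A B"
 shows "(\<integral>\<^sup>+ y. f y * indicator B y \<partial>count_space UNIV) = (\<integral>\<^sup>+ x. f (h x) * indicator A x \<partial>count_space UNIV)"
 using nn_integral_bij_count_space[OF assms, of f]
 by (simp add: nn_integral_count_space_indicator)

text \<open>Euler product: a forest over \<open>insert T U\<close> is a multiplicity of
  \<open>T\<close> together with a forest over \<open>U\<close>, so each tree contributes a
  geometric series.\<close>

lemma forests_product:
 fixes z :: real
 assumes "finite U" "0 \<le> z" "z < 1"
 shows "(\<integral>\<^sup>+ F. ennreal (z ^ fsize F) * indicator {F. set_mset F \<subseteq> U} F \<partial>count_space UNIV) =
  ennreal (\<Prod>T\<in>U. 1 / (1 - z ^ tsize T))"
 using assms(1)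
proof (induction U)
 case empty
 have "{F. set_mset F \<subseteq> {}} = {{#} :: polya multiset}" by auto
 thus ?case by (simp add: nn_integral_count_space_indicator[symmetric])
next
 case (insert T U)
 let ?h = "\<lambda>(j, F). F + replicate_mset j T"
 have bij: "bij_betw ?h (UNIV \<times> {F. set_mset F \<subseteq> U}) {F. set_mset F \<subseteq> insert T U}"
 proof (rule bij_betw_byWitness[where f' = "\<lambda>F. (count F T, filter_mset (\<lambda>T'. T' \<noteq> T) F)"])
  have 1: "count F T = 0" if "set_mset F \<subseteq> U" for F
   using that insert.hyps(2) by (metis count_eq_zero_iff subsetD)
  have 2: "filter_mset (\<lambda>T'. T' \<noteq> T) (F + replicate_mset j T) = F" if "set_mset F \<subseteq> U" for F j
   using 1[OF that] by (intro multiset_eqI) simp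
  show "\<forall>a\<in>UNIV \<times> {F. set_mset F \<subseteq> U}. (count (?h a) T, filter_mset (\<lambda>T'. T' \<noteq> T) (?h a)) = a"
   using 1 2 by (simp add: split_beta prod_eq_iff)
  show "\<forall>F\<in>{F. set_mset F \<subseteq> insert T U}. ?h (count F T, filter_mset (\<lambda>T'. T' \<noteq> T) F) = F"
   by (simp add: multiset_eq_iff)
 qed (auto split: if_splits)
 have zT: "z ^ tsize T < 1" "0 \<le> z ^ tsize T"
  using assms tsize_pos[of T] by (auto simp: power_less_one_iff)
 have "(\<integral>\<^sup>+ F. ennreal (z ^ fsize F) * indicator {F. set_mset F \<subseteq> insert T U} F \<partial>count_space UNIV) =
  (\<integral>\<^sup>+ x. ennreal (z ^ fsize (?h x)) * indicator (UNIV \<times> {F. set_mset F \<subseteq> U}) x \<partial>count_space UNIV)"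
  by (rule count_space_bij[OF bij])
 also have "... = (\<integral>\<^sup>+ (j, F). ennreal ((z ^ tsize T) ^ j) * (ennreal (z ^ fsize F) * indicator {F. set_mset F \<subseteq> U} F) \<partial>count_space UNIV)"
  by (intro nn_integral_cong)
    (auto simp: ennreal_mult[symmetric] power_add power_mult mult.commute assms indicator_def mult_ac
       simp flip: power_mult ennreal_mult')
 also have "... = (\<integral>\<^sup>+ j. \<integral>\<^sup>+ F. ennreal ((z ^ tsize T) ^ j) * (ennreal (z ^ fsize F) * indicator {F. set_mset F \<subseteq> U} F)
   \<partial>count_space UNIV \<partial>count_space UNIV)"
  by (subst nn_integral_fst_count_space[symmetric]) simp
 also have "... = (\<integral>\<^sup>+ j. ennreal ((z ^ tsize T) ^ j) \<partial>count_space UNIV) * ennreal (\<Prod>T\<in>U. 1 / (1 - z ^ tsize T))"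
  by (simp add: nn_integral_cmult nn_integral_multc insert.IH)
 also have "(\<integral>\<^sup>+ j. ennreal ((z ^ tsize T) ^ j) \<partial>count_space UNIV) = ennreal (1 / (1 - z ^ tsize T))"
  unfolding nn_integral_count_space_nat
  using geometric_sums[of "z ^ tsize T"] zT by (intro suminf_ennreal_eq) auto
 also have "ennreal (1 / (1 - z ^ tsize T)) * ennreal (\<Prod>T\<in>U. 1 / (1 - z ^ tsize T)) =
  ennreal (\<Prod>T\<in>insert T U. 1 / (1 - z ^ tsize T))"
  using insert.hyps zT by (simp add: ennreal_mult'[symmetric])
 finally show ?case .
qed

section \<open>Functional equation of A and its value at the singularity\<close>

definition A_part :: "nat \<Rightarrow> real \<Rightarrow> real" where
 "A_part n z = (\<Sum>k\<le>n. real (a_coeff k) * z ^ k)"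

text \<open>Logarithm of the Euler product over the trees with at most \<open>n\<close>
  vertices.\<close>

definition L_part :: "nat \<Rightarrow> real \<Rightarrow> real" where
 "L_part n z = (\<Sum>k\<le>n. real (a_coeff k) * - ln (1 - z ^ k))"

lemma forests_product_exp:
 assumes "0 \<le> z" "z < 1"
 shows "(\<Prod>T | tsize T \<le> n. 1 / (1 - z ^ tsize T)) = exp (L_part n z)"
proof -
 have "exp (L_part n z) = exp (\<Sum>T | tsize T \<le> n. - ln (1 - z ^ tsize T))"
  unfolding L_part_def by (subst sum_over_trees) simp
 also have "... = (\<Prod>T | tsize T \<le> n. 1 / (1 - z ^ tsize T))"
  unfolding exp_sum[OF finite_trees_le]
 proof (rule prod.cong[OF refl])
  fix T have "0 < 1 - z ^ tsize T" using assms tsize_pos[of T] by (auto simp: power_less_one_iff)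
  thus "exp (- ln (1 - z ^ tsize T)) = 1 / (1 - z ^ tsize T)" by (simp add: exp_minus field_simps)
 qed
 finally show ?thesis ..
qed

lemma forests_le:
 assumes "0 \<le> z"
 shows "(\<integral>\<^sup>+ F. ennreal (z ^ fsize F) * indicator {F. fsize F = k} F \<partial>count_space UNIV) = ennreal (real (a_coeff (Suc k)) * z ^ k)"
proof -
 have "(\<integral>\<^sup>+ F. ennreal (z ^ fsize F) * indicator {F. fsize F = k} F \<partial>count_space UNIV) =
  (\<integral>\<^sup>+ F. ennreal (z ^ k) * indicator {F. fsize F = k} F \<partial>count_space UNIV)"
  by (intro nn_integral_cong) (auto split: split_indicator)
 also have "... = ennreal (z ^ k) * of_nat (a_coeff (Suc k))"
  by (simp add: nn_integral_cmult_indicator emeasure_count_space finite_forests a_coeff_Suc)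
 finally show ?thesis using assms by (simp add: ennreal_mult' mult.commute ennreal_of_nat_eq_real_of_nat)
qed

lemma forests_total:
 assumes "0 \<le> z"
 shows "(\<integral>\<^sup>+ F. ennreal (z ^ fsize F) \<partial>count_space UNIV) = (\<Sum>k. ennreal (real (a_coeff (Suc k)) * z ^ k))"
proof -
 have "(\<integral>\<^sup>+ F. ennreal (z ^ fsize F) \<partial>count_space UNIV) =
  (\<integral>\<^sup>+ F. (\<Sum>k. ennreal (z ^ fsize F) * indicator {F. fsize F = k} F) \<partial>count_space UNIV)"
 proof (rule nn_integral_cong)
  fix F
  have "(\<Sum>k. ennreal (z ^ fsize F) * indicator {F. fsize F = k} F) = (\<Sum>k\<in>{fsize F}. ennreal (z ^ fsize F) * indicator {F. fsize F = k} F)"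
   by (rule suminf_finite) auto
  thus "ennreal (z ^ fsize F) = (\<Sum>k. ennreal (z ^ fsize F) * indicator {F. fsize F = k} F)" by simp
 qed
 also have "... = (\<Sum>k. ennreal (real (a_coeff (Suc k)) * z ^ k))"
  by (subst nn_integral_suminf) (simp_all add: forests_le assms)
 finally show ?thesis .
qed

lemma A_part_Suc: "A_part (Suc n) z = z * (\<Sum>k\<le>n. real (a_coeff (Suc k)) * z ^ k)"
 unfolding A_part_def by (subst sum.atMost_Suc_shift) (simp add: sum_distrib_left mult_ac)

text \<open>A forest with at most \<open>n\<close> vertices contains only trees with at most
  \<open>n\<close> vertices, and the product over these trees counts all such forests and
  more.\<close>

lemma A_part_Suc_le:
 assumes "0 \<le> z" "z < 1"
 shows "A_part (Suc n) z \<le> z * exp (L_part n z)"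
proof -
 have "ennreal (\<Sum>k\<le>n. real (a_coeff (Suc k)) * z ^ k) =
  (\<Sum>k\<le>n. (\<integral>\<^sup>+ F. ennreal (z ^ fsize F) * indicator {F. fsize F = k} F \<partial>count_space UNIV))"
  using assms by (simp add: forests_le sum_ennreal)
 also have "... = (\<integral>\<^sup>+ F. (\<Sum>k\<le>n. ennreal (z ^ fsize F) * indicator {F. fsize F = k} F) \<partial>count_space UNIV)"
  by (rule nn_integral_sum[symmetric]) simp
 also have "... \<le> (\<integral>\<^sup>+ F. ennreal (z ^ fsize F) * indicator {F. set_mset F \<subseteq> {T. tsize T \<le> n}} F \<partial>count_space UNIV)"
 proof (rule nn_integral_mono)
  fix F
  have *: "(\<Sum>k\<le>n. indicator {F. fsize F = k} F) = (if fsize F \<le> n then 1 else (0::ennreal))"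
   by (simp add: indicator_def)
  have "(\<Sum>k\<le>n. ennreal (z ^ fsize F) * indicator {F. fsize F = k} F) = ennreal (z ^ fsize F) * (if fsize F \<le> n then 1 else 0)"
   unfolding * [symmetric] by (rule sum_distrib_left[symmetric])
  also have "... \<le> ennreal (z ^ fsize F) * indicator {F. set_mset F \<subseteq> {T. tsize T \<le> n}} F"
  proof (cases "fsize F \<le> n")
   case True
   hence "set_mset F \<subseteq> {T. tsize T \<le> n}" using tsize_le_fsize order_trans by blast
   thus ?thesis using True by simp
  qed simp
  finally show "(\<Sum>k\<le>n. ennreal (z ^ fsize F) * indicator {F. fsize F = k} F) \<le>
   ennreal (z ^ fsize F) * indicator {F. set_mset F \<subseteq> {T. tsize T \<le> n}} F" .
 qed
 also have "... = ennreal (exp (L_part n z))"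
  using forests_product[OF finite_trees_le assms] forests_product_exp[OF assms] by simp
 finally have "(\<Sum>k\<le>n. real (a_coeff (Suc k)) * z ^ k) \<le> exp (L_part n z)"
  by (simp add: ennreal_le_iff)
 thus ?thesis unfolding A_part_Suc using assms by (intro mult_left_mono)
qed

text \<open>The converse estimate: the truncated product counts only some of all forests.\<close>

lemma exp_L_part_le:
 assumes "0 \<le> z" "z < 1"
 shows "ennreal (exp (L_part n z)) \<le> (\<Sum>k. ennreal (real (a_coeff (Suc k)) * z ^ k))"
 unfolding forests_total[OF assms(1), symmetric] forests_product_exp[OF assms, symmetric]
  forests_product[OF finite_trees_le assms, symmetric]
 by (intro nn_integral_mono) (auto split: split_indicator)

lemma neg_ln_sums:
 assumes "0 \<le> w" "w < (1::real)"
 shows "(\<lambda>i. w ^ Suc i / real (Suc i)) sums - ln (1 - w)"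
proof -
 have "(\<lambda>n. (-1) ^ n * (1 / real (n + 1)) * (1 - w - 1) ^ Suc n) sums ln (1 - w)"
 proof (cases "w = 0")
  case False
  have "summable (\<lambda>n. (-1) ^ n * (1 / real (n + 1)) * (1 - w - 1) ^ Suc n)"
  proof (rule summable_comparison_test')
   show "summable (\<lambda>n. w ^ n)" using assms by (simp add: summable_geometric)
   show "norm ((-1) ^ n * (1 / real (n + 1)) * (1 - w - 1) ^ Suc n) \<le> w ^ n" if "n \<ge> 0" for n
   proof -
    have "norm ((-1) ^ n * (1 / real (n + 1)) * (1 - w - 1) ^ Suc n) = w ^ n * (w / real (n + 1))"
     using assms unfolding real_norm_def by (simp add: abs_mult power_abs)
    also have "... \<le> w ^ n * 1" using assms by (intro mult_left_mono) (auto simp: field_simps)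
    finally show ?thesis by simp
   qed
  qed
  thus ?thesis using ln_series[of "1 - w"] assms False by (simp add: summable_sums)
 qed simp
 hence "(\<lambda>n. - ((-1) ^ n * (1 / real (n + 1)) * (1 - w - 1) ^ Suc n)) sums - ln (1 - w)"
  by (rule sums_minus)
 moreover have "- ((-1) ^ n * (1 / real (n + 1)) * (1 - w - 1) ^ Suc n) = w ^ Suc n / real (Suc n)" for n
 proof -
  have "(-1) ^ n * (- w) ^ Suc n = - (w ^ Suc n)" by (cases "even n") auto
  hence "- (((-1) ^ n * (- w) ^ Suc n) * (1 / real (n + 1))) = w ^ Suc n / real (Suc n)" by simp
  thus ?thesis by (simp only: mult_ac diff_add_cancel minus_diff_eq) (simp add: mult_ac)
 qed
 ultimately show ?thesis by (simp only:)
qed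

text \<open>Expanding every logarithm and exchanging the sums produces the powers
  \<open>z ^ i\<close> of the functional equation.\<close>

lemma L_part_sums:
 assumes "0 \<le> z" "z < 1"
 shows "(\<lambda>i. A_part n (z ^ Suc i) / real (Suc i)) sums L_part n z"
proof -
 have "(\<lambda>i. \<Sum>k\<le>n. real (a_coeff k) * ((z ^ k) ^ Suc i / real (Suc i))) sums L_part n z"
  unfolding L_part_def
 proof (intro sums_sum)
  fix k show "(\<lambda>i. real (a_coeff k) * ((z ^ k) ^ Suc i / real (Suc i))) sums (real (a_coeff k) * - ln (1 - z ^ k))"
  proof (cases k)
   case (Suc m)
   hence "z ^ k < 1" using assms by (subst power_less_one_iff) auto
   thus ?thesis using assms by (intro sums_mult neg_ln_sums) auto
  qed simp
 qed
 moreover have "A_part n (z ^ Suc i) / real (Suc i) = (\<Sum>k\<le>n. real (a_coeff k) * ((z ^ k) ^ Suc i / real (Suc i)))" for i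
  unfolding A_part_def sum_divide_distrib
  by (rule sum.cong[OF refl]) (simp only: power_mult[symmetric] mult.commute[of _ "Suc i"] times_divide_eq_right)
 ultimately show ?thesis by simp
qed

lemma A_part_mono: "0 \<le> y \<Longrightarrow> y \<le> z \<Longrightarrow> A_part n y \<le> A_part n z"
 unfolding A_part_def by (intro sum_mono mult_left_mono power_mono) auto

lemma A_part_nonneg: "0 \<le> y \<Longrightarrow> 0 \<le> A_part n y"
 unfolding A_part_def by (intro sum_nonneg) auto

lemma A_part_scale:
 assumes "0 \<le> y" "0 \<le> w" "w \<le> 1"
 shows "A_part n (w * y) \<le> w * A_part n y"
 unfolding A_part_def sum_distrib_left
proof (rule sum_mono)
 fix k show "real (a_coeff k) * (w * y) ^ k \<le> w * (real (a_coeff k) * y ^ k)"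
 proof (cases k)
  case (Suc m)
  have "w ^ Suc m \<le> w" using power_decreasing[of 1 "Suc m" w] assms by simp
  hence "w ^ Suc m * y ^ Suc m \<le> w * y ^ Suc m" using assms by (intro mult_right_mono) auto
  hence "real (a_coeff k) * (w ^ k * y ^ k) \<le> real (a_coeff k) * (w * y ^ k)" unfolding Suc by (intro mult_left_mono) auto
  thus ?thesis by (simp add: power_mult_distrib mult_ac)
 qed simp
qed

text \<open>Source of \<open>rho_ge\<close>. If the partial sum at 1/4 is at most 1/2, scaling
  bounds it at \<open>(1/4)^i\<close> by \<open>2 (1/4)^i\<close>; then the logarithm of the product
  is at most \<open>-2 ln (3/4)\<close> and the next partial sum is at most
  \<open>(1/4) (4/3)^2 = 4/9\<close>.\<close>

lemma A_part_quarter: "A_part n (1/4) \<le> 1/2"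
proof (induction n)
 case (Suc n)
 let ?z = "1/4 :: real"
 have "L_part n ?z \<le> 2 * - ln (1 - ?z)"
 proof (rule sums_le[OF _ L_part_sums sums_mult[OF neg_ln_sums]])
  fix i
  have "A_part n (?z ^ i * ?z) \<le> ?z ^ i * A_part n ?z" by (rule A_part_scale) (auto simp: power_le_one)
  also have "... \<le> ?z ^ i * (1/2)" using Suc by (intro mult_left_mono) auto
  finally have "A_part n (?z ^ Suc i) \<le> 2 * ?z ^ Suc i" by (simp add: mult.commute)
  hence "A_part n (?z ^ Suc i) / real (Suc i) \<le> 2 * ?z ^ Suc i / real (Suc i)"
   by (rule divide_right_mono) simp
  thus "A_part n (?z ^ Suc i) / real (Suc i) \<le> 2 * (?z ^ Suc i / real (Suc i))"
   by (simp only: times_divide_eq_right)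
 qed auto
 also have "... = ln ((4/3)^2)" by (subst ln_realpow) (auto simp: ln_div)
 finally have "exp (L_part n ?z) \<le> (4/3)^2" by (metis exp_le_cancel_iff exp_ln zero_less_power zero_less_divide_iff zero_less_numeral)
 hence "?z * exp (L_part n ?z) \<le> ?z * (4/3)^2" by (intro mult_left_mono) auto
 thus ?case using A_part_Suc_le[of ?z n] by (simp add: power2_eq_square)
qed (simp add: A_part_def)

lemma summable_A_bounded:
 assumes "0 \<le> z" "\<And>n. A_part n z \<le> C"
 shows "summable (\<lambda>k. real (a_coeff k) * z ^ k)" "A_gf z \<le> C"
proof -
 show s: "summable (\<lambda>k. real (a_coeff k) * z ^ k)"
 proof (rule bounded_imp_summable[of _ C])
  show "(\<Sum>k\<le>n. real (a_coeff k) * z ^ k) \<le> C" for n using assms(2)[of n] by (simp add: A_part_def)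
 qed (use assms in auto)
 show "A_gf z \<le> C" unfolding A_gf_def
 proof (rule suminf_le_const[OF s])
  fix n show "(\<Sum>k<n. real (a_coeff k) * z ^ k) \<le> C"
   using assms(2)[of "n - 1"] by (cases n) (auto simp: A_part_def lessThan_Suc_atMost intro: order_trans[OF _ assms(2)[of 0]])
 qed
qed

lemma a_coeff_ge_1: "1 \<le> a_coeff (Suc m)"
proof -
 have "replicate_mset m (Node {#}) \<in> {F. fsize F = m}" by simp
 thus ?thesis unfolding a_coeff_Suc using finite_forests[of m] by (metis card_0_eq emptyE less_one not_less)
qed

lemma not_summable_A_1: "\<not> summable (\<lambda>k. real (a_coeff k) * 1 ^ k)"
proof
 assume "summable (\<lambda>k. real (a_coeff k) * 1 ^ k)"
 hence "(\<lambda>k. real (a_coeff k)) \<longlonglongrightarrow> 0" by (simp add: summable_LIMSEQ_zero)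
 hence "eventually (\<lambda>k. real (a_coeff k) < 1) sequentially" by (rule order_tendstoD) simp
 then obtain N where "\<And>k. k \<ge> N \<Longrightarrow> real (a_coeff k) < 1" by (auto simp: eventually_sequentially)
 from this[of "Suc N"] a_coeff_ge_1[of N] show False by simp
qed

lemma conv_radius_A: "conv_radius (\<lambda>k. real (a_coeff k)) = ereal rho"
 and rho_ge: "1 / 4 \<le> rho" and rho_le: "rho \<le> 1"
proof -
 let ?r = "conv_radius (\<lambda>k. real (a_coeff k))"
 have "ereal (norm (1/4::real)) \<le> ?r"
  by (rule conv_radius_geI) (rule summable_A_bounded(1)[OF _ A_part_quarter], simp)
 hence 1: "ereal (1/4) \<le> ?r" by simp
 have "?r \<le> ereal (norm (1::real))"
  by (rule conv_radius_leI) (use not_summable_A_1 in auto)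
 hence 2: "?r \<le> ereal 1" by (simp add: one_ereal_def)
 show "?r = ereal rho" using 1 2 unfolding rho_def by (cases ?r) auto
 thus "1 / 4 \<le> rho" "rho \<le> 1" using 1 2 by auto
qed

lemma summable_A_less: "0 \<le> z \<Longrightarrow> z < rho \<Longrightarrow> summable (\<lambda>k. real (a_coeff k) * z ^ k)"
 by (rule summable_in_conv_radius) (simp add: conv_radius_A)

definition A_ok :: "real \<Rightarrow> bool" where
 "A_ok z \<longleftrightarrow> 0 \<le> z \<and> z < 1 \<and> summable (\<lambda>k. real (a_coeff k) * z ^ k)"

lemma A_ok_mono: "A_ok z \<Longrightarrow> 0 \<le> y \<Longrightarrow> y \<le> z \<Longrightarrow> A_ok y"
 unfolding A_ok_def
 by (auto intro!: summable_comparison_test'[of "\<lambda>k. real (a_coeff k) * z ^ k" 0] mult_left_mono power_mono)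

lemma A_ok_power: "A_ok z \<Longrightarrow> A_ok (z ^ Suc i)"
proof -
 assume z: "A_ok z"
 hence "0 \<le> z" "z \<le> 1" by (auto simp: A_ok_def)
 thus ?thesis using power_decreasing[of 1 "Suc i" z] by (intro A_ok_mono[OF z]) auto
qed

lemma A_part_le: "A_ok z \<Longrightarrow> A_part n z \<le> A_gf z"
 unfolding A_part_def A_gf_def A_ok_def by (intro sum_le_suminf) auto

lemma A_part_lim: "A_ok z \<Longrightarrow> (\<lambda>n. A_part n z) \<longlonglongrightarrow> A_gf z"
 unfolding A_part_def A_gf_def A_ok_def by (blast intro: summable_LIMSEQ')

lemma A_gf_nonneg: "A_ok z \<Longrightarrow> 0 \<le> A_gf z"
 using A_part_le[of z 0] by (simp add: A_part_def)

lemma A_gf_ge: "A_ok z \<Longrightarrow> z \<le> A_gf z"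
 using A_part_le[of z 1] by (simp add: A_part_def)

lemma A_gf_mono: "A_ok z \<Longrightarrow> 0 \<le> y \<Longrightarrow> y \<le> z \<Longrightarrow> A_gf y \<le> A_gf z"
proof (rule LIMSEQ_le)
 assume z: "A_ok z" and y: "0 \<le> y" "y \<le> z"
 show "(\<lambda>n. A_part n z) \<longlonglongrightarrow> A_gf z" by (rule A_part_lim[OF z])
 show "(\<lambda>n. A_part n y) \<longlonglongrightarrow> A_gf y" by (rule A_part_lim[OF A_ok_mono[OF z y]])
 show "\<exists>N. \<forall>n\<ge>N. A_part n y \<le> A_part n z" using A_part_mono[OF y] by blast
qed

lemma A_gf_scale: "A_ok z \<Longrightarrow> 0 \<le> w \<Longrightarrow> w \<le> 1 \<Longrightarrow> A_gf (w * z) \<le> w * A_gf z"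
proof (rule LIMSEQ_le)
 assume z: "A_ok z" and w: "0 \<le> w" "w \<le> 1"
 hence "0 \<le> z" by (simp add: A_ok_def)
 hence "A_ok (w * z)" using z w by (intro A_ok_mono[OF z]) (auto simp: mult_left_le_one_le)
 thus "(\<lambda>n. A_part n (w * z)) \<longlonglongrightarrow> A_gf (w * z)" by (rule A_part_lim)
 show "(\<lambda>n. w * A_part n z) \<longlonglongrightarrow> w * A_gf z" by (intro tendsto_intros A_part_lim z)
 show "\<exists>N. \<forall>n\<ge>N. A_part n (w * z) \<le> w * A_part n z" using A_part_scale w \<open>0 \<le> z\<close> by blast
qed

lemma A_gf_power_le: "A_ok z \<Longrightarrow> A_gf (z ^ Suc i) \<le> z ^ i * A_gf z"
 using A_gf_scale[of z "z ^ i"] by (simp add: A_ok_def power_le_one mult.commute)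

lemma summable_A_powers:
 assumes z: "A_ok z"
 shows "summable (\<lambda>i. A_gf (z ^ Suc i) / real (Suc i))"
proof (rule summable_comparison_test')
 show "summable (\<lambda>i. z ^ i * A_gf z)" using z by (intro summable_mult2 summable_geometric) (auto simp: A_ok_def)
 fix i
 have "A_gf (z ^ Suc i) / real (Suc i) \<le> A_gf (z ^ Suc i) / 1"
  using A_gf_nonneg[OF A_ok_power[OF z]] by (intro divide_left_mono) auto
 with A_gf_power_le[OF z] A_gf_nonneg[OF A_ok_power[OF z]]
 show "norm (A_gf (z ^ Suc i) / real (Suc i)) \<le> z ^ i * A_gf z" by (metis div_by_1 norm_divide norm_of_nat order_trans real_norm_def abs_of_nonneg)
qed

lemma L_part_le:
 assumes z: "A_ok z"
 shows "L_part n z \<le> (\<Sum>i. A_gf (z ^ Suc i) / real (Suc i))"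
proof (rule sums_le[OF _ L_part_sums summable_sums[OF summable_A_powers[OF z]]])
 show "A_part n (z ^ Suc i) / real (Suc i) \<le> A_gf (z ^ Suc i) / real (Suc i)" for i
  by (intro divide_right_mono A_part_le A_ok_power z) auto
qed (use z in \<open>auto simp: A_ok_def\<close>)

text \<open>Both inequalities are limits of the truncated ones, \<open>A_part_Suc_le\<close> and
  \<open>exp_L_part_le\<close>. In the second, the sum over \<open>i\<close> is cut off at
  \<open>I\<close> first, so that \<open>n\<close> can tend to infinity term by term.\<close>

lemma A_gf_functional:
 assumes z: "A_ok z"
 shows "A_gf z = z * exp (\<Sum>i. A_gf (z ^ Suc i) / real (Suc i))" (is "_ = z * exp ?l")
proof -
 have z01: "0 \<le> z" "z < 1" using z by (auto simp: A_ok_def)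
 let ?f = "\<lambda>k. real (a_coeff (Suc k)) * z ^ k"
 have A: "A_gf z = z * (\<Sum>k. ?f k)" and s: "summable ?f" if "0 < z"
 proof -
  have 1: "summable (\<lambda>k. real (a_coeff (Suc k)) * z ^ Suc k)"
   using z unfolding A_ok_def by (subst summable_Suc_iff) auto
  hence "summable (\<lambda>k. inverse z * (real (a_coeff (Suc k)) * z ^ Suc k))" by (rule summable_mult)
  thus s: "summable ?f" using \<open>0 < z\<close> by (simp add: field_simps)
  have "A_gf z = (\<Sum>k. real (a_coeff (Suc k)) * z ^ Suc k)"
   unfolding A_gf_def using z unfolding A_ok_def by (subst suminf_split_head) auto
  also have "... = (\<Sum>k. z * ?f k)" by (simp add: mult_ac)
  also have "... = z * (\<Sum>k. ?f k)" by (rule suminf_mult[OF s])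
  finally show "A_gf z = z * (\<Sum>k. ?f k)" .
 qed
 show ?thesis
 proof (cases "z = 0")
  case True thus ?thesis by (simp add: A_gf_def)
 next
  case False
  hence "0 < z" using z01 by simp
  note A = A[OF this] and s = s[OF this]
  show ?thesis
  proof (rule antisym)
   show "A_gf z \<le> z * exp ?l"
   proof (rule LIMSEQ_le_const2[OF LIMSEQ_Suc[OF A_part_lim[OF z]]])
    show "\<exists>N. \<forall>n\<ge>N. A_part (Suc n) z \<le> z * exp ?l"
    proof (intro exI allI impI)
     fix n
     have "A_part (Suc n) z \<le> z * exp (L_part n z)" by (rule A_part_Suc_le[OF z01])
     also have "... \<le> z * exp ?l" using L_part_le[OF z] z01 by (intro mult_left_mono) auto
     finally show "A_part (Suc n) z \<le> z * exp ?l" .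
    qed
   qed
   have "L_part n z \<le> ln (\<Sum>k. ?f k)" for n
   proof -
    have "ennreal (exp (L_part n z)) \<le> ennreal (\<Sum>k. ?f k)"
     using exp_L_part_le[OF z01, of n] s z01 by (subst (asm) suminf_ennreal2) auto
    hence "exp (L_part n z) \<le> (\<Sum>k. ?f k)"
     using s z01 by (subst (asm) ennreal_le_iff) (auto intro!: suminf_nonneg)
    thus ?thesis by (metis exp_gt_zero exp_ln ln_exp ln_le_cancel_iff order_less_le_trans)
   qed note L = this
   have "?l \<le> ln (\<Sum>k. ?f k)"
   proof (rule suminf_le_const[OF summable_A_powers[OF z]])
    fix I
    show "(\<Sum>i<I. A_gf (z ^ Suc i) / real (Suc i)) \<le> ln (\<Sum>k. ?f k)"
    proof (rule LIMSEQ_le_const2)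
     show "(\<lambda>n. \<Sum>i<I. A_part n (z ^ Suc i) / real (Suc i)) \<longlonglongrightarrow> (\<Sum>i<I. A_gf (z ^ Suc i) / real (Suc i))"
      by (intro tendsto_sum tendsto_divide tendsto_const A_part_lim A_ok_power z) auto
     show "\<exists>N. \<forall>n\<ge>N. (\<Sum>i<I. A_part n (z ^ Suc i) / real (Suc i)) \<le> ln (\<Sum>k. ?f k)"
     proof (intro exI allI impI)
      fix n
      have "(\<Sum>i<I. A_part n (z ^ Suc i) / real (Suc i)) \<le> L_part n z"
       unfolding sums_unique[OF L_part_sums[OF z01]]
       by (rule sum_le_suminf[OF sums_summable[OF L_part_sums[OF z01]]])
         (use z01 in \<open>auto intro!: divide_nonneg_nonneg A_part_nonneg simp del: power_Suc of_nat_Suc\<close>)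
      with L[of n] show "(\<Sum>i<I. A_part n (z ^ Suc i) / real (Suc i)) \<le> ln (\<Sum>k. ?f k)" by simp
     qed
    qed
   qed
   moreover have "0 < (\<Sum>k. ?f k)" using s z01 \<open>0 < z\<close> by (intro suminf_pos2[of _ 0]) auto
   ultimately have "exp ?l \<le> (\<Sum>k. ?f k)" by (metis exp_le_cancel_iff exp_ln)
   thus "z * exp ?l \<le> A_gf z" unfolding A using z01 by (intro mult_left_mono) auto
  qed
 qed
qed

lemma suminf_A_powers_split:
 assumes z: "A_ok z"
 shows "(\<Sum>i. A_gf (z ^ Suc i) / real (Suc i)) = A_gf z + (\<Sum>i. A_gf (z ^ (i + 2)) / real (i + 2))"
 using suminf_split_head[OF summable_A_powers[OF z]] by (simp add: numeral_2_eq_2)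

lemma A_gf_functional_Phi:
 assumes z: "A_ok z"
 shows "A_gf z = z * exp (A_gf z) * Phi z"
 using A_gf_functional[OF z] unfolding suminf_A_powers_split[OF z] Phi_def exp_add by simp

text \<open>Coefficients of \<^const>\<open>Phi\<close> only involve powers of \<open>z\<close> with exponent at least 2, so it suffices
 that \<^const>\<open>A_gf\<close> converges at \<open>z\<^sup>2\<close>.\<close>

lemma summable_Phi:
 assumes z: "A_ok (z\<^sup>2)" "0 \<le> z" "z < 1"
 shows "summable (\<lambda>i. A_gf (z ^ (i + 2)) / real (i + 2))"
  and "A_ok (z ^ (i + 2))" and "A_gf (z ^ (i + 2)) \<le> z ^ i * A_gf (z\<^sup>2)"
proof -
 show ok: "A_ok (z ^ (i + 2))" for i
  using z power_decreasing[of 2 "i + 2" z] by (intro A_ok_mono[OF z(1)]) auto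
 show le: "A_gf (z ^ (i + 2)) \<le> z ^ i * A_gf (z\<^sup>2)" for i
  unfolding power_add using z by (intro A_gf_scale) (auto simp: power_le_one)
 show "summable (\<lambda>i. A_gf (z ^ (i + 2)) / real (i + 2))"
 proof (rule summable_comparison_test')
  show "summable (\<lambda>i. z ^ i * A_gf (z\<^sup>2))" using z by (intro summable_mult2 summable_geometric) auto
  fix i
  have "A_gf (z ^ (i + 2)) / real (i + 2) \<le> A_gf (z ^ (i + 2)) / 1"
   using A_gf_nonneg[OF ok] by (intro divide_left_mono) auto
  with le[of i] A_gf_nonneg[OF ok, of i]
  show "norm (A_gf (z ^ (i + 2)) / real (i + 2)) \<le> z ^ i * A_gf (z\<^sup>2)"
   by (simp add: abs_of_nonneg)
 qed
qed

lemma A_part_Suc_le_Phi: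
 assumes z: "A_ok (z\<^sup>2)" "0 \<le> z" "z < 1"
 shows "A_part (Suc n) z \<le> z * exp (A_part n z) * Phi z"
proof -
 have s: "(\<lambda>i. A_part n (z ^ (i + 2)) / real (i + 2)) sums (L_part n z - A_part n z)"
 proof -
  have "(\<lambda>i. A_part n (z ^ Suc (Suc i)) / real (Suc (Suc i))) sums (L_part n z - A_part n z)"
   using L_part_sums[OF z(2,3), of n]
   by (subst sums_Suc_iff[of "\<lambda>i. A_part n (z ^ Suc i) / real (Suc i)"]) simp
  thus ?thesis by (simp add: numeral_2_eq_2)
 qed
 have "L_part n z - A_part n z \<le> (\<Sum>i. A_gf (z ^ (i + 2)) / real (i + 2))"
  by (rule sums_le[OF _ s summable_sums[OF summable_Phi(1)[OF z]]])
    (intro divide_right_mono A_part_le summable_Phi(2) z, simp)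
 hence "exp (L_part n z) \<le> exp (A_part n z + (\<Sum>i. A_gf (z ^ (i + 2)) / real (i + 2)))" by simp
 hence "exp (L_part n z) \<le> exp (A_part n z) * Phi z" unfolding Phi_def exp_add .
 hence "z * exp (L_part n z) \<le> z * (exp (A_part n z) * Phi z)" using z by (intro mult_left_mono)
 with A_part_Suc_le[OF z(2,3), of n] show ?thesis by (simp add: mult.assoc)
qed

text \<open>The map sending \<open>x\<close> to \<open>exp x * z * Phi z\<close> keeps values at
  most 1 when \<open>z * Phi z <= 1/e\<close>, and the partial sums are dominated by its iterates.
  As convergence is demanded at the square of \<open>z\<close> only, the criterion also applies
  beyond \<open>rho\<close>.\<close>

lemma A_part_le_1:
 assumes z: "A_ok (z\<^sup>2)" "0 \<le> z" "z < 1" and le: "z * Phi z \<le> exp (-1)"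
 shows "A_part n z \<le> 1"
proof (induction n)
 case (Suc n)
 have "A_part (Suc n) z \<le> exp (A_part n z) * (z * Phi z)"
  using A_part_Suc_le_Phi[OF z, of n] by (simp add: mult_ac)
 also have "... \<le> exp 1 * exp (-1)" using Suc le z by (intro mult_mono) (auto simp: Phi_def)
 finally show ?case by (simp add: exp_minus)
qed (simp add: A_part_def)

lemma A_ok_less: "0 \<le> z \<Longrightarrow> z < rho \<Longrightarrow> A_ok z"
 unfolding A_ok_def using rho_le summable_A_less by auto

lemma A_part_rho_le: "A_part n rho \<le> 1"
proof -
 have le: "A_part n z \<le> 1" if "0 \<le> z" "z < rho" for z
 proof (rule A_part_le_1)
  have "z\<^sup>2 \<le> z" using that rho_le by (simp add: power2_eq_square mult_left_le)
  thus "A_ok (z\<^sup>2)" using that by (intro A_ok_less) auto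
  show "z * Phi z \<le> exp (-1)"
  proof -
   \<comment> \<open>\<open>x * exp (- x)\<close> never exceeds \<open>1/e\<close>, so the criterion
     holds everywhere below \<open>rho\<close>; polynomials then carry the bound to
     \<open>rho\<close> by continuity.\<close>
   have "A_gf z * exp (- A_gf z) = z * Phi z"
    using A_gf_functional_Phi[OF A_ok_less[OF that]] by (metis (no_types) exp_minus_inverse mult.assoc mult.commute mult_1)
   moreover have "A_gf z * exp (- A_gf z) \<le> exp (A_gf z - 1) * exp (- A_gf z)"
    using exp_ge_add_one_self[of "A_gf z - 1"] by (intro mult_right_mono) auto
   ultimately show ?thesis by (simp add: exp_add[symmetric])
  qed
 qed (use that rho_le in auto)
 have "((\<lambda>z. A_part n z) \<longlongrightarrow> A_part n rho) (at_left rho)"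
  unfolding A_part_def by (intro tendsto_intros)
 moreover have "eventually (\<lambda>z. A_part n z \<le> 1) (at_left rho)"
  using eventually_at_left_real[of 0 rho] rho_ge by (auto intro!: le elim!: eventually_mono)
 ultimately show ?thesis by (intro tendsto_upperbound) (auto simp: trivial_limit_at_left_real)
qed

lemma rho_less: "rho < 1"
 using summable_A_bounded(1)[OF _ A_part_rho_le] rho_ge rho_le not_summable_A_1 by (metis less_eq_real_def order_trans zero_le_divide_1_iff zero_le_numeral)

lemma A_ok_rho: "A_ok rho"
 unfolding A_ok_def using summable_A_bounded(1)[OF _ A_part_rho_le] rho_ge rho_less by auto

lemma A_ok: "0 \<le> z \<Longrightarrow> z \<le> rho \<Longrightarrow> A_ok z"
 by (rule A_ok_mono[OF A_ok_rho])

lemma A_rho_le: "A_gf rho \<le> 1"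
 using summable_A_bounded(2)[OF _ A_part_rho_le] rho_ge by simp

lemma isCont_A: "0 \<le> z \<Longrightarrow> z < rho \<Longrightarrow> isCont A_gf z"
proof -
 assume z: "0 \<le> z" "z < rho"
 have "isCont (\<lambda>x. \<Sum>k. real (a_coeff k) * x ^ k) z"
  by (rule isCont_powser[of _ rho]) (use z A_ok_rho in \<open>auto simp: A_ok_def\<close>)
 thus ?thesis by (simp add: A_gf_def[abs_def])
qed

text \<open>Only powers with exponent at least 2 enter, so the series converges uniformly up to any
  \<open>r < sqrt rho\<close>; choosing \<open>r\<close> above \<open>rho\<close> makes
  \<open>rho\<close> an interior point.\<close>

lemma isCont_Phi_rho: "isCont Phi rho"
proof -
 define r where "r = (rho + sqrt rho) / 2"
 have sq: "rho < sqrt rho" using rho_less rho_ge by (intro real_less_rsqrt) (simp add: power2_eq_square)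
 hence r: "rho < r" "r < sqrt rho" "0 < rho" using rho_ge by (auto simp: r_def)
 have r2: "r\<^sup>2 < rho" using r by (metis abs_of_pos less_trans real_sqrt_abs real_sqrt_less_iff)
 have r1: "r < 1" using r(2) rho_less by (meson less_trans real_sqrt_lt_1_iff)
 have okr: "A_ok (r\<^sup>2)" using r2 by (intro A_ok) auto
 have ok: "A_ok (x ^ (i + 2))" "x ^ (i + 2) \<le> r ^ (i + 2)" "x ^ (i + 2) < rho" if "x \<in> {0..r}" for x i
 proof -
  show le: "x ^ (i + 2) \<le> r ^ (i + 2)" using that by (intro power_mono) auto
  have "r ^ (i + 2) \<le> r\<^sup>2" using r r1 by (intro power_decreasing) auto
  with le r2 show "x ^ (i + 2) < rho" by simp
  thus "A_ok (x ^ (i + 2))" using that by (intro A_ok_less) auto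
 qed
 have u: "uniform_limit {0..r} (\<lambda>n x. \<Sum>i<n. A_gf (x ^ (i + 2)) / real (i + 2)) (\<lambda>x. \<Sum>i. A_gf (x ^ (i + 2)) / real (i + 2)) sequentially"
 proof (rule Weierstrass_m_test)
  show "summable (\<lambda>i. A_gf (r ^ (i + 2)) / real (i + 2))" using r r1 okr by (intro summable_Phi(1)) auto
  fix i x assume x: "x \<in> {0..r}"
  have "A_gf (x ^ (i + 2)) \<le> A_gf (r ^ (i + 2))"
   using r r1 x by (intro A_gf_mono summable_Phi(2) okr ok) auto
  thus "norm (A_gf (x ^ (i + 2)) / real (i + 2)) \<le> A_gf (r ^ (i + 2)) / real (i + 2)"
   using A_gf_nonneg[OF ok(1)[OF x, of i]] by (simp add: divide_right_mono)
 qed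
 have c: "continuous_on {0..r} (\<lambda>x. \<Sum>i<n. A_gf (x ^ (i + 2)) / real (i + 2))" for n
 proof (intro continuous_on_sum continuous_on_divide continuous_on_const)
  fix i
  have "isCont (\<lambda>x. A_gf (x ^ (i + 2))) x" if "x \<in> {0..r}" for x
   by (rule isCont_o2[OF _ isCont_A]) (use that ok[OF that] in auto)
  thus "continuous_on {0..r} (\<lambda>x. A_gf (x ^ (i + 2)))" by (intro continuous_at_imp_continuous_on) auto
 qed auto
 have "continuous_on {0..r} (\<lambda>x. \<Sum>i. A_gf (x ^ (i + 2)) / real (i + 2))"
  by (rule uniform_limit_theorem[OF always_eventually[OF allI[OF c]] u trivial_limit_sequentially])
 hence "continuous_on {0..r} Phi" unfolding Phi_def[abs_def] by (rule continuous_on_exp)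
 hence "continuous_on {0<..<r} Phi" by (rule continuous_on_subset) auto
 thus ?thesis using r by (simp add: continuous_on_eq_continuous_at)
qed

text \<open>If \<open>A_gf rho\<close> were below 1, then \<open>rho * Phi rho < 1/e\<close>
  strictly. By continuity the same holds at some \<open>z > rho\<close>, and
  \<open>A_part_le_1\<close> would make the series converge beyond its radius.\<close>

lemma A_rho: "A_gf rho = 1"
proof (rule ccontr)
 assume "A_gf rho \<noteq> 1"
 with A_rho_le have lt: "A_gf rho < 1" by simp
 have rp: "0 < rho" using rho_ge by simp
 have "A_gf rho * exp (- A_gf rho) = rho * Phi rho"
  using A_gf_functional_Phi[OF A_ok_rho] by (metis (no_types) exp_minus_inverse mult.assoc mult.commute mult_1)
 moreover have "A_gf rho * exp (- A_gf rho) < exp (A_gf rho - 1) * exp (- A_gf rho)"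
 proof (rule mult_strict_right_mono)
  have "A_gf rho \<noteq> exp (A_gf rho - 1)"
   using ln_eq_minus_one[of "A_gf rho"] lt A_gf_ge[OF A_ok_rho] rp by (metis less_irrefl less_le_trans ln_exp)
  thus "A_gf rho < exp (A_gf rho - 1)" using exp_ge_add_one_self[of "A_gf rho - 1"] by simp
 qed simp
 ultimately have "rho * Phi rho < exp (-1)" by (simp add: exp_add[symmetric])
 moreover have "isCont (\<lambda>z. z * Phi z) rho" by (intro continuous_intros isCont_Phi_rho)
 ultimately have ev: "eventually (\<lambda>z. z * Phi z < exp (-1)) (at_right rho)"
  by (intro order_tendstoD(2)[of _ "rho * Phi rho"]) (auto simp: isCont_def intro: tendsto_within_subset filterlim_at_split[THEN iffD1, THEN conjunct2])
 have "rho < sqrt rho" using rho_less rho_ge by (intro real_less_rsqrt) (simp add: power2_eq_square)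
 from eventually_at_right_real[OF this]
 have "eventually (\<lambda>z. z \<in> {rho<..<sqrt rho} \<and> z * Phi z < exp (-1)) (at_right rho)" using ev by (rule eventually_conj)
 then obtain z where z: "rho < z" "z < sqrt rho" "z * Phi z < exp (-1)"
  using eventually_happens'[of "at_right rho"] by (auto simp: trivial_limit_at_right_real)
 have z2: "z\<^sup>2 < rho" using z rp by (metis abs_of_pos less_trans real_sqrt_abs real_sqrt_less_iff)
 have z1: "z < 1" using z(2) rho_less by (meson less_trans real_sqrt_lt_1_iff)
 have "A_part n z \<le> 1" for n using z z1 z2 rp by (intro A_part_le_1 A_ok) auto
 hence "summable (\<lambda>k. real (a_coeff k) * z ^ k)" using z rp by (intro summable_A_bounded(1)) auto
 hence "ereal (norm z) \<le> conv_radius (\<lambda>k. real (a_coeff k))" by (rule conv_radius_geI)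
 thus False using z rp by (simp add: conv_radius_A)
qed

text \<open>The identity behind \<open>base_00\<close>: without tilting, the pair (X, Y) is (0, 0)
  with probability \<open>rho\<close>.\<close>

lemma rho_Phi_rho: "rho * Phi rho = exp (-1)"
 using A_gf_functional_Phi[OF A_ok_rho] unfolding A_rho
 by (simp add: exp_minus field_simps)

section \<open>Deterministic programs with cost bounds\<close>

definition runs :: "'a prog \<Rightarrow> ('a \<Rightarrow> bool) \<Rightarrow> nat \<Rightarrow> bool" where
 "runs p P C \<longleftrightarrow> (\<exists>x c. p = detp x c \<and> P x \<and> c \<le> C)"

lemma runs_detp: "P x \<Longrightarrow> c \<le> C \<Longrightarrow> runs (detp x c) P C"
 unfolding runs_def by blast

lemma runs_ret: "P x \<Longrightarrow> runs (ret x) P C"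
 unfolding ret_eq by (rule runs_detp) simp_all

lemma calc_eq: "calc e = detp (rval e) (rcost e)"
 unfolding calc_def tick_eq ret_eq using pbind_detp_detp[of "\<lambda>_. detp (rval e) 0" "()"] by simp

lemma test_less_eq: "test_less e f = detp (rval e < rval f) (rcost e + rcost f + 1)"
 unfolding test_less_def tick_eq ret_eq using pbind_detp_detp[of "\<lambda>_. detp (rval e < rval f) 0" "()"] by simp

lemma get_eq: "get xs i = detp (xs ! i) 1"
 unfolding get_def tick_eq ret_eq using pbind_detp_detp[of "\<lambda>_. detp (xs ! i) 0" "()"] by simp

lemma push_eq: "push xs x = detp (xs @ [x]) 1"
 unfolding push_def tick_eq ret_eq using pbind_detp_detp[of "\<lambda>_. detp (xs @ [x]) 0" "()"] by simp

lemma runs_pbind: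
 assumes "runs p P a" "\<And>x. P x \<Longrightarrow> runs (k x) Q b" "a + b \<le> C"
 shows "runs (pbind p k) Q C"
proof -
 obtain x c where 1: "p = detp x c" "P x" "c \<le> a" using assms(1) unfolding runs_def by blast
 obtain y c' where 2: "k x = detp y c'" "Q y" "c' \<le> b" using assms(2)[OF 1(2)] unfolding runs_def by blast
 have "pbind p k = detp y (c + c')" unfolding 1(1) using pbind_detp_detp[of k x y c' c, OF 2(1)] .
 thus ?thesis unfolding runs_def using 1 2 assms(3) by (intro exI[of _ y] exI[of _ "c + c'"]) simp
qed

lemma runs_bind_detp:
 assumes "runs (k x) Q b" "c + b \<le> C"
 shows "runs (pbind (detp x c) k) Q C"
 by (rule runs_pbind[of _ "\<lambda>y. y = x" c _ _ b]) (use assms in \<open>auto intro: runs_detp\<close>)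

lemma runs_mono: "runs p P a \<Longrightarrow> (\<And>x. P x \<Longrightarrow> Q x) \<Longrightarrow> a \<le> b \<Longrightarrow> runs p Q b"
 unfolding runs_def by force

lemma runs_good: "runs p P C \<Longrightarrow> good q p"
 unfolding runs_def by (auto simp: good_detp)

lemma runs_cst: "runs p P C \<Longrightarrow> cst q p \<le> of_nat C"
 unfolding runs_def by (auto simp: cst_detp)

lemma runs_for_loop:
 assumes "I i s" and "\<And>j s. i \<le> j \<Longrightarrow> j < i + k \<Longrightarrow> I j s \<Longrightarrow> runs (f j s) (I (Suc j)) C"
 shows "runs (for_loop k i f s) (I (i + k)) (1 + k * (2 + C))"
 using assms
proof (induction k arbitrary: i s)
 case 0 thus ?case unfolding for_loop.simps tick_eq
  by (intro runs_bind_detp[of _ _ _ 0] runs_ret) auto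
next
 case (Suc k)
 have "runs (for_loop k (Suc i) f s') (I (Suc i + k)) (1 + k * (2 + C))" if "I (Suc i) s'" for s'
  by (rule Suc.IH[OF that]) (use Suc.prems in auto)
 thus ?case unfolding for_loop.simps tick_eq
  using Suc.prems
  by (intro runs_bind_detp[of _ _ _ "C + (1 + k * (2 + C))"] runs_pbind[of _ "I (Suc i)" C]) auto
qed

lemma runs_for_each:
 assumes "I xs s" and "\<And>x ys s. I (x # ys) s \<Longrightarrow> runs (f x s) (I ys) (C x)"
 shows "runs (for_each xs f s) (I []) (1 + (\<Sum>x\<leftarrow>xs. 2 + C x))"
 using assms
proof (induction xs arbitrary: s)
 case Nil thus ?case unfolding for_each.simps tick_eq
  by (intro runs_bind_detp[of _ _ _ 0] runs_ret) auto
next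
 case (Cons x xs)
 have "runs (for_each xs f s') (I []) (1 + (\<Sum>x\<leftarrow>xs. 2 + C x))" if "I xs s'" for s'
  by (rule Cons.IH[OF that]) (use Cons.prems in auto)
 thus ?case unfolding for_each.simps tick_eq
  using Cons.prems
  by (intro runs_bind_detp[of _ _ _ "C x + (1 + (\<Sum>x\<leftarrow>xs. 2 + C x))"] runs_pbind[of _ "I xs" "C x"]) auto
qed

definition a_list :: "nat \<Rightarrow> real list" where
 "a_list n = map (\<lambda>k. real (a_coeff k)) [0..<n]"

lemma a_list_nth: "i < n \<Longrightarrow> a_list n ! i = real (a_coeff i)"
 by (simp add: a_list_def)

lemma a_list_Suc: "a_list (Suc n) = a_list n @ [real (a_coeff n)]"
 by (simp add: a_list_def)

lemma b_coeff_sum: "1 \<le> m \<Longrightarrow> real (b_coeff m) = (\<Sum>e\<in>{1..m}. if e dvd m then real e * real (a_coeff e) else 0)"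
proof -
 assume m: "1 \<le> m"
 hence "{e. e dvd m} = {e\<in>{1..m}. e dvd m}" by (auto dest: dvd_imp_le intro: Suc_leI dvd_pos_nat)
 hence "real (b_coeff m) = (\<Sum>e\<in>{e\<in>{1..m}. e dvd m}. real e * real (a_coeff e))" by (simp add: b_coeff_def)
 also have "... = (\<Sum>e\<in>{1..m}. if e dvd m then real e * real (a_coeff e) else 0)" by (rule sum.inter_filter) simp
 finally show ?thesis .
qed

text \<open>The inner loops compute \<open>b_coeff_sum\<close> and the right side of
  \<open>a_coeff_rec\<close>. The length is \<open>Suc (Suc (d - 1))\<close> because the array
  starts out with two entries and receives \<open>d - 1\<close> more.\<close>

lemma runs_coeffs: "runs (coeffs d) (\<lambda>as. as = a_list (Suc (Suc (d - 1)))) (4 + 22 * d\<^sup>2)"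
proof -
 let ?B = "\<lambda>m j. \<Sum>e\<in>{1..<j}. if e dvd m then real e * real (a_coeff e) else 0"
 let ?C = "\<lambda>m j. \<Sum>k\<in>{1..<j}. real (b_coeff k) * real (a_coeff (Suc m - k))"
 let ?f = "\<lambda>(m :: nat) as e b. do {
  detp () 2; if e dvd m then do { x \<leftarrow> get as e; calc (V b \<^bold>+ V (real e) \<^bold>* V x) } else ret b }"
 let ?h = "\<lambda>m as bs k c. do {
  detp () 2; y \<leftarrow> get bs k; x \<leftarrow> get as (m + 1 - k); calc (V c \<^bold>+ V y \<^bold>* V x) }"
 let ?r = "\<lambda>m as bs b. do { bs \<leftarrow> push bs b; c \<leftarrow> for_loop m 1 (?h m as bs) 0;
  x \<leftarrow> calc (V c \<^bold>/ V (real m)); as \<leftarrow> push as x; ret (as, bs) }"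
 define I where "I m S \<longleftrightarrow> (case S of (as, bs) \<Rightarrow> as = a_list (Suc m) \<and> bs = map (\<lambda>k. real (b_coeff k)) [0..<m])"
  for m :: nat and S :: "real list \<times> real list"
 have b: "runs (for_loop m 1 (?f m as) 0)
   (\<lambda>b. b = real (b_coeff m)) (1 + m * (2 + 5))" if m: "1 \<le> m" and as: "as = a_list (Suc m)" for m as
 proof (rule runs_mono[OF runs_for_loop[of "\<lambda>j b. b = ?B m j"]])
  fix j b assume j: "1 \<le> j" "j < 1 + m" and b: "b = ?B m j"
  have "?B m (Suc j) = b + (if j dvd m then real j * real (a_coeff j) else 0)"
   using j b by (simp add: sum.atLeastLessThan_Suc)
  thus "runs (?f m as j b) (\<lambda>b. b = ?B m (Suc j)) 5"
   using j as
   by (intro runs_bind_detp[of _ _ _ 3]) (auto simp: get_eq calc_eq a_list_nth intro!: runs_bind_detp[of _ _ _ 2] runs_detp runs_ret)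
 next
  show "b = real (b_coeff m)" if "b = ?B m (1 + m)" for b
   using that m by (simp add: b_coeff_sum atLeastLessThanSuc_atLeastAtMost)
 qed auto
 have c: "runs (for_loop m 1 (?h m as bs) 0) (\<lambda>c. c = real m * real (a_coeff (Suc m))) (1 + m * (2 + 6))"
  if as: "as = a_list (Suc m)" and bs: "bs = map (\<lambda>k. real (b_coeff k)) [0..<Suc m]" for m as bs
 proof (rule runs_mono[OF runs_for_loop[of "\<lambda>j c. c = ?C m j"]])
  fix j c assume j: "1 \<le> j" "j < 1 + m" and c: "c = ?C m j"
  have "?C m (Suc j) = c + real (b_coeff j) * real (a_coeff (Suc m - j))"
   using j c by (simp add: sum.atLeastLessThan_Suc)
  moreover have "bs ! j = real (b_coeff j)" "as ! (m + 1 - j) = real (a_coeff (Suc m - j))"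
   using j by (simp_all add: as bs a_list_nth del: upt_Suc)
  ultimately show "runs (?h m as bs j c) (\<lambda>c. c = ?C m (Suc j)) 6"
   unfolding get_eq calc_eq
   by (intro runs_bind_detp[of _ _ _ 4] runs_bind_detp[of _ _ _ 3] runs_bind_detp[of _ _ _ 2] runs_detp) auto
 next
  have "real m * real (a_coeff (Suc m)) = ?C m (1 + m)"
   using arg_cong[OF a_coeff_rec[of m], of real] by (simp add: atLeastLessThanSuc_atLeastAtMost)
  thus "c = real m * real (a_coeff (Suc m))"
   if "c = ?C m (1 + m)" for c
   using that by simp
 qed auto
 show ?thesis unfolding coeffs_def tick_eq
 proof (rule runs_bind_detp, rule runs_pbind[OF runs_for_loop[of I _ _ _ _ "5 + 15 * d"]])
  show "I 1 ([0, 1], [0])" by (simp add: I_def a_list_def b_coeff_def upt_rec)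
 next
  fix m S assume m: "1 \<le> m" "m < 1 + (d - 1)" and "I m S"
  then obtain as bs where S: "S = (as, bs)" "as = a_list (Suc m)" "bs = map (\<lambda>k. real (b_coeff k)) [0..<m]"
   by (auto simp: I_def)
  show "runs (case S of (as, bs) \<Rightarrow> do { b \<leftarrow> for_loop m 1 (?f m as) 0; ?r m as bs b }) (I (Suc m)) (5 + 15 * d)"
   unfolding S(1) prod.case
  proof (rule runs_pbind[OF b[OF m(1) S(2)]])
   fix b assume b: "b = real (b_coeff m)"
   show "runs (?r m as bs b) (I (Suc m)) (4 + 8 * m)"
    unfolding push_eq calc_eq[of "_ \<^bold>/ _"]
   proof (rule runs_bind_detp[of _ _ _ "3 + 8 * m"], rule runs_pbind[OF c[OF S(2)]])
    show "bs @ [b] = map (\<lambda>k. real (b_coeff k)) [0..<Suc m]" by (simp add: S(3) b)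
    fix c assume "c = real m * real (a_coeff (Suc m))"
    hence "rval (V c \<^bold>/ V (real m)) = real (a_coeff (Suc m))" using m by simp
    thus "runs (do { x \<leftarrow> detp (rval (V c \<^bold>/ V (real m))) (rcost (V c \<^bold>/ V (real m)));
      as \<leftarrow> detp (as @ [x]) 1; ret (as, bs @ [b]) }) (I (Suc m)) 2"
     by (intro runs_bind_detp[of _ _ _ 1] runs_bind_detp[of _ _ _ 0] runs_ret)
       (auto simp: I_def S a_list_Suc b)
   qed auto
  qed (use m in auto)
 next
  fix S assume "I (1 + (d - 1)) S"
  thus "runs (case S of (as, bs) \<Rightarrow> ret as) (\<lambda>as. as = a_list (Suc (Suc (d - 1)))) 0"
   by (auto simp: I_def intro!: runs_ret)
 next
  show "1 + (d - 1) * (2 + (5 + 15 * d)) + 0 \<le> 1 + 22 * d\<^sup>2"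
  proof (cases d)
   case (Suc e) thus ?thesis by (simp add: power2_eq_square algebra_simps)
  qed simp
 qed simp
qed

section \<open>Approximations and elementary samplers\<close>

text \<open>The rate \<open>sqrt rho\<close> suits all Taylor approximations in use, because
  \<open>t <= rho^(3/2)\<close> gives \<open>t / rho <= sqrt rho\<close>. The quadratic cost is that
  of the coefficient table.\<close>

definition approx_ok :: "nat \<Rightarrow> approx \<Rightarrow> real \<Rightarrow> real \<Rightarrow> bool" where
 "approx_ok K f x W \<longleftrightarrow> (\<exists>l h c. (\<forall>d. f d = detp (l d, h d) (c d)) \<and>
   (\<forall>d\<ge>1. l d \<le> x \<and> x \<le> h d \<and> h d - l d \<le> W * sqrt rho ^ d \<and> c d \<le> K * (d + 1)\<^sup>2))"

text \<open>This weaker notion suffices for \<open>good\<close> and holds for all parameters,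
  whereas \<open>approx_ok\<close> needs the parameter to lie in the range of the error
  estimate.\<close>

definition approx_det :: "approx \<Rightarrow> bool" where
 "approx_det f \<longleftrightarrow> (\<exists>l h c. \<forall>d. f d = detp (l d, h d) (c d))"

lemma scaled_eq: "f d = detp (l, h) k \<Longrightarrow> scaled c f d = detp (l / c, h / c) (k + 2)"
 unfolding scaled_def calc_eq ret_eq by (simp add: pbind_detp_detp)

lemma approx_det_exact: "approx_det (exact x)"
 unfolding approx_det_def exact_def ret_eq
 by (rule exI[of _ "\<lambda>_. x"], rule exI[of _ "\<lambda>_. x"], rule exI[of _ "\<lambda>_. 0"]) simp

lemma approx_det_scaled: "approx_det f \<Longrightarrow> approx_det (scaled c f)"
proof -
 assume "approx_det f"
 then obtain l h k where f: "\<And>d. f d = detp (l d, h d) (k d)" unfolding approx_det_def by blast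
 have "scaled c f d = detp (l d / c, h d / c) (k d + 2)" for d by (rule scaled_eq[of f d, OF f])
 thus ?thesis unfolding approx_det_def
  by (intro exI[of _ "\<lambda>d. l d / c"] exI[of _ "\<lambda>d. h d / c"] exI[of _ "\<lambda>d. k d + 2"]) simp
qed

lemma approx_ok_exact: "approx_ok 0 (exact x) x 0"
 unfolding approx_ok_def exact_def ret_eq
 by (rule exI[of _ "\<lambda>_. x"], rule exI[of _ "\<lambda>_. x"], rule exI[of _ "\<lambda>_. 0"]) simp

lemma approx_ok_scaled:
 assumes "approx_ok K f x W" "0 < c"
 shows "approx_ok (K + 2) (scaled c f) (x / c) (W / c)"
proof -
 obtain l h k where f: "\<And>d. f d = detp (l d, h d) (k d)"
  and b: "\<And>d. 1 \<le> d \<Longrightarrow> l d \<le> x \<and> x \<le> h d \<and> h d - l d \<le> W * sqrt rho ^ d \<and> k d \<le> K * (d + 1)\<^sup>2"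
  using assms(1) unfolding approx_ok_def by blast
 have "h d / c - l d / c \<le> W / c * sqrt rho ^ d" if "1 \<le> d" for d
 proof -
  have "(h d - l d) / c \<le> (W * sqrt rho ^ d) / c" using b[OF that] assms(2) by (intro divide_right_mono) auto
  thus ?thesis by (simp add: diff_divide_distrib)
 qed
 moreover have "k d + 2 \<le> (K + 2) * (d + 1)\<^sup>2" if "1 \<le> d" for d
 proof -
  have "1 \<le> (d + 1)\<^sup>2" by simp
  moreover have "k d \<le> K * (d + 1)\<^sup>2" using b[OF that] by blast
  ultimately show ?thesis unfolding add_mult_distrib by linarith
 qed
 ultimately show ?thesis unfolding approx_ok_def using b assms(2)
  by (intro exI[of _ "\<lambda>d. l d / c"] exI[of _ "\<lambda>d. h d / c"] exI[of _ "\<lambda>d. k d + 2"])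
    (auto simp: scaled_eq[OF f] divide_right_mono)
qed

lemma approx_ok_det: "approx_ok K f x W \<Longrightarrow> approx_det f"
 unfolding approx_ok_def approx_det_def by blast

lemma approx_ok_mono: "approx_ok K f x W \<Longrightarrow> K \<le> K' \<Longrightarrow> W \<le> W' \<Longrightarrow> approx_ok K' f x W'"
proof -
 assume f: "approx_ok K f x W" and le: "K \<le> K'" "W \<le> W'"
 have "W * sqrt rho ^ d \<le> W' * sqrt rho ^ d" for d using le rho_ge by (intro mult_right_mono) auto
 moreover have "K * (d + 1)\<^sup>2 \<le> K' * (d + 1)\<^sup>2" for d using le by (intro mult_right_mono) auto
 moreover obtain l h k where "\<And>d. f d = detp (l d, h d) (k d)"
  and "\<And>d. 1 \<le> d \<Longrightarrow> l d \<le> x \<and> x \<le> h d \<and> h d - l d \<le> W * sqrt rho ^ d \<and> k d \<le> K * (d + 1)\<^sup>2"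
  using f unfolding approx_ok_def by blast
 ultimately show ?thesis unfolding approx_ok_def
  by (intro exI[of _ l] exI[of _ h] exI[of _ k]) (meson order_trans)
qed

lemma runs_approx_A:
 "runs (approx_A t d) (\<lambda>(l, h). t \<noteq> rho \<longrightarrow> 1 \<le> d \<longrightarrow> l = A_part d t \<and> h = l + (t / rho) ^ Suc d / (1 - t / rho)) (39 * (d + 1)\<^sup>2)" (is "runs _ ?Q _")
proof (cases "t = rho")
 case True thus ?thesis unfolding approx_A_def tick_eq
  by (intro runs_bind_detp[of _ _ _ 0]) (auto intro!: runs_ret simp: Suc_le_eq)
next
 case False
 define I where "I j S \<longleftrightarrow> (case S of (s, x, y) \<Rightarrow> 1 \<le> d \<longrightarrow> s = (\<Sum>k<j. real (a_coeff k) * t ^ k) \<and> x = t ^ (j - 1) \<and> y = (t / rho) ^ j)"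
  for j :: nat and S :: "real \<times> real \<times> real"
 let ?f = "\<lambda>as y0 j (s, x, y). do { c \<leftarrow> get as j; x' \<leftarrow> calc (V x \<^bold>* V t);
  y' \<leftarrow> calc (V y \<^bold>* V y0); s' \<leftarrow> calc (V s \<^bold>+ V c \<^bold>* V x'); ret (s', x', y') }"
 let ?l = "\<lambda>as y0. for_loop d 1 (?f as y0) (0, 1, y0)"
 have l: "runs (?l as y0) (I (1 + d)) (1 + d * (2 + 5))"
  if as: "as = a_list (Suc (Suc (d - 1)))" and y0: "y0 = t / rho" for as y0
 proof (rule runs_for_loop)
  fix j S assume j: "1 \<le> j" "j < 1 + d" and S: "I j S"
  obtain s x y where S': "S = (s, x, y)" by (cases S)
  have "as ! j = real (a_coeff j)" using j by (simp add: as a_list_nth)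
  moreover have "x * t = t ^ j" using S j by (cases j) (simp_all add: I_def S')
  ultimately show "runs (?f as y0 j S) (I (Suc j)) 5"
   unfolding S' prod.case get_eq calc_eq
   by (intro runs_bind_detp[of _ _ _ 4] runs_bind_detp[of _ _ _ 3] runs_bind_detp[of _ _ _ 2] runs_bind_detp[of _ _ _ 0] runs_ret)
     (use S in \<open>auto simp: I_def S' y0\<close>)
 qed (simp add: I_def y0)
 show ?thesis unfolding approx_A_def tick_eq if_not_P[OF False]
 proof (rule runs_bind_detp, rule runs_pbind[OF runs_coeffs])
  fix as assume as: "as = a_list (Suc (Suc (d - 1)))"
  show "runs (do { y0 \<leftarrow> calc (V t \<^bold>/ V rho); (s, x, y) \<leftarrow> ?l as y0; h \<leftarrow> calc (V s \<^bold>+ V y \<^bold>/ (V 1 \<^bold>- V y0));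
    ret (s, h) }) ?Q (5 + 7 * d)"
   unfolding calc_eq[of "V t \<^bold>/ V rho"]
  proof (rule runs_bind_detp[of _ _ _ "4 + 7 * d"], rule runs_pbind[OF l[OF as]])
   show "rval (V t \<^bold>/ V rho) = t / rho" by simp
   fix S assume S: "I (1 + d) S"
   obtain s x y where S': "S = (s, x, y)" by (cases S)
   show "runs (case S of (s, x, y) \<Rightarrow> do {
     h \<leftarrow> calc (V s \<^bold>+ V y \<^bold>/ (V 1 \<^bold>- V (rval (V t \<^bold>/ V rho)))); ret (s, h) })
     ?Q 3"
    unfolding S' prod.case calc_eq
    by (intro runs_bind_detp[of _ _ _ 0] runs_ret) (use S in \<open>auto simp: S' I_def A_part_def lessThan_Suc_atMost\<close>)
  qed simp_all
 next
  have "d \<le> d\<^sup>2" by (cases d) (simp_all add: power2_eq_square)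
  moreover have "(d + 1)\<^sup>2 = d\<^sup>2 + 2 * d + 1" by (simp add: power2_eq_square)
  ultimately show "1 + (4 + 22 * d\<^sup>2 + (5 + 7 * d)) \<le> 39 * (d + 1)\<^sup>2" by linarith
 qed simp
qed

lemma approx_det_A: "approx_det (approx_A t)"
proof -
 have "\<exists>l h c. approx_A t d = detp (l, h) c" for d
  using runs_approx_A[of t d] unfolding runs_def by auto
 thus ?thesis unfolding approx_det_def by metis
qed

lemma A_gf_le_quot: "0 \<le> t \<Longrightarrow> t \<le> rho \<Longrightarrow> A_gf t \<le> t / rho"
 using A_gf_scale[OF A_ok_rho, of "t / rho"] rho_ge by (simp add: A_rho)

lemma a_coeff_rho_le: "real (a_coeff j) * rho ^ j \<le> 1"
proof -
 have "(\<Sum>k\<in>{j}. real (a_coeff k) * rho ^ k) \<le> A_gf rho"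
  unfolding A_gf_def using A_ok_rho by (intro sum_le_suminf) (auto simp: A_ok_def)
 thus ?thesis by (simp add: A_rho)
qed

lemma A_gf_remainder:
 assumes t: "0 \<le> t" "t < rho"
 shows "A_gf t \<le> A_part d t + (t / rho) ^ Suc d / (1 - t / rho)"
proof -
 let ?a = "\<lambda>k. real (a_coeff k) * t ^ k"
 have rp: "0 < rho" using t by simp
 have s: "summable ?a" using A_ok[of t] t by (simp add: A_ok_def)
 have "A_gf t = (\<Sum>k. ?a (k + Suc d)) + (\<Sum>k<Suc d. ?a k)"
  unfolding A_gf_def by (rule suminf_split_initial_segment[OF s])
 also have "(\<Sum>k. ?a (k + Suc d)) \<le> (\<Sum>k. (t / rho) ^ Suc d * (t / rho) ^ k)"
 proof (rule suminf_le)
  show "summable (\<lambda>k. ?a (k + Suc d))" using s by (rule summable_ignore_initial_segment)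
  show "summable (\<lambda>k. (t / rho) ^ Suc d * (t / rho) ^ k)" using t rp by (intro summable_mult summable_geometric) auto
  fix k
  have "?a (k + Suc d) = (real (a_coeff (k + Suc d)) * rho ^ (k + Suc d)) * (t / rho) ^ (k + Suc d)"
   using rp by (simp add: power_divide)
  also have "... \<le> 1 * (t / rho) ^ (k + Suc d)" using t rp by (intro mult_right_mono a_coeff_rho_le) auto
  finally show "?a (k + Suc d) \<le> (t / rho) ^ Suc d * (t / rho) ^ k" by (simp add: power_add mult_ac)
 qed
 also have "(\<Sum>k. (t / rho) ^ Suc d * (t / rho) ^ k) = (t / rho) ^ Suc d / (1 - t / rho)"
  using t rp by (subst suminf_mult) (auto simp: suminf_geometric)
 finally show ?thesis by (simp add: A_part_def lessThan_Suc_atMost)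
qed

text \<open>The width keeps the factor \<open>t\<close>. In the index sampler the interval is
  divided by the geometrically small \<open>mi_c g\<close>, and it is this factor that
  compensates.\<close>

lemma approx_ok_A:
 assumes t: "0 \<le> t" "t \<le> rho * sqrt rho"
 shows "approx_ok 39 (approx_A t) (A_gf t) (t / (rho * (1 - sqrt rho)))"
proof -
 have rp: "0 < rho" "0 < sqrt rho" "sqrt rho < 1" using rho_ge rho_less by auto
 hence lt: "t < rho" using t by (metis mult.right_neutral mult_strict_left_mono order_le_less_trans)
 have tr: "t / rho \<le> sqrt rho" "0 \<le> t / rho" "t / rho < 1" using t rp lt by (auto simp: field_simps)
 have "\<exists>l h c. approx_A t d = detp (l, h) c \<and> (1 \<le> d \<longrightarrow> l = A_part d t \<and> h = l + (t / rho) ^ Suc d / (1 - t / rho)) \<and> c \<le> 39 * (d + 1)\<^sup>2" for d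
  using runs_approx_A[of t d] lt unfolding runs_def by auto
 then obtain l h c where 1: "\<And>d. approx_A t d = detp (l d, h d) (c d)"
  "\<And>d. 1 \<le> d \<Longrightarrow> l d = A_part d t \<and> h d = l d + (t / rho) ^ Suc d / (1 - t / rho)" "\<And>d. c d \<le> 39 * (d + 1)\<^sup>2"
  by metis
 show ?thesis unfolding approx_ok_def
 proof (intro exI conjI allI impI)
  fix d :: nat assume d: "1 \<le> d"
  show "l d \<le> A_gf t" using 1(2)[OF d] A_part_le[OF A_ok[of t]] t lt by simp
  show "A_gf t \<le> h d" using 1(2)[OF d] A_gf_remainder[OF t(1) lt] by simp
  have "h d - l d = (t / rho) * (t / rho) ^ d / (1 - t / rho)" using 1(2)[OF d] by simp
  also have "... \<le> (t / rho) * sqrt rho ^ d / (1 - sqrt rho)"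
   using tr rp t by (intro frac_le mult_left_mono power_mono mult_nonneg_nonneg) auto
  finally show "h d - l d \<le> t / (rho * (1 - sqrt rho)) * sqrt rho ^ d" by simp
  show "c d \<le> 39 * (d + 1)\<^sup>2" by (rule 1(3))
 qed (rule 1(1))
qed

section \<open>Comparison of a uniform variable with refined approximations\<close>

context
 fixes l h :: "nat \<Rightarrow> real" and c :: "nat \<Rightarrow> nat"
begin

text \<open>Result and cost of the comparison of \<open>u\<close> with the approximations \<open>d, d + 1, ...\<close>, cut off
 after \<open>n\<close> rounds.\<close>

primrec refine :: "nat \<Rightarrow> real \<Rightarrow> nat \<Rightarrow> (bool \<times> nat) option" where
 "refine 0 u d = None"
| "refine (Suc n) u d =
  (if u < l d then Some (True, c d + 1)
   else if u < h d then map_option (\<lambda>(b, k). (b, c d + 4 + k)) (refine n u (Suc d))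
   else Some (False, c d + 3))"

lemma refine_measurable: "(\<lambda>u. refine n u d) \<in> borel \<rightarrow>\<^sub>M count_space UNIV"
proof (induction n arbitrary: d)
 case (Suc n)
 have 1: "(\<lambda>u. map_option (\<lambda>(b, k). (b, c d + 4 + k)) (refine n u (Suc d))) \<in> borel \<rightarrow>\<^sub>M count_space UNIV"
  by (rule measurable_compose[OF Suc]) simp
 have 2: "{u \<in> space borel. u < x} \<in> sets borel" for x :: real by measurable
 show ?case unfolding refine.simps by (intro measurable_If 1 2 measurable_const) auto
qed simp

lemma refine_mono: "refine n u d = Some r \<Longrightarrow> refine (Suc n) u d = Some r"
proof (induction n arbitrary: d r)
 case (Suc n)
 show ?case
 proof (cases "\<not> u < l d \<and> u < h d")
  case True
  with Suc.prems obtain r' where "refine n u (Suc d) = Some r'" "r = (case r' of (b, k) \<Rightarrow> (b, c d + 4 + k))"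
   by auto
  with Suc.IH[of "Suc d" r'] True show ?thesis by (subst refine.simps(2)) (simp del: refine.simps)
 next
  case False
  with Suc.prems show ?thesis by (auto split: if_split_asm)
 qed
qed simp

lemma refine_terminates:
 assumes "u < l (d + n) \<or> h (d + n) \<le> u"
 shows "refine (Suc n) u d \<noteq> None"
 using assms
proof (induction n arbitrary: d)
 case (Suc n)
 have "refine (Suc n) u (Suc d) \<noteq> None" by (rule Suc.IH) (use Suc.prems in simp)
 thus ?case by (subst refine.simps(2)) auto
qed auto

lemma refine_sound:
 assumes "\<And>d. 1 \<le> d \<Longrightarrow> l d \<le> x \<and> x \<le> h d" "u \<noteq> x" "1 \<le> d" "refine n u d = Some (b, k)"
 shows "b \<longleftrightarrow> u < x"
 using assms(3,4)
proof (induction n arbitrary: d k)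
 case (Suc n)
 thus ?case using assms(1)[OF Suc.prems(1)] assms(2) by (auto split: if_splits dest: Suc.IH[rotated])
qed simp

text \<open>Round \<open>d + j + 1\<close> is entered only if \<open>u\<close> lies in the interval
  of round \<open>d + j\<close>. In expectation each round therefore costs at most its price times
  the preceding width.\<close>

lemma refine_cost:
 assumes "refine n u d = Some (b, k)"
 shows "(of_nat k :: ennreal) \<le> of_nat (c d + 4) + (\<Sum>j. of_nat (c (Suc (d + j)) + 4) * indicator {l (d + j)..<h (d + j)} u)"
 using assms
proof (induction n arbitrary: d k)
 case (Suc n)
 let ?f = "\<lambda>d j. of_nat (c (Suc (d + j)) + 4) * indicator {l (d + j)..<h (d + j)} u :: ennreal"
 show ?case
 proof (cases "\<not> u < l d \<and> u < h d")
  case True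
  with Suc.prems obtain k' where k': "refine n u (Suc d) = Some (b, k')" "k = c d + 4 + k'" by auto
  have "(\<Sum>j. ?f d j) = ?f d 0 + (\<Sum>j. ?f (Suc d) j)"
   using suminf_offset[OF summableI, of "?f d" 1] by (simp add: add.commute)
  also have "?f d 0 = of_nat (c (Suc d) + 4)" using True by simp
  finally have "(\<Sum>j. ?f d j) = of_nat (c (Suc d) + 4) + (\<Sum>j. ?f (Suc d) j)" .
  with Suc.IH[OF k'(1)] show ?thesis unfolding k'(2) by (simp add: add_mono)
 next
  case False
  hence "k \<le> c d + 4" using Suc.prems by (auto split: if_splits)
  hence "(of_nat k :: ennreal) \<le> of_nat (c d + 4)" by (rule of_nat_mono)
  thus ?thesis by (rule order_trans) simp
 qed
qed simp

end

text \<open>The uniform variable and all its comparisons are read off a single cell, so only a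
  Boolean leaves the program and \<open>good_draw\<close> applies.\<close>

lemma bernoulli_lim:
 assumes f: "\<And>d. f d = detp (l d, h d) (c d)"
 shows "prog_lim (\<lambda>n. draw (\<lambda>z. map_option (\<lambda>(b, k). (b, Suc k)) (refine l h c n (fst z) 1))) (bernoulli f)"
proof -
 define body where "body u d = (do {
    (l, h) \<leftarrow> f d;
    below \<leftarrow> test_less (V u) (V l);
    if below then ret (Inr True) else do {
     undecided \<leftarrow> test_less (V u) (V h);
     tick 1;
     ret (if undecided then Inl (d + 1) else Inr False) } })" for u :: real and d :: nat
 have body: "body u d = (if u < l d then detp (Inr True) (c d + 1) else
   if u < h d then detp (Inl (Suc d)) (c d + 3) else detp (Inr False) (c d + 3))" for u d
  unfolding body_def f test_less_eq tick_eq ret_eq by (simp add: pbind_detp_detp numeral_3_eq_3)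
 have ln: "loop_n n (body u) d = (\<lambda>tp. map_option (\<lambda>(b, k). (b, k, tp)) (refine l h c n u d))" for n u d
 proof (induction n arbitrary: d)
  case (Suc n)
  consider "u < l d" | "\<not> u < l d" "u < h d" | "\<not> u < l d" "\<not> u < h d" by blast
  thus ?case
  proof cases
   case 1
   hence b: "body u d = detp (Inr True) (c d + 1)" by (simp add: body)
   show ?thesis unfolding loop_n.simps b using 1 by (simp add: pbind_detp ret_def)
  next
   case 2
   hence b: "body u d = detp (Inl (Suc d)) (c d + 3)" by (simp add: body)
   show ?thesis unfolding loop_n.simps b tick_eq pbind_detp sum.case Suc[of "Suc d"] using 2
    by (auto simp: fun_eq_iff option.map_comp comp_def split_beta intro!: option.map_cong)
  next
   case 3
   hence b: "body u d = detp (Inr False) (c d + 3)" by (simp add: body)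
   show ?thesis unfolding loop_n.simps b using 3 by (simp add: pbind_detp ret_def)
  qed
 qed simp
 have "prog_lim (\<lambda>n. pbind uniform (\<lambda>u. loop_n n (body u) 1)) (pbind uniform (\<lambda>u. loop (body u) 1))"
  by (intro prog_lim_pbind prog_lim_const prog_lim_loop)
 moreover have "pbind uniform (\<lambda>u. loop_n n (body u) 1) =
   draw (\<lambda>z. map_option (\<lambda>(b, k). (b, Suc k)) (refine l h c n (fst z) 1))" for n
 proof
  fix tp
  show "pbind uniform (\<lambda>u. loop_n n (body u) 1) tp =
   draw (\<lambda>z. map_option (\<lambda>(b, k). (b, Suc k)) (refine l h c n (fst z) 1)) tp"
   unfolding ln
   by (cases "refine l h c n (fst (shd tp)) 1") (auto simp: pbind_def uniform_def draw_def)
 qed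
 moreover have "bernoulli f = pbind uniform (\<lambda>u. loop (body u) 1)"
  unfolding bernoulli_def body_def ..
 ultimately show ?thesis by simp
qed

lemma refine_cell_measurable:
 "(\<lambda>z. map_option (\<lambda>(b, k). (b, Suc k)) (refine l h c n (fst z) 1)) \<in> cell_measure q \<rightarrow>\<^sub>M count_space UNIV"
proof -
 have [measurable]: "(\<lambda>u. refine l h c n u 1) \<in> borel \<rightarrow>\<^sub>M count_space UNIV" by (rule refine_measurable)
 have "(\<lambda>u. map_option (\<lambda>(b, k). (b, Suc k)) (refine l h c n u 1)) \<in> borel \<rightarrow>\<^sub>M count_space UNIV"
  by (rule measurable_compose[OF refine_measurable]) simp
 from measurable_compose[OF cell_components(1) this] show ?thesis .
qed

lemma good_bernoulli: "approx_det f \<Longrightarrow> good q (bernoulli f)"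
 unfolding approx_det_def
 by (elim exE) (rule good_lim[OF bernoulli_lim good_draw[OF refine_cell_measurable]], blast)

lemma nn_integral_unif:
 assumes [measurable]: "f \<in> borel_measurable borel"
 shows "(\<integral>\<^sup>+ u. f u \<partial>unif) = (\<integral>\<^sup>+ u. f u * indicator {0..1} u \<partial>lborel)"
 by (subst nn_integral_uniform_measure) (auto simp: divide_ennreal_def)

lemma emeasure_unif_Ico_le: "emeasure unif {a..<b} \<le> ennreal (b - a)"
proof -
 have "emeasure unif {a..<b} = emeasure lborel ({0..1} \<inter> {a..<b})"
  by (subst emeasure_uniform_measure) (auto simp: divide_ennreal_def)
 also have "... \<le> emeasure lborel {a..<b}" by (intro emeasure_mono) auto
 also have "... \<le> ennreal (b - a)" by (cases "a \<le> b") auto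
 finally show ?thesis .
qed

lemma nn_integral_unif_threshold:
 assumes "0 \<le> x" "x \<le> 1"
 shows "(\<integral>\<^sup>+ u. (if u < x then a else b) \<partial>unif) = a * ennreal x + b * ennreal (1 - x)"
proof -
 have "(\<integral>\<^sup>+ u. (if u < x then a else b) \<partial>unif) =
  (\<integral>\<^sup>+ u. a * indicator {0..<x} u + b * indicator {x..1} u \<partial>lborel)"
  using assms by (subst nn_integral_unif, measurable, intro nn_integral_cong) (auto split: split_indicator)
 also have "... = a * ennreal x + b * ennreal (1 - x)"
  using assms by (simp add: nn_integral_add nn_integral_cmult)
 finally show ?thesis .
qed

text \<open>Unless \<open>u = x\<close>, a null event, the widths eventually fall below the distance
  of \<open>u\<close> from \<open>x\<close>; then the comparison is decided, and decided
  correctly.\<close>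

lemma val_bernoulli:
 assumes f: "approx_ok K f x W" and x: "0 \<le> x" "x \<le> 1"
 shows "val q (bernoulli f) g = g True * ennreal x + g False * ennreal (1 - x)"
proof -
 obtain l h c where d: "\<And>d. f d = detp (l d, h d) (c d)"
  and b: "\<And>d. 1 \<le> d \<Longrightarrow> l d \<le> x \<and> x \<le> h d \<and> h d - l d \<le> W * sqrt rho ^ d \<and> c d \<le> K * (d + 1)\<^sup>2"
  using f unfolding approx_ok_def by blast
 define G where "G n u = (case refine l h c n u 1 of None \<Rightarrow> 0 | Some (b, k) \<Rightarrow> g b)" for n u
 have [measurable]: "G n \<in> borel_measurable borel" for n
  unfolding G_def[abs_def] by (rule measurable_compose[OF refine_measurable]) simp
 have "val q (bernoulli f) g = (SUP n. (\<integral>\<^sup>+ u. G n u \<partial>unif))"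
 proof -
  have "val q (bernoulli f) g = (SUP n. wp q (draw (\<lambda>z. map_option (\<lambda>(b, k). (b, Suc k)) (refine l h c n (fst z) 1))) (\<lambda>b _. g b))"
   unfolding val_def by (rule wp_lim[OF bernoulli_lim[OF d] good_draw[OF refine_cell_measurable]])
  also have "... = (SUP n. (\<integral>\<^sup>+ z. G n (fst z) \<partial>cell_measure q))"
   by (intro SUP_cong refl, subst wp_draw[OF refine_cell_measurable])
     (auto simp: G_def intro!: nn_integral_cong split: option.split)
  also have "... = (SUP n. (\<integral>\<^sup>+ u. G n u \<partial>unif))"
   by (intro SUP_cong refl nn_integral_cell) simp
  finally show ?thesis .
 qed
 also have "... = (\<integral>\<^sup>+ u. (SUP n. G n u) \<partial>unif)"
 proof (rule nn_integral_monotone_convergence_SUP[symmetric])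
  show "incseq G"
  proof (intro incseq_SucI le_funI)
   fix n u show "G n u \<le> G (Suc n) u"
    using refine_mono[of l h c n u 1] by (cases "refine l h c n u 1") (auto simp: G_def simp del: refine.simps)
  qed
 qed simp
 also have "... = (\<integral>\<^sup>+ u. (if u < x then g True else g False) \<partial>unif)"
 proof (rule nn_integral_cong_AE)
  have "AE u in lborel. u \<noteq> x" by (rule AE_lborel_singleton)
  hence "AE u in unif. u \<noteq> x" by (intro AE_uniform_measureI) auto
  thus "AE u in unif. (SUP n. G n u) = (if u < x then g True else g False)"
  proof eventually_elim
   fix u assume u: "u \<noteq> x"
   have le: "G n u \<le> (if u < x then g True else g False)" for n
    using refine_sound[of l x h u 1 c n] b u by (cases "refine l h c n u 1") (auto simp: G_def)
   have "(\<lambda>d. W * sqrt rho ^ d) \<longlonglongrightarrow> W * 0"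
    using rho_ge rho_less by (intro tendsto_mult tendsto_const LIMSEQ_power_zero) auto
   hence "eventually (\<lambda>d. W * sqrt rho ^ d < \<bar>u - x\<bar>) sequentially"
    using u by (intro order_tendstoD(2)) auto
   then obtain D where D: "\<And>d. D \<le> d \<Longrightarrow> W * sqrt rho ^ d < \<bar>u - x\<bar>" by (auto simp: eventually_sequentially)
   have "u < l (1 + D) \<or> h (1 + D) \<le> u" using D[of "1 + D"] b[of "1 + D"] by (auto split: abs_split)
   then obtain r where "refine l h c (Suc D) u 1 = Some r" using refine_terminates[of u l 1 D h c] by blast
   moreover obtain b' k where "r = (b', k)" by (cases r)
   ultimately have "G (Suc D) u = (if u < x then g True else g False)"
    using refine_sound[of l x h u 1 c "Suc D" b' k] b u by (auto simp: G_def simp del: refine.simps)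
   thus "(SUP n. G n u) = (if u < x then g True else g False)"
    using le by (intro antisym SUP_least) (auto intro: SUP_upper2[of "Suc D"])
  qed
 qed
 also have "... = g True * ennreal x + g False * ennreal (1 - x)"
  by (rule nn_integral_unif_threshold[OF x])
 finally show ?thesis .
qed

text \<open>First round, plus the price of round \<open>j + 2\<close> times the width left by round
  \<open>j + 1\<close>, for width factor 1.\<close>

definition bern_const :: "nat \<Rightarrow> real" where
 "bern_const K = 5 + 4 * real K + (\<Sum>j. (real K * (real j + 3)\<^sup>2 + 4) * sqrt rho ^ Suc j)"

lemma summable_sq_geometric:
 fixes r :: real
 assumes "0 < r" "r < 1"
 shows "summable (\<lambda>j. (real j + 3)\<^sup>2 * r ^ j)"
proof -
 have "(\<lambda>j. (real j + 3)\<^sup>2 * r ^ j) \<in> O(\<lambda>j. ((1 + r) / 2) ^ j)"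
  using assms by real_asymp
 moreover have "summable (\<lambda>j. norm (((1 + r) / 2) ^ j))" using assms by (simp add: summable_geometric norm_power)
 ultimately show ?thesis by (rule summable_comparison_test_bigo[rotated])
qed

lemma summable_bern: "summable (\<lambda>j. (real K * (real j + 3)\<^sup>2 + 4) * sqrt rho ^ Suc j)"
proof -
 have r: "0 < sqrt rho" "sqrt rho < 1" using rho_ge rho_less by auto
 have "summable (\<lambda>j. (real K * sqrt rho) * ((real j + 3)\<^sup>2 * sqrt rho ^ j) + (4 * sqrt rho) * sqrt rho ^ j)"
  using r by (intro summable_add summable_mult summable_sq_geometric summable_geometric) auto
 thus ?thesis by (simp add: algebra_simps)
qed

lemma cst_bernoulli:
 assumes f: "approx_ok K f x W" and W: "0 \<le> W"
 shows "cst q (bernoulli f) \<le> ennreal (bern_const K * (1 + W))"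
proof -
 obtain l h c where d: "\<And>d. f d = detp (l d, h d) (c d)"
  and b: "\<And>d. 1 \<le> d \<Longrightarrow> l d \<le> x \<and> x \<le> h d \<and> h d - l d \<le> W * sqrt rho ^ d \<and> c d \<le> K * (d + 1)\<^sup>2"
  using f unfolding approx_ok_def by blast
 have r: "0 < sqrt rho" "sqrt rho < 1" using rho_ge rho_less by auto
 let ?S = "\<Sum>j. (real K * (real j + 3)\<^sup>2 + 4) * sqrt rho ^ Suc j"
 have S: "0 \<le> ?S" using r by (intro suminf_nonneg summable_bern) auto
 define H :: "real \<Rightarrow> ennreal" where "H u = of_nat (c 1 + 5) + (\<Sum>j. of_nat (c (Suc (1 + j)) + 4) * indicator {l (1 + j)..<h (1 + j)} u)" for u :: real
 have H: "H \<in> borel_measurable borel"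
  unfolding H_def[abs_def]
  by (intro borel_measurable_add borel_measurable_suminf_order borel_measurable_times_ennreal
    borel_measurable_const borel_measurable_indicator) auto
 have "cst q (bernoulli f) = (SUP n. wp q (draw (\<lambda>z. map_option (\<lambda>(b, k). (b, Suc k)) (refine l h c n (fst z) 1))) (\<lambda>_ k. of_nat k))"
  unfolding cst_def by (rule wp_lim[OF bernoulli_lim[OF d] good_draw[OF refine_cell_measurable]])
 also have "... \<le> (\<integral>\<^sup>+ z. H (fst z) \<partial>cell_measure q)"
 proof (rule SUP_least, subst wp_draw[OF refine_cell_measurable], rule nn_integral_mono)
  fix n and z :: cell
  have Suc5: "c 1 + 5 = Suc (c 1 + 4)" by simp
  show "(case map_option (\<lambda>(b, k). (b, Suc k)) (refine l h c n (fst z) 1) of None \<Rightarrow> 0 | Some (x, xa) \<Rightarrow> of_nat xa) \<le> H (fst z)"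
  proof (cases "refine l h c n (fst z) 1")
   case (Some r)
   obtain b k where "r = (b, k)" by (cases r)
   with Some have "refine l h c n (fst z) 1 = Some (b, k)" by simp
   from add_left_mono[OF refine_cost[OF this], of 1]
   have "of_nat (Suc k) \<le> H (fst z)"
    unfolding H_def Suc5 of_nat_Suc add.assoc by simp
   thus ?thesis unfolding Some \<open>r = (b, k)\<close> by simp
  qed simp
 qed
 also have "... = (\<integral>\<^sup>+ u. H u \<partial>unif)" by (rule nn_integral_cell[OF H])
 also have "... = of_nat (c 1 + 5) * emeasure unif UNIV + (\<Sum>j. of_nat (c (Suc (1 + j)) + 4) * emeasure unif {l (1 + j)..<h (1 + j)})"
  unfolding H_def
  by (subst nn_integral_add) (auto simp: nn_integral_suminf nn_integral_cmult)
 also have "... \<le> ennreal (5 + 4 * real K) + (\<Sum>j. ennreal (W * ((real K * (real j + 3)\<^sup>2 + 4) * sqrt rho ^ Suc j)))"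
 proof (intro add_mono suminf_le summableI)
  have "c 1 \<le> K * 4" using b[of 1] by (simp add: power2_eq_square)
  hence "real (c 1 + 5) \<le> 5 + 4 * real K" by simp
  hence "of_nat (c 1 + 5) \<le> ennreal (5 + 4 * real K)" unfolding ennreal_of_nat_eq_real_of_nat by (intro ennreal_leI)
  moreover have "emeasure unif UNIV = 1"
   using prob_space.emeasure_space_1[OF prob_space_uniform_measure[of lborel "{0..1::real}"]] by simp
  ultimately show "of_nat (c 1 + 5) * emeasure unif UNIV \<le> ennreal (5 + 4 * real K)" by simp
  fix j
  have cj: "c (Suc (1 + j)) \<le> K * (j + 3)\<^sup>2" using b[of "Suc (1 + j)"] by (simp add: add.commute eval_nat_numeral)
  hence "real (c (Suc (1 + j))) \<le> real (K * (j + 3)\<^sup>2)" by (rule of_nat_mono)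
  hence 1: "real (c (Suc (1 + j)) + 4) \<le> real K * (real j + 3)\<^sup>2 + 4" by simp
  have "of_nat (c (Suc (1 + j)) + 4) * emeasure unif {l (1 + j)..<h (1 + j)} \<le>
   ennreal (real K * (real j + 3)\<^sup>2 + 4) * ennreal (W * sqrt rho ^ Suc j)"
  proof (rule mult_mono)
   show "of_nat (c (Suc (1 + j)) + 4) \<le> ennreal (real K * (real j + 3)\<^sup>2 + 4)"
    unfolding ennreal_of_nat_eq_real_of_nat by (intro ennreal_leI 1)
   show "emeasure unif {l (1 + j)..<h (1 + j)} \<le> ennreal (W * sqrt rho ^ Suc j)"
    using b[of "1 + j"] by (intro order_trans[OF emeasure_unif_Ico_le] ennreal_leI) simp
  qed auto
  also have "... = ennreal (W * ((real K * (real j + 3)\<^sup>2 + 4) * sqrt rho ^ Suc j))"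
   using W r by (subst ennreal_mult[symmetric]) (auto simp: mult_ac)
  finally show "of_nat (c (Suc (1 + j)) + 4) * emeasure unif {l (1 + j)..<h (1 + j)} \<le>
   ennreal (W * ((real K * (real j + 3)\<^sup>2 + 4) * sqrt rho ^ Suc j))" .
 qed
 also have "... = ennreal (5 + 4 * real K) + ennreal (W * ?S)"
  using W r summable_bern[of K]
  by (subst suminf_ennreal2) (auto intro!: mult_nonneg_nonneg summable_mult simp: suminf_mult)
 also have "... = ennreal (5 + 4 * real K + W * ?S)" using S W by (subst ennreal_plus) auto
 also have "... \<le> ennreal (bern_const K * (1 + W))"
  using S W unfolding bern_const_def by (intro ennreal_leI) (auto simp: algebra_simps)
 finally show ?thesis .
qed

lemma bern_const_nonneg: "0 \<le> bern_const K"
 unfolding bern_const_def using rho_ge by (intro add_nonneg_nonneg suminf_nonneg summable_bern) auto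

section \<open>Laws from generating functions; Poisson samplers\<close>

lemma powser_unique_pos:
 fixes p q :: "nat \<Rightarrow> real"
 assumes R: "0 < R" and s: "summable (\<lambda>n. p n * R ^ n)" "summable (\<lambda>n. q n * R ^ n)"
  and eq: "\<And>r. 0 < r \<Longrightarrow> r < R \<Longrightarrow> (\<Sum>n. p n * r ^ n) = (\<Sum>n. q n * r ^ n)"
 shows "p n = q n"
proof (rule ccontr)
 define d where "d n = p n - q n" for n
 assume "p n \<noteq> q n"
 hence ex: "\<exists>n. d n \<noteq> 0" by (auto simp: d_def)
 \<comment> \<open>The first differing coefficient. The two series are compared at positive
   arguments only, so its value is obtained as a limit from the right after dividing by
   \<open>x ^ m\<close>.\<close>
 define m where "m = (LEAST n. d n \<noteq> 0)"
 have m: "d m \<noteq> 0" unfolding m_def by (rule LeastI_ex[OF ex])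
 have less: "d n = 0" if "n < m" for n using not_less_Least[of n] that unfolding m_def by blast
 have sd: "summable (\<lambda>n. d n * x ^ n)" if "norm x < R" for x
 proof (rule powser_inside)
  show "summable (\<lambda>n. d n * R ^ n)" unfolding d_def left_diff_distrib by (intro summable_diff s)
 qed (use that R in auto)
 have shift: "summable (\<lambda>n. d (n + m) * x ^ n)" if "norm x < R" for x
  using sd[OF that] powser_split_head(3)[of d]
  by (cases "x = 0") (auto simp: summable_powser_ignore_initial_segment powser_sums_zero_iff intro: sums_summable)
 have "((\<lambda>x. \<Sum>n. d (n + m) * x ^ n) \<longlongrightarrow> d (0 + m)) (at 0)"
  by (rule powser_limit_0[OF R]) (use shift in \<open>auto simp: summable_sums\<close>)
 hence lim: "((\<lambda>x. \<Sum>n. d (n + m) * x ^ n) \<longlongrightarrow> d m) (at_right 0)"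
  by (simp add: filterlim_at_split)
 have "(\<Sum>n. d (n + m) * x ^ n) = 0" if x: "0 < x" "x < R" for x
 proof -
  have xR: "norm x < R" using x by simp
  have sp: "summable (\<lambda>n. p n * x ^ n)" "summable (\<lambda>n. q n * x ^ n)"
   using s x by (auto intro: powser_inside)
  have "(\<Sum>n. d n * x ^ n) = (\<Sum>n. p n * x ^ n) - (\<Sum>n. q n * x ^ n)"
   unfolding d_def left_diff_distrib by (rule suminf_diff[symmetric]) (use sp in auto)
  hence "0 = (\<Sum>n. d n * x ^ n)" using eq x by simp
  also have "... = (\<Sum>n. d (n + m) * x ^ (n + m)) + (\<Sum>n<m. d n * x ^ n)"
   by (rule suminf_split_initial_segment[OF sd[OF xR]])
  also have "(\<Sum>n<m. d n * x ^ n) = 0" using less by (intro sum.neutral) auto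
  also have "(\<Sum>n. d (n + m) * x ^ (n + m)) = (\<Sum>n. x ^ m * (d (n + m) * x ^ n))"
   by (simp add: power_add mult_ac)
  also have "... = x ^ m * (\<Sum>n. d (n + m) * x ^ n)" by (rule suminf_mult[OF shift[OF xR]])
  finally show ?thesis using x by simp
 qed
 hence "eventually (\<lambda>x. (\<Sum>n. d (n + m) * x ^ n) = 0) (at_right 0)"
  using eventually_at_right_real[OF R] by (auto elim: eventually_mono)
 hence "((\<lambda>x. \<Sum>n. d (n + m) * x ^ n) \<longlongrightarrow> 0) (at_right 0)" by (rule tendsto_eventually)
 from tendsto_unique[OF _ lim this] m show False by (simp add: trivial_limit_at_right_real)
qed

lemma suminf_indicator: "(\<Sum>n. indicator {n} k * f n) = (f k :: ennreal)"
proof -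
 have "(\<Sum>n. indicator {n} k * f n) = (\<Sum>n\<in>{k}. indicator {n} k * f n)" by (rule suminf_finite) auto
 thus ?thesis by simp
qed

lemma val_by_size:
 assumes "good q p"
 shows "val q p (\<lambda>x. g (sz x)) = (\<Sum>n. val q p (\<lambda>x. indicator {n} (sz x)) * g n)"
proof -
 have "val q p (\<lambda>x. g (sz x)) = val q p (\<lambda>x. \<Sum>n. indicator {n} (sz x) * g n)"
  by (simp add: suminf_indicator)
 also have "... = (\<Sum>n. val q p (\<lambda>x. indicator {n} (sz x)) * g n)"
  by (simp add: val_suminf[OF assms] val_multc[OF assms])
 finally show ?thesis .
qed

text \<open>Determines a law from its generating function on some interval to the right of 0.
  Generating functions multiply along loops, which makes them easier to reach than the law
  itself.\<close>

lemma val_law_from_pgf: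
 assumes g: "good q p" and R: "0 < R" "R \<le> 1" and p0: "\<And>n. 0 \<le> P n" "summable (\<lambda>n. P n * R ^ n)"
  and eq: "\<And>r. 0 < r \<Longrightarrow> r < R \<Longrightarrow> val q p (\<lambda>x. ennreal (r ^ sz x)) = ennreal (\<Sum>n. P n * r ^ n)"
 shows "val q p (\<lambda>x. indicator {n} (sz x)) = ennreal (P n)"
proof -
 define Q where "Q n = enn2real (val q p (\<lambda>x. indicator {n} (sz x)))" for n
 have le1: "val q p (\<lambda>x. indicator {n} (sz x)) \<le> 1" for n
  by (rule val_le_const) (simp add: indicator_def)
 hence Q: "val q p (\<lambda>x. indicator {n} (sz x)) = ennreal (Q n)" for n
  unfolding Q_def by (metis ennreal_enn2real ennreal_one_less_top order_le_less_trans)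
 have Q0: "0 \<le> Q n" for n by (simp add: Q_def)
 have pgf: "val q p (\<lambda>x. ennreal (r ^ sz x)) = (\<Sum>n. ennreal (Q n * r ^ n))" if "0 \<le> r" for r
  using val_by_size[OF g, of "\<lambda>n. ennreal (r ^ n)" sz] Q0 that by (simp add: Q ennreal_mult)
 have sQ: "summable (\<lambda>n. Q n * r ^ n)" if "0 \<le> r" "r \<le> R" for r
 proof -
  have "(\<Sum>n. ennreal (Q n * r ^ n)) \<le> 1"
   unfolding pgf[OF that(1), symmetric] using that R by (intro val_le_const) (simp add: power_le_one)
  hence "(\<Sum>n. ennreal (Q n * r ^ n)) \<noteq> top" by (metis ennreal_one_neq_top top_unique)
  thus ?thesis using Q0 that by (intro summable_suminf_not_top) auto
 qed
 have sP: "summable (\<lambda>n. P n * r ^ n)" if "0 \<le> r" "r < R" for r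
  by (rule powser_inside[OF p0(2)]) (use that in auto)
 have "Q n = P n"
 proof (rule powser_unique_pos[OF R(1)])
  fix r assume r: "0 < r" "r < R"
  have "ennreal (\<Sum>n. Q n * r ^ n) = (\<Sum>n. ennreal (Q n * r ^ n))"
   using sQ r Q0 by (subst suminf_ennreal2) auto
  also have "... = ennreal (\<Sum>n. P n * r ^ n)" using eq[OF r] pgf[of r] r by simp
  finally show "(\<Sum>n. Q n * r ^ n) = (\<Sum>n. P n * r ^ n)"
   using sQ sP r Q0 p0 by (subst (asm) ennreal_inj) (auto intro!: suminf_nonneg)
 qed (use sQ p0 R in auto)
 thus ?thesis by (simp add: Q)
qed

lemma poisson1_draw: "poisson1 = draw (\<lambda>z. Some (fst (snd z), 1))"
 by (simp add: poisson1_def draw_def)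

lemma geometric_draw: "geometric = draw (\<lambda>z. Some (snd (snd z), 1))"
 by (simp add: geometric_def draw_def)

lemma measurable_cell_nat:
 "(\<lambda>z. Some (fst (snd z), k)) \<in> cell_measure q \<rightarrow>\<^sub>M count_space UNIV"
 "(\<lambda>z. Some (snd (snd z), k)) \<in> cell_measure q \<rightarrow>\<^sub>M count_space UNIV"
 by (rule measurable_compose[OF cell_components(2)], simp, rule measurable_compose[OF cell_components(3)], simp)

lemma good_poisson1: "good q poisson1" and good_geometric: "good q geometric"
 unfolding poisson1_draw geometric_draw by (intro good_draw measurable_cell_nat)+

lemma wp_poisson1: "wp q poisson1 f = (\<integral>\<^sup>+ n. f n 1 \<partial>poisson_pmf 1)"
 unfolding poisson1_draw wp_draw[OF measurable_cell_nat(1)]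
 using nn_integral_cell(2)[where f = "\<lambda>_. 0" and g = "\<lambda>n. f n 1"] by simp

lemma wp_geometric: "wp q geometric f = (\<integral>\<^sup>+ n. f n 1 \<partial>geometric_pmf (1 - q))"
 unfolding geometric_draw wp_draw[OF measurable_cell_nat(2)]
 using nn_integral_cell(3)[where f = "\<lambda>_. 0" and g = "\<lambda>n. f n 1"] by simp

lemma cst_poisson1: "cst q poisson1 = 1" and cst_geometric: "cst q geometric = 1"
 unfolding cst_def wp_poisson1 wp_geometric by (simp_all add: measure_pmf.emeasure_space_1[simplified])

lemma val_poisson1: "val q poisson1 f = (\<integral>\<^sup>+ n. f n \<partial>poisson_pmf 1)"
 and val_geometric: "val q geometric f = (\<integral>\<^sup>+ n. f n \<partial>geometric_pmf (1 - q))"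
 unfolding val_def wp_poisson1 wp_geometric by simp_all

lemma nn_integral_pmf_nat: "(\<integral>\<^sup>+ n. f n \<partial>measure_pmf D) = (\<Sum>n. ennreal (pmf D n) * f n)" for f :: "nat \<Rightarrow> ennreal"
 by (simp add: nn_integral_measure_pmf nn_integral_count_space_nat)

lemma poisson_pgf:
 assumes a: "0 < a" and "0 \<le> r"
 shows "(\<integral>\<^sup>+ n. ennreal (r ^ n) \<partial>poisson_pmf a) = ennreal (exp (a * (r - 1)))"
proof -
 have "(\<lambda>n. exp (- a) * ((a * r) ^ n /\<^sub>R fact n)) sums (exp (- a) * exp (a * r))"
  by (intro sums_mult exp_converges)
 moreover have "exp (- a) * ((a * r) ^ n /\<^sub>R fact n) = pmf (poisson_pmf a) n * r ^ n" for n
  using a by (simp add: power_mult_distrib field_simps)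
 ultimately have "(\<lambda>n. pmf (poisson_pmf a) n * r ^ n) sums (exp (- a) * exp (a * r))" by (simp only:)
 also have "exp (- a) * exp (a * r) = exp (a * (r - 1))" by (simp add: exp_add[symmetric] algebra_simps)
 finally have "(\<lambda>n. pmf (poisson_pmf a) n * r ^ n) sums exp (a * (r - 1))" .
 thus ?thesis unfolding nn_integral_pmf_nat using assms
  by (subst ennreal_mult[symmetric]) (auto intro!: suminf_ennreal_eq)
qed

text \<open>Used with \<open>h n = r ^ n\<close>, where independent increments multiply generating
  functions, and with indicators that a maximum stays below a bound.\<close>

lemma val_for_loop_mult:
 assumes g: "\<And>i s. good q (f i s)"
  and step: "\<And>i s. val q (f i s) h = h s * a"
 shows "val q (for_loop k i f s) h = h s * a ^ k"
proof (induction k arbitrary: i s)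
 case 0 show ?case by (simp add: val_for_loop_0 del: for_loop.simps)
next
 case (Suc k)
 have "val q (for_loop (Suc k) i f s) h = val q (f i s) (\<lambda>s'. h s' * a ^ k)"
  unfolding val_for_loop_Suc[OF g] Suc ..
 thus ?case by (simp add: val_multc[OF g] step mult_ac del: for_loop.simps)
qed

lemma val_for_loop_add:
 assumes g: "\<And>i s. good q (f i s)"
  and step: "\<And>i s. val q (f i s) h \<le> h s + a"
 shows "val q (for_loop k i f s) h \<le> h s + of_nat k * a"
proof (induction k arbitrary: i s)
 case 0 show ?case by (simp add: val_for_loop_0 del: for_loop.simps)
next
 case (Suc k)
 have "val q (for_loop (Suc k) i f s) h \<le> val q (f i s) (\<lambda>s'. h s' + of_nat k * a)"
  unfolding val_for_loop_Suc[OF g] by (rule val_mono) (rule Suc)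
 also have "... \<le> val q (f i s) h + of_nat k * a"
  unfolding val_add[OF g] by (rule add_left_mono, rule val_le_const) simp
 also have "... \<le> h s + of_nat (Suc k) * a" using add_right_mono[OF step, of i s "of_nat k * a"] by (simp add: distrib_right add_ac)
 finally show ?case .
qed

lemma good_poisson1_sum: "good q (poisson1_sum m)"
 unfolding poisson1_sum_def by (intro good_for_loop good_pbind good_poisson1 good_tick good_ret)

lemma val_poisson1_sum:
 assumes "0 \<le> r"
 shows "val q (poisson1_sum m) (\<lambda>n. ennreal (r ^ n)) = ennreal (exp (real m * (r - 1)))"
proof -
 have "val q (poisson1_sum m) (\<lambda>n. ennreal (r ^ n)) = ennreal (r ^ 0) * ennreal (exp (r - 1)) ^ m"
  unfolding poisson1_sum_def
 proof (rule val_for_loop_mult)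
  fix s :: nat
  have "val q (do { z \<leftarrow> poisson1; tick 1; ret (s + z) }) (\<lambda>n. ennreal (r ^ n)) =
   (\<integral>\<^sup>+ z. ennreal (r ^ (s + z)) \<partial>poisson_pmf 1)"
   by (simp add: val_pbind good_poisson1 good_tick good_ret good_pbind val_tick val_ret val_poisson1)
  also have "... = ennreal (r ^ s) * ennreal (exp (r - 1))"
   using poisson_pgf[of 1 r] assms by (simp add: power_add ennreal_mult nn_integral_cmult)
  finally show "val q (do { z \<leftarrow> poisson1; tick 1; ret (s + z) }) (\<lambda>n. ennreal (r ^ n)) = ennreal (r ^ s) * ennreal (exp (r - 1))" .
 qed (intro good_pbind good_poisson1 good_tick good_ret)
 thus ?thesis by (simp add: ennreal_power exp_of_nat_mult)
qed

lemma of_nat_le_power2: "(of_nat n :: ennreal) \<le> ennreal (2 ^ n)"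
 unfolding ennreal_of_nat_eq_real_of_nat by (intro ennreal_leI) (simp add: of_nat_less_two_power less_imp_le)

text \<open>\<open>n <= 2 ^ n\<close> reduces the mean to the generating function at 2; any finite
  constant will do.\<close>

lemma val_poisson1_sum_mean: "val q (poisson1_sum m) of_nat \<le> ennreal (exp (real m))"
proof -
 have "val q (poisson1_sum m) of_nat \<le> val q (poisson1_sum m) (\<lambda>n. ennreal (2 ^ n))"
  by (intro val_mono of_nat_le_power2)
 thus ?thesis by (simp add: val_poisson1_sum)
qed

lemma cst_poisson1_sum: "cst q (poisson1_sum m) \<le> of_nat (1 + 4 * m)"
proof -
 have "cst q (do { z \<leftarrow> poisson1; tick 1; ret (s + z) }) \<le> 1 + (1 + 0)" for s
  by (intro cst_pbind_le good_pbind good_poisson1 good_tick good_ret) (simp_all add: cst_poisson1 cst_tick cst_ret)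
 hence "cst q (poisson1_sum m) \<le> 1 + of_nat m * (2 + (1 + (1 + 0)))"
  unfolding poisson1_sum_def by (intro cst_for_loop_const good_pbind good_poisson1 good_tick good_ret)
 thus ?thesis by (simp add: mult.commute)
qed

definition poisson_step :: "nat \<Rightarrow> approx \<Rightarrow> nat \<Rightarrow> nat prog" where
 "poisson_step M0 x s = do { b \<leftarrow> bernoulli (scaled (real M0) x); tick 1; ret (if b then s + 1 else s) }"

lemma poisson_alt: "poisson M0 x = do { N' \<leftarrow> poisson1_sum M0; for_loop N' 1 (\<lambda>_. poisson_step M0 x) 0 }"
 unfolding poisson_def poisson_step_def ..

lemma good_poisson_step: "approx_det x \<Longrightarrow> good q (poisson_step M0 x s)"
 unfolding poisson_step_def by (intro good_pbind good_bernoulli good_tick good_ret approx_det_scaled)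

lemma good_poisson: "approx_det x \<Longrightarrow> good q (poisson M0 x)"
 unfolding poisson_alt by (intro good_pbind good_poisson1_sum good_for_loop good_poisson_step)

text \<open>Thinning: keeping each of \<open>N'\<close> points with probability
  \<open>p = x / M0\<close> gives \<open>(1 + p (r - 1)) ^ N'\<close>, and averaging over the
  Poisson variable \<open>N'\<close> of mean \<open>M0\<close> gives
  \<open>exp (x (r - 1))\<close>.\<close>

lemma poisson_pgf_law:
 assumes f: "approx_ok K f x W" and x: "0 < x" "x \<le> real M0" "0 < M0" and r: "0 \<le> r"
 shows "val q (poisson M0 f) (\<lambda>n. ennreal (r ^ n)) = ennreal (exp (x * (r - 1)))"
proof -
 let ?X = "\<lambda>n. ennreal (r ^ n)"
 let ?p = "x / real M0"
 have p: "0 \<le> ?p" "?p \<le> 1" using x by auto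
 have g: "good q (poisson_step M0 f s)" for s by (rule good_poisson_step[OF approx_ok_det[OF f]])
 have gb: "good q (bernoulli (scaled (real M0) f))" by (rule good_bernoulli[OF approx_det_scaled[OF approx_ok_det[OF f]]])
 have a0: "0 \<le> 1 + ?p * (r - 1)"
 proof -
  have "0 \<le> (1 - ?p) + ?p * r" using p r by (intro add_nonneg_nonneg mult_nonneg_nonneg) auto
  moreover have "1 + p * (r - 1) = (1 - p) + p * r" for p by (simp add: algebra_simps)
  ultimately show ?thesis by (simp only:)
 qed
 have step: "val q (poisson_step M0 f s) ?X = ennreal (r ^ s) * ennreal (1 + ?p * (r - 1))" for s
 proof -
  have "val q (poisson_step M0 f s) ?X =
   ennreal (r ^ (s + 1)) * ennreal ?p + ennreal (r ^ s) * ennreal (1 - ?p)"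
   unfolding poisson_step_def using x p
   by (simp add: val_pbind gb good_tick good_ret good_pbind val_tick val_ret
      val_bernoulli[OF approx_ok_scaled[OF f]])
  also have "... = ennreal (r ^ (s + 1) * ?p + r ^ s * (1 - ?p))"
  proof -
   have "ennreal (r ^ (s + 1)) * ennreal p + ennreal (r ^ s) * ennreal (1 - p) = ennreal (r ^ (s + 1) * p + r ^ s * (1 - p))"
    if "0 \<le> p" "p \<le> 1" for p using that r by (simp add: ennreal_mult)
   thus ?thesis using p by blast
  qed
  also have "r ^ (s + 1) * ?p + r ^ s * (1 - ?p) = r ^ s * (1 + ?p * (r - 1))"
  proof -
   have "r ^ (s + 1) * p + r ^ s * (1 - p) = r ^ s * (1 + p * (r - 1))" for p by (simp add: algebra_simps)
   thus ?thesis .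
  qed
  finally show ?thesis using r a0 by (simp add: ennreal_mult)
 qed
 have loop: "val q (for_loop N' 1 (\<lambda>_. poisson_step M0 f) 0) ?X = ennreal ((1 + ?p * (r - 1)) ^ N')" for N'
  using val_for_loop_mult[of q "\<lambda>_. poisson_step M0 f" "\<lambda>n. ennreal (r ^ n)" "ennreal (1 + ?p * (r - 1))" N' 1 0, OF g step] a0
  by (simp add: ennreal_power)
 have "val q (poisson M0 f) ?X = val q (poisson1_sum M0) (\<lambda>N'. ennreal ((1 + ?p * (r - 1)) ^ N'))"
  unfolding poisson_alt loop[symmetric] by (intro val_pbind good_poisson1_sum good_for_loop g)
 also have "... = ennreal (exp (x * (r - 1)))"
  unfolding val_poisson1_sum[OF a0] using x by simp
 finally show ?thesis .
qed

lemma val_poisson: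
 assumes f: "approx_ok K f x W" and x: "0 < x" "x \<le> real M0" "0 < M0"
 shows "val q (poisson M0 f) h = (\<integral>\<^sup>+ n. h n \<partial>poisson_pmf x)"
proof -
 have g: "good q (poisson M0 f)" by (rule good_poisson[OF approx_ok_det[OF f]])
 have s: "summable (\<lambda>n. pmf (poisson_pmf x) n * r ^ n) \<and> ennreal (\<Sum>n. pmf (poisson_pmf x) n * r ^ n) = ennreal (exp (x * (r - 1)))"
  if r: "0 \<le> r" for r
 proof -
  have eq: "(\<Sum>n. ennreal (pmf (poisson_pmf x) n * r ^ n)) = ennreal (exp (x * (r - 1)))"
   using poisson_pgf[OF x(1) r] r unfolding nn_integral_pmf_nat by (simp add: ennreal_mult)
  hence "(\<Sum>n. ennreal (pmf (poisson_pmf x) n * r ^ n)) \<noteq> top" by simp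
  hence "summable (\<lambda>n. pmf (poisson_pmf x) n * r ^ n)" using r by (intro summable_suminf_not_top) auto
  thus ?thesis using eq r by (subst (asm) suminf_ennreal2) auto
 qed
 have "val q (poisson M0 f) (\<lambda>n. indicator {k} n) = ennreal (pmf (poisson_pmf x) k)" for k
  using val_law_from_pgf[of q "poisson M0 f" 1 "pmf (poisson_pmf x)" "\<lambda>n. n" k] g s[of 1] s poisson_pgf_law[OF f x]
  by auto
 thus ?thesis using val_by_size[OF g, of h "\<lambda>n. n"] by (simp add: nn_integral_pmf_nat)
qed

lemma poisson_mean:
 assumes x: "0 < x"
 shows "(\<integral>\<^sup>+ n. of_nat n \<partial>poisson_pmf x) = ennreal x"
proof -
 have "(\<lambda>n. x * exp (- x) * (x ^ n /\<^sub>R fact n)) sums (x * exp (- x) * exp x)"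
  by (intro sums_mult exp_converges)
 moreover have "x * exp (- x) * (x ^ n /\<^sub>R fact n) = real (Suc n) * pmf (poisson_pmf x) (Suc n)" for n
  using x by (simp add: field_simps del: of_nat_Suc)
 ultimately have "(\<lambda>n. real (Suc n) * pmf (poisson_pmf x) (Suc n)) sums (x * exp (- x) * exp x)" by (simp only:)
 also have "x * exp (- x) * exp x = x" by (simp add: mult.assoc flip: exp_add)
 finally have "(\<lambda>n. real (Suc n) * pmf (poisson_pmf x) (Suc n)) sums x" .
 hence "(\<lambda>n. real n * pmf (poisson_pmf x) n) sums x" by (subst (asm) sums_Suc_iff) simp
 thus ?thesis unfolding nn_integral_pmf_nat ennreal_of_nat_eq_real_of_nat
  by (subst ennreal_mult[symmetric]) (auto intro!: suminf_ennreal_eq simp: mult.commute)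
qed

lemma cst_poisson_step:
 assumes f: "approx_ok K f x W" and "0 \<le> W" "0 < M0"
 shows "cst q (poisson_step M0 f s) \<le> ennreal (bern_const (K + 2) * (1 + W) + 1)"
proof -
 have "cst q (poisson_step M0 f s) \<le> ennreal (bern_const (K + 2) * (1 + W / real M0)) + (1 + 0)"
  unfolding poisson_step_def
  using assms by (intro cst_pbind_le good_pbind good_bernoulli good_tick good_ret approx_det_scaled approx_ok_det[OF f]
     cst_bernoulli[OF approx_ok_scaled[OF f]]) (auto simp: cst_tick cst_ret)
 also have "... \<le> ennreal (bern_const (K + 2) * (1 + W)) + 1"
 proof -
  have "W / real M0 \<le> W / 1" using assms by (intro divide_left_mono) auto
  hence "bern_const (K + 2) * (1 + W / real M0) \<le> bern_const (K + 2) * (1 + W)"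
   using bern_const_nonneg by (intro mult_left_mono) auto
  thus ?thesis by (intro add_mono ennreal_leI) auto
 qed
 also have "... = ennreal (bern_const (K + 2) * (1 + W) + 1)"
  using bern_const_nonneg assms by (subst ennreal_plus) auto
 finally show ?thesis .
qed

definition poisson_const :: "nat \<Rightarrow> nat \<Rightarrow> real \<Rightarrow> real" where
 "poisson_const M0 K W = real (1 + 4 * M0) + 1 + exp (real M0) * (3 + bern_const (K + 2) * (1 + W))"

lemma cst_poisson:
 assumes f: "approx_ok K f x W" and W: "0 \<le> W" "0 < M0"
 shows "cst q (poisson M0 f) \<le> ennreal (poisson_const M0 K W)"
proof -
 have g: "good q (poisson_step M0 f s)" for s by (rule good_poisson_step[OF approx_ok_det[OF f]])
 let ?c = "bern_const (K + 2) * (1 + W)"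
 have c: "0 \<le> ?c" using bern_const_nonneg W by simp
 have "cst q (poisson M0 f) \<le> cst q (poisson1_sum M0) + val q (poisson1_sum M0) (\<lambda>N'. cst q (for_loop N' 1 (\<lambda>_. poisson_step M0 f) 0))"
  unfolding poisson_alt by (intro cst_pbind good_poisson1_sum good_for_loop g)
 also have "... \<le> of_nat (1 + 4 * M0) + val q (poisson1_sum M0) (\<lambda>N'. 1 + of_nat N' * (2 + ennreal (?c + 1)))"
  by (intro add_mono cst_poisson1_sum val_mono cst_for_loop_const g cst_poisson_step[OF f W])
 also have "val q (poisson1_sum M0) (\<lambda>N'. 1 + of_nat N' * (2 + ennreal (?c + 1))) \<le> 1 + ennreal (exp (real M0)) * (2 + ennreal (?c + 1))"
  unfolding val_add[OF good_poisson1_sum] val_multc[OF good_poisson1_sum]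
  by (intro add_mono mult_right_mono val_le_const val_poisson1_sum_mean) auto
 also have "of_nat (1 + 4 * M0) + (1 + ennreal (exp (real M0)) * (2 + ennreal (?c + 1))) = ennreal (poisson_const M0 K W)"
 proof -
  have "2 + ennreal (?c + 1) = ennreal (3 + ?c)" using c by (simp add: ennreal_plus[symmetric] del: ennreal_plus flip: ennreal_numeral)
  thus ?thesis using c unfolding poisson_const_def ennreal_of_nat_eq_real_of_nat
   by (simp add: ennreal_mult'[symmetric] ennreal_plus[symmetric] del: ennreal_plus flip: ennreal_1)
 qed
 finally show ?thesis by (simp add: add_left_mono)
qed

abbreviation retry :: "'a + 'b \<Rightarrow> ennreal" where "retry \<equiv> \<lambda>r. case r of Inl _ \<Rightarrow> 1 | Inr _ \<Rightarrow> 0"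
abbreviation success :: "'a + 'b \<Rightarrow> ennreal" where "success \<equiv> \<lambda>r. case r of Inl _ \<Rightarrow> 0 | Inr _ \<Rightarrow> 1"

text \<open>One unfolding yields \<open>V = a V + b\<close>. The equation determines
  \<open>V\<close> only once \<open>V\<close> is known to be finite, which is the purpose of the
  bound \<open>C\<close>.\<close>

lemma val_reject_loop:
 assumes g: "good q body" and f: "\<And>x. f x \<le> ennreal C"
  and A: "val q body retry = ennreal a" "0 \<le> a" "a < 1"
  and b: "val q body (\<lambda>r. case r of Inl _ \<Rightarrow> 0 | Inr x \<Rightarrow> f x) = ennreal b" "0 \<le> b"
 shows "val q (loop (\<lambda>_. body) ()) f = ennreal (b / (1 - a))"
proof -
 let ?V = "val q (loop (\<lambda>_. body) ()) f"
 have "?V \<le> ennreal C" by (rule val_le_const) (rule f)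
 then obtain v where v: "?V = ennreal v" "0 \<le> v"
  by (metis ennreal_cases ennreal_neq_top top_unique)
 have "?V = val q body (\<lambda>r. case r of Inl _ \<Rightarrow> ?V | Inr x \<Rightarrow> f x)"
  by (subst val_loop[OF g]) simp
 also have "... = val q body (\<lambda>r. (case r of Inl _ \<Rightarrow> 1 | Inr _ \<Rightarrow> 0) * ?V + (case r of Inl _ \<Rightarrow> 0 | Inr x \<Rightarrow> f x))"
  by (rule arg_cong[of _ _ "val q body"]) (auto split: sum.split)
 also have "... = ennreal a * ?V + ennreal b"
  unfolding val_add[OF g] val_multc[OF g] A b ..
 finally have "ennreal v = ennreal (a * v + b)"
  unfolding v using A b v by (simp add: ennreal_mult)
 hence "v = a * v + b" using A b v by (subst (asm) ennreal_inj) auto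
 hence "v * (1 - a) = b" by (simp add: algebra_simps)
 hence "v = b / (1 - a)" using A by (simp add: field_simps)
 thus ?thesis using v by simp
qed

text \<open>The constant potential \<open>G = (c + 1) / (1 - a)\<close> satisfies
  \<open>c + a (1 + G) <= G\<close>.\<close>

lemma cst_reject_loop:
 assumes g: "good q body" and A: "val q body retry \<le> ennreal a" "0 \<le> a" "a < 1"
  and c: "cst q body \<le> ennreal c" "0 \<le> c"
 shows "cst q (loop (\<lambda>_. body) ()) \<le> ennreal ((c + 1) / (1 - a))"
proof (rule cst_loop[OF g])
 let ?G = "(c + 1) / (1 - a)"
 have G: "0 \<le> ?G" using A c by simp
 have "val q body (\<lambda>r. case r of Inl s' \<Rightarrow> 1 + ennreal ?G | Inr x \<Rightarrow> 0) =
  val q body (\<lambda>r. (case r of Inl _ \<Rightarrow> 1 | Inr _ \<Rightarrow> 0) * (1 + ennreal ?G))"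
  by (rule arg_cong[of _ _ "val q body"]) (auto split: sum.split)
 also have "... \<le> ennreal a * (1 + ennreal ?G)" unfolding val_multc[OF g] by (intro mult_right_mono A) auto
 also have "... = ennreal (a * (1 + ?G))" using G A by (simp add: ennreal_mult del: ennreal_plus flip: ennreal_plus ennreal_1)
 finally have "cst q body + val q body (\<lambda>r. case r of Inl s' \<Rightarrow> 1 + ennreal ?G | Inr x \<Rightarrow> 0) \<le> ennreal c + ennreal (a * (1 + ?G))"
  by (intro add_mono c)
 also have "... = ennreal (c + a * (1 + ?G))" using G A c by simp
 also have "... \<le> ennreal ?G"
 proof (rule ennreal_leI)
  have "?G * (1 - a) = c + 1" using A by simp
  moreover have "c + a * (1 + g) \<le> g" if "g * (1 - a) = c + 1" for g using that A by (simp add: algebra_simps)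
  ultimately show "c + a * (1 + ?G) \<le> ?G" by blast
 qed
 finally show "cst q body + val q body (\<lambda>r. case r of Inl s' \<Rightarrow> 1 + ennreal ?G | Inr x \<Rightarrow> 0) \<le> ennreal ?G" .
qed

definition poisson_pos_step :: "nat \<Rightarrow> approx \<Rightarrow> (unit + nat) prog" where
 "poisson_pos_step M0 x = do {
   y \<leftarrow> poisson M0 x;
   tick 1;
   let z = y + 1;
   p \<leftarrow> calc (V 1 \<^bold>/ V (real z));
   acc \<leftarrow> bernoulli (exact p);
   ret (if acc then Inr z else Inl ()) }"

lemma poisson_pos_alt: "poisson_pos M0 x = loop (\<lambda>_. poisson_pos_step M0 x) ()"
 unfolding poisson_pos_def poisson_pos_step_def ..

lemma good_calc: "good q (calc e)"
 unfolding calc_eq by (rule good_detp)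

lemma good_poisson_pos_step: "approx_det x \<Longrightarrow> good q (poisson_pos_step M0 x)"
 unfolding poisson_pos_step_def Let_def
 by (intro good_pbind good_poisson good_tick good_calc good_bernoulli good_ret approx_det_exact)

lemma good_poisson_pos: "approx_det x \<Longrightarrow> good q (poisson_pos M0 x)"
 unfolding poisson_pos_alt by (intro good_loop good_poisson_pos_step)

context
 fixes f K x W M0
 assumes f: "approx_ok K f x W" and x: "0 < x" "x \<le> real M0" and M0: "0 < M0"
begin

lemma val_poisson_pos_step:
 "val q (poisson_pos_step M0 f) h = (\<Sum>y. ennreal (pmf (poisson_pmf x) y) *
   (h (Inr (y + 1)) * ennreal (1 / real (y + 1)) + h (Inl ()) * ennreal (1 - 1 / real (y + 1))))"
proof -
 note d = approx_ok_det[OF f]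
 have *: "val q (bernoulli (exact p)) h' = h' True * ennreal p + h' False * ennreal (1 - p)" if "0 \<le> p" "p \<le> 1" for p h'
  using val_bernoulli[OF approx_ok_exact that] .
 show ?thesis
  unfolding poisson_pos_step_def Let_def calc_eq
  by (simp add: val_pbind good_poisson[OF d] good_pbind good_tick good_detp good_bernoulli approx_det_exact good_ret
    val_tick val_detp val_ret * val_poisson[OF f x M0] nn_integral_pmf_nat del: of_nat_Suc)
qed

text \<open>Accepting \<open>y + 1\<close> with probability \<open>1 / (y + 1)\<close> turns
  \<open>x^y / y!\<close> into \<open>x^(y+1) / (y+1)!\<close> up to a constant; the acceptance
  probability adds up to \<open>(1 - exp (- x)) / x\<close>.\<close>

lemma poisson_pos_weights:
 "(\<lambda>z. if z = 0 then 0 else x ^ z / (fact z * (exp x - 1))) sums 1"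
 "(\<lambda>y. pmf (poisson_pmf x) y / real (y + 1)) sums ((1 - exp (- x)) / x)"
proof -
 have "(\<lambda>n. x ^ n /\<^sub>R fact n) sums exp x" by (rule exp_converges)
 hence "(\<lambda>n. x ^ Suc n /\<^sub>R fact (Suc n)) sums (exp x - 1)" by (subst sums_Suc_iff) simp
 hence 1: "(\<lambda>n. x ^ Suc n / fact (Suc n)) sums (exp x - 1)" by (simp add: field_simps del: fact_Suc)
 have ex: "0 < exp x - 1" using x by simp
 from sums_divide[OF 1, of "exp x - 1"] ex
 have "(\<lambda>n. x ^ Suc n / (fact (Suc n) * (exp x - 1))) sums 1" by (simp del: fact_Suc)
 note S = this
 define \<phi> where "\<phi> z = (if z = 0 then 0 else x ^ z / (fact z * (exp x - 1)))" for z
 have "(\<lambda>n. \<phi> (Suc n)) sums 1" using S by (simp only: \<phi>_def nat.distinct if_False)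
 hence "\<phi> sums (1 + \<phi> 0)" by (simp only: sums_Suc_iff)
 thus "(\<lambda>z. if z = 0 then 0 else x ^ z / (fact z * (exp x - 1))) sums 1"
  by (simp add: \<phi>_def[abs_def])
 have "(\<lambda>n. (exp (- x) / x) * (x ^ Suc n / fact (Suc n))) sums ((exp (- x) / x) * (exp x - 1))"
  by (rule sums_mult[OF 1])
 moreover have "(exp (- x) / x) * (x ^ Suc n / fact (Suc n)) = pmf (poisson_pmf x) n / real (n + 1)" for n
  using x by (simp add: field_simps)
 ultimately have "(\<lambda>y. pmf (poisson_pmf x) y / real (y + 1)) sums ((exp (- x) / x) * (exp x - 1))" by (simp only:)
 also have "(exp (- x) / x) * (exp x - 1) = (1 - exp (- x)) / x" by (simp add: right_diff_distrib diff_divide_distrib flip: exp_add)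
 finally show "(\<lambda>y. pmf (poisson_pmf x) y / real (y + 1)) sums ((1 - exp (- x)) / x)" .
qed

lemma poisson_pos_reject:
 "val q (poisson_pos_step M0 f) retry = ennreal (1 - (1 - exp (- x)) / x)"
 "0 \<le> 1 - (1 - exp (- x)) / x" "1 - (1 - exp (- x)) / x \<le> 1 - exp (- x)"
proof -
 have "(\<lambda>n. x ^ n /\<^sub>R fact n) sums exp x" by (rule exp_converges)
 from sums_mult[OF this, of "exp (- x)"] have "(\<lambda>y. pmf (poisson_pmf x) y) sums 1"
  using x by (simp add: field_simps exp_minus)
 from sums_diff[OF this poisson_pos_weights(2)]
 have s: "(\<lambda>y. pmf (poisson_pmf x) y * (1 - 1 / real (y + 1))) sums (1 - (1 - exp (- x)) / x)"
  by (simp add: right_diff_distrib)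
 have nn: "0 \<le> pmf (poisson_pmf x) y * (1 - 1 / real (y + 1))" for y by (intro mult_nonneg_nonneg) auto
 show "0 \<le> 1 - (1 - exp (- x)) / x" by (rule sums_le[OF _ sums_zero s]) (rule nn)
 show "val q (poisson_pos_step M0 f) retry = ennreal (1 - (1 - exp (- x)) / x)"
  unfolding val_poisson_pos_step sum.case mult_zero_left add_0_left mult_1_left
  by (subst ennreal_mult'[symmetric], simp, rule suminf_ennreal_eq[OF nn s])
 have "x \<le> exp x - 1" using exp_ge_add_one_self[of x] by linarith
 hence "x * exp (- x) \<le> (exp x - 1) * exp (- x)" by (intro mult_right_mono) auto
 hence "x * exp (- x) \<le> 1 - exp (- x)" by (simp add: algebra_simps flip: exp_add)
 thus "1 - (1 - exp (- x)) / x \<le> 1 - exp (- x)" using x by (simp add: field_simps)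
qed

lemma val_poisson_pos:
 "val q (poisson_pos M0 f) h = (\<Sum>z. ennreal (if z = 0 then 0 else x ^ z / (fact z * (exp x - 1))) * h z)"
proof -
 note g = good_poisson_pos[OF approx_ok_det[OF f]] and gs = good_poisson_pos_step[OF approx_ok_det[OF f]]
 let ?a = "(1 - exp (- x)) / x"
 have a: "0 < ?a" using x by simp
 have "val q (poisson_pos M0 f) (\<lambda>n. indicator {z} n) = ennreal (if z = 0 then 0 else x ^ z / (fact z * (exp x - 1)))" for z
 proof -
  let ?b = "if z = 0 then 0 else pmf (poisson_pmf x) (z - 1) / real z"
  have "val q (poisson_pos_step M0 f) (\<lambda>r. case r of Inl _ \<Rightarrow> 0 | Inr x \<Rightarrow> indicator {z} x) =
   (\<Sum>y. ennreal (pmf (poisson_pmf x) y) * (indicator {z} (y + 1) * ennreal (1 / real (y + 1))))"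
   unfolding val_poisson_pos_step by simp
  also have "... = (\<Sum>y\<in>(if z = 0 then {} else {z - 1}). ennreal (pmf (poisson_pmf x) y) * (indicator {z} (y + 1) * ennreal (1 / real (y + 1))))"
   by (rule suminf_finite) (auto split: if_splits)
  also have "... = ennreal ?b" by (cases z) (auto simp: ennreal_mult'[symmetric])
  finally have b: "val q (poisson_pos_step M0 f) (\<lambda>r. case r of Inl _ \<Rightarrow> 0 | Inr x \<Rightarrow> indicator {z} x) = ennreal ?b" .
  have "val q (poisson_pos M0 f) (\<lambda>n. indicator {z} n) = ennreal (?b / (1 - (1 - ?a)))"
   unfolding poisson_pos_alt
   by (rule val_reject_loop[OF gs _ poisson_pos_reject(1,2) _ b, where C = 1])
     (use a in \<open>auto simp: indicator_def\<close>)
  also have "?b / (1 - (1 - ?a)) = (if z = 0 then 0 else x ^ z / (fact z * (exp x - 1)))"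
  proof (cases z)
   case (Suc y)
   have 1: "exp x - 1 = (1 - exp (- x)) / exp (- x)" by (simp add: exp_minus field_simps)
   have 2: "1 - exp (- x) \<noteq> 0" "exp (- x) \<noteq> 0" using x by simp_all
   have "x ^ y / fact y * e / real (Suc y) / (1 - (1 - D / x)) = x ^ Suc y / (fact (Suc y) * (D / e))"
    if "D \<noteq> 0" "e \<noteq> 0" for D e
    using that x by (simp add: field_simps)
   from this[OF 2] show ?thesis using x Suc unfolding 1 by simp
  qed simp
  finally show ?thesis .
 qed
 thus ?thesis using val_by_size[OF g, where g = h and sz = "\<lambda>n. n"] by simp
qed

lemma poisson_pos_pgf:
 assumes r: "0 \<le> r"
 shows "val q (poisson_pos M0 f) (\<lambda>n. ennreal (r ^ n)) = ennreal ((exp (x * r) - 1) / (exp x - 1))"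
proof -
 have ex: "0 < exp x - 1" using x by simp
 have "(\<lambda>n. (x * r) ^ n /\<^sub>R fact n) sums exp (x * r)" by (rule exp_converges)
 hence "(\<lambda>n. (x * r) ^ Suc n /\<^sub>R fact (Suc n)) sums (exp (x * r) - 1)" by (subst sums_Suc_iff) simp
 from sums_divide[OF this, of "exp x - 1"]
 have "(\<lambda>n. x ^ Suc n / (fact (Suc n) * (exp x - 1)) * r ^ Suc n) sums ((exp (x * r) - 1) / (exp x - 1))"
  by (simp add: power_mult_distrib field_simps del: fact_Suc)
 note S = this
 define \<phi> where "\<phi> z = (if z = 0 then 0 else x ^ z / (fact z * (exp x - 1))) * r ^ z" for z
 have "(\<lambda>n. \<phi> (Suc n)) sums ((exp (x * r) - 1) / (exp x - 1))"
  using S by (simp only: \<phi>_def nat.distinct if_False)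
 hence "\<phi> sums ((exp (x * r) - 1) / (exp x - 1) + \<phi> 0)" by (simp only: sums_Suc_iff)
 hence \<phi>: "\<phi> sums ((exp (x * r) - 1) / (exp x - 1))" by (simp add: \<phi>_def)
 have "ennreal (if z = 0 then 0 else x ^ z / (fact z * (exp x - 1))) * ennreal (r ^ z) = ennreal (\<phi> z)" for z
  unfolding \<phi>_def using ex x r by (subst ennreal_mult) auto
 moreover have "0 \<le> \<phi> z" for z unfolding \<phi>_def using ex x r by simp
 ultimately show ?thesis unfolding val_poisson_pos using \<phi> by (simp only: suminf_ennreal_eq)
qed

lemma poisson_pos_mean: "val q (poisson_pos M0 f) of_nat = ennreal (x / (1 - exp (- x)))"
proof -
 have ex: "0 < exp x - 1" using x by simp
 have "(\<lambda>n. x ^ n /\<^sub>R fact n) sums exp x" by (rule exp_converges)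
 from sums_mult[OF this, of "x / (exp x - 1)"]
 have "(\<lambda>n. x / (exp x - 1) * (x ^ n /\<^sub>R fact n)) sums (x / (exp x - 1) * exp x)" .
 moreover have "x / (exp x - 1) * (x ^ n /\<^sub>R fact n) = x ^ Suc n / (fact (Suc n) * (exp x - 1)) * real (Suc n)" for n
 proof -
  have "x / E * (x ^ n /\<^sub>R fact n) = x ^ Suc n / (fact (Suc n) * E) * real (Suc n)" if "E \<noteq> 0" for E
  proof -
   have "real (Suc n) \<noteq> 0" "fact (Suc n) = real (Suc n) * fact n" by simp_all
   thus ?thesis using that by (simp add: divide_inverse mult_ac del: of_nat_Suc fact_Suc)
  qed
  thus ?thesis using ex by simp
 qed
 ultimately have "(\<lambda>n. x ^ Suc n / (fact (Suc n) * (exp x - 1)) * real (Suc n)) sums (x / (exp x - 1) * exp x)"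
  by (simp only:)
 also have "x / (exp x - 1) * exp x = x / (1 - exp (- x))"
  using ex by (simp add: exp_minus field_simps)
 finally have S: "(\<lambda>n. x ^ Suc n / (fact (Suc n) * (exp x - 1)) * real (Suc n)) sums (x / (1 - exp (- x)))" .
 define \<phi> where "\<phi> z = (if z = 0 then 0 else x ^ z / (fact z * (exp x - 1))) * real z" for z
 have "(\<lambda>n. \<phi> (Suc n)) sums (x / (1 - exp (- x)))"
  using S by (simp only: \<phi>_def nat.distinct if_False)
 hence "\<phi> sums (x / (1 - exp (- x)) + \<phi> 0)" by (simp only: sums_Suc_iff)
 hence \<phi>: "\<phi> sums (x / (1 - exp (- x)))" by (simp add: \<phi>_def)
 have "ennreal (if z = 0 then 0 else x ^ z / (fact z * (exp x - 1))) * ennreal (real z) = ennreal (\<phi> z)" for z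
  unfolding \<phi>_def using ex x by (subst ennreal_mult) auto
 moreover have "0 \<le> \<phi> z" for z unfolding \<phi>_def using ex x by simp
 ultimately show ?thesis unfolding val_poisson_pos ennreal_of_nat_eq_real_of_nat using \<phi> by (simp only: suminf_ennreal_eq)
qed

lemma cst_poisson_pos:
 assumes W: "0 \<le> W" and x1: "x \<le> 1"
 shows "cst q (poisson_pos M0 f) \<le> ennreal ((poisson_const M0 K W + bern_const 0 + 3) * exp 1)"
proof -
 let ?X = "1 - (1 - (1 - exp (- x)) / x)"
 note d = approx_ok_det[OF f]
 let ?c = "poisson_const M0 K W + bern_const 0 + 2"
 have c0: "0 \<le> poisson_const M0 K W" unfolding poisson_const_def using bern_const_nonneg W by simp
 have "cst q (poisson_pos_step M0 f) \<le> ennreal (poisson_const M0 K W) + (1 + (1 + (ennreal (bern_const 0 * (1 + 0)) + 0)))"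
  unfolding poisson_pos_step_def Let_def calc_eq
  using W M0 by (intro cst_pbind_le good_poisson[OF d] good_pbind good_tick good_detp good_bernoulli approx_det_exact good_ret
   cst_poisson[OF f] cst_bernoulli[OF approx_ok_exact]) (auto simp: cst_tick cst_detp cst_ret)
 also have "... = ennreal ?c"
 proof -
  have "ennreal a + (1 + (1 + (ennreal b + 0))) = ennreal (a + b + 2)" if "0 \<le> a" "0 \<le> b" for a b
  proof -
   have "ennreal (a + b + 2) = ennreal a + ennreal b + (1 + 1)" using that by simp
   thus ?thesis unfolding add_0_right by (simp only: add_ac)
  qed
  thus ?thesis using c0 bern_const_nonneg[of 0] by simp
 qed
 finally have c: "cst q (poisson_pos_step M0 f) \<le> ennreal ?c" .
 have "cst q (poisson_pos M0 f) \<le> ennreal ((?c + 1) / ?X)"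
  unfolding poisson_pos_alt
  by (rule cst_reject_loop[OF good_poisson_pos_step[OF d] eq_refl[OF poisson_pos_reject(1)] poisson_pos_reject(2) _ c])
    (use x c0 bern_const_nonneg[of 0] in auto)
 also have "... \<le> ennreal ((poisson_const M0 K W + bern_const 0 + 3) * exp 1)"
 proof (rule ennreal_leI)
  \<comment> \<open>For \<open>x <= 1\<close> acceptance has probability at least
    \<open>exp (- x) >= 1/e\<close>; hence the factor \<open>exp 1\<close>.\<close>
  have "exp (- 1) \<le> exp (- x)" using x1 by simp
  also have "... \<le> (1 - exp (- x)) / x" using poisson_pos_reject(3) by simp
  finally have "exp (- 1) \<le> (1 - exp (- x)) / x" .
  hence "(?c + 1) / ?X \<le> (?c + 1) / exp (- 1)"
   using x c0 bern_const_nonneg[of 0] by (intro divide_left_mono) auto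
  from this show "(?c + 1) / ?X \<le> (poisson_const M0 K W + bern_const 0 + 3) * exp 1"
  proof -
   have "?c + 1 = poisson_const M0 K W + bern_const 0 + 3" by simp
   thus ?thesis using \<open>(?c + 1) / ?X \<le> (?c + 1) / exp (- 1)\<close>
    by (simp only: exp_minus divide_inverse inverse_inverse_eq)
  qed
 qed
 finally show ?thesis .
qed

end

section \<open>Law and cost of the index sampler\<close>

lemma power_prog_runs: "runs (power_prog x k) (\<lambda>y. y = x ^ k) (1 + k * 3)"
 unfolding power_prog_def
proof (rule runs_mono[OF runs_for_loop[of "\<lambda>j y. y = x ^ (j - 1)" _ _ _ _ 1]])
 show "runs (calc (V y \<^bold>* V x)) (\<lambda>y. y = x ^ (Suc j - 1)) 1" if "1 \<le> j" "y = x ^ (j - 1)" for j y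
  unfolding calc_eq using that by (intro runs_detp) (cases j, auto)
qed auto

lemma power_prog_detp: "\<exists>c. power_prog x k = detp (x ^ k) c \<and> c \<le> 1 + k * 3"
 using power_prog_runs[of x k] unfolding runs_def by auto

definition mi_step :: "nat \<Rightarrow> real \<Rightarrow> real \<Rightarrow> nat \<Rightarrow> nat prog" where
 "mi_step B q s best = do {
    g \<leftarrow> geometric;
    tick 1;
    let j = g + 2;
    t \<leftarrow> power_prog s j;
    x \<leftarrow> power_prog q (j - 2);
    c \<leftarrow> calc (V (real B) \<^bold>* V (real j) \<^bold>* (V 1 \<^bold>- V q) \<^bold>* V x);
    acc \<leftarrow> bernoulli (scaled c (approx_A t));
    tick 1;
    ret (if acc then max best j else best) }"

lemma max_index_alt: "max_index B q s = do { N' \<leftarrow> poisson1_sum B; for_loop N' 1 (\<lambda>_. mi_step B q s) 0 }"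
 unfolding max_index_def mi_step_def ..

lemma good_power_prog: "good q' (power_prog x k)"
 by (rule runs_good[OF power_prog_runs])

lemma good_mi_step: "good q' (mi_step B q s b)"
 unfolding mi_step_def Let_def
 by (intro good_pbind good_geometric good_tick good_power_prog good_calc good_bernoulli good_ret approx_det_scaled approx_det_A)

lemma good_max_index: "good q' (max_index B q s)"
 unfolding max_index_alt by (intro good_pbind good_poisson1_sum good_for_loop good_mi_step)

locale polya_params =
 fixes q :: real and M0 B :: nat
 assumes q_gt: "rho powr (3 / 4) < q" and q_less: "q < 1"
  and B_pos: "1 \<le> B" and B_large: "q\<^sup>2 / (rho * (1 - sqrt rho) * (2 * real B) * (1 - q)) < 1"
  and M0_gt: "\<And>t. 0 < t \<Longrightarrow> t \<le> rho \<Longrightarrow> A_gf t < real M0"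
begin

text \<open>Largest parameter of the forest sampler. The tree sampler is called from it with powers
  \<open>s ^ i\<close>, \<open>i >= 2\<close>, hence with parameters at most
  \<open>t0 = s0^2 = rho^(3/2)\<close>, where the Taylor approximations converge at the rate
  \<open>sqrt rho\<close>.\<close>

definition "s0 = rho powr (3 / 4)"
definition "t0 = rho * sqrt rho"

lemma rho_pos: "0 < rho" using rho_ge by simp

lemma sqrt_rho: "0 < sqrt rho" "sqrt rho < 1" using rho_pos rho_less by auto

lemma t0_eq: "t0 = s0\<^sup>2"
 using rho_pos unfolding s0_def t0_def
 by (simp add: power2_eq_square powr_half_sqrt[symmetric] powr_add[symmetric] powr_mult_base)

lemma s0_bounds: "0 < s0" "s0 < 1" "rho < s0" "s0 < q"
 using rho_pos rho_less q_gt powr_less_mono'[of rho "3/4" 1] powr_less_mono2[of "3/4" rho 1] by (auto simp: s0_def)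

lemma t0_bounds: "0 < t0" "t0 < rho" "t0 < 1" "t0 \<le> s0"
proof -
 show 1: "0 < t0" "t0 < rho" unfolding t0_def using rho_pos sqrt_rho by auto
 thus "t0 < 1" "t0 \<le> s0" using rho_less s0_bounds by auto
qed

lemma q_bounds: "0 < q" "0 < 1 - q" "1 - q \<le> 1"
 using s0_bounds q_less by auto

lemma M0_pos: "0 < M0"
 using M0_gt[of rho] A_rho rho_pos by auto

definition al :: "real \<Rightarrow> nat \<Rightarrow> real" where
 "al s i = A_gf (s ^ i) / real i"

lemma s_power:
 assumes "0 < s" "s \<le> s0"
 shows "A_ok (s\<^sup>2)" "0 < s ^ i" "2 \<le> i \<Longrightarrow> s ^ i \<le> t0" "s < 1"
proof -
 have s1: "s < 1" using assms s0_bounds by simp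
 thus "s < 1" .
 have "s\<^sup>2 \<le> t0" unfolding t0_eq using assms by (intro power_mono) auto
 thus "A_ok (s\<^sup>2)" using t0_bounds by (intro A_ok) auto
 show "0 < s ^ i" using assms by simp
 show "s ^ i \<le> t0" if "2 \<le> i"
 proof -
  have "s ^ i \<le> s\<^sup>2" by (rule power_decreasing) (use that assms s1 in auto)
  thus ?thesis using \<open>s\<^sup>2 \<le> t0\<close> by simp
 qed
qed

lemma al_bounds:
 assumes s: "0 < s" "s \<le> s0" and i: "2 \<le> i"
 shows "0 < al s i" "al s i \<le> 1" "al s i < real M0"
proof -
 have t: "0 < s ^ i" "s ^ i \<le> t0" using s_power[OF s] i by auto
 hence t: "0 < s ^ i" "s ^ i \<le> t0" "s ^ i \<le> rho" using t0_bounds by auto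
 have A: "0 < A_gf (s ^ i)" using A_gf_ge[OF A_ok[of "s ^ i"]] t by simp
 thus "0 < al s i" using i by (simp add: al_def)
 have "al s i \<le> A_gf (s ^ i) / 1" unfolding al_def using A i by (intro divide_left_mono) auto
 moreover have "A_gf (s ^ i) \<le> 1" using A_gf_mono[OF A_ok_rho _ t(3)] t A_rho by simp
 moreover have "A_gf (s ^ i) < real M0" using M0_gt t by simp
 ultimately show "al s i \<le> 1" "al s i < real M0" by auto
qed

lemma summable_al: "0 < s \<Longrightarrow> s \<le> s0 \<Longrightarrow> summable (\<lambda>i. al s (i + 2))"
 unfolding al_def using summable_Phi(1)[of s] s_power[of s] by simp

lemma Phi_al: "0 < s \<Longrightarrow> s \<le> s0 \<Longrightarrow> Phi s = exp (\<Sum>i. al s (i + 2))"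
 unfolding al_def Phi_def ..

definition mi_c :: "nat \<Rightarrow> real" where
 "mi_c g = real B * real (g + 2) * (1 - q) * q ^ g"

lemma mi_c_pos: "0 < mi_c g"
 unfolding mi_c_def using q_bounds B_pos by simp

text \<open>Here \<open>B_large\<close> enters: \<open>s <= q\<close> and \<open>g + 2 >= 2\<close>
  reduce the quotient to the fraction assumed there to be below 1. It bounds the interval width and,
  via \<open>A_gf t <= t / rho\<close>, also the acceptance probability.\<close>

lemma mi_c_bound:
 assumes s: "0 < s" "s \<le> s0"
 shows "s ^ (g + 2) / (rho * (1 - sqrt rho)) / mi_c g \<le> 1"
proof -
 let ?D = "rho * (1 - sqrt rho)"
 have D: "0 < ?D" using rho_pos sqrt_rho by simp
 have "s ^ (g + 2) \<le> q ^ (g + 2)" using s s0_bounds by (intro power_mono) auto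
 hence "s ^ (g + 2) / (?D * mi_c g) \<le> q ^ (g + 2) / (?D * (real B * 2 * (1 - q) * q ^ g))"
  using D B_pos q_bounds s unfolding mi_c_def
  by (intro frac_le mult_left_mono mult_right_mono) auto
 also have "... = q\<^sup>2 / (?D * (2 * real B) * (1 - q))"
 proof -
  have "(p * y) / (D * (b * 2 * r * p)) = y / (D * (2 * b) * r)" if "p \<noteq> 0" for p y D b r :: real
   using that by (simp add: field_simps)
  note gen = this
  show ?thesis unfolding power_add by (rule gen) (use q_bounds in simp)
 qed
 also have "... \<le> 1" using B_large by simp
 finally show ?thesis by simp
qed

lemma mi_approx:
 assumes s: "0 < s" "s \<le> s0"
 shows "approx_ok 41 (scaled (mi_c g) (approx_A (s ^ (g + 2)))) (A_gf (s ^ (g + 2)) / mi_c g) 1"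
  and "0 \<le> A_gf (s ^ (g + 2)) / mi_c g" "A_gf (s ^ (g + 2)) / mi_c g \<le> 1"
proof -
 let ?t = "s ^ (g + 2)"
 have "0 < ?t" "?t \<le> t0" by (rule s_power(2)[OF s], rule s_power(3)[OF s], simp)
 hence t: "0 < ?t" "?t \<le> t0" "?t \<le> rho" using t0_bounds by auto
 have "approx_ok (39 + 2) (scaled (mi_c g) (approx_A ?t)) (A_gf ?t / mi_c g) (?t / (rho * (1 - sqrt rho)) / mi_c g)"
  using t by (intro approx_ok_scaled approx_ok_A mi_c_pos) (auto simp: t0_def)
 thus "approx_ok 41 (scaled (mi_c g) (approx_A ?t)) (A_gf ?t / mi_c g) 1"
  by (rule approx_ok_mono) (use mi_c_bound[OF s] in auto)
 have A: "0 \<le> A_gf ?t" using A_gf_nonneg[OF A_ok[of ?t]] t by simp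
 thus "0 \<le> A_gf ?t / mi_c g" using mi_c_pos[of g] by simp
 have "A_gf ?t \<le> ?t / rho" using A_gf_le_quot t by simp
 also have "... \<le> ?t / (rho * (1 - sqrt rho))"
  using t rho_pos sqrt_rho by (intro divide_left_mono) (auto simp: mult_le_cancel_left1)
 finally have "A_gf ?t / mi_c g \<le> ?t / (rho * (1 - sqrt rho)) / mi_c g"
  using mi_c_pos[of g] by (intro divide_right_mono) auto
 thus "A_gf ?t / mi_c g \<le> 1" using mi_c_bound[OF s, of g] by simp
qed

lemma pmf_geom: "pmf (geometric_pmf (1 - q)) g = q ^ g * (1 - q)"
 using q_bounds by (subst pmf_geometric) auto

lemma mi_c_calc: "rval (V (real B) \<^bold>* V (real (g + 2)) \<^bold>* (V 1 \<^bold>- V q) \<^bold>* V (q ^ (g + 2 - 2))) = mi_c g"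
 by (simp add: mi_c_def)

lemma val_mi_step:
 assumes s: "0 < s" "s \<le> s0"
 shows "val q (mi_step B q s b) h = (\<Sum>g. ennreal (pmf (geometric_pmf (1 - q)) g) *
  (h (max b (g + 2)) * ennreal (A_gf (s ^ (g + 2)) / mi_c g) + h b * ennreal (1 - A_gf (s ^ (g + 2)) / mi_c g)))"
proof -
 have 1: "val q (pbind (power_prog x k) K) f = val q (K (x ^ k)) f" if "\<And>y. good q (K y)" for x k K and f :: "nat \<Rightarrow> ennreal"
 proof -
  obtain c where "power_prog x k = detp (x ^ k) c" using power_prog_detp by blast
  thus ?thesis using that by (simp add: val_pbind good_detp val_detp)
 qed
 note g = good_pbind good_geometric good_tick good_power_prog good_calc good_bernoulli good_ret approx_det_scaled approx_det_A
 show ?thesis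
  unfolding mi_step_def Let_def
  apply (subst val_pbind, intro g, intro g)
  unfolding val_geometric nn_integral_pmf_nat
  apply (subst val_tick_bind, intro g)
  apply (subst 1, intro g)
  apply (subst 1, intro g)
  apply (subst val_pbind, intro g, intro g)
  unfolding calc_eq val_detp mi_c_calc
  apply (subst val_pbind, intro g, intro g)
  unfolding val_bernoulli[OF mi_approx[OF s]]
  apply (subst val_tick_bind, intro g)
  apply (subst val_tick_bind, intro g)
  by (simp add: val_ret)
qed

section \<open>Boltzmann samplers\<close>

definition mi_head :: "real \<Rightarrow> nat \<Rightarrow> real" where
 "mi_head s k = (\<Sum>i\<in>{2..k}. al s i)"

definition mi_tail :: "real \<Rightarrow> nat \<Rightarrow> real" where
 "mi_tail s k = (\<Sum>i. if i + 2 \<le> k then 0 else al s (i + 2))"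

lemma mi_head_tail:
 assumes s: "0 < s" "s \<le> s0"
 shows "summable (\<lambda>i. if i + 2 \<le> k then 0 else al s (i + 2))"
  and "exp (- mi_tail s k) = exp (mi_head s k) / Phi s"
proof -
 have f: "(\<lambda>i. if i + 2 \<le> k then al s (i + 2) else 0) sums mi_head s k"
 proof -
  have "(\<lambda>i. if i \<in> {i. i + 2 \<le> k} then al s (i + 2) else 0) sums (\<Sum>i\<in>{i. i + 2 \<le> k}. al s (i + 2))"
   by (rule sums_If_finite_set) (rule finite_subset[of _ "{..k}"], auto)
  also have "(\<Sum>i\<in>{i. i + 2 \<le> k}. al s (i + 2)) = mi_head s k"
   unfolding mi_head_def
   by (rule sum.reindex_bij_betw[of "\<lambda>i. i + 2"], rule bij_betw_byWitness[where f' = "\<lambda>i. i - 2"]) auto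
  finally show ?thesis by simp
 qed
 have "(\<lambda>i. al s (i + 2) - (if i + 2 \<le> k then al s (i + 2) else 0)) sums ((\<Sum>i. al s (i + 2)) - mi_head s k)"
  by (intro sums_diff f summable_sums summable_al s)
 moreover have "al s (i + 2) - (if i + 2 \<le> k then al s (i + 2) else 0) = (if i + 2 \<le> k then 0 else al s (i + 2))" for i by simp
 ultimately have t: "(\<lambda>i. if i + 2 \<le> k then 0 else al s (i + 2)) sums ((\<Sum>i. al s (i + 2)) - mi_head s k)"
  by (simp only:)
 thus "summable (\<lambda>i. if i + 2 \<le> k then 0 else al s (i + 2))" by (rule sums_summable)
 have "mi_tail s k = (\<Sum>i. al s (i + 2)) - mi_head s k" unfolding mi_tail_def by (rule sums_unique[OF t, symmetric])
 thus "exp (- mi_tail s k) = exp (mi_head s k) / Phi s" by (simp add: Phi_al[OF s] exp_diff)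
qed

text \<open>Proposal probability times acceptance probability of index \<open>i\<close> is
  \<open>al s i / B\<close>, so one candidate exceeds \<open>k\<close> with probability
  \<open>mi_tail s k / B\<close>.\<close>

lemma val_mi_step_le:
 assumes s: "0 < s" "s \<le> s0"
 shows "val q (mi_step B q s b) (\<lambda>n. if n \<le> k then 1 else 0) = (if b \<le> k then 1 else 0) * ennreal (1 - mi_tail s k / real B)"
  and "0 \<le> 1 - mi_tail s k / real B"
proof -
 let ?D = "pmf (geometric_pmf (1 - q))" and ?p = "\<lambda>g. A_gf (s ^ (g + 2)) / mi_c g"
 let ?f = "\<lambda>g. ?D g * (1 - (if g + 2 \<le> k then 0 else ?p g))"
 have Dp: "?D g * ?p g = al s (g + 2) / real B" for g
 proof -
  have "(p * r) * (A / (b * n * r * p)) = A / n / b" if "p \<noteq> 0" "r \<noteq> 0" for p r A b n :: real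
   using that by (simp add: field_simps)
  from this[of "q ^ g" "1 - q"] show ?thesis unfolding pmf_geom mi_c_def al_def using q_bounds by simp
 qed
 have "(\<lambda>g. q ^ g * (1 - q)) sums (1 / (1 - q) * (1 - q))"
  using q_bounds by (intro sums_mult2 geometric_sums) auto
 hence D: "?D sums 1" using q_bounds by (simp add: pmf_geom[abs_def])
 have "(\<lambda>g. ?D g - (if g + 2 \<le> k then 0 else al s (g + 2)) / real B) sums (1 - mi_tail s k / real B)"
  unfolding mi_tail_def by (intro sums_diff D sums_divide summable_sums mi_head_tail s)
 moreover have "?D g - (if g + 2 \<le> k then 0 else al s (g + 2)) / real B = ?f g" for g
  using Dp[of g] by (simp add: right_diff_distrib)
 ultimately have f: "?f sums (1 - mi_tail s k / real B)" by (simp only:)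
 have f0: "0 \<le> ?f g" for g using mi_approx(2,3)[OF s, of g] by (intro mult_nonneg_nonneg) auto
 show "0 \<le> 1 - mi_tail s k / real B" by (rule sums_le[OF f0 sums_zero f])
 show "val q (mi_step B q s b) (\<lambda>n. if n \<le> k then 1 else 0) = (if b \<le> k then 1 else 0) * ennreal (1 - mi_tail s k / real B)"
 proof (cases "b \<le> k")
  case True
  have "ennreal (?D g) * ((if max b (g + 2) \<le> k then 1 else 0) * ennreal (?p g) + (if b \<le> k then 1 else 0) * ennreal (1 - ?p g)) = ennreal (?f g)" for g
  proof -
   have "(if max b (g + 2) \<le> k then 1 else 0) * ennreal (?p g) + (if b \<le> k then 1 else 0) * ennreal (1 - ?p g)
    = ennreal (1 - (if g + 2 \<le> k then 0 else ?p g))"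
    using True mi_approx(2,3)[OF s, of g] by (auto simp flip: ennreal_plus)
   thus ?thesis by (simp add: ennreal_mult')
  qed
  thus ?thesis unfolding val_mi_step[OF s] using True suminf_ennreal_eq[OF f0 f] by simp
 next
  case False
  thus ?thesis unfolding val_mi_step[OF s] by simp
 qed
qed

text \<open>With a Poisson number of candidates of mean \<open>B\<close>, the powers
  \<open>(1 - mi_tail s k / B) ^ N'\<close> average to \<open>exp (- mi_tail s k)\<close>.\<close>

lemma max_index_cdf:
 assumes s: "0 < s" "s \<le> s0"
 shows "val q (max_index B q s) (\<lambda>n. if n \<le> k then 1 else 0) = ennreal (exp (mi_head s k) / Phi s)"
proof -
 let ?a = "1 - mi_tail s k / real B"
 have "val q (for_loop N' 1 (\<lambda>_. mi_step B q s) 0) (\<lambda>n. if n \<le> k then 1 else 0) = ennreal (?a ^ N')" for N'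
  using val_for_loop_mult[of q "\<lambda>_. mi_step B q s" "\<lambda>n. if n \<le> k then 1 else 0" "ennreal ?a" N' 1 0, OF good_mi_step val_mi_step_le(1)[OF s]]
   val_mi_step_le(2)[OF s] by (simp add: ennreal_power)
 hence "val q (max_index B q s) (\<lambda>n. if n \<le> k then 1 else 0) = val q (poisson1_sum B) (\<lambda>N'. ennreal (?a ^ N'))"
  unfolding max_index_alt by (subst val_pbind) (simp_all add: good_poisson1_sum good_for_loop good_mi_step)
 also have "... = ennreal (exp (- mi_tail s k))"
  unfolding val_poisson1_sum[OF val_mi_step_le(2)[OF s]] using B_pos by simp
 finally show ?thesis unfolding mi_head_tail(2)[OF s] .
qed

definition mi_pmf :: "real \<Rightarrow> nat \<Rightarrow> real" where
 "mi_pmf s k = (if k = 0 then 1 else if k = 1 then 0 else exp (mi_head s (k - 1)) * (exp (al s k) - 1)) / Phi s"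

lemma mi_head_Suc: "1 \<le> k \<Longrightarrow> mi_head s (Suc k) = mi_head s k + al s (Suc k)"
 unfolding mi_head_def by simp

lemma mi_head_01: "mi_head s 0 = 0" "mi_head s (Suc 0) = 0"
 unfolding mi_head_def by simp_all

lemma Phi_pos: "0 < Phi s"
 unfolding Phi_def by simp

lemma mi_pmf_nonneg: "0 < s \<Longrightarrow> s \<le> s0 \<Longrightarrow> 0 \<le> mi_pmf s k"
 unfolding mi_pmf_def using al_bounds(1)[of s k] Phi_pos[of s]
 by (cases k) (auto intro!: divide_nonneg_nonneg mult_nonneg_nonneg simp: Suc_le_eq not_less_eq_eq)

lemma val_max_index:
 assumes s: "0 < s" "s \<le> s0"
 shows "val q (max_index B q s) h = (\<Sum>k. ennreal (mi_pmf s k) * h k)"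
proof -
 let ?F = "\<lambda>k. exp (mi_head s k) / Phi s"
 have "val q (max_index B q s) (\<lambda>n. indicator {k} n) = ennreal (mi_pmf s k)" for k
 proof (cases k)
  case 0
  have "(\<lambda>n::nat. indicator {0} n) = (\<lambda>n. if n \<le> 0 then 1 else 0::ennreal)" by (auto simp: indicator_def)
  thus ?thesis using max_index_cdf[OF s, of 0] by (simp add: 0 mi_pmf_def mi_head_01)
 next
  case (Suc m)
  have "ennreal (?F k) = val q (max_index B q s) (\<lambda>n. indicator {k} n + (if n \<le> m then 1 else 0))"
   unfolding max_index_cdf[OF s, symmetric]
   by (rule arg_cong[of _ _ "val q _"]) (auto simp: Suc indicator_def)
  also have "... = val q (max_index B q s) (\<lambda>n. indicator {k} n) + ennreal (?F m)"
   unfolding val_add[OF good_max_index] max_index_cdf[OF s] ..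
  finally have eq: "val q (max_index B q s) (\<lambda>n. indicator {k} n) + ennreal (?F m) = ennreal (?F k)" by simp
  have F: "?F k = mi_pmf s k + ?F m"
  proof (cases m)
   case 0 thus ?thesis by (simp add: Suc mi_pmf_def mi_head_01)
  next
   case (Suc m')
   hence "mi_head s k = mi_head s m + al s k" using mi_head_Suc[of m s] by (simp add: \<open>k = Suc m\<close>)
   thus ?thesis using Suc by (simp add: \<open>k = Suc m\<close> mi_pmf_def exp_add right_diff_distrib add_divide_distrib[symmetric])
  qed
  have "val q (max_index B q s) (\<lambda>n. indicator {k} n) + ennreal (?F m) = ennreal (mi_pmf s k) + ennreal (?F m)"
   unfolding eq F using mi_pmf_nonneg[OF s] Phi_pos[of s] by (subst ennreal_plus) auto
  thus ?thesis by (simp add: add.commute[of _ "ennreal (?F m)"] ennreal_add_left_cancel)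
 qed
 thus ?thesis using val_by_size[OF good_max_index, where g = h and sz = "\<lambda>n. n" and q = q] by simp
qed

definition mi_const :: real where
 "mi_const = real (1 + 4 * B) + 1 + exp (real B) * (2 + 21 + 2 * bern_const 41 + 6 * (q / (1 - q)))"

lemma geometric_mean: "(\<integral>\<^sup>+ g. of_nat g \<partial>geometric_pmf (1 - q)) = ennreal (q / (1 - q))"
proof -
 have "(\<integral>\<^sup>+ g. of_nat g \<partial>geometric_pmf (1 - q)) = ennreal (measure_pmf.expectation (geometric_pmf (1 - q)) real)"
  unfolding ennreal_of_nat_eq_real_of_nat
  by (rule nn_integral_eq_integral) (use q_bounds in \<open>auto intro: integrable_real_geometric_pmf\<close>)
 thus ?thesis using expectation_geometric_pmf[of "1 - q"] q_bounds by simp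
qed

lemma cst_mi_step:
 assumes s: "0 < s" "s \<le> s0"
 shows "cst q (mi_step B q s b) \<le> ennreal (21 + 2 * bern_const 41 + 6 * (q / (1 - q)))"
proof -
 let ?X = "of_nat 4 + (ennreal (bern_const 41 * (1 + 1)) + (of_nat 1 + 0))"
 let ?Y = "14 + 2 * bern_const 41"
 note g = good_pbind good_geometric good_tick good_power_prog good_calc good_bernoulli good_ret approx_det_scaled approx_det_A
 have pp: "cst q (pbind (power_prog x k) K) \<le> of_nat (1 + k * 3) + cst q (K (x ^ k))" if "\<And>y. good q (K y)" for x k and K :: "real \<Rightarrow> nat prog"
 proof -
  obtain c where c: "power_prog x k = detp (x ^ k) c" "c \<le> 1 + k * 3" using power_prog_detp by blast
  have "cst q (pbind (power_prog x k) K) \<le> of_nat c + cst q (K (x ^ k))"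
   unfolding c(1) by (rule order_trans[OF cst_pbind[OF good_detp that]]) (simp add: cst_detp val_detp)
  also have "... \<le> of_nat (1 + k * 3) + cst q (K (x ^ k))" using c(2) by (intro add_right_mono of_nat_mono)
  finally show ?thesis .
 qed
 have "cst q (mi_step B q s b) \<le> cst q geometric + val q geometric (\<lambda>g. of_nat 1 + (of_nat (1 + (g + 2) * 3) + (of_nat (1 + (g + 2 - 2) * 3) +
   ?X)))"
  unfolding mi_step_def Let_def
  apply (rule order_trans[OF cst_pbind], intro g, intro g)
  apply (rule add_left_mono, rule val_mono)
  apply (rule order_trans[OF cst_tick_bind], intro g, rule add_left_mono)
  apply (rule order_trans[OF pp], intro g, rule add_left_mono)
  apply (rule order_trans[OF pp], intro g, rule add_left_mono)
  apply (rule order_trans[OF cst_pbind], intro g, intro g)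
  unfolding calc_eq val_detp cst_detp mi_c_calc
  apply (rule add_mono, simp)
  apply (rule order_trans[OF cst_pbind], intro g, intro g)
  apply (rule add_mono[OF cst_bernoulli[OF mi_approx(1)[OF s]]], simp)
  apply (rule val_le_const)
  apply (rule order_trans[OF cst_tick_bind], intro g)
  by (simp add: cst_ret)
 also have "... \<le> 1 + val q geometric (\<lambda>g. of_nat g * ennreal 6 + ennreal ?Y)"
 proof (rule add_mono[OF _ val_mono])
  fix g
  have "of_nat 1 + (of_nat (1 + (g + 2) * 3) + (of_nat (1 + (g + 2 - 2) * 3) + ?X))
   = ennreal (real (1 + (1 + (g + 2) * 3) + (1 + (g + 2 - 2) * 3) + 4 + 1) + 2 * bern_const 41)"
   using bern_const_nonneg[of 41] unfolding ennreal_of_nat_eq_real_of_nat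
   by (simp flip: ennreal_plus ennreal_1 ennreal_numeral)
  also have "... = ennreal (real g * 6 + ?Y)" by (simp add: algebra_simps)
  finally show "of_nat 1 + (of_nat (1 + (g + 2) * 3) + (of_nat (1 + (g + 2 - 2) * 3) + ?X))
   \<le> of_nat g * ennreal 6 + ennreal ?Y"
   using bern_const_nonneg[of 41] unfolding ennreal_of_nat_eq_real_of_nat by (simp add: ennreal_mult)
 qed (simp add: cst_geometric)
 also have "... \<le> 1 + (ennreal (q / (1 - q)) * ennreal 6 + ennreal ?Y)"
  unfolding val_add[OF good_geometric] val_multc[OF good_geometric]
  by (rule add_mono[OF order_refl add_mono[OF mult_right_mono val_le_const]]) (auto simp: val_geometric geometric_mean)
 also have "... = ennreal (1 + (q / (1 - q) * 6 + ?Y))"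
 proof -
  have "1 + (ennreal a * ennreal 6 + ennreal b) = ennreal (1 + (a * 6 + b))" if "0 \<le> a" "0 \<le> b" for a b
   using that by (simp add: ennreal_mult)
  thus ?thesis using bern_const_nonneg[of 41] q_bounds by simp
 qed
 also have "... \<le> ennreal (21 + 2 * bern_const 41 + 6 * (q / (1 - q)))"
 proof (rule ennreal_leI)
  have "1 + (x * 6 + (14 + 2 * b)) \<le> 21 + 2 * b + 6 * x" for x b :: real by simp
  thus "1 + (q / (1 - q) * 6 + ?Y) \<le> 21 + 2 * bern_const 41 + 6 * (q / (1 - q))" .
 qed
 finally show ?thesis .
qed

lemma cst_max_index:
 assumes s: "0 < s" "s \<le> s0"
 shows "cst q (max_index B q s) \<le> ennreal mi_const"
proof -
 let ?c = "21 + 2 * bern_const 41 + 6 * (q / (1 - q))"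
 have c: "0 \<le> ?c" using bern_const_nonneg[of 41] q_bounds by simp
 have "cst q (max_index B q s) \<le> cst q (poisson1_sum B) + val q (poisson1_sum B) (\<lambda>N'. cst q (for_loop N' 1 (\<lambda>_. mi_step B q s) 0))"
  unfolding max_index_alt by (intro cst_pbind good_poisson1_sum good_for_loop good_mi_step)
 also have "... \<le> of_nat (1 + 4 * B) + val q (poisson1_sum B) (\<lambda>N'. 1 + of_nat N' * (2 + ennreal ?c))"
  by (intro add_mono cst_poisson1_sum val_mono cst_for_loop_const good_mi_step cst_mi_step s)
 also have "val q (poisson1_sum B) (\<lambda>N'. 1 + of_nat N' * (2 + ennreal ?c)) \<le> 1 + ennreal (exp (real B)) * (2 + ennreal ?c)"
  unfolding val_add[OF good_poisson1_sum] val_multc[OF good_poisson1_sum]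
  by (intro add_mono mult_right_mono val_le_const val_poisson1_sum_mean) auto
 also have "of_nat (1 + 4 * B) + (1 + ennreal (exp (real B)) * (2 + ennreal ?c)) = ennreal mi_const"
 proof -
  have "of_nat (1 + 4 * B) + (1 + ennreal (exp (real B)) * (2 + ennreal c)) = ennreal (real (1 + 4 * B) + 1 + exp (real B) * (2 + c))"
   if "0 \<le> c" for c
  proof -
   have "2 + ennreal c = ennreal (2 + c)" using that by simp
   thus ?thesis using that unfolding ennreal_of_nat_eq_real_of_nat
    by (simp add: ennreal_mult'[symmetric] ennreal_plus[symmetric] del: ennreal_plus flip: ennreal_1)
  qed
  from this[OF c] show ?thesis unfolding mi_const_def by (simp only: add.assoc)
 qed
 finally show ?thesis by (simp add: add_left_mono)
qed

text \<open>The maximum of the accepted indices is at most the sum of all proposed ones, each of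
  mean \<open>2 + q / (1 - q)\<close>.\<close>

lemma val_max_index_mean:
 assumes s: "0 < s" "s \<le> s0"
 shows "val q (max_index B q s) of_nat \<le> ennreal (exp (real B) * (2 + q / (1 - q)))"
proof -
 let ?j = "2 + q / (1 - q)"
 have j: "0 \<le> ?j" using q_bounds by simp
 have step: "val q (mi_step B q s b) of_nat \<le> of_nat b + ennreal ?j" for b
 proof -
  have "val q (mi_step B q s b) of_nat \<le> (\<Sum>g. ennreal (pmf (geometric_pmf (1 - q)) g) * (of_nat b + (of_nat g + ennreal 2)))"
   unfolding val_mi_step[OF s]
  proof (intro suminf_le mult_left_mono summableI)
   fix g
   let ?p = "A_gf (s ^ (g + 2)) / mi_c g"
   have m: "(of_nat (max b (g + 2)) :: ennreal) \<le> of_nat b + (of_nat g + ennreal 2)"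
   proof -
    have "(of_nat (max b (g + 2)) :: ennreal) \<le> of_nat (b + (g + 2))" by (intro of_nat_mono) simp
    thus ?thesis by (simp only: of_nat_add of_nat_numeral ennreal_numeral)
   qed
   have "of_nat (max b (g + 2)) * ennreal ?p + of_nat b * ennreal (1 - ?p) \<le>
    (of_nat b + (of_nat g + ennreal 2)) * ennreal ?p + (of_nat b + (of_nat g + ennreal 2)) * ennreal (1 - ?p)"
    by (intro add_mono mult_right_mono m) auto
   also have "... = (of_nat b + (of_nat g + ennreal 2)) * ennreal (?p + (1 - ?p))"
    using mi_approx(2,3)[OF s, of g] by (subst ennreal_plus) (auto simp: distrib_left)
   finally show "of_nat (max b (g + 2)) * ennreal ?p + of_nat b * ennreal (1 - ?p) \<le> of_nat b + (of_nat g + ennreal 2)" by simp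
  qed auto
  also have "... = of_nat b + (ennreal (q / (1 - q)) + ennreal 2)"
   unfolding nn_integral_pmf_nat[symmetric]
   by (subst nn_integral_add, simp, simp, subst nn_integral_add, simp, simp)
     (simp add: geometric_mean measure_pmf.emeasure_space_1[simplified])
  also have "... = of_nat b + ennreal ?j"
  proof -
   have "0 \<le> q / (1 - q)" using q_bounds by simp
   thus ?thesis by (simp add: add.commute)
  qed
  finally show ?thesis .
 qed
 have "val q (max_index B q s) of_nat = val q (poisson1_sum B) (\<lambda>N'. val q (for_loop N' 1 (\<lambda>_. mi_step B q s) 0) of_nat)"
  unfolding max_index_alt by (intro val_pbind good_poisson1_sum good_for_loop good_mi_step)
 also have "... \<le> val q (poisson1_sum B) (\<lambda>N'. of_nat N' * ennreal ?j)"
  using val_for_loop_add[of q "\<lambda>_. mi_step B q s" of_nat "ennreal ?j", OF good_mi_step step]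
  by (intro val_mono) (metis add_0 of_nat_0)
 also have "... \<le> ennreal (exp (real B)) * ennreal ?j"
  unfolding val_multc[OF good_poisson1_sum] by (intro mult_right_mono val_poisson1_sum_mean) auto
 finally show ?thesis using j by (simp add: ennreal_mult)
qed

end

lemma val_for_loop_prod:
 assumes g: "\<And>i s. good q (f i s)"
  and p: "\<And>j s. i \<le> j \<Longrightarrow> j < i + k \<Longrightarrow> I j s \<Longrightarrow> post (f j s) (I (Suc j))"
  and step: "\<And>j s. i \<le> j \<Longrightarrow> j < i + k \<Longrightarrow> I j s \<Longrightarrow> val q (f j s) h = h s * a j" and "I i s"
 shows "val q (for_loop k i f s) h = h s * (\<Prod>j=i..<i+k. a j)"
 using p step \<open>I i s\<close>
proof (induction k arbitrary: i s)
 case 0 show ?case by (simp add: val_for_loop_0 del: for_loop.simps)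
next
 case (Suc k)
 have "val q (for_loop (Suc k) i f s) h = val q (f i s) (\<lambda>s'. val q (for_loop k (Suc i) f s') h)"
  by (rule val_for_loop_Suc[OF g])
 also have "... = val q (f i s) (\<lambda>s'. h s' * (\<Prod>j=Suc i..<Suc i+k. a j))"
 proof (rule val_cong_post)
  show "post (f i s) (I (Suc i))" using Suc.prems by auto
  show "val q (for_loop k (Suc i) f s') h = h s' * (\<Prod>j=Suc i..<Suc i+k. a j)" if "I (Suc i) s'" for s'
   by (rule Suc.IH[OF _ _ that]) (use Suc.prems in auto)
 qed
 also have "... = h s * (a i * (\<Prod>j=Suc i..<Suc i+k. a j))"
  unfolding val_multc[OF g] using Suc.prems by (simp add: mult_ac)
 also have "a i * (\<Prod>j=Suc i..<Suc i+k. a j) = (\<Prod>j=i..<i+Suc k. a j)"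
  by (subst prod.atLeast_Suc_lessThan[of i "i + Suc k"]) auto
 finally show ?case .
qed

lemma good_case_prod: "(\<And>x y. good q (f x y)) \<Longrightarrow> good q (case z of (x, y) \<Rightarrow> f x y)"
 by (cases z) simp

lemma prog_lim_case_prod:
 "(\<And>x y. prog_lim (\<lambda>n. f n x y) (g x y)) \<Longrightarrow> prog_lim (\<lambda>n. case z of (x, y) \<Rightarrow> f n x y) (case z of (x, y) \<Rightarrow> g x y)"
 by (cases z) simp

lemma wp_lim_le: "prog_lim ps p \<Longrightarrow> (\<And>n. good q (ps n)) \<Longrightarrow> wp q (ps n) f \<le> wp q p f"
 by (subst wp_lim[of ps p]) (auto intro: SUP_upper)

section \<open>Recursion and generating functions of the Boltzmann samplers\<close>

definition add_copies :: "(real \<Rightarrow> polya prog) \<Rightarrow> real \<Rightarrow> nat \<Rightarrow> forest \<Rightarrow> forest prog" where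
 "add_copies rec t i F = do { T \<leftarrow> rec t; tick (i * tsize T); ret (F + replicate_mset i T) }"

definition mult_prog :: "nat \<Rightarrow> nat \<Rightarrow> nat \<Rightarrow> real \<Rightarrow> nat prog" where
 "mult_prog M0 k i t = (if i < k then poisson M0 (scaled (real i) (approx_A t))
        else poisson_pos M0 (scaled (real i) (approx_A t)))"

definition gB_step :: "(real \<Rightarrow> polya prog) \<Rightarrow> nat \<Rightarrow> real \<Rightarrow> nat \<Rightarrow> nat \<Rightarrow> forest \<times> real \<Rightarrow> (forest \<times> real) prog" where
 "gB_step rec M0 s k i = (\<lambda>(F, t). do {
     t' \<leftarrow> calc (V t \<^bold>* V s);
     tick 1;
     m \<leftarrow> mult_prog M0 k i t';
     F' \<leftarrow> for_loop m 1 (\<lambda>_. add_copies rec t' i) F;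
     ret (F', t') })"

lemma gammaB_with_alt: "gammaB_with rec M0 B q s = do {
   k \<leftarrow> max_index B q s;
   tick 1;
   S \<leftarrow> for_loop (k - 1) 2 (gB_step rec M0 s k) ({#}, s);
   ret (fst S) }"
 unfolding gammaB_with_def gB_step_def[abs_def] mult_prog_def add_copies_def[abs_def] by (simp only: case_prod_unfold)

definition gA_body :: "nat \<Rightarrow> nat \<Rightarrow> real \<Rightarrow> (real \<Rightarrow> polya prog) \<Rightarrow> real \<Rightarrow> polya prog" where
 "gA_body M0 B q rec t = do {
   tick 1;
   x \<leftarrow> poisson M0 (approx_A t);
   Ts \<leftarrow> for_loop x 1 (\<lambda>_ Ts. do { T \<leftarrow> rec t; tick 1; ret (add_mset T Ts) }) {#};
   F \<leftarrow> gammaB_with rec M0 B q t;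
   tick (size F);
   ret (Node (Ts + F)) }"

lemma gammaA_fixpoint: "gammaA M0 B q t = gA_body M0 B q (gammaA M0 B q) t"
 by (rule ext) (subst gammaA.simps, simp add: gA_body_def)

lemma good_add_copies: "(\<And>t. good q (rec t)) \<Longrightarrow> good q (add_copies rec t i F)"
 unfolding add_copies_def by (intro good_pbind good_tick good_ret)

lemma good_mult_prog: "good q (mult_prog M0 k i t)"
 unfolding mult_prog_def by (simp add: good_poisson good_poisson_pos approx_det_scaled approx_det_A)

lemma good_gB_step: "(\<And>t. good q (rec t)) \<Longrightarrow> good q (gB_step rec M0 s k i S)"
 unfolding gB_step_def
 by (intro good_case_prod good_pbind good_calc good_tick good_mult_prog good_for_loop good_add_copies good_ret)

lemma good_gammaB_with: "(\<And>t. good q (rec t)) \<Longrightarrow> good q (gammaB_with rec M0 B q' s)"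
 unfolding gammaB_with_alt
 by (intro good_pbind good_max_index good_tick good_for_loop good_gB_step good_ret)

lemma good_gA_body: "(\<And>t. good q (rec t)) \<Longrightarrow> good q (gA_body M0 B q' rec t)"
 unfolding gA_body_def
 by (intro good_pbind good_poisson approx_det_A good_tick good_for_loop good_gammaB_with good_ret)

text \<open>The recursion unfolded to depth \<open>n\<close>; deeper calls diverge.\<close>

primrec gA :: "nat \<Rightarrow> nat \<Rightarrow> real \<Rightarrow> nat \<Rightarrow> real \<Rightarrow> polya prog" where
 "gA M0 B q 0 = (\<lambda>t _. None)"
| "gA M0 B q (Suc n) = gA_body M0 B q (gA M0 B q n)"

lemma good_gA: "good q (gA M0 B q' n t)"
 by (induction n arbitrary: t) (simp_all add: good_None good_gA_body)

lemma prog_lim_gB: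
 assumes "\<And>t. prog_lim (\<lambda>n. rs n t) (r t)"
 shows "prog_lim (\<lambda>n. gammaB_with (rs n) M0 B q s) (gammaB_with r M0 B q s)"
 unfolding gammaB_with_alt gB_step_def add_copies_def
 by (intro prog_lim_pbind prog_lim_for_loop prog_lim_const[of "max_index B q s"] prog_lim_const[of "tick _"]
   prog_lim_const[of "ret _"] prog_lim_const[of "calc _"] prog_lim_const[of "mult_prog _ _ _ _"] prog_lim_case_prod assms)

lemma prog_cont_gA: "prog_cont (gA_body M0 B q)"
proof -
 have L: "prog_lim (\<lambda>n. gA_body M0 B q (rs n) t) (gA_body M0 B q r t)" if "\<forall>t. prog_lim (\<lambda>n. rs n t) (r t)" for rs r t
  unfolding gA_body_def
  by (intro prog_lim_pbind prog_lim_for_loop prog_lim_const[of "poisson _ _"] prog_lim_const[of "tick _"]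
    prog_lim_const[of "ret _"] prog_lim_gB that[rule_format])
 show ?thesis unfolding prog_cont_def by (intro allI impI) (rule L)
qed

lemma prog_lim_gA: "prog_lim (\<lambda>n. gA M0 B q n t) (gammaA M0 B q t)"
proof (rule prog_lim_iterate[OF prog_cont_gA])
 show "gammaA M0 B q x = gA_body M0 B q (gammaA M0 B q) x" for x by (rule gammaA_fixpoint)
 fix G t tp v assume G: "\<And>t. G t = gA_body M0 B q G t" and v: "gammaA M0 B q t tp = Some v"
 have "M0' = M0 \<longrightarrow> B' = B \<longrightarrow> q' = q \<longrightarrow> G t tp = Some v" if "gammaA M0' B' q' t tp = Some v" for M0' B' q'
  using that
 proof (rule gammaA.raw_induct[rotated], goal_cases)
  case (1 gamA M0' B' q' t tp x)
  show ?case
  proof (intro impI)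
   assume e: "M0' = M0" "B' = B" "q' = q"
   have "gA_body M0 B q (gamA M0 B q) t tp = Some x" using 1(2) unfolding e gA_body_def .
   thus "G t tp = Some x" unfolding G[of t]
    by (rule functional_le[OF prog_cont_gA, rotated]) (rule 1(1)[rule_format, OF _ refl refl refl])
  qed
 qed
 from this[OF v] show "G t tp = Some v" by blast
qed (simp_all only: gA.simps)

lemma good_gammaA: "good q (gammaA M0 B q' t)"
 by (rule good_lim[OF prog_lim_gA good_gA])

lemma good_gammaB: "good q (gammaB M0 B q' s)"
 unfolding gammaB_def by (rule good_gammaB_with[OF good_gammaA])

context polya_params
begin

definition "w0 = 1 / (1 - sqrt rho)"

lemma w0_pos: "0 < w0" unfolding w0_def using sqrt_rho by simp

lemma approx_al:
 assumes s: "0 < s" "s \<le> s0" and i: "2 \<le> i"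
 shows "approx_ok 41 (scaled (real i) (approx_A (s ^ i))) (al s i) w0"
proof -
 have t: "0 < s ^ i" "s ^ i \<le> t0" using s_power[OF s] i by auto
 have "approx_ok (39 + 2) (scaled (real i) (approx_A (s ^ i))) (A_gf (s ^ i) / real i) (s ^ i / (rho * (1 - sqrt rho)) / real i)"
  using t i by (intro approx_ok_scaled approx_ok_A) (auto simp: t0_def)
 thus ?thesis unfolding al_def
 proof (rule approx_ok_mono)
  have "s ^ i / (rho * (1 - sqrt rho)) / real i \<le> rho / (rho * (1 - sqrt rho)) / 1"
   using t i t0_bounds rho_pos sqrt_rho by (intro frac_le divide_right_mono) auto
  thus "s ^ i / (rho * (1 - sqrt rho)) / real i \<le> w0" using rho_pos by (simp add: w0_def)
 qed simp
qed

text \<open>Generating function of the multiplicity of \<open>i\<close> when the maximal index is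
  \<open>k\<close>: Poisson below \<open>k\<close>, Poisson conditioned to be positive at
  \<open>k\<close>.\<close>

definition mult_pgf :: "real \<Rightarrow> nat \<Rightarrow> nat \<Rightarrow> real \<Rightarrow> real" where
 "mult_pgf s k i r = (if i < k then exp (al s i * (r - 1)) else (exp (al s i * r) - 1) / (exp (al s i) - 1))"

definition mult_mean :: "real \<Rightarrow> nat \<Rightarrow> nat \<Rightarrow> real" where
 "mult_mean s k i = (if i < k then al s i else al s i / (1 - exp (- al s i)))"

definition mult_const :: real where
 "mult_const = poisson_const M0 41 w0 + (poisson_const M0 41 w0 + bern_const 0 + 3) * exp 1"

lemma poisson_const_nonneg: "0 \<le> poisson_const M0 41 w0"
 unfolding poisson_const_def using w0_pos bern_const_nonneg by simp

lemma mult_const_nonneg: "0 \<le> mult_const"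
 unfolding mult_const_def using poisson_const_nonneg bern_const_nonneg[of 0] by simp

lemma mult_pgf_nonneg: "0 < s \<Longrightarrow> s \<le> s0 \<Longrightarrow> 2 \<le> i \<Longrightarrow> 0 \<le> r \<Longrightarrow> 0 \<le> mult_pgf s k i r"
 unfolding mult_pgf_def using al_bounds(1)[of s i] by simp

lemma mult_prog_law:
 assumes s: "0 < s" "s \<le> s0" and i: "2 \<le> i"
 shows "0 \<le> r \<Longrightarrow> val q (mult_prog M0 k i (s ^ i)) (\<lambda>m. ennreal (r ^ m)) = ennreal (mult_pgf s k i r)"
  and "val q (mult_prog M0 k i (s ^ i)) of_nat = ennreal (mult_mean s k i)"
  and "cst q (mult_prog M0 k i (s ^ i)) \<le> ennreal mult_const"
proof -
 note ok = approx_al[OF s i] and a = al_bounds[OF s i]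
 have M: "al s i \<le> real M0" using a by simp
 show "val q (mult_prog M0 k i (s ^ i)) (\<lambda>m. ennreal (r ^ m)) = ennreal (mult_pgf s k i r)" if "0 \<le> r"
  unfolding mult_prog_def mult_pgf_def
  using poisson_pgf_law[OF ok a(1) M M0_pos that] poisson_pos_pgf[OF ok a(1) M M0_pos that] by simp
 show "val q (mult_prog M0 k i (s ^ i)) of_nat = ennreal (mult_mean s k i)"
  unfolding mult_prog_def mult_mean_def
  using val_poisson[OF ok a(1) M M0_pos, of q of_nat] poisson_mean[OF a(1)] poisson_pos_mean[OF ok a(1) M M0_pos] by simp
 have "cst q (poisson M0 (scaled (real i) (approx_A (s ^ i)))) \<le> ennreal mult_const"
  by (rule order_trans[OF cst_poisson[OF ok less_imp_le[OF w0_pos] M0_pos]], rule ennreal_leI)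
    (use poisson_const_nonneg bern_const_nonneg[of 0] in \<open>simp add: mult_const_def\<close>)
 moreover have "cst q (poisson_pos M0 (scaled (real i) (approx_A (s ^ i)))) \<le> ennreal mult_const"
  by (rule order_trans[OF cst_poisson_pos[OF ok a(1) M M0_pos less_imp_le[OF w0_pos] a(2)]], rule ennreal_leI)
    (use poisson_const_nonneg bern_const_nonneg[of 0] in \<open>simp add: mult_const_def\<close>)
 ultimately show "cst q (mult_prog M0 k i (s ^ i)) \<le> ennreal mult_const"
  unfolding mult_prog_def by simp
qed

definition gB_inv :: "real \<Rightarrow> nat \<Rightarrow> forest \<times> real \<Rightarrow> bool" where
 "gB_inv s i S \<longleftrightarrow> snd S = s ^ (i - 1)"

lemma gB_step_eq:
 assumes i: "2 \<le> i" and I: "gB_inv s i S"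
 shows "gB_step rec M0 s k i S = do {
     t' \<leftarrow> detp (s ^ i) 1;
     tick 1;
     m \<leftarrow> mult_prog M0 k i t';
     F' \<leftarrow> for_loop m 1 (\<lambda>_. add_copies rec t' i) (fst S);
     ret (F', t') }"
proof -
 have "s ^ (i - 1) * s = s ^ i" using i by (cases i) auto
 thus ?thesis using I unfolding gB_step_def gB_inv_def calc_eq by (simp add: case_prod_beta)
qed

lemma gB_step_post: "2 \<le> i \<Longrightarrow> gB_inv s i S \<Longrightarrow> post (gB_step rec M0 s k i S) (gB_inv s (Suc i))"
 unfolding gB_step_eq
 by (intro post_pbind[of "detp (s ^ i) 1" "\<lambda>t. t = s ^ i"] post_pbind' post_ret)
   (auto simp: post_detp gB_inv_def)

lemma val_gB_step:
 assumes rec: "\<And>t. good q (rec t)" and s: "0 < s" "s \<le> s0" and i: "2 \<le> i" and I: "gB_inv s i S"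
  and z: "0 \<le> z" and g: "val q (rec (s ^ i)) (\<lambda>T. ennreal (z ^ (i * tsize T))) = ennreal g" "0 \<le> g"
 shows "val q (gB_step rec M0 s k i S) (\<lambda>S. ennreal (z ^ fsize (fst S))) =
  ennreal (z ^ fsize (fst S)) * ennreal (mult_pgf s k i g)"
proof -
 note gd = good_pbind good_detp good_tick good_mult_prog good_for_loop good_add_copies[OF rec] good_ret rec
 have step: "val q (add_copies rec (s ^ i) i F) (\<lambda>F. ennreal (z ^ fsize F)) = ennreal (z ^ fsize F) * ennreal g" for F
 proof -
  have "val q (add_copies rec (s ^ i) i F) (\<lambda>F. ennreal (z ^ fsize F)) =
   val q (rec (s ^ i)) (\<lambda>T. ennreal (z ^ fsize F) * ennreal (z ^ (i * tsize T)))"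
   unfolding add_copies_def using z
   by (simp add: val_pbind gd val_tick val_ret power_add ennreal_mult)
  thus ?thesis unfolding val_cmult[OF rec] g .
 qed
 have l: "val q (for_loop m 1 (\<lambda>_. add_copies rec (s ^ i) i) F) (\<lambda>F. ennreal (z ^ fsize F)) = ennreal (z ^ fsize F) * ennreal (g ^ m)" for m F
  using val_for_loop_mult[of q "\<lambda>_. add_copies rec (s ^ i) i" "\<lambda>F. ennreal (z ^ fsize F)" "ennreal g" m 1 F, OF good_add_copies[OF rec] step] g
  by (simp add: ennreal_power)
 have "val q (gB_step rec M0 s k i S) (\<lambda>S. ennreal (z ^ fsize (fst S))) =
  val q (mult_prog M0 k i (s ^ i)) (\<lambda>m. val q (for_loop m 1 (\<lambda>_. add_copies rec (s ^ i) i) (fst S)) (\<lambda>F. ennreal (z ^ fsize F)))"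
  unfolding gB_step_eq[OF i I] by (simp add: val_pbind gd val_tick val_ret val_detp)
 also have "... = ennreal (z ^ fsize (fst S)) * ennreal (mult_pgf s k i g)"
  unfolding l val_cmult[OF good_mult_prog] mult_prog_law(1)[OF s i g(2)] ..
 finally show ?thesis .
qed

text \<open>The normalisations of the multiplicities cancel against the law of the maximal index.
  What remains is a difference of consecutive exponentials, so that the sum over \<open>k\<close>
  telescopes.\<close>

lemma mi_pmf_mult_pgf:
 assumes s: "0 < s" "s \<le> s0"
 shows "mi_pmf s k * (\<Prod>j=2..<2 + (k - 1). mult_pgf s k j (g j)) =
  (if k = 0 then 1 else exp (\<Sum>j\<in>{2..k}. al s j * g j) - exp (\<Sum>j\<in>{2..k - 1}. al s j * g j)) / Phi s"
proof (cases "k \<le> 1")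
 case True
 hence "k = 0 \<or> k = 1" by auto
 thus ?thesis by (auto simp: mi_pmf_def)
next
 case False
 then obtain m where m: "k = Suc m" "1 \<le> m" by (cases k) auto
 have "(\<Prod>j=2..<2 + (k - 1). mult_pgf s k j (g j)) = (\<Prod>j\<in>{2..m}. mult_pgf s k j (g j)) * mult_pgf s k k (g k)"
 proof -
  have "{2..<2 + (k - 1)} = insert k {2..m}" using m by auto
  thus ?thesis using m by simp
 qed
 also have "(\<Prod>j\<in>{2..m}. mult_pgf s k j (g j)) = exp (\<Sum>j\<in>{2..m}. al s j * (g j - 1))"
  unfolding exp_sum[OF finite_atLeastAtMost] by (rule prod.cong) (auto simp: mult_pgf_def m)
 also have "(\<Sum>j\<in>{2..m}. al s j * (g j - 1)) = (\<Sum>j\<in>{2..m}. al s j * g j) - mi_head s m"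
  unfolding mi_head_def by (simp add: right_diff_distrib sum_subtractf)
 finally have "(\<Prod>j=2..<2 + (k - 1). mult_pgf s k j (g j)) =
  exp (\<Sum>j\<in>{2..m}. al s j * g j) / exp (mi_head s m) * ((exp (al s k * g k) - 1) / (exp (al s k) - 1))"
  by (simp add: mult_pgf_def exp_diff)
 moreover have "exp (al s k) - 1 \<noteq> 0" using al_bounds(1)[OF s, of k] m by simp
 moreover have "exp (\<Sum>j\<in>{2..k}. al s j * g j) = exp (\<Sum>j\<in>{2..m}. al s j * g j) * exp (al s k * g k)"
  using m by (simp add: exp_add[symmetric])
 moreover have "mi_pmf s k = exp (mi_head s m) * (exp (al s k) - 1) / Phi s" using m by (simp add: mi_pmf_def)
 moreover have "E * D / P * (X / E * ((Y - 1) / D)) = (X * Y - X) / P" if "D \<noteq> 0" "E \<noteq> 0" for E D P X Y :: real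
  using that by (cases "P = 0") (simp_all add: field_simps)
 ultimately show ?thesis using m by simp
qed

text \<open>Stated for an arbitrary tree sampler with generating functions \<open>g i\<close>, so
  that it applies to every cut-off recursion as well as to the limit.\<close>

lemma gammaB_with_pgf:
 assumes rec: "\<And>t. good q (rec t)" and s: "0 < s" "s \<le> s0" and z: "0 \<le> z"
  and g: "\<And>i. 2 \<le> i \<Longrightarrow> val q (rec (s ^ i)) (\<lambda>T. ennreal (z ^ (i * tsize T))) = ennreal (g i)"
  "\<And>i. 2 \<le> i \<Longrightarrow> 0 \<le> g i" and sm: "summable (\<lambda>i. al s (i + 2) * g (i + 2))"
 shows "val q (gammaB_with rec M0 B q s) (\<lambda>F. ennreal (z ^ fsize F)) =
  ennreal (exp (\<Sum>i. al s (i + 2) * g (i + 2)) / Phi s)"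
proof -
 let ?X = "\<Sum>i. al s (i + 2) * g (i + 2)"
 note gd = good_pbind good_tick good_max_index good_for_loop good_gB_step[OF rec] good_ret
 have l: "val q (for_loop (k - 1) 2 (gB_step rec M0 s k) ({#}, s)) (\<lambda>S. ennreal (z ^ fsize (fst S))) =
  ennreal (\<Prod>j=2..<2 + (k - 1). mult_pgf s k j (g j))" for k
 proof -
  have "val q (for_loop (k - 1) 2 (gB_step rec M0 s k) ({#}, s)) (\<lambda>S. ennreal (z ^ fsize (fst S))) =
   ennreal (z ^ fsize (fst ({#}, s))) * (\<Prod>j=2..<2 + (k - 1). ennreal (mult_pgf s k j (g j)))"
   by (rule val_for_loop_prod[where I = "gB_inv s"])
     (auto intro!: good_gB_step[OF rec] gB_step_post val_gB_step[OF rec s _ _ z] g simp: gB_inv_def)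
  also have "(\<Prod>j=2..<2 + (k - 1). ennreal (mult_pgf s k j (g j))) = ennreal (\<Prod>j=2..<2 + (k - 1). mult_pgf s k j (g j))"
   by (rule prod_ennreal) (auto intro!: mult_pgf_nonneg s g)
  finally show ?thesis by simp
 qed
 define E where "E k = exp (\<Sum>j\<in>{2..k}. al s j * g j)" for k
 have pn: "0 \<le> (\<Prod>j=2..<2 + (k - 1). mult_pgf s k j (g j))" for k
  by (intro prod_nonneg ballI) (auto intro!: mult_pgf_nonneg s g)
 define f where "f k = mi_pmf s k * (\<Prod>j=2..<2 + (k - 1). mult_pgf s k j (g j))" for k
 have f0: "0 \<le> f k" for k unfolding f_def by (intro mult_nonneg_nonneg mi_pmf_nonneg s prod_nonneg) (auto intro!: mult_pgf_nonneg s g)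
 have f: "f k = (if k = 0 then 1 else E k - E (k - 1)) / Phi s" for k
  unfolding f_def E_def by (rule mi_pmf_mult_pgf[OF s])
 have sh: "(\<Sum>j\<in>{2..k}. al s j * g j) = (\<Sum>i<k - 1. al s (i + 2) * g (i + 2))" for k
  by (rule sum.reindex_bij_witness[of _ "\<lambda>i. i + 2" "\<lambda>j. j - 2"]) (auto simp del: add_2_eq_Suc')
 have "E \<longlonglongrightarrow> exp ?X"
 proof -
  have "(\<lambda>k. \<Sum>i<k. al s (i + 2) * g (i + 2)) \<longlonglongrightarrow> ?X"
   using sm by (rule summable_LIMSEQ)
  hence "(\<lambda>k. \<Sum>i<Suc k - 1. al s (i + 2) * g (i + 2)) \<longlonglongrightarrow> ?X" by simp
  hence "(\<lambda>k. \<Sum>i<k - 1. al s (i + 2) * g (i + 2)) \<longlonglongrightarrow> ?X"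
   by (rule LIMSEQ_imp_Suc)
  thus ?thesis unfolding E_def sh by (intro tendsto_exp)
 qed
 from telescope_sums[OF this] have "(\<lambda>k. (E (Suc k) - E k) / Phi s) sums ((exp ?X - E 0) / Phi s)"
  by (rule sums_divide)
 hence "(\<lambda>k. f (Suc k)) sums ((exp ?X - E 0) / Phi s)"
  unfolding f by simp
 hence "f sums ((exp ?X - E 0) / Phi s + f 0)" by (simp only: sums_Suc_iff)
 moreover have "(exp ?X - E 0) / Phi s + f 0 = exp ?X / Phi s"
  unfolding f E_def by (simp add: diff_divide_distrib)
 ultimately have fs: "f sums (exp ?X / Phi s)" by simp
 have "val q (gammaB_with rec M0 B q s) (\<lambda>F. ennreal (z ^ fsize F)) =
  val q (max_index B q s) (\<lambda>k. val q (for_loop (k - 1) 2 (gB_step rec M0 s k) ({#}, s)) (\<lambda>S. ennreal (z ^ fsize (fst S))))"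
  unfolding gammaB_with_alt by (simp add: val_pbind gd val_tick val_ret)
 also have "... = (\<Sum>k. ennreal (f k))"
  unfolding l val_max_index[OF s] f_def
  by (simp only: ennreal_mult[OF mi_pmf_nonneg[OF s] pn])
 also have "... = ennreal (exp ?X / Phi s)" by (rule suminf_ennreal_eq[OF f0 fs])
 finally show ?thesis .
qed

end

section \<open>Size distributions of the Boltzmann samplers\<close>

context polya_params
begin

lemma A_pos: "0 < t \<Longrightarrow> t \<le> rho \<Longrightarrow> 0 < A_gf t"
 using A_gf_ge[OF A_ok[of t]] by simp

lemma t0_power: "0 < t \<Longrightarrow> t \<le> t0 \<Longrightarrow> 0 < t ^ Suc i \<and> t ^ Suc i \<le> t0"
proof -
 assume t: "0 < t" "t \<le> t0"
 have "t ^ Suc i \<le> t ^ 1" by (rule power_decreasing) (use t t0_bounds in auto)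
 from order_trans[OF this[unfolded power_one_right] t(2)] show ?thesis using t(1) zero_less_power by blast
qed

lemma approx_A_t0:
 assumes t: "0 < t" "t \<le> t0"
 shows "approx_ok 39 (approx_A t) (A_gf t) w0" "0 < A_gf t" "A_gf t \<le> real M0"
proof -
 have "approx_ok 39 (approx_A t) (A_gf t) (t / (rho * (1 - sqrt rho)))"
  using t by (intro approx_ok_A) (auto simp: t0_def)
 thus "approx_ok 39 (approx_A t) (A_gf t) w0"
 proof (rule approx_ok_mono)
  have "t / (rho * (1 - sqrt rho)) \<le> rho / (rho * (1 - sqrt rho))"
   using t t0_bounds rho_pos sqrt_rho by (intro divide_right_mono) auto
  thus "t / (rho * (1 - sqrt rho)) \<le> w0" using rho_pos by (simp add: w0_def)
 qed simp
 show "0 < A_gf t" "A_gf t \<le> real M0" using A_pos[of t] M0_gt[of t] t t0_bounds by auto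
qed

definition add_tree :: "(real \<Rightarrow> polya prog) \<Rightarrow> real \<Rightarrow> forest \<Rightarrow> forest prog" where
 "add_tree rec t Ts = do { T \<leftarrow> rec t; tick 1; ret (add_mset T Ts) }"

lemma gA_body_alt: "gA_body M0 B q rec t = do {
   tick 1;
   x \<leftarrow> poisson M0 (approx_A t);
   Ts \<leftarrow> for_loop x 1 (\<lambda>_. add_tree rec t) {#};
   F \<leftarrow> gammaB_with rec M0 B q t;
   tick (size F);
   ret (Node (Ts + F)) }"
 unfolding gA_body_def add_tree_def[abs_def] ..

lemma good_add_tree: "(\<And>t. good q' (rec t)) \<Longrightarrow> good q' (add_tree rec t Ts)"
 unfolding add_tree_def by (intro good_pbind good_tick good_ret)

text \<open>The root, the Poisson many subtrees and the forest contribute independent factors with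
  denominators \<open>exp (A_gf t)\<close> and \<open>Phi t\<close>; the functional equation merges
  these into \<open>A_gf t / t\<close>.\<close>

lemma gA_body_pgf:
 assumes rec: "\<And>t. good q (rec t)" and t: "0 < t" "t \<le> t0" and z: "0 \<le> z"
  and g: "\<And>i. 1 \<le> i \<Longrightarrow> val q (rec (t ^ i)) (\<lambda>T. ennreal (z ^ (i * tsize T))) = ennreal (g i)"
  "\<And>i. 1 \<le> i \<Longrightarrow> 0 \<le> g i" and sm: "summable (\<lambda>i. al t (Suc i) * g (Suc i))"
 shows "val q (gA_body M0 B q rec t) (\<lambda>T. ennreal (z ^ tsize T)) =
  ennreal (t * z * exp (\<Sum>i. al t (Suc i) * g (Suc i)) / A_gf t)"
proof -
 let ?X = "\<Sum>i. al t (i + 2) * g (i + 2)"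
 note gd = good_pbind good_tick good_poisson approx_det_A good_for_loop good_add_tree[OF rec] good_gammaB_with[OF rec] good_ret rec
 have ts: "0 < t" "t \<le> s0" using t t0_bounds by auto
 have g1: "val q (rec t) (\<lambda>T. ennreal (z ^ tsize T)) = ennreal (g 1)" using g(1)[of 1] by simp
 have step: "val q (add_tree rec t Ts) (\<lambda>Ts. ennreal (z ^ fsize Ts)) = ennreal (z ^ fsize Ts) * ennreal (g 1)" for Ts
 proof -
  have "val q (add_tree rec t Ts) (\<lambda>Ts. ennreal (z ^ fsize Ts)) =
   val q (rec t) (\<lambda>T. ennreal (z ^ fsize Ts) * ennreal (z ^ tsize T))"
   unfolding add_tree_def using z
   by (simp add: val_pbind gd val_tick val_ret power_add ennreal_mult mult.commute)
  thus ?thesis unfolding val_cmult[OF rec] g1 .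
 qed
 have l: "val q (for_loop x 1 (\<lambda>_. add_tree rec t) {#}) (\<lambda>F. ennreal (z ^ fsize F)) = ennreal (g 1 ^ x)" for x
  using val_for_loop_mult[of q "\<lambda>_. add_tree rec t" "\<lambda>F. ennreal (z ^ fsize F)" "ennreal (g 1)" x 1 "{#}", OF good_add_tree[OF rec] step] g(2)[of 1]
  by (simp add: ennreal_power)
 have sm2: "summable (\<lambda>i. al t (i + 2) * g (i + 2))"
  using summable_ignore_initial_segment[OF sm, of 1] by (simp add: numeral_2_eq_2)
 have F: "val q (gammaB_with rec M0 B q t) (\<lambda>F. ennreal (z ^ fsize F)) = ennreal (exp ?X / Phi t)"
  by (rule gammaB_with_pgf[OF rec ts z _ _ sm2]) (use g in auto)
 have z4: "ennreal (z ^ tsize (Node (Ts + F))) = ennreal z * (ennreal (z ^ fsize Ts) * ennreal (z ^ fsize F))" for Ts F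
  using z by (simp add: power_add ennreal_mult tsize_Node del: tsize.simps)
 have "val q (gA_body M0 B q rec t) (\<lambda>T. ennreal (z ^ tsize T)) =
  val q (poisson M0 (approx_A t)) (\<lambda>x. val q (for_loop x 1 (\<lambda>_. add_tree rec t) {#})
   (\<lambda>Ts. val q (gammaB_with rec M0 B q t) (\<lambda>F. ennreal (z ^ tsize (Node (Ts + F))))))"
  unfolding gA_body_alt by (simp add: val_pbind gd val_tick val_ret del: tsize_Node tsize.simps)
 also have "... = ennreal z * (val q (poisson M0 (approx_A t)) (\<lambda>x. ennreal (g 1 ^ x)) *
   ennreal (exp ?X / Phi t))"
  unfolding z4 val_cmult[OF good_gammaB_with[OF rec]] F
  by (simp add: val_cmult val_multc gd l mult.assoc[symmetric] del: One_nat_def)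
 also have "val q (poisson M0 (approx_A t)) (\<lambda>x. ennreal (g 1 ^ x)) = ennreal (exp (A_gf t * (g 1 - 1)))"
  using approx_A_t0[OF t] M0_pos g(2)[of 1] by (intro poisson_pgf_law) auto
 also have "ennreal z * (ennreal (exp (A_gf t * (g 1 - 1))) * ennreal (exp ?X / Phi t))
   = ennreal (z * (exp (A_gf t * (g 1 - 1)) * (exp ?X / Phi t)))"
 proof -
  have "ennreal z * (ennreal a * ennreal b) = ennreal (z * (a * b))" if "0 \<le> a" "0 \<le> b" for a b
   using z that by (simp add: ennreal_mult)
  thus ?thesis using Phi_pos[of t] by simp
 qed
 also have "z * (exp (A_gf t * (g 1 - 1)) * (exp ?X / Phi t)) =
  t * z * exp (\<Sum>i. al t (Suc i) * g (Suc i)) / A_gf t"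
 proof -
  have A: "A_gf t = t * exp (A_gf t) * Phi t" by (rule A_gf_functional_Phi[OF A_ok]) (use t t0_bounds in auto)
  have "(\<Sum>i. al t (Suc i) * g (Suc i)) = A_gf t * g 1 + ?X"
   using suminf_split_head[OF sm] by (simp add: al_def numeral_2_eq_2)
  hence e1: "exp (\<Sum>i. al t (Suc i) * g (Suc i)) = exp (A_gf t * g 1) * exp ?X"
   by (simp add: exp_add)
  have e2: "exp (A_gf t * (g 1 - 1)) = exp (A_gf t * g 1) / exp (A_gf t)"
   by (simp add: right_diff_distrib exp_diff)
  have e3: "z * (X / E * (Y / P)) = t * z * (X * Y) / (t * E * P)" if "P \<noteq> 0" "E \<noteq> 0" for X Y E P :: real
   using that t by (simp add: field_simps)
  have P: "Phi t \<noteq> 0" "exp (A_gf t) \<noteq> 0" using Phi_pos[of t] by auto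
  show ?thesis unfolding e1 e2 e3[OF P] A[symmetric] ..
 qed
 finally show ?thesis .
qed

lemma A_ok_tz: "0 < t \<Longrightarrow> 0 < z \<Longrightarrow> t * z \<le> rho \<Longrightarrow> A_ok (t * z)"
 by (rule A_ok) auto

lemma tz_power:
 assumes "0 < t" "0 < z" "t * z \<le> rho"
 shows "0 < z ^ Suc i" "t ^ Suc i * z ^ Suc i = (t * z) ^ Suc i" "t ^ Suc i * z ^ Suc i \<le> rho"
proof -
 have "(t * z) ^ Suc i \<le> (t * z) ^ 1" by (rule power_decreasing) (use assms rho_less in auto)
 from order_trans[OF this[unfolded power_one_right] assms(3)] show "t ^ Suc i * z ^ Suc i \<le> rho" unfolding power_mult_distrib .
 show "t ^ Suc i * z ^ Suc i = (t * z) ^ Suc i" by (simp add: power_mult_distrib mult_ac)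
 show "0 < z ^ Suc i" using assms by simp
qed

text \<open>The assumed bound makes the generating functions of the recursive calls finite and their
  weighted sum convergent. Passing to the products \<open>a i\<close> allows upper and lower
  estimates alike to be obtained by comparing \<open>a\<close> with the series of the functional
  equation.\<close>

lemma gA_body_pgf_bounded:
 assumes rec: "\<And>t. good q (rec t)" and t: "0 < t" "t \<le> t0" and z: "0 < z" "t * z \<le> rho"
  and le: "\<And>i. val q (rec (t ^ Suc i)) (\<lambda>T. ennreal (z ^ (Suc i * tsize T))) \<le> ennreal (A_gf ((t * z) ^ Suc i) / A_gf (t ^ Suc i))"
 obtains a where "\<And>i. 0 \<le> a i" "\<And>i. a i \<le> A_gf ((t * z) ^ Suc i) / real (Suc i)" "summable a"
  "\<And>i. val q (rec (t ^ Suc i)) (\<lambda>T. ennreal (z ^ (Suc i * tsize T))) = ennreal (a i / al t (Suc i))"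
  "val q (gA_body M0 B q rec t) (\<lambda>T. ennreal (z ^ tsize T)) = ennreal (t * z * exp (\<Sum>i. a i) / A_gf t)"
proof -
 define g where "g i = enn2real (val q (rec (t ^ i)) (\<lambda>T. ennreal (z ^ (i * tsize T))))" for i
 have fin: "val q (rec (t ^ Suc i)) (\<lambda>T. ennreal (z ^ (Suc i * tsize T))) = ennreal (g (Suc i))" for i
  unfolding g_def using le[of i] by (metis ennreal_enn2real ennreal_less_top order_le_less_trans)
 have A0: "0 \<le> A_gf ((t * z) ^ Suc i)" "0 < A_gf (t ^ Suc i)" for i
  using A_gf_nonneg[OF A_ok_power[OF A_ok_tz[OF t(1) z]]] A_pos[of "t ^ Suc i"] t0_power[OF t, of i] t0_bounds by auto
 have gle: "g (Suc i) \<le> A_gf ((t * z) ^ Suc i) / A_gf (t ^ Suc i)" for i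
  using le[of i] A0[of i] unfolding fin by (subst (asm) ennreal_le_iff) auto
 have g0: "0 \<le> g i" for i by (simp add: g_def)
 have al0: "0 < al t (Suc i)" for i using A0(2)[of i] by (simp add: al_def del: power_Suc)
 have ale: "al t (Suc i) * g (Suc i) \<le> A_gf ((t * z) ^ Suc i) / real (Suc i)" for i
 proof -
  have "al t (Suc i) * g (Suc i) \<le> al t (Suc i) * (A_gf ((t * z) ^ Suc i) / A_gf (t ^ Suc i))"
   by (intro mult_left_mono gle less_imp_le al0)
  thus ?thesis using A0(2)[of i] by (simp add: al_def del: of_nat_Suc power_Suc)
 qed
 have a0: "0 \<le> al t (Suc i) * g (Suc i)" for i using less_imp_le[OF al0] g0 by simp
 have sm: "summable (\<lambda>i. al t (Suc i) * g (Suc i))"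
  by (rule summable_comparison_test'[OF summable_A_powers[OF A_ok_tz[OF t(1) z]]]) (use ale a0 in auto)
 show thesis
 proof (rule that[OF a0 ale sm])
  show "val q (rec (t ^ Suc i)) (\<lambda>T. ennreal (z ^ (Suc i * tsize T))) = ennreal (al t (Suc i) * g (Suc i) / al t (Suc i))" for i
   using fin[of i] al0[of i] by simp
  show "val q (gA_body M0 B q rec t) (\<lambda>T. ennreal (z ^ tsize T)) = ennreal (t * z * exp (\<Sum>i. al t (Suc i) * g (Suc i)) / A_gf t)"
  proof (rule gA_body_pgf[OF rec t less_imp_le[OF z(1)] _ g0 sm])
   show "val q (rec (t ^ i)) (\<lambda>T. ennreal (z ^ (i * tsize T))) = ennreal (g i)" if "1 \<le> i" for i
    using fin[of "i - 1"] that by simp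
  qed
 qed
qed

text \<open>Induction on the depth, general in \<open>t\<close> and \<open>z\<close> because the
  calls use \<open>t ^ i\<close> and \<open>z ^ i\<close>. The bound reproduces itself by the
  functional equation at \<open>t * z\<close>.\<close>

lemma gA_pgf_le:
 assumes "0 < t" "t \<le> t0" "0 < z" "t * z \<le> rho"
 shows "val q (gA M0 B q n t) (\<lambda>T. ennreal (z ^ tsize T)) \<le> ennreal (A_gf (t * z) / A_gf t)"
 using assms
proof (induction n arbitrary: t z)
 case 0
 have "app (gA M0 B q 0 t) f = (\<lambda>_. 0)" for f by (simp add: app_def fun_eq_iff)
 thus ?case by (simp add: val_def wp_def del: gA.simps)
next
 case (Suc n)
 note t = Suc.prems(1,2) and z = Suc.prems(3) and tz = Suc.prems(4)
 have le: "val q (gA M0 B q n (t ^ Suc i)) (\<lambda>T. ennreal (z ^ (Suc i * tsize T))) \<le> ennreal (A_gf ((t * z) ^ Suc i) / A_gf (t ^ Suc i))" for i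
  using Suc.IH[of "t ^ Suc i" "z ^ Suc i"] t0_power[OF t, of i] tz_power[OF t(1) z tz, of i]
  by (simp only: power_mult)
 obtain a where a: "\<And>i. a i \<le> A_gf ((t * z) ^ Suc i) / real (Suc i)" "summable a"
  and v: "val q (gA_body M0 B q (gA M0 B q n) t) (\<lambda>T. ennreal (z ^ tsize T)) = ennreal (t * z * exp (\<Sum>i. a i) / A_gf t)"
  by (rule gA_body_pgf_bounded[OF good_gA t z tz le]) (erule (2) that)
 show ?case unfolding gA.simps v
 proof (intro ennreal_leI divide_right_mono)
  have "(\<Sum>i. a i) \<le> (\<Sum>i. A_gf ((t * z) ^ Suc i) / real (Suc i))"
   by (intro suminf_le a summable_A_powers A_ok_tz t z tz)
  thus "t * z * exp (\<Sum>i. a i) \<le> A_gf (t * z)"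
   unfolding A_gf_functional[OF A_ok_tz[OF t(1) z tz]] using t z by (intro mult_left_mono) auto
  show "0 \<le> A_gf t" using A_pos[of t] t t0_bounds by simp
 qed
qed

text \<open>The upper bound passes from the cut-off recursions to the limit. The lower bound
  iterates the fixed point equation: the truncations \<open>A_part n\<close> propagate by
  \<open>A_part_Suc_le\<close>. At \<open>z = 1\<close> the statement is termination with
  probability 1.\<close>

lemma gammaA_pgf:
 assumes "0 < t" "t \<le> t0" "0 < z" "t * z \<le> rho"
 shows "val q (gammaA M0 B q t) (\<lambda>T. ennreal (z ^ tsize T)) = ennreal (A_gf (t * z) / A_gf t)"
proof (rule antisym)
 have le: "val q (gammaA M0 B q t) (\<lambda>T. ennreal (z ^ tsize T)) \<le> ennreal (A_gf (t * z) / A_gf t)"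
  if "0 < t" "t \<le> t0" "0 < z" "t * z \<le> rho" for t z
  unfolding val_def wp_lim[OF prog_lim_gA good_gA]
  by (rule SUP_least) (use gA_pgf_le[OF that] in \<open>simp add: val_def\<close>)
 show "val q (gammaA M0 B q t) (\<lambda>T. ennreal (z ^ tsize T)) \<le> ennreal (A_gf (t * z) / A_gf t)"
  by (rule le[OF assms])
 have ge: "ennreal (A_part n (t * z) / A_gf t) \<le> val q (gammaA M0 B q t) (\<lambda>T. ennreal (z ^ tsize T))"
  if "0 < t" "t \<le> t0" "0 < z" "t * z \<le> rho" for n t z
  using that
 proof (induction n arbitrary: t z)
  case 0 thus ?case by (simp add: A_part_def)
 next
  case (Suc n)
  note t = Suc.prems(1,2) and z = Suc.prems(3) and tz = Suc.prems(4)
  have leg: "ennreal (A_part n ((t * z) ^ Suc i) / A_gf (t ^ Suc i)) \<le> val q (gammaA M0 B q (t ^ Suc i)) (\<lambda>T. ennreal (z ^ (Suc i * tsize T)))"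
   "val q (gammaA M0 B q (t ^ Suc i)) (\<lambda>T. ennreal (z ^ (Suc i * tsize T))) \<le> ennreal (A_gf ((t * z) ^ Suc i) / A_gf (t ^ Suc i))" for i
   using Suc.IH[of "t ^ Suc i" "z ^ Suc i"] le[of "t ^ Suc i" "z ^ Suc i"] t0_power[OF t, of i] tz_power[OF t(1) z tz, of i]
   by (simp_all only: power_mult)
  obtain a where a: "\<And>i. 0 \<le> a i" "\<And>i. a i \<le> A_gf ((t * z) ^ Suc i) / real (Suc i)" "summable a"
   "\<And>i. val q (gammaA M0 B q (t ^ Suc i)) (\<lambda>T. ennreal (z ^ (Suc i * tsize T))) = ennreal (a i / al t (Suc i))"
   and v: "val q (gA_body M0 B q (gammaA M0 B q) t) (\<lambda>T. ennreal (z ^ tsize T)) = ennreal (t * z * exp (\<Sum>i. a i) / A_gf t)"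
   by (rule gA_body_pgf_bounded[OF good_gammaA t z tz leg(2)]) (rule that)
  have A: "0 < A_gf (t ^ Suc i)" for i using A_pos[of "t ^ Suc i"] t0_power[OF t, of i] t0_bounds by auto
  have ale: "A_part n ((t * z) ^ Suc i) / real (Suc i) \<le> a i" for i
  proof -
   have "0 \<le> a i / al t (Suc i)" using a(1)[of i] A[of i] by (simp add: al_def del: power_Suc of_nat_Suc)
   hence "A_part n ((t * z) ^ Suc i) / A_gf (t ^ Suc i) \<le> a i / al t (Suc i)"
    using leg(1)[of i] unfolding a(4) by (subst (asm) ennreal_le_iff) auto
   thus ?thesis using A[of i] by (simp add: al_def field_simps del: power_Suc of_nat_Suc)
  qed
  have tz1: "0 \<le> t * z" "t * z < 1" using t z tz rho_less by auto
  show ?case unfolding gammaA_fixpoint[of _ _ _ t] v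
  proof (intro ennreal_leI divide_right_mono)
   have "L_part n (t * z) \<le> (\<Sum>i. a i)"
    by (rule sums_le[OF ale L_part_sums[OF tz1] summable_sums[OF a(3)]])
   hence "t * z * exp (L_part n (t * z)) \<le> t * z * exp (\<Sum>i. a i)"
    using tz1 by (intro mult_left_mono) auto
   thus "A_part (Suc n) (t * z) \<le> t * z * exp (\<Sum>i. a i)"
    using A_part_Suc_le[OF tz1, of n] by simp
   show "0 \<le> A_gf t" using A[of 0] by simp
  qed
 qed
 have "(\<lambda>n. ennreal (A_part n (t * z) / A_gf t)) \<longlonglongrightarrow> ennreal (A_gf (t * z) / A_gf t)"
  using assms by (intro tendsto_ennrealI tendsto_divide tendsto_const A_part_lim A_ok_tz)
   (use A_pos[of t] t0_bounds in auto)
 thus "ennreal (A_gf (t * z) / A_gf t) \<le> val q (gammaA M0 B q t) (\<lambda>T. ennreal (z ^ tsize T))"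
  by (rule LIMSEQ_le_const2) (use ge[OF assms] in blast)
qed

lemma gammaB_pgf:
 assumes s: "0 < s" "s \<le> s0" and z: "0 < z" "(s * z)\<^sup>2 \<le> rho"
 shows "val q (gammaB M0 B q s) (\<lambda>F. ennreal (z ^ fsize F)) = ennreal (Phi (s * z) / Phi s)"
proof -
 have sz0: "0 < s * z" using s z by simp
 have sz1: "s * z < 1"
 proof (rule ccontr)
  assume "\<not> s * z < 1"
  hence "1 \<le> (s * z)\<^sup>2" by simp
  thus False using z rho_less by simp
 qed
 have szi: "s ^ i * z ^ i = (s * z) ^ i" "(s * z) ^ i \<le> rho" if "2 \<le> i" for i
  using power_decreasing[OF that, of "s * z"] sz0 sz1 z by (auto simp: power_mult_distrib)
 define g where "g i = A_gf ((s * z) ^ i) / A_gf (s ^ i)" for i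
 have A0: "0 < A_gf (s ^ i)" "0 < A_gf ((s * z) ^ i)" if "2 \<le> i" for i
  using A_pos[of "s ^ i"] A_pos[of "(s * z) ^ i"] s_power(2)[OF s, of i] s_power(3)[OF s that] t0_bounds szi[OF that] sz0 by auto
 have ag: "al s (i + 2) * g (i + 2) = A_gf ((s * z) ^ (i + 2)) / real (i + 2)" for i
  using A0(1)[of "i + 2"] by (simp add: al_def g_def del: power_Suc of_nat_Suc add_2_eq_Suc' of_nat_add power_add)
 have ok: "A_ok ((s * z)\<^sup>2)" using z by (intro A_ok) auto
 have "val q (gammaB M0 B q s) (\<lambda>F. ennreal (z ^ fsize F)) = ennreal (exp (\<Sum>i. al s (i + 2) * g (i + 2)) / Phi s)"
  unfolding gammaB_def
 proof (rule gammaB_with_pgf[OF good_gammaA s less_imp_le[OF z(1)]])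
  fix i :: nat assume i: "2 \<le> i"
  show "0 \<le> g i" using A0[OF i] by (simp add: g_def)
  show "val q (gammaA M0 B q (s ^ i)) (\<lambda>T. ennreal (z ^ (i * tsize T))) = ennreal (g i)"
   using gammaA_pgf[of "s ^ i" "z ^ i"] s_power(2)[OF s, of i] s_power(3)[OF s i] szi[OF i] z by (simp add: g_def power_mult)
 next
  show "summable (\<lambda>i. al s (i + 2) * g (i + 2))" unfolding ag using ok sz0 sz1 by (intro summable_Phi(1)) auto
 qed
 thus ?thesis unfolding ag by (simp add: Phi_def)
qed

text \<open>Bernoulli's inequality gives \<open>n <= z^n / (z - 1)\<close>, so an exponential moment
  bounds the mean.\<close>

lemma val_size_le:
 assumes "good q p" "1 < z" "val q p (\<lambda>x. ennreal (z ^ sz x)) \<le> ennreal C"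
 shows "val q p (\<lambda>x. of_nat (sz x)) \<le> ennreal (C / (z - 1))"
proof -
 have "(of_nat n :: ennreal) \<le> ennreal (1 / (z - 1)) * ennreal (z ^ n)" for n
 proof -
  have "1 + real n * (z - 1) \<le> z ^ n" using Bernoulli_inequality[of "z - 1" n] assms(2) by simp
  hence "real n * (z - 1) \<le> z ^ n" by simp
  hence "real n \<le> z ^ n / (z - 1)" using assms(2) by (simp add: pos_le_divide_eq)
  thus ?thesis unfolding ennreal_of_nat_eq_real_of_nat
   using assms(2) by (subst ennreal_mult[symmetric]) (auto intro: ennreal_leI)
 qed
 hence "val q p (\<lambda>x. of_nat (sz x)) \<le> val q p (\<lambda>x. ennreal (1 / (z - 1)) * ennreal (z ^ sz x))"
  by (rule val_mono)
 also have "... \<le> ennreal (1 / (z - 1)) * ennreal C"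
  unfolding val_cmult[OF assms(1)] by (intro mult_left_mono assms(3)) simp
 also have "... = ennreal (C / (z - 1))" using assms(2) by (subst ennreal_mult'[symmetric]) auto
 finally show ?thesis .
qed

text \<open>\<open>1 / sqrt rho\<close> is the largest \<open>z\<close> with
  \<open>t0 * z <= rho\<close>, the limit of validity of \<open>gammaA_pgf\<close>.\<close>

definition "size_constA = (1 / sqrt rho / rho) / (1 / sqrt rho - 1)"

lemma size_constA_nonneg: "0 \<le> size_constA"
 unfolding size_constA_def using rho_pos sqrt_rho by (intro divide_nonneg_nonneg) (auto simp: field_simps)

lemma gammaA_size:
 assumes t: "0 < t" "t \<le> t0"
 shows "val q (gammaA M0 B q t) (\<lambda>T. of_nat (tsize T)) \<le> ennreal size_constA"
 unfolding size_constA_def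
proof (rule val_size_le[OF good_gammaA])
 let ?z = "1 / sqrt rho"
 show "1 < ?z" using sqrt_rho by simp
 have tz: "t * ?z \<le> rho" using t sqrt_rho by (simp add: t0_def field_simps)
 have "A_gf (t * ?z) / A_gf t \<le> (t * ?z / rho) / t"
  using t t0_bounds tz A_gf_le_quot[of "t * ?z"] A_gf_ge[OF A_ok[of t]] sqrt_rho rho_pos
  by (intro frac_le) auto
 also have "... = ?z / rho" using t by simp
 finally show "val q (gammaA M0 B q t) (\<lambda>T. ennreal (?z ^ tsize T)) \<le> ennreal (?z / rho)"
  using gammaA_pgf[OF t _ tz] sqrt_rho by (simp add: ennreal_leI)
qed

lemma Phi_ge_1: "0 < s \<Longrightarrow> s \<le> s0 \<Longrightarrow> 1 \<le> Phi s"
proof -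
 assume s: "0 < s" "s \<le> s0"
 have "0 \<le> (\<Sum>i. al s (i + 2))"
  by (rule suminf_nonneg[OF summable_al[OF s]]) (rule less_imp_le[OF al_bounds(1)[OF s]], simp)
 thus ?thesis by (simp add: Phi_al[OF s])
qed

lemma Phi_mono:
 assumes "0 \<le> x" "x \<le> y" "A_ok (y\<^sup>2)" "y < 1"
 shows "Phi x \<le> Phi y"
 unfolding Phi_def exp_le_cancel_iff
proof (rule suminf_le)
 have x: "A_ok (x\<^sup>2)" using assms by (intro A_ok_mono[OF assms(3)]) (auto intro: power_mono)
 show "summable (\<lambda>i. A_gf (x ^ (i + 2)) / real (i + 2))" "summable (\<lambda>i. A_gf (y ^ (i + 2)) / real (i + 2))"
  using assms x by (intro summable_Phi(1); simp)+
 show "A_gf (x ^ (i + 2)) / real (i + 2) \<le> A_gf (y ^ (i + 2)) / real (i + 2)" for i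
  using assms by (intro divide_right_mono A_gf_mono summable_Phi(2) power_mono) auto
qed

text \<open>\<open>rho powr (- 1/4)\<close> moves \<open>s0\<close> to \<open>sqrt rho\<close>,
  where \<open>Phi\<close> still converges because only \<open>A_gf\<close> at \<open>rho\<close>
  and below is involved.\<close>

definition "size_constB = Phi (sqrt rho) / (rho powr (- 1 / 4) - 1)"

lemma gammaB_size:
 assumes s: "0 < s" "s \<le> s0"
 shows "val q (gammaB M0 B q s) (\<lambda>F. of_nat (fsize F)) \<le> ennreal size_constB"
 unfolding size_constB_def
proof (rule val_size_le[OF good_gammaB])
 let ?z = "rho powr (- 1 / 4)"
 show z1: "1 < ?z" using rho_pos rho_less powr_less_mono'[of rho "-1/4" 0] by simp
 have "s * ?z \<le> s0 * ?z" using s by (intro mult_right_mono) auto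
 also have "... = sqrt rho" using rho_pos by (simp add: s0_def powr_add[symmetric] powr_half_sqrt[symmetric])
 finally have sz: "s * ?z \<le> sqrt rho" .
 hence "(s * ?z)\<^sup>2 \<le> (sqrt rho)\<^sup>2" using s by (intro power_mono) auto
 hence sz2: "(s * ?z)\<^sup>2 \<le> rho" using rho_pos by simp
 have "Phi (s * ?z) / Phi s \<le> Phi (sqrt rho) / 1"
  using Phi_ge_1[OF s] sz s Phi_pos rho_pos sqrt_rho A_ok_rho
  by (intro frac_le Phi_mono) (auto simp: less_imp_le)
 thus "val q (gammaB M0 B q s) (\<lambda>F. ennreal (?z ^ fsize F)) \<le> ennreal (Phi (sqrt rho))"
  using gammaB_pgf[OF s _ sz2] z1 rho_pos by (simp add: ennreal_leI)
qed

end

lemma ennreal_num_add: "1 + (1 + x) = 2 + x" "2 + (x + 1) = 3 + x" for x :: ennreal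
proof -
 show "1 + (1 + x) = 2 + x" by (simp only: add.assoc[symmetric] one_add_one)
 have "2 + (x + 1) = (2 + 1) + x" by (simp only: add_ac)
 thus "2 + (x + 1) = 3 + x" by simp
qed

section \<open>Expected cost of the Boltzmann samplers\<close>

context polya_params
begin

definition "theta = ln (5 / 2 :: real)"

lemma theta: "0 < theta" "theta < 1"
proof -
 show "0 < theta" unfolding theta_def by simp
 \<comment> \<open>Squaring the quadratic Taylor bound at 1/2 gives
   \<open>exp 1 >= 169/64 > 5/2\<close>.\<close>
 have "1 + 1/2 + (1/2)^2 / 2 \<le> exp (1/2 :: real)" by (rule exp_lower_Taylor_quadratic) simp
 hence "(13/8 :: real) \<le> exp (1/2)" by (simp add: power2_eq_square)
 hence "(13/8 :: real) * (13/8) \<le> exp (1/2) * exp (1/2)" by (intro mult_mono) auto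
 also have "... = exp 1" by (simp flip: exp_add)
 finally have "5/2 < exp (1 :: real)" by simp
 hence "ln (5 / 2 :: real) < ln (exp 1)" by (subst ln_less_cancel_iff) auto
 thus "theta < 1" unfolding theta_def by simp
qed

text \<open>The mean number of children in \<^const>\<open>gammaA\<close>, that is, of recursive calls, is
 \<open>ln (A_gf t / t)\<close>.\<close>

lemma mean_children:
 assumes t: "0 < t" "t \<le> t0"
 shows "summable (\<lambda>i. al t (Suc i))" "(\<Sum>i. al t (Suc i)) \<le> theta"
  "A_gf t + (\<Sum>i. al t (i + 2)) \<le> theta"
proof -
 let ?X = "t - t\<^sup>2 / rho"
 have tr: "t \<le> rho" using t t0_bounds by simp
 have ok: "A_ok t" using t tr by (intro A_ok) auto
 show sm: "summable (\<lambda>i. al t (Suc i))" unfolding al_def by (rule summable_A_powers[OF ok])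
 have x: "0 < t / rho" "t / rho \<le> 1" using t tr rho_pos by auto
 \<comment> \<open>For \<open>k >= 2\<close> one has \<open>t^k <= (t / rho)^2 * rho^k\<close>;
   \<open>?X\<close> corrects the linear term, whose coefficient is 1. The tail is thereby compared
   with the known bound at \<open>rho\<close>.\<close>
 have "A_part n t \<le> ?X + (t / rho)\<^sup>2 * A_part n rho" for n
 proof (induction n)
  case 0
  have "t * t \<le> t * rho" using t tr by (intro mult_left_mono) auto
  thus ?case using rho_pos t by (simp add: A_part_def power2_eq_square field_simps)
 next
  case (Suc n)
  show ?case
  proof (cases n)
   case 0 thus ?thesis using rho_pos by (simp add: A_part_def power2_eq_square field_simps)
  next
   case (Suc m)
   have "t ^ Suc n = (t / rho) ^ Suc n * rho ^ Suc n" using rho_pos by (simp add: power_divide del: power_Suc)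
   also have "... \<le> (t / rho)\<^sup>2 * rho ^ Suc n"
    using x rho_pos Suc by (intro mult_right_mono power_decreasing) auto
   finally have "real (a_coeff (Suc n)) * t ^ Suc n \<le> (t / rho)\<^sup>2 * (real (a_coeff (Suc n)) * rho ^ Suc n)"
    by (metis mult.left_commute mult_left_mono of_nat_0_le_iff)
   hence "A_part (Suc n) t \<le> A_part n t + (t / rho)\<^sup>2 * (real (a_coeff (Suc n)) * rho ^ Suc n)"
    by (simp add: A_part_def)
   also have "... \<le> ?X + (t / rho)\<^sup>2 * A_part n rho + (t / rho)\<^sup>2 * (real (a_coeff (Suc n)) * rho ^ Suc n)"
    using Suc.IH by simp
   also have "... = ?X + (t / rho)\<^sup>2 * A_part (Suc n) rho"
    by (simp add: A_part_def distrib_left)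
   finally show ?thesis .
  qed
 qed
 also have "?X + (t / rho)\<^sup>2 * A_part n rho \<le> ?X + (t / rho)\<^sup>2 * 1" for n
  by (intro add_left_mono mult_left_mono A_part_rho_le) auto
 finally have "A_gf t \<le> ?X + (t / rho)\<^sup>2"
  by (intro LIMSEQ_le_const2[OF A_part_lim[OF ok]]) auto
 also have "... = t * (1 + (t / rho) * (1 - rho) / rho)"
  using rho_pos by (simp add: field_simps power2_eq_square)
 also have "... \<le> t * (5 / 2)"
 proof (intro mult_left_mono)
  \<comment> \<open>The factor grows with \<open>t\<close>, and at \<open>t0\<close> it equals
    \<open>1 + 1 / sqrt rho - sqrt rho\<close>; with \<open>rho >= 1/4\<close> this is at most
    \<open>1 + 2 - 1/2\<close>.\<close>
  have s: "1 / 2 \<le> sqrt rho" using rho_ge by (intro real_le_rsqrt) (simp add: power2_eq_square)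
  have "t / rho \<le> sqrt rho" using t rho_pos by (simp add: t0_def field_simps)
  hence "(t / rho) * (1 - rho) / rho \<le> sqrt rho * (1 - rho) / rho"
   using rho_less rho_pos by (intro divide_right_mono mult_right_mono) auto
  also have "... = 1 / sqrt rho - sqrt rho"
  proof -
   have r: "rho = sqrt rho * sqrt rho" using rho_pos by simp
   have "s * (1 - s * s) / (s * s) = 1 / s - s" if "s \<noteq> 0" for s :: real using that by (simp add: field_simps)
   thus ?thesis using r sqrt_rho by (metis less_irrefl)
  qed
  also have "... \<le> 1 / (1 / 2) - 1 / 2" using s rho_pos by (intro diff_mono divide_left_mono) auto
  finally show "1 + (t / rho) * (1 - rho) / rho \<le> 5 / 2" by simp
 qed (use t in simp)
 finally have le: "A_gf t \<le> t * (5 / 2)" .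
 have "A_gf t = t * exp (\<Sum>i. al t (Suc i))" unfolding al_def by (rule A_gf_functional[OF ok])
 with le have "exp (\<Sum>i. al t (Suc i)) \<le> 5 / 2" using t by simp
 thus l: "(\<Sum>i. al t (Suc i)) \<le> theta" unfolding theta_def by (metis exp_gt_zero ln_exp ln_le_cancel_iff less_le_trans)
 have "(\<Sum>i. al t (Suc i)) = A_gf t + (\<Sum>i. al t (i + 2))"
  using suminf_split_head[OF sm] by (simp add: al_def numeral_2_eq_2)
 with l show "A_gf t + (\<Sum>i. al t (i + 2)) \<le> theta" by simp
qed

lemma sum_A_powers_le:
 assumes s: "0 < s" "s \<le> s0"
 shows "summable (\<lambda>i. A_gf (s ^ (i + 2)))" "(\<Sum>i. A_gf (s ^ (i + 2))) \<le> 1 / (1 - s0)"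
  "(\<Sum>i. al s (i + 2)) \<le> 1 / (1 - s0)"
proof -
 have t: "0 < s ^ (i + 2)" "s ^ (i + 2) \<le> t0" "s ^ (i + 2) \<le> rho" for i
 proof -
  show "0 < s ^ (i + 2)" by (rule s_power(2)[OF s])
  show 1: "s ^ (i + 2) \<le> t0" by (rule s_power(3)[OF s]) simp
  thus "s ^ (i + 2) \<le> rho" using t0_bounds by simp
 qed
 have g: "summable (\<lambda>i. s0 ^ i)" "(\<Sum>i. s0 ^ i) = 1 / (1 - s0)"
  using s0_bounds by (auto intro: summable_geometric simp: suminf_geometric)
 have le: "A_gf (s ^ (i + 2)) \<le> s0 ^ i" for i
 proof -
  have "A_gf (s ^ (i + 2)) \<le> s ^ (i + 2) / rho" using t[of i] by (intro A_gf_le_quot) auto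
  also have "... = s ^ i * (s\<^sup>2 / rho)" unfolding power_add by simp
  also have "... \<le> s0 ^ i * 1"
   using s t(3)[of 0] rho_pos by (intro mult_mono power_mono) (auto simp: power2_eq_square)
  finally show ?thesis by simp
 qed
 have p: "0 \<le> A_gf (s ^ (i + 2))" for i using A_pos[OF t(1,3)] by (simp add: less_imp_le)
 show sm: "summable (\<lambda>i. A_gf (s ^ (i + 2)))"
  by (rule summable_comparison_test'[OF g(1), of 0]) (use le p in auto)
 show "(\<Sum>i. A_gf (s ^ (i + 2))) \<le> 1 / (1 - s0)"
  unfolding g(2)[symmetric] by (intro suminf_le le sm g)
 have "al s (i + 2) \<le> s0 ^ i" for i
 proof -
  have "al s (i + 2) \<le> A_gf (s ^ (i + 2)) / 1" unfolding al_def using p[of i] by (intro divide_left_mono) auto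
  thus ?thesis using le[of i] by simp
 qed
 thus "(\<Sum>i. al s (i + 2)) \<le> 1 / (1 - s0)"
  unfolding g(2)[symmetric] by (intro suminf_le summable_al s g)
qed

lemma sum_indices: "(\<Sum>j=2..<2 + (k - 1). f j) = (\<Sum>i. if i + 2 \<le> k then f (i + 2) else (0::ennreal))"
proof -
 have "(\<Sum>i. if i + 2 \<le> k then f (i + 2) else 0) = (\<Sum>i<k - 1. if i + 2 \<le> k then f (i + 2) else 0)"
  by (rule suminf_finite) auto
 also have "... = (\<Sum>j=2..<2 + (k - 1). f j)"
  by (rule sum.reindex_bij_witness[of _ "\<lambda>j. j - 2" "\<lambda>i. i + 2"]) (auto simp del: add_2_eq_Suc')
 finally show ?thesis ..
qed

text \<open>The index drawn by \<^const>\<open>max_index\<close> is the largest one with a positive multiplicity, so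
 the multiplicity of \<open>i\<close> has the unconditional mean \<open>al s i\<close>.\<close>

lemma val_mult_mean_le:
 assumes s: "0 < s" "s \<le> s0" and i: "2 \<le> i"
 shows "val q (max_index B q s) (\<lambda>k. if i \<le> k then ennreal (mult_mean s k i) else 0) \<le> ennreal (al s i)"
proof -
 let ?X = "\<lambda>k. if i \<le> k then ennreal (mult_mean s k i) else 0"
 let ?a = "al s i" and ?m = "al s i / (1 - exp (- al s i))" and ?F = "exp (mi_head s i) / Phi s"
 have a: "0 < ?a" by (rule al_bounds(1)[OF s i])
 have m: "0 \<le> ?m" using a by simp
 have F: "0 \<le> ?F" using Phi_pos[of s] by simp
 have pi: "val q (max_index B q s) (\<lambda>k. indicator {i} k) = ennreal (mi_pmf s i)"
  unfolding val_max_index[OF s] using suminf_indicator[of i "\<lambda>k. ennreal (mi_pmf s k)"]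
  by (simp add: mult.commute indicator_def eq_commute)
 have mF: "mi_pmf s i * ?m = ?F * ?a"
 proof -
  obtain k where k: "i = Suc k" "1 \<le> k" using i by (cases i) auto
  have h: "mi_head s i = mi_head s k + ?a" unfolding k(1) by (rule mi_head_Suc[OF k(2)])
  have "mi_pmf s i = exp (mi_head s k) * (exp ?a - 1) / Phi s" using k by (simp add: mi_pmf_def)
  moreover have "exp ?a - 1 = exp ?a * (1 - exp (- ?a))" by (simp add: right_diff_distrib flip: exp_add)
  moreover have "H * (E * D) / P * (a / D) = H * E / P * a" if "D \<noteq> 0" for H E D P a :: real
   using that by simp
  ultimately show ?thesis unfolding h exp_add using a by simp
 qed
 \<comment> \<open>Adding \<open>al s i\<close> on the event that the maximum is at most
   \<open>i\<close> leaves the constant \<open>al s i\<close> plus a term at \<open>i\<close> alone.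
   That term has expectation \<open>?F * al s i\<close>, exactly what was added, and
   cancels.\<close>
 have "val q (max_index B q s) ?X + ennreal ?F * ennreal ?a =
  val q (max_index B q s) (\<lambda>k. ?X k + (if k \<le> i then 1 else 0) * ennreal ?a)"
  unfolding val_add[OF good_max_index] val_multc[OF good_max_index] max_index_cdf[OF s] ..
 also have "... = val q (max_index B q s) (\<lambda>k. ennreal ?a + indicator {i} k * ennreal ?m)"
  by (rule arg_cong[of _ _ "val q _"]) (auto simp: fun_eq_iff mult_mean_def indicator_def add.commute)
 also have "... \<le> ennreal ?a + ennreal (mi_pmf s i) * ennreal ?m"
  unfolding val_add[OF good_max_index] val_multc[OF good_max_index] pi
  by (intro add_right_mono val_le_const) simp
 also have "ennreal (mi_pmf s i) * ennreal ?m = ennreal ?F * ennreal ?a"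
  using mF mi_pmf_nonneg[OF s, of i] m F by (metis ennreal_mult')
 finally show ?thesis using a F by (simp add: ennreal_add_left_cancel_le add.commute[of _ "ennreal ?F * ennreal ?a"] ennreal_mult_eq_top_iff)
qed

lemma val_mult_means_le:
 assumes s: "0 < s" "s \<le> s0"
 shows "val q (max_index B q s) (\<lambda>k. \<Sum>j=2..<2 + (k - 1). ennreal (mult_mean s k j) * H j) \<le> (\<Sum>i. ennreal (al s (i + 2)) * H (i + 2))"
proof -
 have "val q (max_index B q s) (\<lambda>k. \<Sum>j=2..<2 + (k - 1). ennreal (mult_mean s k j) * H j) =
  val q (max_index B q s) (\<lambda>k. \<Sum>i. (if i + 2 \<le> k then ennreal (mult_mean s k (i + 2)) else 0) * H (i + 2))"
  unfolding sum_indices by (rule arg_cong[of _ _ "val q _"]) (intro ext arg_cong[of _ _ suminf], simp)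
 also have "... = (\<Sum>i. val q (max_index B q s) (\<lambda>k. if i + 2 \<le> k then ennreal (mult_mean s k (i + 2)) else 0) * H (i + 2))"
  unfolding val_suminf[OF good_max_index] val_multc[OF good_max_index] ..
 also have "... \<le> (\<Sum>i. ennreal (al s (i + 2)) * H (i + 2))"
  by (intro suminf_le mult_right_mono val_mult_mean_le s summableI) auto
 finally show ?thesis .
qed

lemma cst_gB_step:
 assumes rec: "\<And>t. good q (rec t)" and s: "0 < s" "s \<le> s0" and i: "2 \<le> i" and I: "gB_inv s i S"
  and H: "cst q (rec (s ^ i)) + of_nat i * val q (rec (s ^ i)) (\<lambda>T. of_nat (tsize T)) \<le> ennreal h" "0 \<le> h"
 shows "cst q (gB_step rec M0 s k i S) \<le> ennreal (mult_const + 3) + ennreal (mult_mean s k i) * ennreal (2 + h)"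
proof -
 note gd = good_pbind good_detp good_tick good_mult_prog good_for_loop good_add_copies[OF rec] good_ret rec
 have ac: "cst q (add_copies rec (s ^ i) i F) \<le> ennreal h" for F
 proof -
  have "cst q (add_copies rec (s ^ i) i F) \<le> cst q (rec (s ^ i)) + val q (rec (s ^ i)) (\<lambda>T. of_nat (i * tsize T) + cst q (ret (F + replicate_mset i T)))"
   unfolding add_copies_def
   by (rule order_trans[OF cst_pbind], intro gd, intro gd, intro add_left_mono val_mono cst_tick_bind gd)
  also have "val q (rec (s ^ i)) (\<lambda>T. of_nat (i * tsize T) + cst q (ret (F + replicate_mset i T))) = of_nat i * val q (rec (s ^ i)) (\<lambda>T. of_nat (tsize T))"
   by (simp add: cst_ret val_cmult[OF rec])
  finally show ?thesis using H(1) by (rule order_trans)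
 qed
 have "cst q (gB_step rec M0 s k i S) \<le> of_nat 1 + (of_nat 1 + (ennreal mult_const +
   val q (mult_prog M0 k i (s ^ i)) (\<lambda>m. (1 + of_nat m * (2 + ennreal h)) + 0)))"
  unfolding gB_step_eq[OF i I]
  apply (rule order_trans[OF cst_detp_bind], intro gd, rule add_left_mono)
  apply (rule order_trans[OF cst_tick_bind], intro gd, rule add_left_mono)
  apply (rule order_trans[OF cst_pbind], intro gd, intro gd)
  apply (rule add_mono[OF mult_prog_law(3)[OF s i] val_mono])
  apply (rule cst_pbind_le, intro gd, intro gd)
   apply (rule cst_for_loop_const, intro gd, rule ac)
  by (simp add: cst_ret)
 also have "val q (mult_prog M0 k i (s ^ i)) (\<lambda>m. (1 + of_nat m * (2 + ennreal h)) + 0) \<le> 1 + ennreal (mult_mean s k i) * (2 + ennreal h)"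
  unfolding add_0_right val_add[OF good_mult_prog] val_multc[OF good_mult_prog] mult_prog_law(2)[OF s i]
  by (intro add_right_mono val_le_const) simp
 also have "of_nat 1 + (of_nat 1 + (ennreal mult_const + (1 + ennreal (mult_mean s k i) * (2 + ennreal h)))) =
  ennreal (mult_const + 3) + ennreal (mult_mean s k i) * ennreal (2 + h)"
 proof -
  have "ennreal (m + 3) = 1 + (1 + (ennreal m + 1))" if "0 \<le> m" for m
   using that by (simp add: ennreal_num_add add.commute)
  thus ?thesis using mult_const_nonneg H(2) by (simp add: add.assoc)
 qed
 finally show ?thesis by (simp add: add_left_mono)
qed

definition "index_mean = exp (real B) * (2 + q / (1 - q))"

lemma index_mean_nonneg: "0 \<le> index_mean"
 unfolding index_mean_def using q_bounds by simp

lemma mi_const_nonneg: "0 \<le> mi_const"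
 unfolding mi_const_def using q_bounds bern_const_nonneg[of 41] by simp

text \<open>\<open>h i\<close> pays for sampling one tree and creating its \<open>i\<close> copies;
  the fixed overhead per index is charged to the mean of the maximal index.\<close>

lemma cst_gammaB_with:
 assumes rec: "\<And>t. good q (rec t)" and s: "0 < s" "s \<le> s0"
  and H: "\<And>i. 2 \<le> i \<Longrightarrow> cst q (rec (s ^ i)) + of_nat i * val q (rec (s ^ i)) (\<lambda>T. of_nat (tsize T)) \<le> ennreal (h i)"
  and h: "\<And>i. 0 \<le> h i"
 shows "cst q (gammaB_with rec M0 B q s) \<le> ennreal (mi_const + 2 + index_mean * (mult_const + 5)) + (\<Sum>i. ennreal (al s (i + 2)) * ennreal (2 + h (i + 2)))"
proof -
 let ?X = "mult_const + 5"
 note gd = good_pbind good_tick good_max_index good_for_loop good_gB_step[OF rec] good_ret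
 have l: "cst q (for_loop (k - 1) 2 (gB_step rec M0 s k) ({#}, s)) \<le>
  1 + (of_nat k * ennreal ?X + (\<Sum>j=2..<2 + (k - 1). ennreal (mult_mean s k j) * ennreal (2 + h j)))" for k
 proof -
  have "cst q (for_loop (k - 1) 2 (gB_step rec M0 s k) ({#}, s)) \<le>
   1 + (\<Sum>j=2..<2 + (k - 1). 2 + (ennreal (mult_const + 3) + ennreal (mult_mean s k j) * ennreal (2 + h j)))"
  proof (rule cst_for_loop_post[where I = "gB_inv s"])
   show "good q (gB_step rec M0 s k i S)" for i S by (rule good_gB_step[OF rec])
   show "gB_inv s 2 ({#}, s)" by (simp add: gB_inv_def)
   fix j S assume j: "2 \<le> j" "j < 2 + (k - 1)" "gB_inv s j S"
   show "cst q (gB_step rec M0 s k j S) \<le> ennreal (mult_const + 3) + ennreal (mult_mean s k j) * ennreal (2 + h j)"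
    using rec s j(1,3) H[OF j(1)] h[of j] by (rule cst_gB_step)
   show "post (gB_step rec M0 s k j S) (gB_inv s (Suc j))" by (rule gB_step_post[OF j(1,3)])
  qed
  also have "(\<Sum>j=2..<2 + (k - 1). 2 + (ennreal (mult_const + 3) + ennreal (mult_mean s k j) * ennreal (2 + h j))) =
   of_nat (k - 1) * ennreal ?X + (\<Sum>j=2..<2 + (k - 1). ennreal (mult_mean s k j) * ennreal (2 + h j))"
  proof -
   have e: "2 + (ennreal (mult_const + 3) + x) = ennreal ?X + x" for x
   proof -
    have "2 + ennreal (m + 3) = ennreal (m + 5)" if "0 \<le> m" for m
    proof -
     have "ennreal (m + 5) = ennreal (2 + (m + 3))" by (simp add: add.commute)
     also have "... = 2 + ennreal (m + 3)" using that by (subst ennreal_plus) auto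
     finally show ?thesis ..
    qed
    from this[OF mult_const_nonneg] show ?thesis by (simp only: add.assoc[symmetric])
   qed
   show ?thesis unfolding e by (simp add: sum.distrib)
  qed
  also have "... \<le> of_nat k * ennreal ?X + (\<Sum>j=2..<2 + (k - 1). ennreal (mult_mean s k j) * ennreal (2 + h j))"
   by (intro add_right_mono mult_right_mono of_nat_mono) auto
  finally show ?thesis by (simp add: add_left_mono)
 qed
 have "cst q (gammaB_with rec M0 B q s) \<le> ennreal mi_const + val q (max_index B q s)
   (\<lambda>k. of_nat 1 + ((1 + (of_nat k * ennreal ?X + (\<Sum>j=2..<2 + (k - 1). ennreal (mult_mean s k j) * ennreal (2 + h j)))) + 0))"
  unfolding gammaB_with_alt
  apply (rule order_trans[OF cst_pbind], intro gd, intro gd)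
  apply (rule add_mono[OF cst_max_index[OF s] val_mono])
  apply (rule order_trans[OF cst_tick_bind], intro gd, rule add_left_mono)
  apply (rule cst_pbind_le, intro gd, intro gd, rule l)
  by (simp add: cst_ret)
 also have "... \<le> ennreal mi_const + (1 + (1 + (ennreal index_mean * ennreal ?X + (\<Sum>i. ennreal (al s (i + 2)) * ennreal (2 + h (i + 2))))))"
  unfolding add_0_right val_add[OF good_max_index] val_multc[OF good_max_index] index_mean_def
  by (intro add_left_mono add_mono mult_right_mono val_max_index_mean s val_mult_means_le) (auto intro: val_le_const)
 also have "... = ennreal (mi_const + 2 + index_mean * ?X) + (\<Sum>i. ennreal (al s (i + 2)) * ennreal (2 + h (i + 2)))"
 proof -
  have "ennreal (a + 2 + b * c) = ennreal a + (1 + (1 + ennreal b * ennreal c))" if "0 \<le> a" "0 \<le> b" "0 \<le> c" for a b c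
   using that by (simp add: ennreal_mult ennreal_num_add add.assoc)
  from this[OF mi_const_nonneg index_mean_nonneg, of "mult_const + 5"] show ?thesis
   using mult_const_nonneg by (simp only: add.assoc)
 qed
 finally show ?thesis .
qed

text \<open>The factor \<open>i\<close> for the copies is harmless, as
  \<open>i * al s i = A_gf (s ^ i)\<close> still decays geometrically.\<close>

lemma al_sum_bound:
 assumes s: "0 < s" "s \<le> s0" and c: "0 \<le> c" "0 \<le> d"
 shows "(\<Sum>i. ennreal (al s (i + 2)) * ennreal (2 + (c + real (i + 2) * d))) \<le>
  ennreal ((2 + c) * (\<Sum>i. al s (i + 2)) + d / (1 - s0))"
proof -
 have a: "0 \<le> al s (i + 2)" for i using al_bounds(1)[OF s, of "i + 2"] by simp
 have eq: "al s (i + 2) * (2 + (c + real (i + 2) * d)) = (2 + c) * al s (i + 2) + d * A_gf (s ^ (i + 2))" for i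
 proof -
  have "A / n * (2 + (c + n * d)) = (2 + c) * (A / n) + d * A" if "n \<noteq> 0" for A n :: real
   using that by (simp add: field_simps)
  from this[of "real (i + 2)"] show ?thesis unfolding al_def by simp
 qed
 have sm: "summable (\<lambda>i. (2 + c) * al s (i + 2) + d * A_gf (s ^ (i + 2)))"
  by (intro summable_add summable_mult summable_al sum_A_powers_le s)
 have "(\<Sum>i. ennreal (al s (i + 2)) * ennreal (2 + (c + real (i + 2) * d))) = (\<Sum>i. ennreal ((2 + c) * al s (i + 2) + d * A_gf (s ^ (i + 2))))"
  unfolding eq[symmetric] using a c by (subst ennreal_mult) auto
 also have "... = ennreal (\<Sum>i. (2 + c) * al s (i + 2) + d * A_gf (s ^ (i + 2)))"
  unfolding eq[symmetric] using a c sm[unfolded eq[symmetric]] by (intro suminf_ennreal2) auto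
 also have "(\<Sum>i. (2 + c) * al s (i + 2) + d * A_gf (s ^ (i + 2))) = (2 + c) * (\<Sum>i. al s (i + 2)) + d * (\<Sum>i. A_gf (s ^ (i + 2)))"
  using summable_al[OF s] sum_A_powers_le(1)[OF s]
  by (subst suminf_add[symmetric]) (auto intro: summable_mult simp: suminf_mult)
 also have "ennreal ... \<le> ennreal ((2 + c) * (\<Sum>i. al s (i + 2)) + d / (1 - s0))"
  using mult_left_mono[OF sum_A_powers_le(2)[OF s] c(2)] by (intro ennreal_leI) simp
 finally show ?thesis .
qed

definition "costB_base = mi_const + 2 + index_mean * (mult_const + 5) + size_constA / (1 - s0)"

lemma costB_base_nonneg: "0 \<le> costB_base"
 unfolding costB_base_def using mi_const_nonneg index_mean_nonneg mult_const_nonneg size_constA_nonneg s0_bounds by simp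

lemma cst_gammaB_with_le:
 assumes rec: "\<And>t. good q (rec t)" and s: "0 < s" "s \<le> s0"
  and c: "\<And>t. 0 < t \<Longrightarrow> t \<le> t0 \<Longrightarrow> cst q (rec t) \<le> ennreal c" "0 \<le> c"
  and d: "\<And>t. 0 < t \<Longrightarrow> t \<le> t0 \<Longrightarrow> val q (rec t) (\<lambda>T. of_nat (tsize T)) \<le> ennreal size_constA"
 shows "cst q (gammaB_with rec M0 B q s) \<le> ennreal (costB_base + (2 + c) * (\<Sum>i. al s (i + 2)))"
proof -
 have "cst q (gammaB_with rec M0 B q s) \<le> ennreal (mi_const + 2 + index_mean * (mult_const + 5)) +
  (\<Sum>i. ennreal (al s (i + 2)) * ennreal (2 + (c + real (i + 2) * size_constA)))"
 proof (rule cst_gammaB_with[OF rec s])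
  fix i :: nat assume i: "2 \<le> i"
  have "cst q (rec (s ^ i)) + of_nat i * val q (rec (s ^ i)) (\<lambda>T. of_nat (tsize T)) \<le> ennreal c + of_nat i * ennreal size_constA"
   by (intro add_mono mult_left_mono c d s_power(2)[OF s] s_power(3)[OF s i]) auto
  also have "... = ennreal (c + real i * size_constA)"
   using c(2) size_constA_nonneg unfolding ennreal_of_nat_eq_real_of_nat by (simp add: ennreal_mult)
  finally show "cst q (rec (s ^ i)) + of_nat i * val q (rec (s ^ i)) (\<lambda>T. of_nat (tsize T)) \<le> ennreal (c + real i * size_constA)" .
 qed (use c(2) size_constA_nonneg in simp)
 also have "... \<le> ennreal (mi_const + 2 + index_mean * (mult_const + 5)) + ennreal ((2 + c) * (\<Sum>i. al s (i + 2)) + size_constA / (1 - s0))"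
  by (intro add_left_mono al_sum_bound s c size_constA_nonneg)
 also have "... = ennreal (mi_const + 2 + index_mean * (mult_const + 5) + ((2 + c) * (\<Sum>i. al s (i + 2)) + size_constA / (1 - s0)))"
 proof (rule ennreal_plus[symmetric])
  have "0 \<le> (\<Sum>i. al s (i + 2))" by (rule suminf_nonneg[OF summable_al[OF s]]) (rule less_imp_le[OF al_bounds(1)[OF s]], simp)
  thus "0 \<le> (2 + c) * (\<Sum>i. al s (i + 2)) + size_constA / (1 - s0)" using c(2) size_constA_nonneg s0_bounds by simp
 qed (use mi_const_nonneg index_mean_nonneg mult_const_nonneg in simp)
 finally show ?thesis by (simp add: costB_base_def add_ac)
qed

definition "costA_base = 2 + poisson_const M0 39 w0 + costB_base + 3 + size_constB"
text \<open>Solution of \<open>c = costA_base + theta * c\<close>: the cost of a branching process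
  with mean offspring at most \<open>theta < 1\<close>.\<close>

definition "costA = costA_base / (1 - theta)"

lemma size_constB_nonneg: "0 \<le> size_constB"
proof -
 have "1 < rho powr (- 1 / 4)" using rho_pos rho_less powr_less_mono'[of rho "-1/4" 0] by simp
 thus ?thesis unfolding size_constB_def using Phi_pos by (simp add: less_imp_le)
qed

lemma poisson_const_nonneg39: "0 \<le> poisson_const M0 39 w0"
 unfolding poisson_const_def using w0_pos bern_const_nonneg by simp

lemma costA_base_nonneg: "0 \<le> costA_base"
 unfolding costA_base_def using poisson_const_nonneg39 costB_base_nonneg size_constB_nonneg by simp

lemma costA_nonneg: "0 \<le> costA"
 unfolding costA_def using costA_base_nonneg theta by simp

text \<open>Induction on the depth with a bound independent of it. The size bounds of the full
  recursion dominate those of the cut-off one, which terminates on fewer tapes.\<close>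

lemma cst_gA: "0 < t \<Longrightarrow> t \<le> t0 \<Longrightarrow> cst q (gA M0 B q n t) \<le> ennreal costA"
proof (induction n arbitrary: t)
 case 0
 have "app (gA M0 B q 0 t) f = (\<lambda>_. 0)" for f by (simp add: app_def fun_eq_iff)
 thus ?case by (simp add: cst_def wp_def del: gA.simps)
next
 case (Suc n)
 note t = Suc.prems
 have ts: "0 < t" "t \<le> s0" using t t0_bounds by auto
 let ?r = "gA M0 B q n" and ?f = "\<Sum>i. al t (i + 2)"
 note gd = good_pbind good_tick good_poisson approx_det_A good_for_loop good_add_tree[OF good_gA] good_gammaB_with[OF good_gA] good_ret good_gA
 have f0: "0 \<le> ?f" by (rule suminf_nonneg[OF summable_al[OF ts]]) (rule less_imp_le[OF al_bounds(1)[OF ts]], simp)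
 have A: "0 < A_gf t" using approx_A_t0(2)[OF t] .
 have at: "cst q (add_tree ?r t Ts) \<le> ennreal costA + (of_nat 1 + 0)" for Ts
  unfolding add_tree_def
  by (rule cst_pbind_le, intro gd, intro gd, rule Suc.IH[OF t], rule order_trans[OF cst_tick_bind], intro gd) (simp add: cst_ret)
 have sA: "val q (?r t') (\<lambda>T. of_nat (tsize T)) \<le> ennreal size_constA" if "0 < t'" "t' \<le> t0" for t'
  using wp_lim_le[OF prog_lim_gA good_gA, of q M0 B q n t' "\<lambda>T _. of_nat (tsize T)"] gammaA_size[OF that]
  unfolding val_def by (rule order_trans)
 have sB: "val q (gammaB_with ?r M0 B q t) (\<lambda>F. of_nat (size F)) \<le> ennreal size_constB"
 proof -
  have "val q (gammaB_with ?r M0 B q t) (\<lambda>F. of_nat (size F)) \<le> val q (gammaB_with ?r M0 B q t) (\<lambda>F. of_nat (fsize F))"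
   by (intro val_mono of_nat_mono size_le_fsize)
  also have "... \<le> val q (gammaB M0 B q t) (\<lambda>F. of_nat (fsize F))"
   unfolding val_def gammaB_def
   by (rule wp_lim_le[of "\<lambda>n. gammaB_with (gA M0 B q n) M0 B q t", OF prog_lim_gB[OF prog_lim_gA] good_gammaB_with[OF good_gA]])
  finally show ?thesis using gammaB_size[OF ts] by (rule order_trans)
 qed
 have cB: "cst q (gammaB_with ?r M0 B q t) \<le> ennreal (costB_base + (2 + costA) * ?f)"
  by (rule cst_gammaB_with_le[OF good_gA ts Suc.IH costA_nonneg sA])
 have "cst q (gA_body M0 B q ?r t) \<le> of_nat 1 + (ennreal (poisson_const M0 39 w0) + val q (poisson M0 (approx_A t))
   (\<lambda>x. (1 + of_nat x * (2 + (ennreal costA + (of_nat 1 + 0)))) + (ennreal (costB_base + (2 + costA) * ?f) + ennreal size_constB)))"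
  unfolding gA_body_alt
  apply (rule order_trans[OF cst_tick_bind], intro gd, rule add_left_mono)
  apply (rule order_trans[OF cst_pbind], intro gd, intro gd)
  apply (rule add_mono[OF cst_poisson[OF approx_A_t0(1)[OF t] less_imp_le[OF w0_pos] M0_pos] val_mono])
  apply (rule cst_pbind_le, intro gd, intro gd)
   apply (rule cst_for_loop_const, intro gd, rule at)
  apply (rule order_trans[OF cst_pbind], intro gd, intro gd)
  apply (rule add_mono[OF cB])
  apply (rule order_trans[OF val_mono sB])
  apply (rule order_trans[OF cst_tick_bind], intro gd)
  by (simp add: cst_ret)
 also have "val q (poisson M0 (approx_A t)) (\<lambda>x. (1 + of_nat x * (2 + (ennreal costA + (of_nat 1 + 0)))) + (ennreal (costB_base + (2 + costA) * ?f) + ennreal size_constB))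
  \<le> (1 + ennreal (A_gf t) * (2 + (ennreal costA + (of_nat 1 + 0)))) + (ennreal (costB_base + (2 + costA) * ?f) + ennreal size_constB)"
 proof -
  have g: "good q (poisson M0 (approx_A t))" by (intro good_poisson approx_det_A)
  have m: "val q (poisson M0 (approx_A t)) of_nat = ennreal (A_gf t)"
   using val_poisson[OF approx_A_t0(1)[OF t] A approx_A_t0(3)[OF t] M0_pos] poisson_mean[OF A] by simp
  show ?thesis unfolding val_add[OF g] val_multc[OF g] m
   by (rule add_mono[OF add_mono[OF val_le_const order_refl] add_mono[OF val_le_const val_le_const]]) simp_all
 qed
 also have "of_nat 1 + (ennreal (poisson_const M0 39 w0) + ((1 + ennreal (A_gf t) * (2 + (ennreal costA + (of_nat 1 + 0)))) + (ennreal (costB_base + (2 + costA) * ?f) + ennreal size_constB)))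
  = ennreal (1 + (poisson_const M0 39 w0 + ((1 + A_gf t * (2 + (costA + 1))) + ((costB_base + (2 + costA) * ?f) + size_constB))))"
 proof -
  have "of_nat 1 + (ennreal p + ((1 + ennreal a * (2 + (ennreal c + (of_nat 1 + 0)))) + (ennreal b + ennreal d))) =
   ennreal (1 + (p + ((1 + a * (2 + (c + 1))) + (b + d))))" if "0 \<le> p" "0 \<le> a" "0 \<le> c" "0 \<le> b" "0 \<le> d" for p a b c d
   using that by (simp add: ennreal_mult ennreal_num_add)
  thus ?thesis using poisson_const_nonneg39 A costA_nonneg costB_base_nonneg size_constB_nonneg f0 by simp
 qed
 also have "... \<le> ennreal costA"
 proof (rule ennreal_leI)
  \<comment> \<open>Each recursive call causes at most 3 units of overhead besides its own cost, and
    the mean number of calls is at most \<open>theta\<close>.\<close>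
  have m: "A_gf t + ?f \<le> theta" by (rule mean_children(3)[OF t])
  have "1 + (poisson_const M0 39 w0 + ((1 + A_gf t * (2 + (costA + 1))) + ((costB_base + (2 + costA) * ?f) + size_constB)))
   \<le> costA_base - 3 + 3 * (A_gf t + ?f) + costA * (A_gf t + ?f)"
   using f0 by (simp add: costA_base_def algebra_simps)
  also have "... \<le> costA_base + costA * theta"
   using m theta mult_left_mono[OF m costA_nonneg] by simp
  also have "... = costA"
   using theta by (simp add: costA_def field_simps)
  finally show "1 + (poisson_const M0 39 w0 + ((1 + A_gf t * (2 + (costA + 1))) + ((costB_base + (2 + costA) * ?f) + size_constB))) \<le> costA" .
 qed
 finally show ?case by (simp add: add_left_mono)
qed

lemma cst_gammaA: "0 < t \<Longrightarrow> t \<le> t0 \<Longrightarrow> cst q (gammaA M0 B q t) \<le> ennreal costA"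
 unfolding cst_def wp_lim[OF prog_lim_gA good_gA]
 by (rule SUP_least) (use cst_gA in \<open>simp add: cst_def\<close>)

definition "costB = costB_base + (2 + costA) / (1 - s0)"

lemma costB_nonneg: "0 \<le> costB"
 unfolding costB_def using costB_base_nonneg costA_nonneg s0_bounds by simp

lemma cst_gammaB:
 assumes s: "0 < s" "s \<le> s0"
 shows "cst q (gammaB M0 B q s) \<le> ennreal costB"
proof -
 have "cst q (gammaB M0 B q s) \<le> ennreal (costB_base + (2 + costA) * (\<Sum>i. al s (i + 2)))"
  unfolding gammaB_def by (rule cst_gammaB_with_le[OF good_gammaA s cst_gammaA costA_nonneg gammaA_size])
 also have "... \<le> ennreal costB"
 proof (rule ennreal_leI)
  have "(2 + costA) * (\<Sum>i. al s (i + 2)) \<le> (2 + costA) * (1 / (1 - s0))"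
   using costA_nonneg by (intro mult_left_mono sum_A_powers_le(3)[OF s]) simp
  thus "costB_base + (2 + costA) * (\<Sum>i. al s (i + 2)) \<le> costB" unfolding costB_def by simp
 qed
 finally show ?thesis .
qed

end

lemma val_zero: "val q p (\<lambda>_. 0) = 0"
 using val_le_const[of "\<lambda>_. 0" 0 q p] by simp

lemma ennreal_cmult_suminf:
 assumes "0 \<le> c"
 shows "ennreal c * (\<Sum>y. ennreal (d y) * h y) = (\<Sum>y. ennreal (c * d y) * h y)"
 by (simp only: ennreal_suminf_cmult[symmetric] ennreal_mult'[OF assms] mult.assoc)

section \<open>Law of the forest size and exponential tilting\<close>

context polya_params
begin

text \<open>The coefficients of \<open>Phi\<close>, read off from the law of the forest sampler at
  \<open>s0\<close>. Their non-negativity and the expansion up to \<open>s0\<close> then come from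
  the sampler, without expanding the exponential.\<close>

definition phi :: "nat \<Rightarrow> real" where
 "phi y = enn2real (val q (gammaB M0 B q s0) (\<lambda>F. indicator {y} (fsize F))) * Phi s0 / s0 ^ y"

lemma phi_nonneg: "0 \<le> phi y"
 unfolding phi_def using Phi_pos[of s0] s0_bounds by simp

lemma phi_sums:
 assumes s: "0 < s" "s \<le> s0"
 shows "(\<lambda>y. phi y * s ^ y) sums Phi s"
proof -
 define P where "P y = enn2real (val q (gammaB M0 B q s0) (\<lambda>F. indicator {y} (fsize F)))" for y
 have P0: "0 \<le> P y" for y by (simp add: P_def)
 define z where "z = s / s0"
 have z: "0 < z" "z \<le> 1" "s0 * z = s" using s s0_bounds by (auto simp: z_def)
 have fin: "val q (gammaB M0 B q s0) (\<lambda>F. indicator {y} (fsize F)) = ennreal (P y)" for y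
 proof -
  have "val q (gammaB M0 B q s0) (\<lambda>F. indicator {y} (fsize F)) \<le> 1" by (rule val_le_const) (simp add: indicator_def)
  thus ?thesis unfolding P_def by (metis ennreal_enn2real ennreal_one_less_top order_le_less_trans)
 qed
 have "(s0 * z)\<^sup>2 \<le> rho" unfolding z(3)
 proof -
  have "s\<^sup>2 \<le> s0\<^sup>2" using s by (intro power_mono) auto
  thus "s\<^sup>2 \<le> rho" using t0_eq t0_bounds by simp
 qed
 hence "ennreal (Phi (s0 * z) / Phi s0) = val q (gammaB M0 B q s0) (\<lambda>F. ennreal (z ^ fsize F))"
  using gammaB_pgf[of s0 z] s0_bounds z by simp
 also have "... = (\<Sum>y. ennreal (P y * z ^ y))"
  unfolding val_by_size[OF good_gammaB, of q M0 B q s0 "\<lambda>n. ennreal (z ^ n)" fsize] fin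
  using z P0 by (simp add: ennreal_mult)
 finally have e: "(\<Sum>y. ennreal (P y * z ^ y)) = ennreal (Phi s / Phi s0)" unfolding z(3) ..
 have sm: "summable (\<lambda>y. P y * z ^ y)"
  using z e P0 by (intro summable_suminf_not_top) auto
 have "(\<Sum>y. P y * z ^ y) = Phi s / Phi s0"
 proof -
  have nn: "0 \<le> (\<Sum>y. P y * z ^ y)" by (rule suminf_nonneg[OF sm]) (use z P0 in simp)
  have "ennreal (\<Sum>y. P y * z ^ y) = ennreal (Phi s / Phi s0)"
   unfolding e[symmetric] by (rule suminf_ennreal2[symmetric, OF _ sm]) (use z P0 in simp)
  thus ?thesis using nn Phi_pos[of s] Phi_pos[of s0] by (metis divide_nonneg_pos ennreal_inj less_imp_le)
 qed
 hence "(\<lambda>y. P y * z ^ y) sums (Phi s / Phi s0)" using sm by (simp add: sums_iff)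
 from sums_mult[OF this, of "Phi s0"] have "(\<lambda>y. Phi s0 * (P y * z ^ y)) sums (Phi s0 * (Phi s / Phi s0))" .
 moreover have "Phi s0 * (P y * z ^ y) = phi y * s ^ y" for y
  unfolding phi_def z_def power_divide P_def[symmetric] by simp
 ultimately show ?thesis using Phi_pos[of s0] by simp
qed

lemma gammaB_law:
 assumes s: "0 < s" "s \<le> s0"
 shows "val q (gammaB M0 B q s) (\<lambda>F. indicator {y} (fsize F)) = ennreal (phi y * s ^ y / Phi s)"
proof (rule val_law_from_pgf[OF good_gammaB, where R = 1])
 note P = sums_divide[OF phi_sums[OF s], of "Phi s"]
 show "summable (\<lambda>n. phi n * s ^ n / Phi s * 1 ^ n)" using sums_summable[OF P] by simp
 show "0 \<le> phi n * s ^ n / Phi s" for n using phi_nonneg s Phi_pos[of s] by simp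
 fix r :: real assume r: "0 < r" "r < 1"
 have "s * r \<le> s * 1" using s r by (intro mult_left_mono) auto
 from order_trans[OF this[unfolded mult_1_right] s(2)] have sr: "0 < s * r" "s * r \<le> s0" using s r by auto
 have "(s * r)\<^sup>2 \<le> s0\<^sup>2" using sr by (intro power_mono) auto
 hence sr2: "(s * r)\<^sup>2 \<le> rho" using t0_eq t0_bounds by simp
 have "(\<Sum>n. phi n * s ^ n / Phi s * r ^ n) = Phi (s * r) / Phi s"
  using sums_unique[OF sums_divide[OF phi_sums[OF sr], of "Phi s"]] by (simp add: power_mult_distrib mult_ac)
 thus "val q (gammaB M0 B q s) (\<lambda>x. ennreal (r ^ fsize x)) = ennreal (\<Sum>n. phi n * s ^ n / Phi s * r ^ n)"
  using gammaB_pgf[OF s r(1) sr2] by simp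
qed simp_all

text \<open>The generating function at 0, where every tree has weight 0. The statement
  \<open>gammaB_pgf\<close> assumes \<open>0 < z\<close>, hence the recourse to
  \<open>gammaB_with_pgf\<close>.\<close>

lemma phi_0: "phi 0 = 1"
proof -
 have s: "0 < s0" "s0 \<le> s0" using s0_bounds by auto
 have "val q (gammaB_with (gammaA M0 B q) M0 B q s0) (\<lambda>F. ennreal (0 ^ fsize F)) = ennreal (exp (\<Sum>i. al s0 (i + 2) * 0) / Phi s0)"
 proof (rule gammaB_with_pgf[OF good_gammaA s])
  fix i :: nat assume i: "2 \<le> i"
  have "val q (gammaA M0 B q (s0 ^ i)) (\<lambda>T. ennreal (0 ^ (i * tsize T))) = val q (gammaA M0 B q (s0 ^ i)) (\<lambda>T. 0)"
   using i tsize_neq_0 by (intro arg_cong[of _ _ "val q _"] ext) (simp add: power_0_left)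
  thus "val q (gammaA M0 B q (s0 ^ i)) (\<lambda>T. ennreal (0 ^ (i * tsize T))) = ennreal 0"
   by (simp add: val_zero)
 qed auto
 moreover have "ennreal (0 ^ n) = indicator {0} n" for n by (cases n) auto
 ultimately have "ennreal (phi 0 / Phi s0) = ennreal (1 / Phi s0)"
  using gammaB_law[OF s, of 0] by (simp add: gammaB_def)
 hence "phi 0 / Phi s0 = 1 / Phi s0"
  using phi_nonneg[of 0] Phi_pos[of s0] by (subst (asm) ennreal_inj) (auto simp: less_imp_le)
 thus ?thesis using Phi_pos[of s0] by simp
qed

text \<open>Untilted joint law of X, which is Poisson(1), and of the independent forest size Y at
  parameter \<open>rho\<close>.\<close>

definition base :: "nat \<Rightarrow> nat \<Rightarrow> real" where
 "base x y = exp (- 1) / fact x * (phi y * rho ^ y / Phi rho)"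

lemma base_nonneg: "0 \<le> base x y"
 unfolding base_def using phi_nonneg rho_pos Phi_pos[of rho] by simp

lemma base_00: "base 0 0 = rho"
 unfolding base_def using rho_Phi_rho phi_0 Phi_pos[of rho] by (simp add: field_simps)

text \<open>Tilted law without normalisation and with the rejected pair (0, 0) removed; its total
  mass is \<open>mgf l - rho\<close>.\<close>

definition wt :: "real \<Rightarrow> nat \<Rightarrow> nat \<Rightarrow> real" where
 "wt l x y = (if x = 0 \<and> y = 0 then 0 else base x y * exp (l * real (x + y)))"

text \<open>Expectation of \<open>exp (l (X + Y))\<close> under \<open>base\<close>; the constants
  C_+ and C_- are \<open>mgf l - rho\<close> and \<open>mgf (- l) - rho\<close>.\<close>

definition mgf :: "real \<Rightarrow> real" where
 "mgf l = exp (exp l - 1) * Phi (rho * exp l) / Phi rho"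

definition lmax :: real where
 "lmax = ln (1 / rho) / 4"

lemma lmax: "0 < lmax" "rho * exp lmax = s0"
proof -
 show "0 < lmax" unfolding lmax_def using rho_pos rho_less by simp
 have "exp lmax = rho powr (- 1 / 4)" unfolding lmax_def powr_def using rho_pos by (simp add: ln_div)
 thus "rho * exp lmax = s0" unfolding s0_def using rho_pos by (simp add: powr_mult_base)
qed

lemma rho_exp: "\<bar>l\<bar> \<le> lmax \<Longrightarrow> 0 < rho * exp l \<and> rho * exp l \<le> s0"
 unfolding lmax(2)[symmetric] using rho_pos by auto

lemma mgf_pos: "0 < mgf l"
 unfolding mgf_def using Phi_pos[of rho] Phi_pos[of "rho * exp l"] by simp

text \<open>Poisson and Boltzmann laws are exponential families: changing their parameters
  multiplies the law by an exponential in \<open>x + y\<close>, up to normalisation.\<close>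

lemma base_tilt:
 "exp l ^ x / fact x * exp (- exp l) * (phi y * (rho * exp l) ^ y / Phi (rho * exp l)) = base x y * exp (l * real (x + y)) / mgf l"
proof -
 have e: "exp (l * real (x + y)) = exp l ^ x * exp l ^ y" by (simp add: distrib_left exp_add exp_of_nat2_mult)
 have h: "exp (- exp l) = exp (- 1) / exp (exp l - 1)" by (simp add: exp_diff exp_minus field_simps)
 have gen: "E ^ x / f * (a / b) * (p * (r * E) ^ y / P) = a / f * (p * r ^ y / Q) * (E ^ x * E ^ y) / (b * P / Q)"
  if "b \<noteq> 0" "P \<noteq> 0" "Q \<noteq> 0" "f \<noteq> 0" for E f a b p r P Q :: real
  using that by (simp add: field_simps power_mult_distrib)
 show ?thesis unfolding e base_def mgf_def h
  by (rule gen) (use Phi_pos[of rho] Phi_pos[of "rho * exp l"] in auto)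
qed

section \<open>Sampler Q\<close>

lemma base_00_tilt: "exp (- exp l) * (1 / Phi (rho * exp l)) = rho / mgf l"
 using base_tilt[of l 0 0] by (simp add: phi_0 base_00)

definition q_step :: "real \<Rightarrow> real \<Rightarrow> (unit + triple) prog" where
 "q_step e z = do {
    x \<leftarrow> poisson M0 (exact e);
    F \<leftarrow> gammaB M0 B q z;
    tick (fsize F);
    let y = fsize F;
    tick 2;
    ret (if (x, y) = (0, 0) then Inl () else Inr (x, y, F)) }"

abbreviation q_body :: "real \<Rightarrow> (unit + triple) prog" where "q_body l \<equiv> q_step (exp l) (rho * exp l)"
abbreviation q_loop :: "real \<Rightarrow> triple prog" where "q_loop l \<equiv> loop (\<lambda>_. q_body l) ()"

lemma samplerQ_alt: "samplerQ M0 B q c = do {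
   p \<leftarrow> calc (V (Cplus c) \<^bold>/ (V (Cplus c) \<^bold>+ V (Cminus c)));
   plus \<leftarrow> bernoulli (exact p);
   let sg = (if plus then 1 else - 1);
   e \<leftarrow> calc (Exp (V sg \<^bold>* V (lam_val c)));
   z \<leftarrow> calc (V rho \<^bold>* V e);
   loop (\<lambda>_. q_step e z) () }"
 unfolding samplerQ_def q_step_def ..

lemma good_q_step: "good q' (q_step e z)"
 unfolding q_step_def Let_def by (intro good_pbind good_poisson approx_det_exact good_gammaB good_tick good_ret)

lemma good_samplerQ: "good q' (samplerQ M0 B q c)"
 unfolding samplerQ_alt Let_def by (intro good_pbind good_calc good_bernoulli approx_det_exact good_loop good_q_step)

lemma post_samplerQ: "post (samplerQ M0 B q c) (\<lambda>(x, y, F). y = fsize F \<and> (x, y) \<noteq> (0, 0))"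
 unfolding samplerQ_alt Let_def
proof (intro post_pbind')
 fix e z
 show "post (loop (\<lambda>_. q_step e z) ()) (\<lambda>(x, y, F). y = fsize F \<and> (x, y) \<noteq> (0, 0))"
 proof (rule post_loop[where I = "\<lambda>_. True"])
  show "post (q_step e z) (\<lambda>r. case r of Inl s' \<Rightarrow> True | Inr (x, y, F) \<Rightarrow> y = fsize F \<and> (x, y) \<noteq> (0, 0))"
   unfolding q_step_def Let_def by (intro post_pbind' post_ret) auto
 qed simp
qed

definition q_loop_cost :: real where
 "q_loop_cost = (poisson_const M0 0 0 + costB + size_constB + 2 + 1) / (1 - exp (- exp (- lmax)))"

lemma q_loop_cost_nonneg: "0 \<le> q_loop_cost"
proof -
 have "0 \<le> poisson_const M0 0 0" unfolding poisson_const_def using bern_const_nonneg by simp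
 thus ?thesis unfolding q_loop_cost_def using costB_nonneg size_constB_nonneg by simp
qed

definition samplerQ_cost :: real where
 "samplerQ_cost = 10 + bern_const 0 + q_loop_cost"

lemma samplerQ_cost_nonneg: "0 \<le> samplerQ_cost"
 unfolding samplerQ_cost_def using bern_const_nonneg[of 0] q_loop_cost_nonneg by simp

context
 fixes l :: real
 assumes l: "\<bar>l\<bar> \<le> lmax" and M0l: "exp l \<le> real M0"
begin

lemma val_q_step:
 "val q (q_body l) (\<lambda>r. case r of Inl _ \<Rightarrow> a | Inr (x, y, F) \<Rightarrow> f x y) =
  (\<Sum>x. \<Sum>y. ennreal (base x y * exp (l * real (x + y)) / mgf l) * (if x = 0 \<and> y = 0 then a else f x y))"
proof -
 note gd = good_pbind good_poisson approx_det_exact good_gammaB good_tick good_ret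
 have s: "0 < rho * exp l" "rho * exp l \<le> s0" using rho_exp[OF l] by auto
 have "val q (q_body l) (\<lambda>r. case r of Inl _ \<Rightarrow> a | Inr (x, y, F) \<Rightarrow> f x y) =
  val q (poisson M0 (exact (exp l))) (\<lambda>x. val q (gammaB M0 B q (rho * exp l)) (\<lambda>F. if x = 0 \<and> fsize F = 0 then a else f x (fsize F)))"
  unfolding q_step_def Let_def
  apply (subst val_pbind, intro gd, intro gd)
  apply (subst val_pbind, intro gd, intro gd)
  apply (subst val_tick_bind, intro gd)
  apply (subst val_tick_bind, intro gd)
  unfolding val_ret by (intro arg_cong[of _ _ "val q _"] ext) simp
 also have "... = (\<Sum>x. \<Sum>y. ennreal (exp l ^ x / fact x * exp (- exp l) * (phi y * (rho * exp l) ^ y / Phi (rho * exp l))) * (if x = 0 \<and> y = 0 then a else f x y))"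
  unfolding val_poisson[OF approx_ok_exact exp_gt_zero M0l M0_pos] nn_integral_pmf_nat
 proof (intro arg_cong[of _ _ suminf] ext)
  fix x
  have "val q (gammaB M0 B q (rho * exp l)) (\<lambda>F. if x = 0 \<and> fsize F = 0 then a else f x (fsize F)) =
   (\<Sum>y. ennreal (phi y * (rho * exp l) ^ y / Phi (rho * exp l)) * (if x = 0 \<and> y = 0 then a else f x y))"
   using val_by_size[OF good_gammaB, of q M0 B q "rho * exp l" "\<lambda>y. if x = 0 \<and> y = 0 then a else f x y" fsize]
   unfolding gammaB_law[OF s] by simp
  thus "ennreal (pmf (poisson_pmf (exp l)) x) * val q (gammaB M0 B q (rho * exp l)) (\<lambda>F. if x = 0 \<and> fsize F = 0 then a else f x (fsize F)) =
   (\<Sum>y. ennreal (exp l ^ x / fact x * exp (- exp l) * (phi y * (rho * exp l) ^ y / Phi (rho * exp l))) * (if x = 0 \<and> y = 0 then a else f x y))"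
   unfolding pmf_poisson[OF exp_gt_zero] by (simp only: ennreal_cmult_suminf[of "exp l ^ x / fact x * exp (- exp l)"] exp_ge_zero zero_le_power divide_nonneg_nonneg fact_ge_zero mult_nonneg_nonneg)
 qed
 finally show ?thesis unfolding base_tilt .
qed

lemma mass_q_step: "val q (q_body l) (\<lambda>_. 1) = 1"
proof -
 note gd = good_pbind good_poisson approx_det_exact good_gammaB good_tick good_ret
 have s: "0 < rho * exp l" "rho * exp l \<le> s0" using rho_exp[OF l] by auto
 have "(rho * exp l * 1)\<^sup>2 \<le> s0\<^sup>2" using s by (intro power_mono) auto
 hence s2: "(rho * exp l * 1)\<^sup>2 \<le> rho" using t0_eq t0_bounds by simp
 have "val q (gammaB M0 B q (rho * exp l)) (\<lambda>_. 1) = 1"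
  using gammaB_pgf[OF s zero_less_one s2] Phi_pos[of "rho * exp l"] by simp
 thus ?thesis
  unfolding q_step_def Let_def
  by (simp add: val_pbind gd val_tick val_ret val_poisson[OF approx_ok_exact exp_gt_zero M0l M0_pos] measure_pmf.emeasure_space_1[simplified])
qed

lemma reject_q_step:
 "val q (q_body l) retry = ennreal (rho / mgf l)"
proof -
 have "val q (q_body l) retry =
  val q (q_body l) (\<lambda>r. case r of Inl _ \<Rightarrow> 1 | Inr (x, y, F) \<Rightarrow> 0)"
  by (rule arg_cong[of _ _ "val q _"]) (auto simp: fun_eq_iff split: sum.split)
 also have "... = (\<Sum>x. \<Sum>y. ennreal (base x y * exp (l * real (x + y)) / mgf l) * (if x = 0 \<and> y = 0 then 1 else 0))"
  by (rule val_q_step)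
 also have "... = (\<Sum>x\<in>{0}. \<Sum>y. ennreal (base x y * exp (l * real (x + y)) / mgf l) * (if x = 0 \<and> y = 0 then 1 else 0))"
  by (rule suminf_finite) auto
 also have "... = (\<Sum>y\<in>{0}. ennreal (base 0 y * exp (l * real (0 + y)) / mgf l) * (if y = 0 then 1 else 0))"
  by simp (subst suminf_finite[of "{0}"], auto)
 finally show ?thesis by (simp add: base_00)
qed

text \<open>\<open>exp l >= exp (- lmax)\<close> and \<open>Phi >= 1\<close> make the rejection
  probability smaller than a constant below 1 that does not depend on \<open>l\<close>, hence not on
  N.\<close>

lemma reject_bound: "rho / mgf l \<le> exp (- exp (- lmax))" "0 \<le> rho / mgf l" "rho / mgf l < 1" "0 < mgf l - rho"
proof -
 have s: "0 < rho * exp l" "rho * exp l \<le> s0" using rho_exp[OF l] by auto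
 have "rho / mgf l = exp (- exp l) * (1 / Phi (rho * exp l))" by (rule base_00_tilt[symmetric])
 also have "... \<le> exp (- exp (- lmax)) * 1"
  using l Phi_ge_1[OF s] by (intro mult_mono) auto
 finally show 1: "rho / mgf l \<le> exp (- exp (- lmax))" by simp
 show "0 \<le> rho / mgf l" using rho_pos mgf_pos[of l] by simp
 show "rho / mgf l < 1" by (rule le_less_trans[OF 1]) simp
 thus "0 < mgf l - rho" using mgf_pos[of l] by (simp add: field_simps)
qed

lemma val_q_loop:
 assumes f: "\<And>x y. f x y \<le> 1"
 shows "val q (q_loop l) (\<lambda>(x, y, F). f x y) =
  ennreal (1 / (mgf l - rho)) * (\<Sum>x. \<Sum>y. ennreal (wt l x y) * f x y)"
proof -
 let ?S = "\<Sum>x. \<Sum>y. ennreal (wt l x y) * f x y"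
 have m: "0 < mgf l" by (rule mgf_pos)
 have e: "ennreal (base x y * exp (l * real (x + y)) / mgf l) * (if x = 0 \<and> y = 0 then 0 else f x y) =
  ennreal (1 / mgf l) * (ennreal (wt l x y) * f x y)" for x y
 proof (cases "x = 0 \<and> y = 0")
  case False
  have "ennreal (base x y * exp (l * real (x + y)) / mgf l) = ennreal (1 / mgf l) * ennreal (wt l x y)"
   using m base_nonneg[of x y] False by (subst ennreal_mult[symmetric]) (auto simp: wt_def)
  thus ?thesis using False by (simp only: if_False mult.assoc)
 qed (simp add: wt_def)
 have b: "val q (q_body l) (\<lambda>r. case r of Inl _ \<Rightarrow> 0 | Inr (x, y, F) \<Rightarrow> f x y) = ennreal (1 / mgf l) * ?S"
  unfolding val_q_step e by (simp only: ennreal_suminf_cmult)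
 have "ennreal (1 / mgf l) * ?S \<le> 1"
  unfolding b[symmetric] using f by (intro val_le_const) (auto split: sum.split)
 \<comment> \<open>Finiteness is needed because \<open>val_reject_loop\<close> works with a real
   success weight.\<close>
 hence "?S \<noteq> top"
 proof (rule contrapos_pn)
  assume "?S = top"
  moreover have "ennreal (1 / mgf l) * top = top" using m by (simp add: ennreal_mult_eq_top_iff)
  ultimately have "ennreal (1 / mgf l) * ?S = top" by (simp only:)
  thus "\<not> ennreal (1 / mgf l) * ?S \<le> 1" by (simp only: top_unique ennreal_one_neq_top not_False_eq_True)
 qed
 define S where "S = enn2real ?S"
 have S: "?S = ennreal S" "0 \<le> S"
  unfolding S_def using \<open>?S \<noteq> top\<close> by (simp_all only: ennreal_enn2real_if if_False enn2real_nonneg)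
 have b': "val q (q_body l) (\<lambda>r. case r of Inl _ \<Rightarrow> 0 | Inr x \<Rightarrow> (\<lambda>(x, y, F). f x y) x) = ennreal (S / mgf l)"
 proof -
  have "ennreal (1 / mgf l) * ennreal S = ennreal (S / mgf l)"
   using m S(2) by (subst ennreal_mult[symmetric]) auto
  thus ?thesis using b unfolding S(1) by (simp only:)
 qed
 have "val q (q_loop l) (\<lambda>(x, y, F). f x y) = ennreal ((S / mgf l) / (1 - rho / mgf l))"
  by (rule val_reject_loop[OF good_q_step _ reject_q_step reject_bound(2,3) b', where C = 1])
    (use f S m in auto)
 also have "(S / mgf l) / (1 - rho / mgf l) = 1 / (mgf l - rho) * S"
  using m reject_bound(4) by (simp add: field_simps)
 also have "ennreal (1 / (mgf l - rho) * S) = ennreal (1 / (mgf l - rho)) * ennreal S"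
  using reject_bound(4) by (intro ennreal_mult S(2)) simp
 finally show ?thesis unfolding S(1) .
qed

lemma cst_q_loop: "cst q (q_loop l) \<le> ennreal q_loop_cost"
proof -
 note gd = good_pbind good_poisson approx_det_exact good_gammaB good_tick good_ret
 have s: "0 < rho * exp l" "rho * exp l \<le> s0" using rho_exp[OF l] by auto
 have p0: "0 \<le> poisson_const M0 0 0" unfolding poisson_const_def using bern_const_nonneg by simp
 have "cst q (q_body l) \<le> ennreal (poisson_const M0 0 0) + (ennreal costB + (ennreal size_constB + of_nat 2))"
  unfolding q_step_def Let_def
  apply (rule cst_pbind_le, intro gd, intro gd)
   apply (rule cst_poisson[OF approx_ok_exact], simp, rule M0_pos)
  apply (rule order_trans[OF cst_pbind], intro gd, intro gd)
  apply (rule add_mono[OF cst_gammaB[OF s]])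
  apply (rule order_trans[of _ "val q (gammaB M0 B q (rho * exp l)) (\<lambda>F. of_nat (fsize F) + of_nat 2)"])
   apply (rule val_mono)
   apply (rule order_trans[OF cst_tick_bind], intro gd, rule add_left_mono)
   apply (rule order_trans[OF cst_tick_bind], intro gd, simp add: cst_ret)
  unfolding val_add[OF good_gammaB]
  by (intro add_mono gammaB_size[OF s] val_le_const) simp
 also have "... = ennreal (poisson_const M0 0 0 + costB + size_constB + 2)"
 proof -
  have "ennreal a + (ennreal b + (ennreal c + of_nat 2)) = ennreal (a + b + c + 2)" if "0 \<le> a" "0 \<le> b" "0 \<le> c" for a b c
   using that by (simp add: add.assoc)
  thus ?thesis using p0 costB_nonneg size_constB_nonneg by blast
 qed
 finally have c: "cst q (q_body l) \<le> ennreal (poisson_const M0 0 0 + costB + size_constB + 2)" .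
 have "val q (q_body l) retry \<le> ennreal (exp (- exp (- lmax)))"
  unfolding reject_q_step by (rule ennreal_leI[OF reject_bound(1)])
 thus ?thesis unfolding q_loop_cost_def
  by (rule cst_reject_loop[OF good_q_step _ _ _ c]) (use p0 costB_nonneg size_constB_nonneg in auto)
qed

lemma mass_q_loop: "val q (q_loop l) (\<lambda>_. 1) = 1"
proof -
 have r: "0 \<le> rho / mgf l" "rho / mgf l < 1" by (rule reject_bound)+
 let ?b = "q_step (exp l) (rho * exp l)"
 have "val q ?b retry + val q ?b success = val q ?b (\<lambda>_. 1)"
  unfolding val_add[OF good_q_step, symmetric]
  by (intro arg_cong[of _ _ "val q ?b"] ext) (simp split: sum.split)
 hence e: "ennreal (rho / mgf l) + val q ?b success = 1"
  unfolding reject_q_step mass_q_step .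
 have gen: "v = ennreal (1 - a)" if "ennreal a + v = 1" "0 \<le> a" "a < 1" for a v
 proof -
  have "ennreal a + v = ennreal a + ennreal (1 - a)" unfolding that(1) using that by (subst ennreal_plus[symmetric]) auto
  thus ?thesis by (simp only: ennreal_add_left_cancel) simp
 qed
 have v: "val q ?b (\<lambda>r. case r of Inl _ \<Rightarrow> 0 | Inr x \<Rightarrow> (\<lambda>_. 1) x) = ennreal (1 - rho / mgf l)"
  by (rule gen[OF e r])
 have "val q (loop (\<lambda>_. ?b) ()) (\<lambda>_. 1) = ennreal ((1 - rho / mgf l) / (1 - rho / mgf l))"
  by (rule val_reject_loop[OF good_q_step _ reject_q_step r v, where C = 1]) (use r in auto)
 moreover have "1 - rho / mgf l \<noteq> 0" using r(2) by linarith
 ultimately show ?thesis by (simp only: divide_self ennreal_1 not_False_eq_True)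
qed

end

definition pre_ok :: "pre \<Rightarrow> real \<Rightarrow> bool" where
 "pre_ok c l \<longleftrightarrow> lam_val c = l \<and> Cplus c = mgf l - rho \<and> Cminus c = mgf (- l) - rho \<and>
   BN c = (Cplus c + Cminus c) / 2 \<and> 0 \<le> l \<and> l \<le> lmax \<and> exp l \<le> real M0"

text \<open>Average of the two tilted weights. Choosing the signs in proportion to
  \<open>Cplus\<close> and \<open>Cminus\<close> cancels their separate normalisations and leaves
  this weight over \<open>BN\<close>.\<close>

definition wc :: "real \<Rightarrow> nat \<Rightarrow> nat \<Rightarrow> real" where
 "wc l x y = (if x = 0 \<and> y = 0 then 0 else base x y * cosh (l * real (x + y)))"

lemma wc_nonneg: "0 \<le> wc l x y"
 unfolding wc_def using base_nonneg[of x y] by simp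

context
 fixes c l assumes c: "pre_ok c l"
begin

lemma pre_lam: "lam_val c = l" "\<bar>l\<bar> \<le> lmax" "\<bar>- l\<bar> \<le> lmax" "exp l \<le> real M0" "exp (- l) \<le> real M0"
proof -
 show "lam_val c = l" "\<bar>l\<bar> \<le> lmax" "\<bar>- l\<bar> \<le> lmax" "exp l \<le> real M0" using c unfolding pre_ok_def by auto
 show "exp (- l) \<le> real M0" by (rule order_trans[of _ "exp l"]) (use c in \<open>auto simp: pre_ok_def\<close>)
qed

lemma pre_C: "0 < Cplus c" "0 < Cminus c" "BN c = (Cplus c + Cminus c) / 2" "0 < BN c"
proof -
 show "0 < Cplus c" "0 < Cminus c"
  using c reject_bound(4)[OF pre_lam(2,4)] reject_bound(4)[OF pre_lam(3,5)] unfolding pre_ok_def by auto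
 moreover show "BN c = (Cplus c + Cminus c) / 2" using c unfolding pre_ok_def by auto
 ultimately show "0 < BN c" by simp
qed

lemma val_samplerQ_loops:
 "val q (samplerQ M0 B q c) f =
  val q (q_loop l) f * ennreal (Cplus c / (Cplus c + Cminus c)) +
  val q (q_loop (- l)) f * ennreal (Cminus c / (Cplus c + Cminus c))"
proof -
 have p: "0 \<le> Cplus c / (Cplus c + Cminus c)" "Cplus c / (Cplus c + Cminus c) \<le> 1"
  "1 - Cplus c / (Cplus c + Cminus c) = Cminus c / (Cplus c + Cminus c)"
  using pre_C by (auto simp: field_simps)
 note gd = good_pbind good_calc good_bernoulli approx_det_exact good_loop good_q_step good_detp
 show ?thesis
  unfolding samplerQ_alt Let_def calc_eq rval.simps pre_lam(1)
  apply (subst val_detp_bind, intro gd)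
  apply (subst val_pbind, intro gd, intro gd)
  apply (subst val_bernoulli[OF approx_ok_exact p(1,2)])
  apply (subst val_detp_bind, intro gd)+
  unfolding p(3) by simp
qed

lemma mass_samplerQ: "val q (samplerQ M0 B q c) (\<lambda>_. 1) = 1"
 unfolding val_samplerQ_loops mass_q_loop[OF pre_lam(2,4)] mass_q_loop[OF pre_lam(3,5)]
 using pre_C by (simp add: ennreal_plus[symmetric] add_divide_distrib[symmetric] del: ennreal_plus)

lemma val_samplerQ:
 assumes f: "\<And>x y. f x y \<le> 1"
 shows "val q (samplerQ M0 B q c) (\<lambda>(x, y, F). f x y) = ennreal (1 / BN c) * (\<Sum>x. \<Sum>y. ennreal (wc l x y) * f x y)"
proof -
 have m: "mgf l - rho = Cplus c" "mgf (- l) - rho = Cminus c" using c unfolding pre_ok_def by auto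
 have gen: "ennreal a * S * ennreal b = ennreal d * (ennreal e * S)" if "0 \<le> a" "0 \<le> b" "0 \<le> d" "0 \<le> e" "a * b = d * e" for a b d e S
 proof -
  have "ennreal a * S * ennreal b = ennreal (a * b) * S" unfolding ennreal_mult[OF that(1,2)] by (simp only: mult_ac)
  also have "... = ennreal d * (ennreal e * S)" unfolding that(5) ennreal_mult[OF that(3,4)] by (simp only: mult_ac)
  finally show ?thesis .
 qed
 have e1: "ennreal (1 / Cplus c) * S * ennreal (Cplus c / (Cplus c + Cminus c)) = ennreal (1 / BN c) * (ennreal (1 / 2) * S)" for S
  using pre_C by (intro gen) (auto simp: field_simps)
 have e2: "ennreal (1 / Cminus c) * S * ennreal (Cminus c / (Cplus c + Cminus c)) = ennreal (1 / BN c) * (ennreal (1 / 2) * S)" for S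
  using pre_C by (intro gen) (auto simp: field_simps)
 have w: "ennreal (1 / 2) * (ennreal (wt l x y) * f x y + ennreal (wt (- l) x y) * f x y) = ennreal (wc l x y) * f x y" for x y
 proof -
  have p: "0 \<le> wt l x y" "0 \<le> wt (- l) x y" unfolding wt_def using base_nonneg[of x y] by auto
  have h: "wc l x y = 1 / 2 * wt l x y + 1 / 2 * wt (- l) x y"
   unfolding wc_def wt_def by (simp add: cosh_def field_simps)
  have "ennreal (1 / 2 * a + 1 / 2 * b) = ennreal (1 / 2) * ennreal a + ennreal (1 / 2) * ennreal b" if "0 \<le> a" "0 \<le> b" for a b
   using that by (subst ennreal_plus) (auto simp: ennreal_mult'[symmetric] simp del: ennreal_half)
  from this[OF p] show ?thesis unfolding h by (simp only: distrib_left distrib_right mult.assoc)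
 qed
 show ?thesis
  unfolding val_samplerQ_loops val_q_loop[OF pre_lam(2,4), of f, OF f] val_q_loop[OF pre_lam(3,5), of f, OF f] m e1 e2
  unfolding distrib_left[symmetric] ennreal_suminf_cmult[symmetric] suminf_add[OF summableI summableI] w ..
qed

lemma cst_samplerQ: "cst q (samplerQ M0 B q c) \<le> ennreal samplerQ_cost"
proof -
 note gd = good_pbind good_calc good_bernoulli approx_det_exact good_loop good_q_step good_detp
 have h: "cst q (loop (\<lambda>_. q_step (exp (sg * l)) (rho * exp (sg * l))) ()) \<le> ennreal q_loop_cost" if "sg = 1 \<or> sg = - 1" for sg
  using that cst_q_loop[OF pre_lam(2,4)] cst_q_loop[OF pre_lam(3,5)] by auto
 have "cst q (samplerQ M0 B q c) \<le> of_nat 2 + (ennreal (bern_const 0 * (1 + 0)) + (of_nat 2 + (of_nat 1 + ennreal q_loop_cost)))"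
  unfolding samplerQ_alt Let_def calc_eq rval.simps pre_lam(1) rcost.simps
  apply (rule order_trans[OF cst_detp_bind], intro gd)
  apply (rule add_mono, simp)
  apply (rule cst_pbind_le, intro gd, intro gd, rule cst_bernoulli[OF approx_ok_exact], simp)
  apply (rule order_trans[OF cst_detp_bind], intro gd)
  apply (rule add_mono, simp)
  apply (rule order_trans[OF cst_detp_bind], intro gd)
  apply (rule add_mono, simp)
  apply (rule h, simp)
  done
 also have "... = ennreal (5 + bern_const 0 + q_loop_cost)"
 proof -
  have "of_nat 2 + (ennreal (a * (1 + 0)) + (of_nat 2 + (of_nat 1 + ennreal b))) = ennreal (5 + a + b)" if "0 \<le> a" "0 \<le> b" for a b :: real
  proof -
   have "of_nat 2 + (ennreal (a * (1 + 0)) + (of_nat 2 + (of_nat 1 + ennreal b))) = ennreal (2 + (a + (2 + (1 + b))))"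
    using that by (simp add: ennreal_plus ennreal_num_add)
   thus ?thesis by (simp add: algebra_simps)
  qed
  thus ?thesis using bern_const_nonneg q_loop_cost_nonneg by blast
 qed
 also have "... \<le> ennreal samplerQ_cost" unfolding samplerQ_cost_def by (intro ennreal_leI) simp
 finally show ?thesis .
qed

end

end

section \<open>Upper bound for a single bridge weight\<close>

lemma sinh_ge_real:
 fixes t :: real
 assumes "0 \<le> t"
 shows "t \<le> sinh t"
proof -
 define a where "a = 1 + t + t\<^sup>2 / 2"
 have a: "0 < a" "a \<le> exp t" unfolding a_def using assms exp_lower_Taylor_quadratic[OF assms] by (auto intro: add_pos_nonneg)
 have "2 * t * a \<le> a * a - 1"
 proof -
  have "a * a - 1 - 2 * t * a = (t\<^sup>2)\<^sup>2 / 4" unfolding a_def by (simp add: power2_eq_square field_simps)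
  thus ?thesis using zero_le_power2[of "t\<^sup>2"] by linarith
 qed
 hence "2 * t \<le> a - 1 / a" using a(1) by (simp add: field_simps)
 also have "... \<le> exp t - 1 / exp t" using a by (intro diff_mono divide_left_mono) auto
 finally show ?thesis by (simp add: sinh_def exp_minus field_simps)
qed

lemma cosh_ge_quadratic: "1 + y\<^sup>2 / 2 \<le> cosh (y :: real)"
proof -
 have "(\<bar>y\<bar> / 2)\<^sup>2 \<le> (sinh (\<bar>y\<bar> / 2))\<^sup>2" by (intro power_mono sinh_ge_real) auto
 moreover have "cosh \<bar>y\<bar> = 1 + 2 * (sinh (\<bar>y\<bar> / 2))\<^sup>2"
  using cosh_double[of "\<bar>y\<bar> / 2"] cosh_square_eq[of "\<bar>y\<bar> / 2"] by simp
 moreover have "cosh \<bar>y\<bar> = cosh y" by (rule cosh_real_abs)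
 ultimately show ?thesis by (simp add: power_divide)
qed

text \<open>The square matters: it gives a factor \<open>(N/k)^2\<close> against short walks, enough
  to beat the \<open>k^(-3/2)\<close> of the remaining factors, while a single factor
  \<open>N/k\<close> would not be.\<close>

lemma cosh_ge_square: "(1 + y\<^sup>2 / 12)\<^sup>2 \<le> cosh (y :: real)"
proof -
 have "(1 + (y / 2)\<^sup>2 / 2)\<^sup>2 \<le> (cosh (y / 2))\<^sup>2" by (intro power_mono cosh_ge_quadratic) auto
 moreover have "cosh y = 2 * (cosh (y / 2))\<^sup>2 - 1"
  using cosh_double[of "y / 2"] cosh_square_eq[of "y / 2"] by simp
 moreover have "2 * (1 + (y / 2)\<^sup>2 / 2)\<^sup>2 - 1 - (1 + y\<^sup>2 / 12)\<^sup>2 = y\<^sup>2 / 3 + (y\<^sup>2)\<^sup>2 * (7 / 288)"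
  by (simp add: power2_eq_square field_simps)
 moreover have "0 \<le> y\<^sup>2 / 3 + (y\<^sup>2)\<^sup>2 * (7 / 288)" by simp
 ultimately show ?thesis by linarith
qed

text \<open>Termwise comparison of even power series: the scaling factor to the power
  \<open>n >= 2\<close> is at most its square. This is the source of
  \<open>BN = 1 - rho + O(1/N)\<close>.\<close>

lemma cosh_scale:
 fixes \<theta> t :: real
 assumes "0 \<le> \<theta>" "\<theta> \<le> 1"
 shows "cosh (\<theta> * t) \<le> 1 + \<theta>\<^sup>2 * cosh t"
proof -
 have "(\<lambda>n. if n = 0 then 1 else 0) sums (1 :: real)" using sums_single[of 0 "\<lambda>_. 1 :: real"] by simp
 from sums_add[OF this sums_mult[OF cosh_converges[of t], of "\<theta>\<^sup>2"]]
 have "(\<lambda>n. (if n = 0 then 1 else 0) + \<theta>\<^sup>2 * (if even n then t ^ n /\<^sub>R fact n else 0)) sums (1 + \<theta>\<^sup>2 * cosh t)" .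
 note S = this
 show ?thesis
 proof (rule sums_le[OF _ cosh_converges[of "\<theta> * t"] S])
  fix n
  show "(if even n then (\<theta> * t) ^ n /\<^sub>R fact n else 0) \<le> (if n = 0 then 1 else 0) + \<theta>\<^sup>2 * (if even n then t ^ n /\<^sub>R fact n else 0)"
  proof (cases "even n \<and> n \<noteq> 0")
   case True
   hence "\<theta> ^ n \<le> \<theta>\<^sup>2" using assms by (intro power_decreasing) (auto elim!: evenE)
   moreover have "0 \<le> t ^ n / fact n" using True by (simp add: zero_le_even_power)
   ultimately have "\<theta> ^ n * (t ^ n / fact n) \<le> \<theta>\<^sup>2 * (t ^ n / fact n)" by (rule mult_right_mono)
   thus ?thesis using True by (simp add: power_mult_distrib divide_inverse mult_ac)
  qed auto
 qed
qed

lemma prod_list_one_plus_ge: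
 fixes us :: "real list"
 assumes "\<And>u. u \<in> set us \<Longrightarrow> 0 \<le> u"
 shows "1 + sum_list us \<le> (\<Prod>u\<leftarrow>us. 1 + u)"
 using assms
proof (induction us)
 case (Cons u us)
 have "(1 + u) * (1 + sum_list us) \<le> (1 + u) * (\<Prod>u\<leftarrow>us. 1 + u)" using Cons by (intro mult_left_mono) auto
 moreover have "0 \<le> u * sum_list us" using Cons by (intro mult_nonneg_nonneg sum_list_nonneg) auto
 ultimately show ?case by (simp add: algebra_simps)
qed simp

lemma sum_list_square_le:
 fixes ds :: "nat list"
 shows "(real (sum_list ds))\<^sup>2 \<le> real (length ds) * (\<Sum>d\<leftarrow>ds. (real d)\<^sup>2)"
proof (induction ds)
 case (Cons d ds)
 define S Q k where "S = real (sum_list ds)" "Q = (\<Sum>d\<leftarrow>ds. (real d)\<^sup>2)" "k = real (length ds)"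
 have ih: "S\<^sup>2 \<le> k * Q" using Cons by (simp add: S_Q_k_def)
 have k: "0 \<le> k" "0 \<le> Q" "k = 0 \<Longrightarrow> S = 0" by (auto simp: S_Q_k_def intro!: sum_list_nonneg)
 have "2 * (real d * S) \<le> k * (real d)\<^sup>2 + Q"
 proof (cases "k = 0")
  case False
  hence kp: "0 < k" using k by simp
  have "0 \<le> (k * real d - S)\<^sup>2" by simp
  hence "2 * k * (real d * S) \<le> k * (k * (real d)\<^sup>2) + S\<^sup>2" by (simp add: power2_eq_square algebra_simps)
  also have "... \<le> k * (k * (real d)\<^sup>2 + Q)" using ih by (simp add: algebra_simps)
  finally have "k * (2 * (real d * S)) \<le> k * (k * (real d)\<^sup>2 + Q)" by (simp add: algebra_simps)
  thus ?thesis using kp by simp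
 qed (use k in simp)
 hence "(real d + S)\<^sup>2 \<le> (1 + k) * ((real d)\<^sup>2 + Q)"
  using ih by (simp add: power2_eq_square algebra_simps)
 thus ?case by (simp add: S_Q_k_def)
qed simp

text \<open>A product of terms \<open>1 + u\<close> is at least one plus the sum of the
  \<open>u\<close>, and Cauchy-Schwarz bounds the sum of the squared step sizes from below by its
  value for equal steps.\<close>

lemma prod_list_cosh_ge:
 fixes ds :: "nat list" and l :: real
 assumes "ds \<noteq> []"
 shows "(1 + l\<^sup>2 * (real (sum_list ds))\<^sup>2 / (12 * real (length ds)))\<^sup>2 \<le> (\<Prod>d\<leftarrow>ds. cosh (l * real d))"
proof -
 let ?X = "\<Prod>d\<leftarrow>ds. 1 + (l * real d)\<^sup>2 / 12"
 let ?Y = "12 * real (length ds)"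
 define us where "us = map (\<lambda>d. (l * real d)\<^sup>2 / 12) ds"
 have sq: "?X\<^sup>2 \<le> (\<Prod>d\<leftarrow>ds. cosh (l * real d))"
 proof (induction ds)
  case (Cons d ds)
  show ?case unfolding list.map prod_list.Cons power_mult_distrib[of "1 + (l * real d)\<^sup>2 / 12"]
   by (rule mult_mono[OF cosh_ge_square Cons]) auto
 qed simp
 have "l\<^sup>2 * (real (sum_list ds))\<^sup>2 / ?Y \<le> l\<^sup>2 * (real (length ds) * (\<Sum>d\<leftarrow>ds. (real d)\<^sup>2)) / ?Y"
  by (intro divide_right_mono mult_left_mono sum_list_square_le) auto
 also have "... = l\<^sup>2 / 12 * (\<Sum>d\<leftarrow>ds. (real d)\<^sup>2)" using assms by simp
 also have "... = sum_list us" unfolding us_def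
  by (induction ds) (simp_all add: power_mult_distrib distrib_left)
 finally have "1 + l\<^sup>2 * (real (sum_list ds))\<^sup>2 / ?Y \<le> 1 + sum_list us" by simp
 also have "... \<le> (\<Prod>u\<leftarrow>us. 1 + u)" by (rule prod_list_one_plus_ge) (auto simp: us_def)
 finally have "1 + l\<^sup>2 * (real (sum_list ds))\<^sup>2 / ?Y \<le> ?X"
  by (simp add: us_def o_def)
 hence "(1 + l\<^sup>2 * (real (sum_list ds))\<^sup>2 / ?Y)\<^sup>2 \<le> ?X\<^sup>2"
  by (intro power_mono) auto
 thus ?thesis using sq by linarith
qed

text \<open>Stirling's upper bound with constant \<open>exp 1\<close>; the induction step amounts to
  \<open>(1 + 1/n)^(n + 1/2) >= exp 1\<close>.\<close>

lemma fact_le: "1 \<le> n \<Longrightarrow> fact n \<le> exp 1 * sqrt (real n) * (real n / exp 1) ^ n"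
proof (induction n rule: nat_induct_at_least)
 case (Suc n)
 define a where "a = real n"
 have a: "0 < a" "real (Suc n) = a + 1" using Suc by (auto simp: a_def)
 have "2 * (((a + 1) / a - 1) / ((a + 1) / a + 1)) \<le> ln ((a + 1) / a)"
  using ln_approx_bounds[of "(a + 1) / a" 1] a by (simp add: divide_less_eq)
 moreover have "((a + 1) / a - 1) / ((a + 1) / a + 1) = 1 / (2 * a + 1)"
  using a by (simp add: divide_simps)
 ultimately have "1 \<le> (a + 1 / 2) * ln ((a + 1) / a)"
  using a by (simp add: field_simps)
 hence "exp 1 \<le> exp ((a + 1 / 2) * ln ((a + 1) / a))" by simp
 also have "... = ((a + 1) / a) powr (a + 1 / 2)" using a by (simp add: powr_def)
 also have "... = ((a + 1) / a) ^ n * (sqrt (a + 1) / sqrt a)"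
  using a by (simp add: powr_add a_def powr_realpow powr_half_sqrt real_sqrt_divide)
 finally have h: "exp 1 \<le> ((a + 1) / a) ^ n * (sqrt (a + 1) / sqrt a)" .
 have "fact (Suc n) \<le> (a + 1) * (exp 1 * sqrt a * (a / exp 1) ^ n)"
  unfolding a(2)[symmetric] a_def fact_Suc using mult_left_mono[OF Suc.IH, of "real (Suc n)"] by (simp add: add.commute)
 also have "... = exp 1 * ((a + 1) * sqrt a * (a / exp 1) ^ n)" by simp
 also have "... \<le> (((a + 1) / a) ^ n * (sqrt (a + 1) / sqrt a)) * ((a + 1) * sqrt a * (a / exp 1) ^ n)"
  using a by (intro mult_right_mono h) auto
 also have "... = exp 1 * sqrt (real (Suc n)) * (real (Suc n) / exp 1) ^ Suc n"
  unfolding a(2) using a by (simp add: power_divide)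
 finally show ?case .
qed simp

text \<open>The right side is the probability that a Galton-Watson tree with Poisson(1) offspring
  has \<open>L\<close> vertices.\<close>

lemma tree_coeff_ge:
 assumes "1 \<le> L"
 shows "exp (- 1) / (real L * sqrt (real L)) \<le> exp (- real L) * real L ^ (L - 1) / fact L"
proof -
 define a where "a = real L"
 have a: "0 < a" using assms by (simp add: a_def)
 have p: "a ^ L = a * a ^ (L - 1)" using assms by (simp add: power_eq_if)
 have "exp (- 1) / (a * sqrt a) * (exp 1 * sqrt a * (a / exp 1) ^ L) = exp (- a) * a ^ (L - 1)"
 proof -
  have "exp (- a) = 1 / exp 1 ^ L" by (simp add: a_def exp_minus exp_of_nat_mult[symmetric] divide_inverse)
  thus ?thesis unfolding power_divide p using a by (simp add: exp_minus field_simps)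
 qed
 moreover have "exp (- 1) / (a * sqrt a) * fact L \<le> exp (- 1) / (a * sqrt a) * (exp 1 * sqrt a * (a / exp 1) ^ L)"
  using fact_le[OF assms] a by (intro mult_left_mono) (auto simp: a_def)
 ultimately show ?thesis unfolding a_def[symmetric] by (simp add: pos_le_divide_eq)
qed

text \<open>The ratio of consecutive masses is explicit. Beyond its maximum the law loses at most
  half over a stretch of order \<open>sqrt k\<close>, and the masses on this stretch add up to at
  most 1.\<close>

lemma neg_binomial_pmf_le:
 fixes r :: real
 assumes r: "0 < r" "r < 1" and k: "1 \<le> k"
 shows "pmf (neg_binomial_pmf k (1 - r)) m \<le> 16 / r / sqrt (real k)"
proof -
 define f where "f m = pmf (neg_binomial_pmf k (1 - r)) m" for m
 define c where "c = 4 / r"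
 have c: "4 \<le> c" using r by (simp add: c_def field_simps)
 have f0: "0 \<le> f m" and f1: "f m \<le> 1" for m by (auto simp: f_def pmf_le_1)
 have step: "real (m + 1) * f (m + 1) = r * real (k + m) * f m" for m
 proof -
  have "Suc m * (Suc (m + k - 1) choose Suc m) = Suc (m + k - 1) * (m + k - 1 choose m)"
   by (rule Suc_times_binomial)
  hence "real (Suc m) * real (Suc (m + k - 1) choose Suc m) = real (k + m) * real (m + k - 1 choose m)"
   using k by (metis Suc_diff_1 Suc_pred add.commute add_gr_0 less_eq_Suc_le of_nat_mult One_nat_def)
  thus ?thesis unfolding f_def using r k by (subst (1 2) pmf_neg_binomial) auto
 qed
 show ?thesis
 \<comment> \<open>The claimed bound is \<open>4 c / sqrt k\<close>, which exceeds 1 for small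
   \<open>k\<close>.\<close>
 proof (cases "2 * c \<le> sqrt (real k)")
  case False
  hence "1 \<le> 4 * c / sqrt (real k)" using k c by (simp add: pos_le_divide_eq)
  thus ?thesis using f1[of m] unfolding f_def c_def by simp
 next
  case big: True
  define s where "s = sqrt (real k)"
  have s: "2 * c \<le> s" "s * s = real k" "0 < s" using big k c by (auto simp: s_def)
  have "8 * 8 \<le> s * s" using s c by (intro mult_mono) auto
  hence k8: "8 \<le> real k" using s by simp
  \<comment> \<open>From \<open>m\<close> to \<open>m + 1\<close> the masses do not increase once
    \<open>m + 1 >= w\<close>, so every mass is dominated by one at some
    \<open>m' <= w\<close>.\<close>
  define w where "w = r * (real k - 1) / (1 - r)"
  have w0: "0 \<le> w" using r k by (simp add: w_def)
  have w: "(1 - r) * w = r * (real k - 1)" using r by (simp add: w_def)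
  have "\<exists>m'. real m' \<le> w \<and> f m \<le> f m'"
  proof (induction m)
   case (Suc m)
   show ?case
   proof (cases "real (Suc m) \<le> w")
    case False
    hence "(1 - r) * w \<le> (1 - r) * (real m + 1)" using r by (intro mult_left_mono) auto
    hence le: "r * real (k + m) \<le> real (m + 1)" unfolding w by (simp add: algebra_simps)
    have "real (m + 1) * f (m + 1) \<le> real (m + 1) * f m"
     unfolding step by (rule mult_right_mono[OF le f0])
    hence "f (Suc m) \<le> f m" by (simp add: mult_le_cancel_left_pos)
    moreover obtain m' where "real m' \<le> w" "f m \<le> f m'" using Suc by blast
    ultimately show ?thesis by (intro exI[of _ m']) simp
   qed (rule exI[of _ "Suc m"], simp)
  qed (rule exI[of _ 0], use w0 in simp)
  then obtain m' where m': "real m' \<le> w" "f m \<le> f m'" by blast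
  \<comment> \<open>Loss per step: up to distance \<open>s\<close> beyond \<open>w\<close> the ratio
    of consecutive masses is at least \<open>1 - a\<close>.\<close>
  define a where "a = c / s"
  have a: "0 \<le> a" "a \<le> 1 / 2" using s c by (auto simp: a_def field_simps)
  have up: "(1 - real d * a) * f m' \<le> f (m' + d)" if "real d \<le> s" for d
   using that
  proof (induction d)
   case (Suc d)
   define x where "x = real (m' + d)"
   have x: "0 \<le> x" "x \<le> w + s - 1" using m' Suc by (auto simp: x_def)
   have "(1 - a) * (x + 1) \<le> r * (real k + x)"
   proof (cases "x + 1 \<le> w")
    case True
    hence "(1 - r) * (x + 1) \<le> (1 - r) * w" using r by (intro mult_left_mono) auto
    hence "x + 1 \<le> r * (real k + x)" unfolding w by (simp add: algebra_simps)
    moreover have "(1 - a) * (x + 1) \<le> 1 * (x + 1)" using a x by (intro mult_right_mono) auto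
    ultimately show ?thesis by simp
   next
    case False
    have "(1 - r) * (x + 1) \<le> (1 - r) * (w + s)" using r x by (intro mult_left_mono) auto
    also have "... = r * (real k - 1) + (1 - r) * s" using w by (simp add: algebra_simps)
    also have "... \<le> r * (real k - 1) + s" using r s by (simp add: algebra_simps)
    finally have 1: "(1 - r) * (x + 1) \<le> r * (real k - 1) + s" .
    have "r * (real k / 2) \<le> r * (real k - 1)" using r k8 by (intro mult_left_mono) auto
    also have "... \<le> w" using mult_right_mono[of "1 - r" 1 w] w0 r unfolding w by simp
    finally have "a * (r * (real k / 2)) \<le> a * (x + 1)" using a False by (intro mult_left_mono) auto
    moreover have "a * (r * (real k / 2)) = 2 * s" unfolding a_def c_def s(2)[symmetric] using r s(3) by simp
    ultimately show ?thesis using 1 s by (simp add: algebra_simps)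
   qed
   hence "(1 - a) * (x + 1) * f (m' + d) \<le> (x + 1) * f (m' + d + 1)"
    using step[of "m' + d"] f0[of "m' + d"] mult_right_mono[of "(1 - a) * (x + 1)" "r * (real k + x)" "f (m' + d)"] by (simp add: x_def add_ac)
   hence "(x + 1) * ((1 - a) * f (m' + d)) \<le> (x + 1) * f (m' + d + 1)" by (simp add: mult_ac)
   hence 2: "(1 - a) * f (m' + d) \<le> f (m' + d + 1)" using x by simp
   have "(1 - real (Suc d) * a) * f m' \<le> (1 - a) * ((1 - real d * a) * f m')"
   proof -
    have "0 \<le> real d * a * a * f m'" using a f0 by simp
    thus ?thesis by (simp add: algebra_simps)
   qed
   also have "... \<le> (1 - a) * f (m' + d)" using Suc a by (intro mult_left_mono) auto
   finally show ?case using 2 by simp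
  qed simp
  \<comment> \<open>Within \<open>s / (2 c)\<close> steps the accumulated loss is at most 1/2, so
    \<open>D\<close> masses of at least \<open>f m' / 2\<close> have sum at most 1.\<close>
  define D where "D = nat \<lfloor>s / (2 * c)\<rfloor> + 1"
  have D: "s / (2 * c) \<le> real D" "real (D - 1) \<le> s / (2 * c)" "1 \<le> D" using s c by (auto simp: D_def) linarith
  have "real D * (f m' / 2) = (\<Sum>d<D. f m' / 2)" by simp
  also have "... \<le> (\<Sum>d<D. f (m' + d))"
  proof (rule sum_mono)
   fix d assume "d \<in> {..<D}"
   hence d: "real d \<le> s / (2 * c)" using D(2) by (auto intro: order_trans[rotated])
   have "s / (2 * c) \<le> s / 1" using s c by (intro divide_left_mono) auto
   hence "(1 - real d * a) * f m' \<le> f (m' + d)" using d by (intro up) simp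
   moreover have "1 / 2 * f m' \<le> (1 - real d * a) * f m'"
   proof (rule mult_right_mono[OF _ f0])
    have "real d * a \<le> s / (2 * c) * a" using d a by (intro mult_right_mono) auto
    also have "... = 1 / 2" unfolding a_def using s c by simp
    finally show "1 / 2 \<le> 1 - real d * a" by simp
   qed
   ultimately show "f m' / 2 \<le> f (m' + d)" by simp
  qed
  also have "... = sum f ((+) m' ` {..<D})" by (subst sum.reindex) auto
  also have "... = measure_pmf.prob (neg_binomial_pmf k (1 - r)) ((+) m' ` {..<D})"
   unfolding f_def by (rule measure_measure_pmf_finite[symmetric]) simp
  also have "... \<le> 1" by (rule measure_pmf.prob_le_1)
  finally have "real D * (f m' / 2) \<le> 1" .
  moreover have "s / (2 * c) * (f m' / 2) \<le> real D * (f m' / 2)" using D f0 by (intro mult_right_mono) auto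
  ultimately have "s / (2 * c) * (f m' / 2) \<le> 1" by linarith
  hence "f m' \<le> 4 * c / s" using s c by (simp add: field_simps)
  thus ?thesis using m'(2) unfolding f_def c_def s_def by simp
 qed
qed

text \<open>\<open>s(k,m)\<close> with an arbitrary list of step sizes in place of the balanced one;
  it is also the numerator of the acceptance probability R.\<close>

definition bridge_weight :: "real \<Rightarrow> real \<Rightarrow> real \<Rightarrow> nat list \<Rightarrow> nat \<Rightarrow> real" where
 "bridge_weight r b l ds m = b ^ length ds * r ^ m * fact (length ds + m - 1) / (fact (length ds) * fact m) /
   (\<Prod>d\<leftarrow>ds. cosh (l * real d))"

text \<open>The power of \<open>b\<close> costs at most \<open>exp cb\<close>, the negative binomial
  law gives \<open>k^(-1/2)\<close>, passing from the binomial coefficient to the factorials gives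
  \<open>1/k\<close>, and the \<open>cosh\<close> product gives \<open>(k/N)^2\<close>. Together
  this is \<open>sqrt k / N^2\<close>, at most \<open>N^(-3/2)\<close> for
  \<open>k <= N\<close>.\<close>

lemma bridge_weight_le:
 fixes r cb cs :: real
 assumes r: "0 < r" "r < 1" and cs: "0 < cs" and cb: "0 \<le> cb"
 defines "C \<equiv> exp cb * (16 / r) * (12 / cs)\<^sup>2"
 assumes ds: "length ds = k" "sum_list ds = N" and k: "1 \<le> k" "k \<le> N"
  and B: "0 < b" "b \<le> (1 - r) * (1 + cb / real N)" and l: "cs / real N \<le> l\<^sup>2"
 shows "bridge_weight r b l ds m \<le> C / (real N * sqrt (real N))"
proof -
 let ?X = "cs / 12 * (real N / real k)"
 have N: "0 < real N" "0 < real k" "real k \<le> real N" using k by auto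
 have "(b / (1 - r)) ^ k \<le> (1 + cb / real N) ^ k"
  using B r by (intro power_mono) (auto simp: field_simps)
 also have "... \<le> (1 + cb / real N) ^ N" using cb k N by (intro power_increasing) auto
 also have "... \<le> exp cb" using exp_ge_one_plus_x_over_n_power_n[of N cb] cb N by simp
 finally have h1: "(b / (1 - r)) ^ k \<le> exp cb" .
 have bin: "fact (k + m - 1) / (fact k * fact m) = real (m + k - 1 choose m) / real k"
 proof -
  have "real (m + k - 1 choose m) = fact (m + k - 1) / (fact m * fact (m + k - 1 - m))"
   by (rule binomial_fact) (use k in auto)
  moreover have "m + k - 1 - m = k - 1" "(fact k :: real) = real k * fact (k - 1)" using k by (auto simp: fact_reduce)
  ultimately show ?thesis using N by (simp add: add.commute field_simps)
 qed
 have h2: "real (m + k - 1 choose m) * (1 - r) ^ k * r ^ m \<le> 16 / r / sqrt (real k)"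
  using neg_binomial_pmf_le[OF r k(1), of m] r by (subst (asm) pmf_neg_binomial) auto
 define Q where "Q = (\<Prod>d\<leftarrow>ds. cosh (l * real d))"
 have "?X\<^sup>2 \<le> (1 + l\<^sup>2 * (real N)\<^sup>2 / (12 * real k))\<^sup>2"
 proof (intro power_mono)
  have "cs / 12 * (real N / real k) = cs / real N * (real N)\<^sup>2 / (12 * real k)" using N by (simp add: power2_eq_square)
  also have "... \<le> l\<^sup>2 * (real N)\<^sup>2 / (12 * real k)" using l N by (intro divide_right_mono mult_right_mono) auto
  finally show "cs / 12 * (real N / real k) \<le> 1 + l\<^sup>2 * (real N)\<^sup>2 / (12 * real k)" by simp
 qed (use cs N in auto)
 also have "... \<le> Q" unfolding Q_def using prod_list_cosh_ge[of ds l] k ds by (cases "ds = []") auto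
 finally have h3: "?X\<^sup>2 \<le> Q" .
 have pos: "0 < ?X\<^sup>2" using cs N by simp
 have "b ^ k * r ^ m * fact (k + m - 1) / (fact k * fact m) / Q =
  (b / (1 - r)) ^ k * (real (m + k - 1 choose m) * (1 - r) ^ k * r ^ m) / real k / Q"
 proof -
  have "b ^ k * r ^ m * fact (k + m - 1) / (fact k * fact m) = b ^ k * r ^ m * (fact (k + m - 1) / (fact k * fact m))" by simp
  thus ?thesis unfolding bin using r by (simp add: power_divide)
 qed
 also have "... \<le> (exp cb * (16 / r / sqrt (real k))) / real k / ?X\<^sup>2"
  by (intro frac_le divide_right_mono mult_mono h1 h2 h3) (use r B N pos in auto)
 also have "... = C * sqrt (real k) / (real N)\<^sup>2"
 proof -
  have "real k = sqrt (real k) * sqrt (real k)" by simp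
  hence gen: "e * (q / s) / K / (c / 12 * (n / K))\<^sup>2 = e * q * (12 / c)\<^sup>2 * s / n\<^sup>2"
   if "s \<noteq> 0" "K = s * s" "c \<noteq> 0" "n \<noteq> 0" for e q s K c n :: real
   using that by (simp add: field_simps power2_eq_square)
  show ?thesis unfolding C_def by (rule gen) (use N cs in auto)
 qed
 also have "... \<le> C * sqrt (real N) / (real N)\<^sup>2"
  using N r by (intro divide_right_mono mult_left_mono) (auto simp: C_def)
 also have "... = C / (real N * sqrt (real N))"
 proof -
  have gen: "c * s / n\<^sup>2 = c / (n * s)" if "s \<noteq> 0" "n = s * s" for c s n :: real
   using that by (simp add: field_simps power2_eq_square)
  show ?thesis by (rule gen) (use N in auto)
 qed
 finally show ?thesis unfolding Q_def bridge_weight_def ds(1) .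
qed

section \<open>Bridges\<close>

notation fps_nth (infixl "$$" 75)

text \<open>The sum is the probability that a renewal process with steps one plus a variable of law
  \<open>\<psi>\<close> visits \<open>n\<close>. Finite mean makes a visit shortly before
  \<open>n\<close> likely, and from there steps of size 1, each of probability
  \<open>\<psi> 0\<close>, lead to \<open>n\<close>.\<close>

lemma renewal_bound:
 fixes \<psi> :: "nat \<Rightarrow> real" and w :: real
 assumes nn: "\<And>y. 0 \<le> \<psi> y" and p: "0 < \<psi> 0" and one: "\<psi> sums 1" and w: "1 < w" "summable (\<lambda>y. \<psi> y * w ^ y)"
 shows "\<exists>c>0. \<forall>n\<ge>1. c \<le> (\<Sum>L=1..n. (Abs_fps \<psi> ^ L) $$ (n - L))"
proof -
 define F where "F = fps_X * Abs_fps \<psi>"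
 define u where "u = inverse (1 - F)"
 have F0: "F $$ 0 = 0" by (simp add: F_def)
 have uF: "u * (1 - F) = 1" unfolding u_def by (rule inverse_mult_eq_1) (simp add: F0)
 have u0: "u $$ 0 = 1" using arg_cong[OF uF, of "\<lambda>f. f $$ 0"] F0 by simp
 have Fs: "F $$ Suc j = \<psi> j" for j by (simp add: F_def)
 have F_nn: "0 \<le> F $$ j" for j using nn by (cases j) (auto simp: F0 Fs)
 have uS: "u $$ n = (\<Sum>i=0..n. u $$ i * F $$ (n - i))" if "0 < n" for n
 proof -
  have "u = 1 + u * F" using uF by (simp add: algebra_simps)
  hence "u $$ n = (1 + u * F) $$ n" by simp
  thus ?thesis using \<open>0 < n\<close> by (simp add: fps_mult_nth)
 qed
 have u_nn: "0 \<le> u $$ n" for n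
 proof (induction n rule: less_induct)
  case (less n)
  show ?case
  proof (cases "n = 0")
   case False
   have "0 \<le> (\<Sum>i=0..n. u $$ i * F $$ (n - i))"
   proof (rule sum_nonneg)
    fix i assume "i \<in> {0..n}"
    thus "0 \<le> u $$ i * F $$ (n - i)" using less[of i] F_nn[of "n - i"] F0 by (cases "i = n") auto
   qed
   thus ?thesis using uS[of n] False by simp
  qed (simp add: u0)
 qed
 have u_step: "\<psi> 0 * u $$ n \<le> u $$ Suc n" for n
 proof -
  have "u $$ n * F $$ (Suc n - n) \<le> (\<Sum>i=0..Suc n. u $$ i * F $$ (Suc n - i))"
   by (rule member_le_sum) (use u_nn F_nn in auto)
  also have "... = u $$ Suc n" by (rule uS[symmetric]) simp
  also have "Suc n - n = Suc 0" by simp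
  finally show ?thesis unfolding Fs by (simp only: mult.commute)
 qed
 \<comment> \<open>Tails of the step law. The factorisation \<open>1 - F = R (1 - X)\<close> turns
   \<open>u (1 - F) = 1\<close> into the decomposition by the last visit: the convolution of
   \<open>u\<close> and \<open>R\<close> is constantly 1.\<close>
 define R where "R = Abs_fps (\<lambda>m. 1 - (\<Sum>j<m. \<psi> j))"
 have R_eq: "R * (1 - fps_X) = 1 - F"
 proof (rule fps_ext)
  fix n show "(R * (1 - fps_X)) $$ n = (1 - F) $$ n"
   by (cases n) (auto simp: algebra_simps R_def F0 Fs)
 qed
 have "u * R * (1 - fps_X) = 1" using uF R_eq by (simp add: mult.assoc)
 hence uR: "(u * R) $$ n = 1" for n
 proof (induction n)
  case 0
  show ?case by (simp add: u0 R_def)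
 next
  case (Suc n)
  have "(u * R * (1 - fps_X)) $$ Suc n = 0" unfolding \<open>u * R * (1 - fps_X) = 1\<close> by simp
  moreover have "(u * R * (1 - fps_X)) $$ Suc n = (u * R) $$ Suc n - (u * R) $$ n"
   by (simp only: right_diff_distrib mult_1_right fps_sub_nth fps_X_mult_right_nth) simp
  ultimately show ?case using Suc by simp
 qed
 have r: "R $$ m = (\<Sum>j. \<psi> (j + m))" for m
  using suminf_minus_initial_segment[OF sums_summable[OF one], of m] sums_unique[OF one] by (simp add: R_def)
 have R_nn: "0 \<le> R $$ m" for m
  unfolding r by (intro suminf_nonneg summable_ignore_initial_segment sums_summable[OF one] nn)
 have u_le: "u $$ n \<le> 1" for n
 proof -
  have "u $$ n * R $$ (n - n) \<le> (\<Sum>i=0..n. u $$ i * R $$ (n - i))"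
   by (rule member_le_sum) (use u_nn R_nn in auto)
  thus ?thesis using uR[of n] by (simp add: fps_mult_nth R_def)
 qed
 \<comment> \<open>Markov's inequality with the exponential moment \<open>?M\<close> makes the tails
   geometrically small.\<close>
 have "summable (\<lambda>m. R $$ m)"
 proof (rule summable_comparison_test'[where N = 0])
  let ?M = "\<Sum>y. \<psi> y * w ^ y"
  show "summable (\<lambda>m. ?M * (1 / w) ^ m)" using w by (intro summable_mult summable_geometric) simp
  fix m
  have s: "summable (\<lambda>j. \<psi> (j + m) * w ^ (j + m))" by (rule summable_ignore_initial_segment[OF w(2)])
  have "w ^ m * R $$ m = (\<Sum>j. w ^ m * \<psi> (j + m))"
   unfolding r by (rule suminf_mult[symmetric, OF summable_ignore_initial_segment[OF sums_summable[OF one]]])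
  also have "... \<le> (\<Sum>j. \<psi> (j + m) * w ^ (j + m))"
   by (intro suminf_le summable_mult summable_ignore_initial_segment[OF sums_summable[OF one]] s)
     (use nn w in \<open>auto simp: mult.commute[of "w ^ m"] intro!: mult_left_mono power_increasing\<close>)
  also have "... \<le> ?M"
   unfolding suminf_split_initial_segment[OF w(2), of m] using nn w by (simp add: sum_nonneg)
  finally show "norm (R $$ m) \<le> ?M * (1 / w) ^ m"
   using R_nn[of m] w by (simp add: power_divide pos_le_divide_eq mult.commute)
 qed
 then obtain m0 where "norm (\<Sum>m. R $$ (m + m0)) < 1 / 2"
  using suminf_exist_split[of "1 / 2" "\<lambda>m. R $$ m"] by auto
 hence m0: "(\<Sum>m. R $$ (m + m0)) < 1 / 2" by simp
 have tail: "(\<Sum>m\<in>A. R $$ m) < 1 / 2" if A: "finite A" "A \<subseteq> {m0..}" for A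
 proof -
  have "(\<Sum>m\<in>A. R $$ m) = (\<Sum>m\<in>(\<lambda>m. m - m0) ` A. R $$ (m + m0))"
   by (rule sum.reindex_bij_witness[where j = "\<lambda>m. m - m0" and i = "\<lambda>m. m + m0"]) (use A in \<open>auto simp: subset_iff\<close>)
  also have "... \<le> (\<Sum>m. R $$ (m + m0))"
   by (intro sum_le_suminf summable_ignore_initial_segment[OF \<open>summable (\<lambda>m. R $$ m)\<close>]) (use A R_nn in auto)
  finally show ?thesis using m0 by simp
 qed
 have p1: "\<psi> 0 \<le> 1" using sum_le_suminf[OF sums_summable[OF one], of "{0}"] nn sums_unique[OF one] by auto
 \<comment> \<open>In that convolution the indices from \<open>m0\<close> on contribute less than
   1/2. At most \<open>m0\<close> others remain, each at most
   \<open>u_n / \<psi> 0 ^ m0\<close>.\<close>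
 define c where "c = \<psi> 0 ^ m0 / (2 * (real m0 + 1))"
 have c: "0 < c" using p by (simp add: c_def)
 have bk: "\<psi> 0 ^ i * u $$ (n - i) \<le> u $$ n" if "i \<le> n" for i n
  using that
 proof (induction i)
  case (Suc i)
  have "\<psi> 0 * u $$ (n - Suc i) \<le> u $$ (n - i)" using u_step[of "n - Suc i"] Suc.prems by (simp add: Suc_diff_Suc)
  hence "\<psi> 0 ^ i * (\<psi> 0 * u $$ (n - Suc i)) \<le> \<psi> 0 ^ i * u $$ (n - i)" using p by (intro mult_left_mono) auto
  thus ?case using Suc by (simp add: mult_ac)
 qed simp
 have lower: "c \<le> u $$ n" for n
 proof -
  have "1 = (\<Sum>i=0..n. u $$ (n - i) * R $$ i)" using uR[of n] unfolding mult.commute[of u R] by (simp add: fps_mult_nth mult.commute)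
  also have "... = (\<Sum>i\<in>{0..n} \<inter> {..<m0}. u $$ (n - i) * R $$ i) + (\<Sum>i\<in>{0..n} \<inter> {m0..}. u $$ (n - i) * R $$ i)"
   by (subst sum.union_disjoint[symmetric]) (auto intro!: sum.cong)
  also have "(\<Sum>i\<in>{0..n} \<inter> {m0..}. u $$ (n - i) * R $$ i) \<le> (\<Sum>i\<in>{0..n} \<inter> {m0..}. 1 * R $$ i)"
   by (intro sum_mono mult_right_mono u_le R_nn)
  also have "... < 1 / 2" using tail[of "{0..n} \<inter> {m0..}"] by simp
  also have "(\<Sum>i\<in>{0..n} \<inter> {..<m0}. u $$ (n - i) * R $$ i) \<le> (\<Sum>i\<in>{0..n} \<inter> {..<m0}. u $$ n / \<psi> 0 ^ m0)"
  proof (rule sum_mono)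
   fix i assume i: "i \<in> {0..n} \<inter> {..<m0}"
   have "R $$ i \<le> 1" unfolding R_def using nn by (simp add: sum_nonneg)
   hence "u $$ (n - i) * R $$ i \<le> u $$ (n - i)" using u_nn[of "n - i"] mult_left_mono[of "R $$ i" 1 "u $$ (n - i)"] by simp
   moreover have "\<psi> 0 ^ m0 * u $$ (n - i) \<le> \<psi> 0 ^ i * u $$ (n - i)"
    using i p p1 u_nn by (intro mult_right_mono power_decreasing) auto
   moreover have "\<psi> 0 ^ i * u $$ (n - i) \<le> u $$ n" using i by (intro bk) auto
   ultimately have 1: "u $$ (n - i) * R $$ i \<le> u $$ (n - i)" and 2: "u $$ (n - i) * \<psi> 0 ^ m0 \<le> u $$ n"
    by (simp_all add: mult.commute)
   have "u $$ (n - i) \<le> u $$ n / \<psi> 0 ^ m0" using 2 p by (simp add: pos_le_divide_eq)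
   with 1 show "u $$ (n - i) * R $$ i \<le> u $$ n / \<psi> 0 ^ m0" by (rule order_trans)
  qed
  also have "... = real (card ({0..n} \<inter> {..<m0})) * (u $$ n / \<psi> 0 ^ m0)" by simp
  also have "... \<le> (real m0 + 1) * (u $$ n / \<psi> 0 ^ m0)"
   using card_mono[of "{..<m0}" "{0..n} \<inter> {..<m0}"] u_nn[of n] p by (intro mult_right_mono) auto
  finally have "1 < (real m0 + 1) * (u $$ n / \<psi> 0 ^ m0) + 1 / 2" by simp
  hence "1 / 2 < (real m0 + 1) * (u $$ n / \<psi> 0 ^ m0)" by linarith
  thus ?thesis unfolding c_def using p by (simp add: field_simps)
 qed
 have "(\<Sum>L=1..n. (Abs_fps \<psi> ^ L) $$ (n - L)) = u $$ n" if n: "1 \<le> n" for n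
 proof -
  have "(1 - F) * (\<Sum>L<Suc n. F ^ L) = 1 - F ^ Suc n" by (rule one_diff_power_eq[symmetric])
  hence "u * ((1 - F) * (\<Sum>L<Suc n. F ^ L)) = u * (1 - F ^ Suc n)" by (rule arg_cong)
  hence "(\<Sum>L<Suc n. F ^ L) = u - u * F ^ Suc n"
   using uF by (simp only: mult.assoc[symmetric] mult_1_left right_diff_distrib mult_1_right)
  moreover have "(u * F ^ Suc n) $$ n = 0"
  proof -
   have "u * F ^ Suc n = fps_X ^ Suc n * (Abs_fps \<psi> ^ Suc n * u)" unfolding F_def power_mult_distrib by (simp only: mult_ac)
   thus ?thesis by (simp only: fps_X_power_mult_nth) simp
  qed
  ultimately have "(\<Sum>L<Suc n. F ^ L) $$ n = u $$ n" by simp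
  hence "(\<Sum>L<Suc n. (F ^ L) $$ n) = u $$ n" by (simp only: fps_sum_nth)
  moreover have "(\<Sum>L<Suc n. (F ^ L) $$ n) = (\<Sum>L\<in>{1..n}. (F ^ L) $$ n)"
   using n by (intro sum.mono_neutral_right) (auto simp: less_Suc_eq_le Suc_le_eq)
  moreover have "(F ^ L) $$ n = (Abs_fps \<psi> ^ L) $$ (n - L)" if "L \<in> {1..n}" for L
   using that unfolding F_def power_mult_distrib by (simp add: fps_X_power_mult_nth)
  ultimately show ?thesis by simp
 qed
 thus ?thesis using lower c by auto
qed

section \<open>Total weight of the bridges of the untilted walk\<close>

context polya_params
begin

definition psi :: "nat \<Rightarrow> real" where
 "psi y = phi y * rho ^ y / Phi rho"

lemma rho_le_s0: "rho \<le> s0"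
 using lmax rho_pos mult_left_mono[of 1 "exp lmax" rho] by simp

lemma psi: "0 \<le> psi y" "0 < psi 0" "psi sums 1" "1 < s0 / rho" "summable (\<lambda>y. psi y * (s0 / rho) ^ y)"
proof -
 show "0 \<le> psi y" unfolding psi_def using phi_nonneg rho_pos Phi_pos[of rho] by simp
 show "0 < psi 0" unfolding psi_def phi_0 using Phi_pos[of rho] by simp
 show "psi sums 1" using sums_divide[OF phi_sums[OF rho_pos rho_le_s0], of "Phi rho"] Phi_pos[of rho]
  unfolding psi_def[symmetric] by simp
 have "s0 / rho = exp lmax" unfolding lmax(2)[symmetric] using rho_pos by simp
 thus "1 < s0 / rho" using lmax by simp
 have "psi y * (s0 / rho) ^ y = phi y * s0 ^ y / Phi rho" for y
  unfolding psi_def using rho_pos by (simp add: power_divide)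
 thus "summable (\<lambda>y. psi y * (s0 / rho) ^ y)"
  using summable_divide[OF sums_summable[OF phi_sums[of s0]], of "Phi rho"] s0_bounds by simp
qed

lemma base_psi: "base x y = exp (- 1) / fact x * psi y"
 unfolding base_def psi_def ..

text \<open>The outer variable marks X, the inner one Y; the step (0, 0), of probability
  \<open>rho\<close>, is left out.\<close>

definition step_fps :: "real fps fps" where
 "step_fps = Abs_fps (\<lambda>x. Abs_fps (\<lambda>y. if x = 0 \<and> y = 0 then 0 else base x y))"

lemma step_fps_nth: "step_fps $$ x $$ y = (if x = 0 \<and> y = 0 then 0 else base x y)"
 by (simp add: step_fps_def)

lemma step_fps_nonneg: "0 \<le> step_fps $$ x $$ y"
 by (simp add: step_fps_nth base_nonneg)

text \<open>With the step (0, 0) restored, X and Y are independent, and a sum of \<open>L\<close>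
  Poisson(1) variables is Poisson(\<open>L\<close>).\<close>

lemma full_step_power:
 "((step_fps + fps_const (fps_const rho)) ^ L) $$ e = fps_const (exp (- real L) * real L ^ e / fact e) * Abs_fps psi ^ L"
proof (induction L arbitrary: e)
 case 0
 show ?case by (cases e) auto
next
 case (Suc L)
 have P: "(step_fps + fps_const (fps_const rho)) $$ x = fps_const (exp (- 1) / fact x) * Abs_fps psi" for x
  by (rule fps_ext) (auto simp: step_fps_nth base_00[symmetric] base_psi)
 have "((step_fps + fps_const (fps_const rho)) ^ Suc L) $$ e =
  (\<Sum>x=0..e. fps_const (exp (- 1) / fact x) * Abs_fps psi * (fps_const (exp (- real L) * real L ^ (e - x) / fact (e - x)) * Abs_fps psi ^ L))"
  unfolding power_Suc fps_mult_nth P Suc ..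
 also have "... = (\<Sum>x=0..e. fps_const (exp (- real (Suc L)) * (real L ^ (e - x) / (fact x * fact (e - x)))) * Abs_fps psi ^ Suc L)"
 proof (rule sum.cong[OF refl])
  fix x
  have "exp (- real (Suc L)) * (real L ^ (e - x) / (fact x * fact (e - x))) = exp (- 1) / fact x * (exp (- real L) * real L ^ (e - x) / fact (e - x))"
   by (simp add: exp_add[symmetric] mult_ac)
  thus "fps_const (exp (- 1) / fact x) * Abs_fps psi * (fps_const (exp (- real L) * real L ^ (e - x) / fact (e - x)) * Abs_fps psi ^ L) =
   fps_const (exp (- real (Suc L)) * (real L ^ (e - x) / (fact x * fact (e - x)))) * Abs_fps psi ^ Suc L"
   by (simp only: fps_const_mult[symmetric] power_Suc mult_ac)
 qed
 also have "... = fps_const (\<Sum>x=0..e. exp (- real (Suc L)) * (real L ^ (e - x) / (fact x * fact (e - x)))) * Abs_fps psi ^ Suc L"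
  by (rule fps_ext) (simp only: fps_sum_nth fps_mult_left_const_nth sum_distrib_right)
 also have "(\<Sum>x=0..e. exp (- real (Suc L)) * (real L ^ (e - x) / (fact x * fact (e - x)))) = exp (- real (Suc L)) * real (Suc L) ^ e / fact e"
 proof -
  have "real (Suc L) ^ e = (1 + real L) ^ e" by simp
  also have "... = (\<Sum>x\<le>e. real (e choose x) * 1 ^ x * real L ^ (e - x))" by (rule binomial_ring)
  also have "... = fact e * (\<Sum>x=0..e. real L ^ (e - x) / (fact x * fact (e - x)))"
   unfolding sum_distrib_left by (intro sum.cong) (auto simp: binomial_fact)
  finally show ?thesis unfolding sum_distrib_left[symmetric] by simp
 qed
 finally show ?case .
qed

text \<open>With \<open>M = 1 + a - k\<close> and \<open>L = k + M\<close> this is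
  \<open>(L choose k) * rho^M / L\<close>: the ways to insert \<open>M\<close> zero steps, their
  probability, and one out of \<open>L\<close> cyclic rotations.\<close>

definition hw :: "nat \<Rightarrow> nat \<Rightarrow> real" where
 "hw k a = (if k \<le> 1 + a then rho ^ (1 + a - k) * fact a / (fact k * fact (1 + a - k)) else 0)"

lemma hw_nonneg: "0 \<le> hw k a"
 unfolding hw_def using rho_pos by simp

text \<open>Weight of the continuations, by fewer than \<open>J\<close> steps of total size
  \<open>d\<close>, of a walk that has \<open>k\<close> steps and X-sum \<open>a\<close>. The cutoff
  \<open>J\<close> carries the induction over the first step.\<close>

definition bridge_sum :: "nat \<Rightarrow> nat \<Rightarrow> nat \<Rightarrow> nat \<Rightarrow> real" where
 "bridge_sum J d k a = (\<Sum>j<J. \<Sum>e\<le>d. (step_fps ^ j) $$ e $$ (d - e) * hw (k + j) (a + e))"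

lemma bridge_sum_0: "bridge_sum J 0 k a \<le> hw k a"
proof -
 have "(step_fps ^ j) $$ 0 $$ 0 = (if j = 0 then 1 else 0)" for j
  by (induction j) (auto simp: step_fps_nth)
 hence "bridge_sum J 0 k a = (\<Sum>j<J. if j = 0 then hw k a else 0)"
  unfolding bridge_sum_def by (intro sum.cong) auto
 thus ?thesis using hw_nonneg by (cases J) auto
qed

lemma bridge_sum_Suc:
 assumes d: "0 < d"
 shows "bridge_sum (Suc J) d k a = (\<Sum>x\<le>d. \<Sum>y\<le>d - x. step_fps $$ x $$ y * bridge_sum J (d - x - y) (Suc k) (a + x))"
proof -
 have z: "(\<Sum>e\<le>d. (step_fps ^ 0) $$ e $$ (d - e) * hw (k + 0) (a + e)) = 0"
  using d by (intro sum.neutral) auto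
 have "bridge_sum (Suc J) d k a = (\<Sum>j<J. \<Sum>e\<le>d. (step_fps ^ Suc j) $$ e $$ (d - e) * hw (k + Suc j) (a + e))"
  unfolding bridge_sum_def sum.lessThan_Suc_shift z by simp
 also have "... = (\<Sum>j<J. \<Sum>x\<le>d. \<Sum>y\<le>d - x. step_fps $$ x $$ y * (\<Sum>e\<le>d - x - y. (step_fps ^ j) $$ e $$ (d - x - y - e) * hw (Suc k + j) (a + x + e)))"
 proof (rule sum.cong[OF refl])
  fix j
  have "(\<Sum>e\<le>d. (step_fps ^ Suc j) $$ e $$ (d - e) * hw (k + Suc j) (a + e)) =
   (\<Sum>e\<le>d. \<Sum>x\<le>e. \<Sum>y\<le>d - e. step_fps $$ x $$ y * (step_fps ^ j) $$ (e - x) $$ (d - e - y) * hw (Suc k + j) (a + e))"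
   unfolding power_Suc fps_mult_nth fps_sum_nth atLeast0AtMost sum_distrib_right by simp
  also have "... = (\<Sum>(e, x, y)\<in>(SIGMA e:{..d}. {..e} \<times> {..d - e}). step_fps $$ x $$ y * (step_fps ^ j) $$ (e - x) $$ (d - e - y) * hw (Suc k + j) (a + e))"
   by (simp add: sum.Sigma sum.cartesian_product split_beta)
  \<comment> \<open>Reordering by the first step (x, y); \<open>e\<close> becomes the X-sum of the
    later steps.\<close>
  also have "... = (\<Sum>(x, y, e)\<in>(SIGMA x:{..d}. SIGMA y:{..d - x}. {..d - x - y}). step_fps $$ x $$ y * ((step_fps ^ j) $$ e $$ (d - x - y - e) * hw (Suc k + j) (a + x + e)))"
   by (rule sum.reindex_bij_witness[where j = "\<lambda>(e, x, y). (x, y, e - x)" and i = "\<lambda>(x, y, e). (x + e, x, y)"])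
     (auto simp: mult.assoc diff_diff_eq add_ac)
  also have "... = (\<Sum>x\<le>d. \<Sum>y\<le>d - x. step_fps $$ x $$ y * (\<Sum>e\<le>d - x - y. (step_fps ^ j) $$ e $$ (d - x - y - e) * hw (Suc k + j) (a + x + e)))"
   by (simp add: sum.Sigma[symmetric] sum_distrib_left)
  finally show "(\<Sum>e\<le>d. (step_fps ^ Suc j) $$ e $$ (d - e) * hw (k + Suc j) (a + e)) = ..." .
 qed
 also have "... = (\<Sum>x\<le>d. \<Sum>y\<le>d - x. step_fps $$ x $$ y * bridge_sum J (d - x - y) (Suc k) (a + x))"
  unfolding bridge_sum_def sum_distrib_left
  by (subst sum.swap, rule sum.cong[OF refl], subst sum.swap, rule refl)
 finally show ?thesis .
qed

lemma bridge_sum_nonneg: "0 \<le> bridge_sum J d k a"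
proof (induction J arbitrary: d k a)
 case (Suc J)
 show ?case
 proof (cases "d = 0")
  case True
  have "(step_fps ^ j) $$ 0 $$ 0 = (if j = 0 then 1 else 0)" for j
   by (induction j) (auto simp: step_fps_nth)
  thus ?thesis unfolding bridge_sum_def True by (auto intro!: sum_nonneg hw_nonneg)
 next
  case False
  thus ?thesis using Suc by (auto simp: bridge_sum_Suc intro!: sum_nonneg mult_nonneg_nonneg step_fps_nonneg)
 qed
qed (simp add: bridge_sum_def)

text \<open>By the binomial theorem \<open>hw\<close> reinstates the zero steps, leaving closed
  walks whose length \<open>L\<close> is one more than their X-sum. This is the probability that a
  critical tree decorated with forests has \<open>N + 1\<close> vertices. \<open>hw j e\<close>
  vanishes for \<open>j > e + 1\<close>, so \<open>N + 2\<close> captures every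
  \<open>j\<close>.\<close>

lemma bridge_sum_full:
 "bridge_sum (N + 2) N 0 0 = (\<Sum>L=1..Suc N. exp (- real L) * real L ^ (L - 1) / fact L * (Abs_fps psi ^ L) $$ (Suc N - L))"
proof -
 have "(\<Sum>j<N + 2. (step_fps ^ j) $$ e $$ (N - e) * hw j e) =
  exp (- real (Suc e)) * real (Suc e) ^ e / fact (Suc e) * (Abs_fps psi ^ Suc e) $$ (N - e)" if e: "e \<le> N" for e
 proof -
  have "(\<Sum>j<N + 2. (step_fps ^ j) $$ e $$ (N - e) * hw j e) = (\<Sum>j\<le>Suc e. (step_fps ^ j) $$ e $$ (N - e) * hw j e)"
   using e by (intro sum.mono_neutral_right) (auto simp: hw_def)
  also have "... = (\<Sum>j\<le>Suc e. real (Suc e choose j) * (step_fps ^ j) $$ e $$ (N - e) * rho ^ (Suc e - j)) / real (Suc e)"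
  proof -
   have f: "fact (Suc e) = real (Suc e) * fact e" by simp
   show ?thesis unfolding sum_divide_distrib
    by (intro sum.cong) (auto simp: hw_def binomial_fact f simp del: of_nat_Suc fact_Suc)
  qed
  also have "(\<Sum>j\<le>Suc e. real (Suc e choose j) * (step_fps ^ j) $$ e $$ (N - e) * rho ^ (Suc e - j)) =
   ((step_fps + fps_const (fps_const rho)) ^ Suc e) $$ e $$ (N - e)"
   unfolding binomial_ring fps_sum_nth fps_const_power
   by (intro sum.cong) (simp_all add: fps_of_nat[symmetric] mult_ac)
  also have "... = exp (- real (Suc e)) * real (Suc e) ^ e / fact e * (Abs_fps psi ^ Suc e) $$ (N - e)"
   unfolding full_step_power by simp
  finally show ?thesis by (simp add: fact_Suc)
 qed
 hence "bridge_sum (N + 2) N 0 0 = (\<Sum>e\<le>N. exp (- real (Suc e)) * real (Suc e) ^ e / fact (Suc e) * (Abs_fps psi ^ Suc e) $$ (N - e))"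
  unfolding bridge_sum_def by (subst sum.swap) simp
 also have "... = (\<Sum>L=1..Suc N. exp (- real L) * real L ^ (L - 1) / fact L * (Abs_fps psi ^ L) $$ (Suc N - L))"
  by (rule sum.reindex_bij_witness[where j = Suc and i = "\<lambda>L. L - 1"]) auto
 finally show ?thesis .
qed

text \<open>All tree coefficients with \<open>L <= N + 1\<close> are at least of order
  \<open>N^(-3/2)\<close>; what is left is a renewal sum. The factor \<open>2 * sqrt 2\<close>
  replaces \<open>N + 1\<close> by \<open>N\<close>.\<close>

lemma bridge_sum_lower:
 "\<exists>c>0. \<forall>N\<ge>1. c / (real N * sqrt (real N)) \<le> bridge_sum (N + 2) N 0 0"
proof -
 from renewal_bound[OF psi] obtain c where c: "0 < c" "\<And>n. 1 \<le> n \<Longrightarrow> c \<le> (\<Sum>L=1..n. (Abs_fps psi ^ L) $$ (n - L))" by blast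
 have pw: "0 \<le> (Abs_fps psi ^ L) $$ i" for L i
  by (induction L arbitrary: i) (auto simp: fps_mult_nth intro!: sum_nonneg mult_nonneg_nonneg psi)
 define c' where "c' = c * exp (- 1) / (2 * sqrt 2)"
 have "c' / (real N * sqrt (real N)) \<le> bridge_sum (N + 2) N 0 0" if N: "1 \<le> N" for N
 proof -
  have n: "real (Suc N) \<le> 2 * real N" using N by simp
  have s: "sqrt (real (Suc N)) \<le> sqrt 2 * sqrt (real N)" using real_sqrt_le_mono[OF n] by (simp add: real_sqrt_mult)
  have "real (Suc N) * sqrt (real (Suc N)) \<le> (2 * real N) * (sqrt 2 * sqrt (real N))" by (intro mult_mono n s) auto
  hence "exp (- 1) / ((2 * real N) * (sqrt 2 * sqrt (real N))) \<le> exp (- 1) / (real (Suc N) * sqrt (real (Suc N)))"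
   by (intro divide_left_mono) (use N in auto)
  hence "exp (- 1) / ((2 * real N) * (sqrt 2 * sqrt (real N))) * c \<le> exp (- 1) / (real (Suc N) * sqrt (real (Suc N))) * c"
   using c(1) by (intro mult_right_mono) auto
  moreover have "c' / (real N * sqrt (real N)) = exp (- 1) / ((2 * real N) * (sqrt 2 * sqrt (real N))) * c"
   by (simp add: c'_def mult_ac)
  ultimately have "c' / (real N * sqrt (real N)) \<le> exp (- 1) / (real (Suc N) * sqrt (real (Suc N))) * c"
   by simp
  also have "... \<le> exp (- 1) / (real (Suc N) * sqrt (real (Suc N))) * (\<Sum>L=1..Suc N. (Abs_fps psi ^ L) $$ (Suc N - L))"
   by (intro mult_left_mono c(2)) auto
  also have "... = (\<Sum>L=1..Suc N. exp (- 1) / (real (Suc N) * sqrt (real (Suc N))) * (Abs_fps psi ^ L) $$ (Suc N - L))"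
   by (rule sum_distrib_left)
  also have "... \<le> (\<Sum>L=1..Suc N. exp (- real L) * real L ^ (L - 1) / fact L * (Abs_fps psi ^ L) $$ (Suc N - L))"
  proof (intro sum_mono mult_right_mono pw)
   fix L assume L: "L \<in> {1..Suc N}"
   have "real L * sqrt (real L) \<le> real (Suc N) * sqrt (real (Suc N))" using L by (intro mult_mono) auto
   hence "exp (- 1) / (real (Suc N) * sqrt (real (Suc N))) \<le> exp (- 1) / (real L * sqrt (real L))"
    using L by (intro divide_left_mono) auto
   also have "... \<le> exp (- real L) * real L ^ (L - 1) / fact L" using L by (intro tree_coeff_ge) auto
   finally show "exp (- 1) / (real (Suc N) * sqrt (real (Suc N))) \<le> exp (- real L) * real L ^ (L - 1) / fact L" .
  qed
  finally show ?thesis unfolding bridge_sum_full .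
 qed
 moreover have "0 < c'" using c by (simp add: c'_def)
 ultimately show ?thesis by blast
qed

end

lemma suminf_single: "(\<Sum>x. if x = a then f x else 0) = (f a :: ennreal)"
 by (subst suminf_finite[of "{a}"]) auto

section \<open>The walk until it reaches N, and the change of measure\<close>

definition triple_size :: "triple \<Rightarrow> nat" where
 "triple_size t = fst t + fst (snd t)"

definition proper :: "triple \<Rightarrow> bool" where
 "proper t \<longleftrightarrow> 0 < triple_size t \<and> fst (snd t) = fsize (snd (snd t))"

definition walk_end :: "nat \<Rightarrow> nat \<times> triple list \<Rightarrow> bool" where
 "walk_end N st \<longleftrightarrow> fst st = sum_list (map triple_size (snd st)) \<and> (\<forall>t\<in>set (snd st). proper t) \<and>
   N \<le> fst st \<and> 1 \<le> length (snd st) \<and> length (snd st) \<le> N"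

lemma length_le_size: "(\<And>t. t \<in> set ts \<Longrightarrow> proper t) \<Longrightarrow> length ts \<le> sum_list (map triple_size ts)"
 by (induction ts) (fastforce simp: proper_def)+

definition next_state :: "nat \<Rightarrow> nat \<times> triple list \<Rightarrow> triple \<Rightarrow> (nat \<times> triple list) + (nat \<times> triple list)" where
 "next_state N st t = (let s' = fst st + fst t + fst (snd t); ts' = snd st @ [t] in
   if s' < N then Inl (s', ts') else Inr (s', ts'))"

context polya_params
begin

definition until_step :: "pre \<Rightarrow> nat \<Rightarrow> nat \<times> triple list \<Rightarrow> ((nat \<times> triple list) + (nat \<times> triple list)) prog" where
 "until_step c N st = pbind (samplerQ M0 B q c) (\<lambda>t. detp (next_state N st t) 4)"

lemma sample_until_eq: "sample_until M0 B q c N = loop (until_step c N) (0, [])"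
proof -
 have "(\<lambda>(s, ts). pbind (samplerQ M0 B q c) (\<lambda>(x, y, F). pbind (push ts (x, y, F)) (\<lambda>ts'. pbind (tick 3)
   (\<lambda>_. let s' = s + x + y in ret (if s' < N then Inl (s', ts') else Inr (s', ts')))))) = until_step c N"
  unfolding until_step_def next_state_def push_eq tick_eq ret_eq Let_def split_beta
  by (intro ext arg_cong[of _ _ "pbind (samplerQ M0 B q c)"]) (simp add: pbind_detp_detp)
 thus ?thesis unfolding sample_until_def by simp
qed

lemma good_until_step: "good q' (until_step c N st)"
 unfolding until_step_def by (intro good_pbind good_samplerQ good_detp)

lemma good_sample_until: "good q' (sample_until M0 B q c N)"
 unfolding sample_until_eq by (intro good_loop good_until_step)

lemma post_samplerQ_proper: "post (samplerQ M0 B q c) proper"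
 by (rule post_mono[OF post_samplerQ]) (auto simp: proper_def triple_size_def)

lemma post_until_step:
 "post (until_step c N st) (\<lambda>r. \<exists>t. proper t \<and> r = next_state N st t)"
 unfolding until_step_def by (rule post_pbind[OF post_samplerQ_proper]) (auto simp: post_detp)

lemma post_sample_until:
 assumes N: "1 \<le> N"
 shows "post (sample_until M0 B q c N) (walk_end N)"
 unfolding sample_until_eq
proof (rule post_loop[where I = "\<lambda>st. fst st = sum_list (map triple_size (snd st)) \<and> (\<forall>t\<in>set (snd st). proper t) \<and> fst st < N"], goal_cases)
 case (1 st)
 hence "length (snd st) \<le> fst st" using length_le_size[of "snd st"] by auto
 thus ?case using 1
  by (intro post_mono[OF post_until_step]) (auto simp: walk_end_def next_state_def Let_def triple_size_def split: if_splits)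
qed (use N in auto)

context
 fixes c l assumes c: "pre_ok c l"
begin

text \<open>The potential is proportional to the remaining distance, which every triple shortens by
  at least 1.\<close>

lemma cst_sample_until: "cst q (sample_until M0 B q c N) \<le> ennreal ((real N + 1) * (samplerQ_cost + 5))"
proof -
 define K where "K = samplerQ_cost + 5"
 have K: "5 \<le> K" using samplerQ_cost_nonneg by (simp add: K_def)
 define g where "g st = ennreal ((real (N - fst st) + 1) * K)" for st :: "nat \<times> triple list"
 have "cst q (loop (until_step c N) (0, [])) \<le> g (0, [])"
 proof (rule cst_loop[OF good_until_step])
  fix st :: "nat \<times> triple list"
  have "cst q (until_step c N st) \<le> ennreal samplerQ_cost + of_nat 4"
   unfolding until_step_def by (rule cst_pbind_le[OF good_samplerQ good_detp cst_samplerQ[OF c]]) (simp add: cst_detp)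
  also have "... = ennreal (K - 1)" using samplerQ_cost_nonneg by (simp add: K_def ennreal_num_add add.commute)
  finally have 1: "cst q (until_step c N st) \<le> ennreal (K - 1)" .
  have "val q (until_step c N st) (\<lambda>r. case r of Inl s' \<Rightarrow> 1 + g s' | Inr x \<Rightarrow> 0) \<le> ennreal (1 + real (N - fst st) * K)"
  proof (rule val_le_const_post[OF post_until_step])
   fix r assume "\<exists>t. proper t \<and> r = next_state N st t"
   then obtain t where t: "proper t" "r = next_state N st t" by blast
   have p: "0 \<le> real (N - fst st) * K" using K by simp
   show "(case r of Inl s' \<Rightarrow> 1 + g s' | Inr x \<Rightarrow> 0) \<le> ennreal (1 + real (N - fst st) * K)"
   proof (cases "fst st + fst t + fst (snd t) < N")
    case True
    have "0 < fst t + fst (snd t)" using t by (auto simp: proper_def triple_size_def)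
    hence "real (N - (fst st + fst t + fst (snd t))) + 1 \<le> real (N - fst st)" using True by linarith
    hence "(real (N - (fst st + fst t + fst (snd t))) + 1) * K \<le> real (N - fst st) * K"
     using K by (intro mult_right_mono) auto
    moreover have "(case r of Inl s' \<Rightarrow> 1 + g s' | Inr x \<Rightarrow> 0) = ennreal (1 + (real (N - (fst st + fst t + fst (snd t))) + 1) * K)"
    proof -
     have g1: "1 + ennreal z = ennreal (1 + z)" if "0 \<le> z" for z using that by simp
     have "0 \<le> (real (N - (fst st + fst t + fst (snd t))) + 1) * K" using K by simp
     from g1[OF this] show ?thesis using True by (simp only: t(2) next_state_def Let_def g_def if_True sum.case fst_conv)
    qed
    ultimately show ?thesis by (auto intro!: ennreal_leI)
   qed (use p in \<open>simp add: t(2) next_state_def Let_def\<close>)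
  qed
  from add_mono[OF 1 this] have "cst q (until_step c N st) + val q (until_step c N st) (\<lambda>r. case r of Inl s' \<Rightarrow> 1 + g s' | Inr x \<Rightarrow> 0)
   \<le> ennreal (K - 1) + ennreal (1 + real (N - fst st) * K)" .
  also have "... = g st" using K unfolding g_def by (subst ennreal_plus[symmetric]) (auto simp: algebra_simps)
  finally show "cst q (until_step c N st) + val q (until_step c N st) (\<lambda>r. case r of Inl s' \<Rightarrow> 1 + g s' | Inr x \<Rightarrow> 0) \<le> g st" .
 qed
 thus ?thesis unfolding sample_until_eq g_def K_def by simp
qed

lemma mass_sample_until: "val q (sample_until M0 B q c N) (\<lambda>_. 1) = 1"
proof -
 have m: "val q (until_step c N st) (\<lambda>_. 1) = 1" for st
  unfolding until_step_def by (subst val_pbind[OF good_samplerQ good_detp]) (simp add: val_detp mass_samplerQ[OF c])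
 have "val q (loop (until_step c N) st) (\<lambda>_. 1) = 1" for st
 proof (induction "N - fst st" arbitrary: st rule: less_induct)
  case less
  have "val q (loop (until_step c N) st) (\<lambda>_. 1) = val q (until_step c N st) (\<lambda>r. case r of Inl s' \<Rightarrow> val q (loop (until_step c N) s') (\<lambda>_. 1) | Inr x \<Rightarrow> 1)"
   by (rule val_loop[OF good_until_step])
  also have "... = val q (until_step c N st) (\<lambda>_. 1)"
  proof (rule val_cong_post[OF post_until_step])
   fix r assume "\<exists>t. proper t \<and> r = next_state N st t"
   then obtain t where t: "proper t" "r = next_state N st t" by blast
   show "(case r of Inl s' \<Rightarrow> val q (loop (until_step c N) s') (\<lambda>_. 1) | Inr x \<Rightarrow> 1) = 1"
    using t less by (auto simp: next_state_def Let_def proper_def triple_size_def)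
  qed
  finally show ?case by (simp add: m)
 qed
 thus ?thesis unfolding sample_until_eq .
qed

text \<open>Extends \<open>val_samplerQ\<close> to functions that need not be bounded by 1, by
  splitting into the single values of (X, Y).\<close>

lemma val_samplerQ_any:
 "val q (samplerQ M0 B q c) (\<lambda>t. f (fst t) (fst (snd t))) = (\<Sum>x. \<Sum>y. ennreal (wc l x y / BN c) * f x y)"
proof -
 let ?X = "samplerQ M0 B q c"
 define ind :: "nat \<Rightarrow> nat \<Rightarrow> triple \<Rightarrow> ennreal" where "ind x y t = (if fst t = x \<and> fst (snd t) = y then 1 else 0)" for x y t
 have i: "val q ?X (ind x y) = ennreal (wc l x y / BN c)" for x y
 proof -
  have "val q ?X (ind x y) = val q ?X (\<lambda>(x', y', F). if x' = x \<and> y' = y then 1 else 0)"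
   by (intro arg_cong[of _ _ "val q ?X"] ext) (auto simp: ind_def)
  also have "... = ennreal (1 / BN c) * (\<Sum>x'. \<Sum>y'. ennreal (wc l x' y') * (if x' = x \<and> y' = y then 1 else 0))"
   by (rule val_samplerQ[OF c]) simp
  also have "(\<Sum>x'. \<Sum>y'. ennreal (wc l x' y') * (if x' = x \<and> y' = y then 1 else 0)) =
   (\<Sum>x'. if x' = x then (\<Sum>y'. if y' = y then ennreal (wc l x' y') else 0) else 0)"
   by (intro arg_cong[of _ _ suminf] ext) (auto intro!: arg_cong[of _ _ suminf])
  also have "... = ennreal (wc l x y)" unfolding suminf_single ..
  also have "ennreal (1 / BN c) * ennreal (wc l x y) = ennreal (wc l x y / BN c)"
   using pre_C(4)[OF c] wc_nonneg by (subst ennreal_mult[symmetric]) auto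
  finally show ?thesis .
 qed
 have "(\<Sum>x. \<Sum>y. f x y * ind x y t) = f (fst t) (fst (snd t))" for t
 proof -
  have "(\<Sum>x. \<Sum>y. f x y * ind x y t) = (\<Sum>x. if x = fst t then (\<Sum>y. if y = fst (snd t) then f x y else 0) else 0)"
   by (intro arg_cong[of _ _ suminf] ext) (auto simp: ind_def intro!: arg_cong[of _ _ suminf])
  thus ?thesis unfolding suminf_single .
 qed
 hence "val q ?X (\<lambda>t. f (fst t) (fst (snd t))) = val q ?X (\<lambda>t. \<Sum>x. \<Sum>y. f x y * ind x y t)"
  by simp
 also have "... = (\<Sum>x. \<Sum>y. f x y * val q ?X (ind x y))"
  by (simp only: val_suminf[OF good_samplerQ] val_cmult[OF good_samplerQ])
 finally show ?thesis unfolding i by (simp only: mult.commute)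
qed

text \<open>Density of the untilted walk with respect to the sampled one: each factor turns
  \<open>wc / BN\<close> back into \<open>base\<close>.\<close>

definition tilt :: "triple list \<Rightarrow> real" where
 "tilt ts = (\<Prod>t\<leftarrow>ts. BN c / cosh (l * real (triple_size t)))"

lemma tilt_nonneg: "0 \<le> tilt ts"
 unfolding tilt_def using pre_C(4)[OF c] by (induction ts) auto

text \<open>\<open>tilt\<close> and \<open>hw\<close> together are the numerator of the acceptance
  probability R of a walk that ends at \<open>N\<close>.\<close>

definition hit :: "nat \<Rightarrow> nat \<times> triple list \<Rightarrow> ennreal" where
 "hit N st = (if fst st = N then ennreal (tilt (snd st) * hw (length (snd st)) (sum_list (map fst (snd st)))) else 0)"

text \<open>One sampled triple cancels its factor in \<open>tilt\<close>, which reproduces the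
  decomposition by the first step. Since only a lower bound is claimed, walks longer than the cutoff
  may be dropped.\<close>

lemma val_sample_until_lower_aux:
 "s < N \<Longrightarrow> ennreal (tilt ts * bridge_sum J (N - s) (length ts) (sum_list (map fst ts))) \<le> val q (loop (until_step c N) (s, ts)) (hit N)"
proof (induction J arbitrary: s ts)
 case 0
 show ?case by (simp add: bridge_sum_def)
next
 case (Suc J)
 define d k a where "d = N - s" and "k = length ts" and "a = sum_list (map fst ts)"
 have d: "0 < d" "N = s + d" using Suc by (auto simp: d_def)
 have b: "0 < BN c" by (rule pre_C(4)[OF c])
 define f where "f x y = (if 0 < x + y \<and> x + y \<le> d then ennreal (tilt ts * (BN c / cosh (l * real (x + y))) * bridge_sum J (d - x - y) (Suc k) (a + x)) else 0)" for x y :: nat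
 have "ennreal (tilt ts * bridge_sum (Suc J) d k a) = (\<Sum>x\<le>d. \<Sum>y\<le>d - x. ennreal (wc l x y / BN c) * f x y)"
 proof -
  have e: "ennreal (wc l x y / BN c) * f x y = ennreal (tilt ts * (step_fps $$ x $$ y * bridge_sum J (d - x - y) (Suc k) (a + x)))"
   if "x \<le> d" "y \<le> d - x" for x y
  proof (cases "x = 0 \<and> y = 0")
   case False
   have "ennreal (wc l x y / BN c) * f x y = ennreal (wc l x y / BN c * (tilt ts * (BN c / cosh (l * real (x + y))) * bridge_sum J (d - x - y) (Suc k) (a + x)))"
    using that b wc_nonneg[of l x y] tilt_nonneg[of ts] False bridge_sum_nonneg[of J "d - x - y" "Suc k" "a + x"] unfolding f_def
    by (subst ennreal_mult) auto
   also have "wc l x y / BN c * (tilt ts * (BN c / cosh (l * real (x + y))) * bridge_sum J (d - x - y) (Suc k) (a + x)) =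
    tilt ts * (step_fps $$ x $$ y * bridge_sum J (d - x - y) (Suc k) (a + x))"
    using b False by (auto simp: wc_def step_fps_nth)
   finally show ?thesis .
  qed (simp add: f_def step_fps_nth)
  define g where "g x y = tilt ts * (step_fps $$ x $$ y * bridge_sum J (d - x - y) (Suc k) (a + x))" for x y
  have nn: "0 \<le> g x y" for x y
   unfolding g_def using tilt_nonneg step_fps_nonneg bridge_sum_nonneg by simp
  have "(\<Sum>x\<le>d. \<Sum>y\<le>d - x. ennreal (wc l x y / BN c) * f x y) = (\<Sum>x\<le>d. \<Sum>y\<le>d - x. ennreal (g x y))"
   unfolding g_def by (intro sum.cong refl e) auto
  also have "... = ennreal (\<Sum>x\<le>d. \<Sum>y\<le>d - x. g x y)" by (simp add: nn sum_nonneg)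
  also have "(\<Sum>x\<le>d. \<Sum>y\<le>d - x. g x y) = tilt ts * bridge_sum (Suc J) d k a"
   unfolding g_def bridge_sum_Suc[OF d(1)] sum_distrib_left ..
  finally show ?thesis ..
 qed
 also have "... \<le> (\<Sum>x\<le>d. \<Sum>y. ennreal (wc l x y / BN c) * f x y)"
  by (intro sum_mono sum_le_suminf) auto
 also have "... \<le> (\<Sum>x. \<Sum>y. ennreal (wc l x y / BN c) * f x y)"
  by (intro sum_le_suminf) auto
 also have "... = val q (samplerQ M0 B q c) (\<lambda>t. f (fst t) (fst (snd t)))"
  by (rule val_samplerQ_any[symmetric])
 also have "... \<le> val q (samplerQ M0 B q c) (\<lambda>t. case next_state N (s, ts) t of Inl s' \<Rightarrow> val q (loop (until_step c N) s') (hit N) | Inr x \<Rightarrow> hit N x)"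
 proof (rule val_mono)
  fix t :: triple
  let ?x = "fst t" and ?y = "fst (snd t)"
  have t: "tilt (ts @ [t]) = tilt ts * (BN c / cosh (l * real (?x + ?y)))"
   by (simp add: tilt_def triple_size_def)
  \<comment> \<open>The walk stays below \<open>N\<close>, lands on \<open>N\<close>, or takes a
    zero or overshooting step, where \<open>f\<close> is 0.\<close>
  consider "0 < ?x + ?y" "?x + ?y < d" | "0 < ?x + ?y" "?x + ?y = d" | "\<not> (0 < ?x + ?y \<and> ?x + ?y \<le> d)" by linarith
  thus "f ?x ?y \<le> (case next_state N (s, ts) t of Inl s' \<Rightarrow> val q (loop (until_step c N) s') (hit N) | Inr x \<Rightarrow> hit N x)"
  proof cases
   case 1
   hence lt: "s + ?x + ?y < N" "N - (s + ?x + ?y) = d - ?x - ?y" using d by auto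
   from Suc.IH[OF lt(1), of "ts @ [t]"] show ?thesis
    using 1 lt unfolding t lt(2) by (simp add: f_def next_state_def Let_def k_def a_def)
  next
   case 2
   hence eq: "s + ?x + ?y = N" using d by auto
   have "tilt (ts @ [t]) * bridge_sum J 0 (Suc k) (a + ?x) \<le> tilt (ts @ [t]) * hw (Suc k) (a + ?x)"
    by (intro mult_left_mono bridge_sum_0 tilt_nonneg)
   moreover have "d - ?x - ?y = 0" using 2 by simp
   ultimately show ?thesis
    using 2 eq unfolding t by (simp add: f_def next_state_def Let_def k_def a_def hit_def t ennreal_leI)
  next
   case 3
   hence "f ?x ?y = 0" by (simp only: f_def if_False)
   thus ?thesis by simp
  qed
 qed
 also have "... = val q (until_step c N (s, ts)) (\<lambda>r. case r of Inl s' \<Rightarrow> val q (loop (until_step c N) s') (hit N) | Inr x \<Rightarrow> hit N x)"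
  unfolding until_step_def by (subst val_pbind[OF good_samplerQ good_detp]) (simp add: val_detp until_step_def)
 also have "... = val q (loop (until_step c N) (s, ts)) (hit N)"
  by (rule val_loop[OF good_until_step, symmetric])
 finally show ?case unfolding d_def k_def a_def .
qed

lemma val_sample_until_lower:
 assumes "1 \<le> N"
 shows "ennreal (bridge_sum J N 0 0) \<le> val q (sample_until M0 B q c N) (hit N)"
 using val_sample_until_lower_aux[of 0 N "[]" J] assms unfolding sample_until_eq by (simp add: tilt_def)

end

end

section \<open>Acceptance test, insertion of zero triples, and assembly\<close>

definition udraw :: "(real \<Rightarrow> 'a) \<Rightarrow> nat \<Rightarrow> 'a prog" where
 "udraw h k = draw (\<lambda>z. Some (h (fst z), k))"

text \<open>The uniform real is consumed inside the draw, which hands out a countable value only;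
  this makes it \<open>good\<close>.\<close>

lemma udraw:
 fixes h :: "real \<Rightarrow> 'a::countable"
 assumes h: "h \<in> borel \<rightarrow>\<^sub>M count_space UNIV"
 shows "good q (udraw h k)" and "val q (udraw h k) f = (\<integral>\<^sup>+ u. f (h u) \<partial>unif)"
  and "cst q (udraw h k) = of_nat k" and "val q (udraw h k) (\<lambda>_. 1) = 1"
proof -
 have "(\<lambda>u. Some (h u, k)) \<in> borel \<rightarrow>\<^sub>M count_space UNIV" by (rule measurable_compose[OF h]) simp
 from measurable_compose[OF cell_components(1) this]
 have m: "(\<lambda>z. Some (h (fst z), k)) \<in> cell_measure q \<rightarrow>\<^sub>M count_space UNIV" .
 show "good q (udraw h k)" unfolding udraw_def by (rule good_draw[OF m])
 have w: "wp q (udraw h k) g = (\<integral>\<^sup>+ u. g (h u) k \<partial>unif)" for g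
  unfolding udraw_def wp_draw[OF m]
  using nn_integral_cell(1)[of "\<lambda>u. g (h u) k"] measurable_compose[OF h, of "\<lambda>x. g x k" borel] by simp
 show v: "val q (udraw h k) f = (\<integral>\<^sup>+ u. f (h u) \<partial>unif)" for f unfolding val_def w ..
 interpret u: prob_space unif by (rule prob_space_uniform_measure) auto
 show "cst q (udraw h k) = of_nat k" unfolding cst_def w by (simp add: u.emeasure_space_1)
 show "val q (udraw h k) (\<lambda>_. 1) = 1" unfolding v by (simp add: u.emeasure_space_1)
qed

lemma post_udraw: "(\<And>u. P (h u)) \<Longrightarrow> post (udraw h k) P"
 by (auto simp: post_def udraw_def draw_def)

lemma uniform_int_udraw: "uniform_int i j = udraw (\<lambda>u. min j (i + nat \<lfloor>u * real (j + 1 - i)\<rfloor>)) 1"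
 by (simp add: uniform_int_def udraw_def draw_def)

lemma uniform_int_measurable: "(\<lambda>u. min j (i + nat \<lfloor>u * real (j + 1 - i)\<rfloor>)) \<in> borel \<rightarrow>\<^sub>M count_space UNIV"
proof -
 have "(\<lambda>u. \<lfloor>u * real (j + 1 - i)\<rfloor>) \<in> borel \<rightarrow>\<^sub>M count_space UNIV" by measurable
 from measurable_compose[OF this, of "\<lambda>k. min j (i + nat k)" "count_space UNIV"] show ?thesis by simp
qed

lemmas uniform_int = udraw[OF uniform_int_measurable, where k = 1, folded uniform_int_udraw]

lemma post_uniform_int: "i \<le> j \<Longrightarrow> post (uniform_int i j) (\<lambda>r. i \<le> r \<and> r \<le> j)"
 unfolding uniform_int_udraw by (rule post_udraw) auto

lemma uniform_test_less: "pbind uniform (\<lambda>u. test_less (Log (V u)) (V r)) = udraw (\<lambda>u. ln u < r) 3"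
 unfolding test_less_eq by (simp add: fun_eq_iff pbind_def uniform_def detp_def udraw_def draw_def)

lemma ln_less_measurable: "(\<lambda>u :: real. ln u < r) \<in> borel \<rightarrow>\<^sub>M count_space UNIV"
 by measurable

lemma ln_less_prob_ge:
 assumes v: "0 \<le> v" "v \<le> 1" "v \<le> exp r"
 shows "ennreal v \<le> (\<integral>\<^sup>+ u. (if ln u < r then 1 else 0) \<partial>unif)"
proof -
 \<comment> \<open>The open interval avoids \<open>u = 0\<close>, where \<open>ln\<close> has the
   default value 0.\<close>
 have "ennreal v = emeasure lborel {0<..<v}" using v by simp
 also have "... = (\<integral>\<^sup>+ u. indicator {0<..<v} u \<partial>lborel)" by simp
 also have "... \<le> (\<integral>\<^sup>+ u. (if ln u < r then 1 else 0) * indicator {0..1} u \<partial>lborel)"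
 proof (intro nn_integral_mono)
  fix u :: real
  have "ln u < r" if "0 < u" "u < v" using that v(3) by (metis exp_ln exp_less_cancel_iff order_less_le_trans)
  thus "indicator {0<..<v} u \<le> (if ln u < r then 1 else 0 :: ennreal) * indicator {0..1} u"
   using v by (auto split: split_indicator)
 qed
 also have "... = (\<integral>\<^sup>+ u. (if ln u < r then 1 else 0) \<partial>unif)" by (rule nn_integral_unif[symmetric]) measurable
 finally show ?thesis .
qed

lemma mass_pbind:
 "good q p \<Longrightarrow> (\<And>x. good q (k x)) \<Longrightarrow> val q p (\<lambda>_. 1) = 1 \<Longrightarrow> (\<And>x. val q (k x) (\<lambda>_. 1) = 1) \<Longrightarrow> val q (pbind p k) (\<lambda>_. 1) = 1"
 by (simp add: val_pbind)

lemma mass_for_loop: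
 assumes "\<And>i s. good q (f i s)" "\<And>i s. val q (f i s) (\<lambda>_. 1) = 1"
 shows "val q (for_loop k i f s) (\<lambda>_. 1) = 1"
 by (induction k arbitrary: i s) (simp_all only: val_for_loop_0 val_for_loop_Suc assms)

text \<open>Number of edges created at the vertex, which is its share of the cost of
  \<open>build_tree\<close> up to a constant.\<close>

definition degree_weight :: "triple \<Rightarrow> nat" where
 "degree_weight t = fst t + size (snd (snd t))"

abbreviation weights :: "triple list \<Rightarrow> nat" where
 "weights ts \<equiv> sum_list (map degree_weight ts)"

definition insert_step :: "triple list \<Rightarrow> nat \<Rightarrow> nat \<Rightarrow> nat \<times> triple list \<Rightarrow> (nat \<times> triple list) prog" where
 "insert_step ts L i st = pbind (tick 5) (\<lambda>_. pbind (uniform_int 1 (L + 1 - i)) (\<lambda>r.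
   if r \<le> fst st then detp (fst st - 1, snd st @ [ts ! (length ts - fst st)]) 2
   else detp (fst st, snd st @ [(0, 0, {#})]) 1))"

lemma insert_triples_eq:
 "insert_triples ts L = pbind (for_loop L 1 (insert_step ts L) (length ts, [])) (\<lambda>st. ret (snd st))"
proof -
 have "(\<lambda>i (k, out). pbind (tick 5) (\<lambda>_. pbind (uniform_int 1 (L + 1 - i)) (\<lambda>r.
     if r \<le> k then pbind (get ts (length ts - k)) (\<lambda>x. pbind (push out x) (\<lambda>out'. ret (k - 1, out')))
     else pbind (push out (0, 0, {#})) (\<lambda>out'. ret (k, out'))))) = insert_step ts L"
  unfolding insert_step_def get_eq push_eq ret_eq split_beta
  by (intro ext arg_cong[of _ _ "pbind (tick 5)"] arg_cong[of _ _ "pbind (uniform_int 1 _)"]) (auto simp: pbind_detp_detp numeral_2_eq_2)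
 thus ?thesis unfolding insert_triples_def split_beta by simp
qed

lemma good_insert_step: "good q (insert_step ts L i st)"
 unfolding insert_step_def by (intro good_pbind good_tick uniform_int) (simp add: good_detp)

lemma good_insert_triples: "good q (insert_triples ts L)"
 unfolding insert_triples_eq by (intro good_pbind good_for_loop good_insert_step good_ret)

lemma mass_insert_triples: "val q (insert_triples ts L) (\<lambda>_. 1) = 1"
proof -
 have "val q (insert_step ts L i st) (\<lambda>_. 1) = 1" for i st
  unfolding insert_step_def
  by (intro mass_pbind good_pbind good_tick uniform_int) (simp_all add: good_detp val_tick val_detp)
 thus ?thesis unfolding insert_triples_eq
  by (intro mass_pbind good_for_loop good_insert_step good_ret mass_for_loop) (simp_all add: val_ret)
qed

lemma cst_insert_triples: "cst q (insert_triples ts L) \<le> of_nat (1 + 10 * L)"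
proof -
 have "cst q (insert_step ts L i st) \<le> of_nat 5 + (of_nat 1 + of_nat 2)" for i st
  unfolding insert_step_def
  by (intro order_trans[OF cst_tick_bind] add_left_mono cst_pbind_le good_pbind uniform_int)
    (auto simp: good_detp cst_detp uniform_int(3))
 hence "cst q (for_loop L 1 (insert_step ts L) (length ts, [])) \<le> 1 + of_nat L * (2 + (of_nat 5 + (of_nat 1 + of_nat 2)))"
  by (intro cst_for_loop_const good_insert_step)
 from cst_pbind_le[OF good_for_loop[OF good_insert_step] good_ret this, of snd 0]
 have "cst q (insert_triples ts L) \<le> 1 + of_nat L * (2 + (of_nat 5 + (of_nat 1 + of_nat 2)))"
  unfolding insert_triples_eq by (simp add: cst_ret)
 also have "... = of_nat (1 + 10 * L)" by (simp add: mult.commute)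
 finally show ?thesis .
qed

text \<open>The triples placed so far come from a prefix of \<open>ts\<close>, and the inserted zero
  triples have weight 0.\<close>

lemma post_insert_triples:
 "post (insert_triples ts L) (\<lambda>out. length out = L \<and> weights out \<le> weights ts)"
proof -
 define I where "I i st \<longleftrightarrow> fst st \<le> length ts \<and> length (snd st) + 1 = i \<and>
  weights (snd st) \<le> weights (take (length ts - fst st) ts)" for i and st :: "nat \<times> triple list"
 have "post (for_loop L 1 (insert_step ts L) (length ts, [])) (I (1 + L))"
 proof (rule post_for_loop)
  show "I 1 (length ts, [])" by (simp add: I_def)
  fix i st assume i: "1 \<le> i" "i < 1 + L" and st: "I i st"
  show "post (insert_step ts L i st) (I (Suc i))"
   unfolding insert_step_def
  proof (rule post_pbind', rule post_pbind[OF post_uniform_int])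
   show "1 \<le> L + 1 - i" using i by simp
   fix r assume r: "1 \<le> r \<and> r \<le> L + 1 - i"
   have t: "take (length ts - (fst st - 1)) ts = take (length ts - fst st) ts @ [ts ! (length ts - fst st)]" if "1 \<le> fst st"
   proof -
    have "length ts - (fst st - 1) = Suc (length ts - fst st)" "length ts - fst st < length ts" using that st by (auto simp: I_def)
    thus ?thesis by (simp add: take_Suc_conv_app_nth)
   qed
   show "post (if r \<le> fst st then detp (fst st - 1, snd st @ [ts ! (length ts - fst st)]) 2
     else detp (fst st, snd st @ [(0, 0, {#})]) 1) (I (Suc i))"
    using r st t by (auto simp: post_detp I_def degree_weight_def)
  qed
 qed
 thus ?thesis unfolding insert_triples_eq
 proof (rule post_pbind)
  fix st assume "I (1 + L) st"
  moreover have "weights (take j ts) \<le> weights ts" for j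
   by (subst (2) append_take_drop_id[of j ts, symmetric]) (simp only: map_append sum_list_append le_add1)
  ultimately show "post (ret (snd st)) (\<lambda>out. length out = L \<and> weights out \<le> weights ts)"
   by (intro post_ret) (auto simp: I_def intro: order_trans)
 qed
qed

lemma runs_first_min: "runs (first_min xs) (\<lambda>_. True) (1 + 7 * length xs)"
proof -
 have "runs (for_each xs (\<lambda>(\<xi>, \<zeta>, \<tau>) (j, h, s, mn). do {
     tick 5;
     let j' = j + 1;
     let h' = h + int \<xi> - 1;
     ret (if j' = 1 \<or> h' < mn then (j', h', j', h') else (j', h', s, mn)) })
    (0 :: nat, 0 :: int, 0 :: nat, 0 :: int)) (\<lambda>_. True) (1 + (\<Sum>x\<leftarrow>xs. 2 + 5))"
  by (rule runs_for_each[where I = "\<lambda>_ _. True"])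
    (auto simp: split_beta tick_eq Let_def intro!: runs_bind_detp[of _ _ _ 0] runs_ret)
 thus ?thesis unfolding first_min_def
  by (rule runs_pbind[where b = 0]) (auto simp: sum_list_triv split_beta intro!: runs_ret)
qed

lemma runs_build_tree: "runs (build_tree xs) (\<lambda>_. True) (1 + 3 * length xs + weights xs)"
proof -
 have "runs (for_each (rev xs) (\<lambda>(\<xi>, \<zeta>, \<tau>) st. do {
     tick (1 + \<xi> + size \<tau>);
     ret (Node (mset (take \<xi> st) + \<tau>) # drop \<xi> st) }) []) (\<lambda>_. True) (1 + (\<Sum>x\<leftarrow>rev xs. 2 + (1 + degree_weight x)))"
  by (rule runs_for_each[where I = "\<lambda>_ _. True"])
    (auto simp: split_beta tick_eq degree_weight_def intro!: runs_bind_detp[of _ _ _ 0] runs_ret)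
 moreover have "(\<Sum>x\<leftarrow>rev xs. 2 + (1 + degree_weight x)) = 3 * length xs + weights xs"
  by (induction xs) auto
 ultimately show ?thesis unfolding build_tree_def
  by (elim runs_pbind[where b = 0]) (auto intro!: runs_ret)
qed

lemma pbind_detp_merge: "pbind (detp x c) (\<lambda>y. pbind (detp (f y) d) k) = pbind (detp (f x) (c + d)) k"
 unfolding pbind_assoc[of "detp x c" "\<lambda>y. detp (f y) d" k, symmetric]
 by (simp add: pbind_detp_detp)

abbreviation xsum :: "triple list \<Rightarrow> nat" where "xsum ts \<equiv> sum_list (map fst ts)"

definition log_ratio :: "pre \<Rightarrow> triple list \<Rightarrow> nat \<Rightarrow> nat \<Rightarrow> real" where
 "log_ratio c ts K M = real K * ln (BN c) + real M * ln rho + logfact c ! (K + M - 1) - logfact c ! K - logfact c ! M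
   - (\<Sum>t\<leftarrow>ts. ln (cosh (lam_val c * real (triple_size t)))) - logMax c"

abbreviation accept_log :: "pre \<Rightarrow> triple list \<Rightarrow> real" where
 "accept_log c ts \<equiv> log_ratio c ts (length ts) (1 + xsum ts - length ts)"

lemma runs_log_R: "runs (log_R c ts K M) (\<lambda>r. r = log_ratio c ts K M) (17 + 7 * length ts)"
proof -
 define I where "I rest d \<longleftrightarrow> d + (\<Sum>t\<leftarrow>rest. ln (cosh (lam_val c * real (triple_size t)))) = (\<Sum>t\<leftarrow>ts. ln (cosh (lam_val c * real (triple_size t))))"
  for rest :: "triple list" and d
 have "runs (for_each ts (\<lambda>(x, y, F) d.
      calc (V d \<^bold>+ Log (Cosh (V (lam_val c) \<^bold>* (V (real x) \<^bold>+ V (real y)))))) 0) (I []) (1 + (\<Sum>x\<leftarrow>ts. 2 + 5))"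
  by (rule runs_for_each) (auto simp: I_def calc_eq triple_size_def algebra_simps intro!: runs_detp)
 thus ?thesis unfolding log_R_def tick_eq get_eq calc_eq
  by (rule runs_pbind[where b = 16])
    (auto simp: sum_list_triv pbind_detp_detp log_ratio_def I_def intro!: runs_detp)
qed

definition attempt :: "pre \<Rightarrow> nat \<Rightarrow> nat \<times> triple list \<Rightarrow> (unit + triple list) prog" where
 "attempt c N st = (case st of (s, ts) \<Rightarrow> do {
   tick 1;
   if s > N then ret (Inl ()) else do {
    sx \<leftarrow> for_each ts (\<lambda>(x, y, F) sx. do { tick 1; ret (sx + x) }) 0;
    let K = length ts;
    tick 4;
    if 1 + sx < K then ret (Inl ()) else do {
     let M = 1 + sx - K;
     r \<leftarrow> log_R c ts K M;
     u \<leftarrow> uniform;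
     acc \<leftarrow> test_less (Log (V u)) (V r);
     if \<not> acc then ret (Inl ()) else do {
      out \<leftarrow> insert_triples ts (K + M);
      ret (Inr out) } } } })"

lemma bridge_sampler_eq:
 "bridge_sampler M0 B q c N = loop (\<lambda>_. pbind (sample_until M0 B q c N) (attempt c N)) ()"
 unfolding bridge_sampler_def attempt_def by (simp add: split_beta)

text \<open>\<open>1 + xsum ts\<close> is \<open>K + M\<close> in the case where the subtraction
  defining \<open>M\<close> does not truncate.\<close>

definition finish :: "triple list \<Rightarrow> real \<Rightarrow> (unit + triple list) prog" where
 "finish ts r = pbind (udraw (\<lambda>u. ln u < r) 3) (\<lambda>acc.
   if acc then pbind (insert_triples ts (1 + xsum ts)) (\<lambda>out. ret (Inr out)) else ret (Inl ()))"

abbreviation attempt_form :: "pre \<Rightarrow> nat \<Rightarrow> nat \<Rightarrow> triple list \<Rightarrow> nat \<Rightarrow> nat \<Rightarrow> (unit + triple list) prog" where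
 "attempt_form c N s ts a b \<equiv>
  (if s > N then detp (Inl ()) 1 else if 1 + xsum ts < length ts then detp (Inl ()) a
   else pbind (detp () b) (\<lambda>_. finish ts (accept_log c ts)))"

text \<open>Normal form: all deterministic parts collapse into the costs \<open>a\<close> and
  \<open>b\<close>, and the randomness is isolated in \<open>finish\<close>.\<close>

lemma attempt_cases:
 "\<exists>a b. a \<le> 6 + 3 * length ts \<and> b \<le> 23 + 10 * length ts \<and> attempt c N (s, ts) =
  attempt_form c N s ts a b"
proof -
 define sx K M where "sx = xsum ts" and "K = length ts" and "M = 1 + sx - K"
 define I where "I rest s \<longleftrightarrow> s + sum_list (map fst rest) = sx" for rest :: "triple list" and s
 have "runs (for_each ts (\<lambda>(x, y, F) sx. do { tick 1; ret (sx + x) }) (0 :: nat)) (I []) (1 + (\<Sum>x\<leftarrow>ts. 2 + 1))"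
  by (rule runs_for_each) (auto simp: I_def sx_def tick_eq ret_eq pbind_detp_detp intro!: runs_detp)
 then obtain c1 where c1: "for_each ts (\<lambda>(x, y, F) sx. do { tick 1; ret (sx + x) }) (0 :: nat) = detp sx c1" "c1 \<le> 1 + 3 * K"
  unfolding runs_def by (auto simp: sum_list_triv K_def I_def)
 obtain c2 where c2: "log_R c ts K M = detp (log_ratio c ts K M) c2" "c2 \<le> 17 + 7 * K"
  using runs_log_R[of c ts K M] unfolding runs_def K_def by auto
 have att: "attempt c N (s, ts) = pbind (detp () 1) (\<lambda>_. if s > N then detp (Inl ()) 0 else pbind (detp sx c1) (\<lambda>_. pbind (detp () 4) (\<lambda>_.
   if 1 + sx < K then detp (Inl ()) 0 else pbind (log_R c ts K M) (\<lambda>r. pbind uniform (\<lambda>u. pbind (test_less (Log (V u)) (V r)) (\<lambda>acc.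
    if \<not> acc then ret (Inl ()) else pbind (insert_triples ts (K + M)) (\<lambda>out. ret (Inr out)))))))) "
  unfolding attempt_def prod.case c1(1)
  unfolding Let_def K_def[symmetric] M_def tick_eq ret_eq pbind_detp by simp
 have fin: "pbind uniform (\<lambda>u. pbind (test_less (Log (V u)) (V r)) (\<lambda>acc.
    if \<not> acc then ret (Inl ()) else pbind (insert_triples ts (K + M)) (\<lambda>out. ret (Inr out)))) = finish ts r"
  if "\<not> 1 + sx < K" for r
 proof -
  have "K + M = 1 + xsum ts" using that by (simp add: M_def sx_def)
  thus ?thesis unfolding finish_def pbind_assoc[symmetric] uniform_test_less
   by (intro arg_cong[of _ _ "pbind _"] ext) simp
 qed
 consider "s > N" | "\<not> s > N" "1 + sx < K" | "\<not> s > N" "\<not> 1 + sx < K" by blast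
 thus ?thesis
 proof cases
  case 1
  hence "attempt c N (s, ts) = detp (Inl ()) 1" unfolding att by (simp add: pbind_detp_detp)
  thus ?thesis using 1 by auto
 next
  case 2
  hence "attempt c N (s, ts) = detp (Inl ()) (c1 + 5)" unfolding att by (simp add: pbind_detp_merge pbind_detp_detp add.commute)
  thus ?thesis using 2 c1(2) unfolding sx_def K_def by (intro exI[of _ "c1 + 5"]) auto
 next
  case 3
  have "attempt c N (s, ts) = pbind (detp (log_ratio c ts K M) (1 + c1 + 4 + c2)) (finish ts)"
   unfolding att c2(1) using 3 by (simp add: fin pbind_detp_merge add_ac)
  hence "attempt c N (s, ts) = pbind (detp () (1 + c1 + 4 + c2)) (\<lambda>_. finish ts (log_ratio c ts K M))"
   unfolding pbind_detp .
  thus ?thesis using 3 c1(2) c2(2) unfolding sx_def K_def M_def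
   by (intro exI[of _ 0] exI[of _ "1 + c1 + 4 + c2"]) auto
 qed
qed

lemma good_finish: "good q (finish ts r)"
 unfolding finish_def
 by (intro good_pbind udraw[OF ln_less_measurable]) (auto intro!: good_pbind good_insert_triples good_ret)

lemma mass_finish: "val q (finish ts r) (\<lambda>_. 1) = 1"
 unfolding finish_def
 by (intro mass_pbind udraw[OF ln_less_measurable])
   (auto intro!: good_pbind good_insert_triples good_ret mass_pbind mass_insert_triples simp: val_ret)

lemma cst_finish: "cst q (finish ts r) \<le> of_nat (14 + 10 * xsum ts)"
proof -
 let ?X = "1 + 10 * (1 + xsum ts)"
 have "cst q (finish ts r) \<le> of_nat 3 + of_nat ?X"
  unfolding finish_def
 proof (rule cst_pbind_le[OF udraw(1)[OF ln_less_measurable]])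
  show "cst q (udraw (\<lambda>u. ln u < r) 3) \<le> of_nat 3" by (simp only: udraw(3)[OF ln_less_measurable] order_refl)
  fix acc
  show "good q (if acc then pbind (insert_triples ts (1 + xsum ts)) (\<lambda>out. ret (Inr out)) else ret (Inl ()))"
   by (auto intro!: good_pbind good_insert_triples good_ret)
  have "cst q (pbind (insert_triples ts (1 + xsum ts)) (\<lambda>out. ret (Inr out :: unit + triple list))) \<le> of_nat ?X + 0"
   by (rule cst_pbind_le[OF good_insert_triples good_ret cst_insert_triples]) (simp add: cst_ret)
  thus "cst q (if acc then pbind (insert_triples ts (1 + xsum ts)) (\<lambda>out. ret (Inr out)) else ret (Inl ())) \<le> of_nat ?X"
   by (simp add: cst_ret)
 qed
 also have "... = of_nat (3 + ?X)" by (rule of_nat_add[symmetric])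
 also have "3 + ?X = 14 + 10 * xsum ts" by simp
 finally show ?thesis .
qed

lemma good_attempt: "good q (attempt c N st)"
proof -
 obtain s ts where st: "st = (s, ts)" by fastforce
 obtain a b where "attempt c N (s, ts) =
  attempt_form c N s ts a b"
  using attempt_cases by blast
 thus ?thesis unfolding st by (auto intro!: good_detp good_pbind good_finish)
qed

lemma mass_attempt: "val q (attempt c N st) (\<lambda>_. 1) = 1"
proof -
 obtain s ts where st: "st = (s, ts)" by fastforce
 obtain a b where "attempt c N (s, ts) =
  attempt_form c N s ts a b"
  using attempt_cases by blast
 thus ?thesis unfolding st by (auto simp: val_detp val_detp_bind good_finish mass_finish)
qed

lemma sum_fst_le: "xsum ts \<le> sum_list (map triple_size ts)"
 by (induction ts) (auto simp: triple_size_def)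

lemma cst_attempt:
 assumes "length ts \<le> N" "s = sum_list (map triple_size ts)"
 shows "cst q (attempt c N (s, ts)) \<le> of_nat (37 + 20 * N)"
proof -
 obtain a b where ab: "a \<le> 6 + 3 * length ts" "b \<le> 23 + 10 * length ts" and e: "attempt c N (s, ts) =
  attempt_form c N s ts a b"
  using attempt_cases by blast
 consider "s > N" | "\<not> s > N" "1 + xsum ts < length ts" | "\<not> s > N" "\<not> 1 + xsum ts < length ts" by blast
 thus ?thesis
 proof cases
  case 1
  hence "cst q (attempt c N (s, ts)) = of_nat 1" unfolding e by (simp add: cst_detp)
  also have "... \<le> of_nat (37 + 20 * N)" by (intro of_nat_mono) simp
  finally show ?thesis .
 next
  case 2
  hence "cst q (attempt c N (s, ts)) = of_nat a" unfolding e by (simp add: cst_detp)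
  also have "... \<le> of_nat (37 + 20 * N)" using ab assms by (intro of_nat_mono) simp
  finally show ?thesis .
 next
  case 3
  let ?r = "accept_log c ts"
  have "cst q (attempt c N (s, ts)) = cst q (pbind (detp () b) (\<lambda>_. finish ts ?r))"
   unfolding e using 3 by simp
  also have "... \<le> of_nat b + cst q (finish ts ?r)" by (rule cst_detp_bind[OF good_finish])
  also have "... \<le> of_nat b + of_nat (14 + 10 * xsum ts)" by (intro add_left_mono cst_finish)
  also have "... = of_nat (b + (14 + 10 * xsum ts))" by (simp only: of_nat_add)
  also have "... \<le> of_nat (37 + 20 * N)"
   using ab assms 3 sum_fst_le[of ts] by (intro of_nat_mono) simp
  finally show ?thesis .
 qed
qed

lemma val_attempt_ge:
 assumes v: "0 \<le> v" "v \<le> 1" "v \<le> exp (accept_log c ts)"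
  and s: "s \<le> N" "length ts \<le> 1 + xsum ts"
 shows "ennreal v \<le> val q (attempt c N (s, ts)) success"
proof -
 let ?r = "accept_log c ts"
 obtain b where e: "attempt c N (s, ts) = pbind (detp () b) (\<lambda>_. finish ts ?r)"
  using attempt_cases[of ts c N s] s by auto
 have "val q (attempt c N (s, ts)) success = val q (finish ts ?r) success"
  unfolding e by (rule val_detp_bind[OF good_finish])
 also have "... = (\<integral>\<^sup>+ u. (if ln u < ?r then 1 else 0) \<partial>unif)"
  unfolding finish_def
  apply (subst val_pbind[OF udraw(1)[OF ln_less_measurable]])
   apply (auto intro!: good_pbind good_insert_triples good_ret)[1]
  unfolding udraw(2)[OF ln_less_measurable]
  by (intro nn_integral_cong) (simp add: val_pbind good_insert_triples good_ret val_ret mass_insert_triples)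
 finally show ?thesis using ln_less_prob_ge[OF v] by simp
qed

lemma post_attempt:
 assumes "s = sum_list (map triple_size ts)" "\<forall>t\<in>set ts. fst (snd t) = fsize (snd (snd t))"
 shows "post (attempt c N (s, ts)) (\<lambda>r. case r of Inl _ \<Rightarrow> True | Inr out \<Rightarrow> length out \<le> N + 1 \<and> weights out \<le> N)"
  (is "post _ ?P")
proof -
 obtain a b where e: "attempt c N (s, ts) =
  attempt_form c N s ts a b"
  using attempt_cases by blast
 have "post (finish ts r) ?P" if "s \<le> N" for r
 proof -
  have w: "weights ts \<le> s"
   unfolding assms(1) using assms(2)
   by (intro sum_list_mono) (auto simp: degree_weight_def triple_size_def size_le_fsize)
  have "post (pbind (insert_triples ts (1 + xsum ts)) (\<lambda>out. ret (Inr out))) ?P"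
   by (rule post_pbind[OF post_insert_triples])
     (use w that sum_fst_le[of ts] assms(1) in \<open>auto intro!: post_ret\<close>)
  moreover have "post (ret (Inl ())) ?P" by (rule post_ret) simp
  ultimately show ?thesis unfolding finish_def by (intro post_pbind') simp
 qed
 thus ?thesis unfolding e by (auto simp: post_detp intro!: post_pbind')
qed

section \<open>Acceptance probability bounded away from 0\<close>

context polya_params
begin

lemma BN_sum:
 assumes c: "pre_ok c l"
 shows "(\<Sum>x. \<Sum>y. ennreal (wc l x y)) = ennreal (BN c)"
proof -
 have b: "0 < BN c" by (rule pre_C(4)[OF c])
 have "1 = (\<Sum>x. \<Sum>y. ennreal (wc l x y / BN c) * 1)"
  using val_samplerQ_any[OF c, of "\<lambda>_ _. 1"] mass_samplerQ[OF c] by simp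
 hence "ennreal (BN c) = (\<Sum>x. \<Sum>y. ennreal (BN c) * ennreal (wc l x y / BN c))"
  by (simp add: ennreal_suminf_cmult)
 also have "... = (\<Sum>x. \<Sum>y. ennreal (wc l x y))"
  using b by (intro arg_cong[of _ _ suminf] ext) (simp add: ennreal_mult'[symmetric])
 finally show ?thesis ..
qed

lemma M0_ge_1: "1 \<le> real M0"
 using M0_pos by (simp add: Suc_le_eq)

text \<open>\<open>BN\<close> is the sum of \<open>wc\<close>, so the pointwise estimate
  \<open>cosh_scale\<close> can be summed. For \<open>l\<close> of order \<open>N^(-1/2)\<close> the
  excess over \<open>1 - rho\<close> is O(1/N), which keeps \<open>(BN / (1 - rho))^k\<close>
  bounded for \<open>k <= N\<close>.\<close>

lemma BN_le:
 assumes c: "pre_ok c l" and c1: "pre_ok c1 l1" and l1: "0 < l1" "l \<le> l1"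
 shows "BN c \<le> (1 - rho) + (l / l1)\<^sup>2 * BN c1"
proof -
 \<comment> \<open>A record for tilt 0, through which \<open>BN_sum\<close> yields the untilted
   total \<open>mgf 0 - rho = 1 - rho\<close>.\<close>
 define c0 where "c0 = \<lparr>lam_val = 0, Cplus = mgf 0 - rho, Cminus = mgf 0 - rho, BN = mgf 0 - rho, logfact = [], logMax = 0\<rparr>"
 have m0: "mgf 0 = 1" using Phi_pos[of rho] by (simp add: mgf_def)
 have c0: "pre_ok c0 0" unfolding pre_ok_def c0_def using lmax M0_ge_1 by simp
 have l: "0 \<le> l" using c by (simp add: pre_ok_def)
 have "wc l x y \<le> wc 0 x y + (l / l1)\<^sup>2 * wc l1 x y" for x y
 proof (cases "x = 0 \<and> y = 0")
  case False
  have "cosh (l / l1 * (l1 * real (x + y))) \<le> 1 + (l / l1)\<^sup>2 * cosh (l1 * real (x + y))"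
   by (rule cosh_scale) (use l l1 in auto)
  hence "base x y * cosh (l * real (x + y)) \<le> base x y * (1 + (l / l1)\<^sup>2 * cosh (l1 * real (x + y)))"
   using l1 by (intro mult_left_mono base_nonneg) auto
  thus ?thesis using False by (auto simp: wc_def algebra_simps)
 qed (auto simp: wc_def)
 hence "ennreal (wc l x y) \<le> ennreal (wc 0 x y) + ennreal ((l / l1)\<^sup>2) * ennreal (wc l1 x y)" for x y
  using wc_nonneg by (simp add: ennreal_mult'[symmetric] ennreal_plus[symmetric] ennreal_leI del: ennreal_plus)
 hence "(\<Sum>x. \<Sum>y. ennreal (wc l x y)) \<le> (\<Sum>x. \<Sum>y. ennreal (wc 0 x y) + ennreal ((l / l1)\<^sup>2) * ennreal (wc l1 x y))"
  by (intro suminf_le summableI allI)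
 also have "... = (\<Sum>x. \<Sum>y. ennreal (wc 0 x y)) + ennreal ((l / l1)\<^sup>2) * (\<Sum>x. \<Sum>y. ennreal (wc l1 x y))"
  by (simp only: suminf_add[symmetric] summableI ennreal_suminf_cmult)
 finally have "ennreal (BN c) \<le> ennreal (BN c0) + ennreal ((l / l1)\<^sup>2) * ennreal (BN c1)"
  unfolding BN_sum[OF c] BN_sum[OF c0] BN_sum[OF c1] .
 also have "... = ennreal (BN c0 + (l / l1)\<^sup>2 * BN c1)"
  using pre_C(4)[OF c0] pre_C(4)[OF c1] by (simp add: ennreal_mult)
 finally have "BN c \<le> BN c0 + (l / l1)\<^sup>2 * BN c1"
  using pre_C(4)[OF c0] pre_C(4)[OF c1] by (subst (asm) ennreal_le_iff) auto
 thus ?thesis by (simp add: c0_def m0)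
qed

lemma lam_eq: "lam \<epsilon> N = min (\<epsilon> / sqrt (real N)) lmax"
 by (simp add: lam_def lmax_def)

text \<open>With \<open>l1 = lam \<epsilon> 1\<close> one has
  \<open>l1 / sqrt N <= lam \<epsilon> N <= \<epsilon> / sqrt N\<close> for all
  \<open>N >= 1\<close>, so the cap in \<open>lam\<close> costs only a constant. The lower bound
  feeds the \<open>cosh\<close> product, the upper bound feeds \<open>BN_le\<close>.\<close>

lemma bridge_weight_bound:
 assumes eps: "0 < \<epsilon>" and M0: "exp (lam \<epsilon> 1) \<le> real M0"
 shows "\<exists>Cm>0. \<forall>N\<ge>1. \<forall>c ds m. pre_ok c (lam \<epsilon> N) \<longrightarrow> sum_list ds = N \<longrightarrow> 1 \<le> length ds \<longrightarrow> length ds \<le> N \<longrightarrow>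
  bridge_weight rho (BN c) (lam \<epsilon> N) ds m \<le> Cm / (real N * sqrt (real N))"
proof -
 define l1 where "l1 = lam \<epsilon> 1"
 have l1: "0 < l1" "l1 \<le> lmax" "l1 \<le> \<epsilon>" using eps lmax by (auto simp: l1_def lam_eq)
 define c1 where "c1 = \<lparr>lam_val = l1, Cplus = mgf l1 - rho, Cminus = mgf (- l1) - rho, BN = (mgf l1 - rho + (mgf (- l1) - rho)) / 2, logfact = [], logMax = 0\<rparr>"
 have c1: "pre_ok c1 l1" unfolding pre_ok_def c1_def using l1 M0 by (simp add: l1_def)
 have B1: "0 < BN c1" by (rule pre_C(4)[OF c1])
 define cb where "cb = (\<epsilon> / l1)\<^sup>2 * BN c1 / (1 - rho)"
 have cb: "0 \<le> cb" using B1 rho_less by (simp add: cb_def)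
 show ?thesis
 proof (intro exI[of _ "exp cb * (16 / rho) * (12 / l1\<^sup>2)\<^sup>2"] conjI allI impI)
  show "0 < exp cb * (16 / rho) * (12 / l1\<^sup>2)\<^sup>2" using rho_pos l1 by simp
  fix N c and ds :: "nat list" and m
  assume N: "1 \<le> N" and c: "pre_ok c (lam \<epsilon> N)" and ds: "sum_list ds = N" and k: "1 \<le> length ds" "length ds \<le> N"
  have s: "1 \<le> sqrt (real N)" using N by simp
  have l: "0 \<le> lam \<epsilon> N" using c by (simp add: pre_ok_def)
  have le: "lam \<epsilon> N \<le> \<epsilon> / sqrt (real N)" by (simp add: lam_def)
  have "\<epsilon> / sqrt (real N) \<le> \<epsilon> / 1" using s eps by (intro divide_left_mono) auto
  hence ll: "lam \<epsilon> N \<le> l1" by (auto simp: l1_def lam_eq)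
  have "l1 / sqrt (real N) \<le> lmax / sqrt (real N)" "l1 / sqrt (real N) \<le> \<epsilon> / sqrt (real N)"
   using l1 s by (auto intro!: divide_right_mono)
  moreover have "lmax / sqrt (real N) \<le> lmax / 1" using s lmax by (intro divide_left_mono) auto
  ultimately have ge: "l1 / sqrt (real N) \<le> lam \<epsilon> N" by (simp add: lam_eq)
  have "(lam \<epsilon> N / l1)\<^sup>2 \<le> (\<epsilon> / sqrt (real N) / l1)\<^sup>2" using le l l1 by (intro power_mono divide_right_mono) auto
  also have "... = (\<epsilon> / l1)\<^sup>2 / real N" by (simp add: power_divide power_mult_distrib mult.commute)
  finally have "(lam \<epsilon> N / l1)\<^sup>2 * BN c1 \<le> (\<epsilon> / l1)\<^sup>2 / real N * BN c1" using B1 by (intro mult_right_mono) auto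
  also have "... = (1 - rho) * (cb / real N)" using rho_less by (simp add: cb_def)
  finally have b: "BN c \<le> (1 - rho) * (1 + cb / real N)"
   using BN_le[OF c c1 l1(1) ll] by (simp add: algebra_simps)
  have "(l1 / sqrt (real N))\<^sup>2 \<le> (lam \<epsilon> N)\<^sup>2" using ge l1 by (intro power_mono) auto
  hence "l1\<^sup>2 / real N \<le> (lam \<epsilon> N)\<^sup>2" by (simp add: power_divide)
  thus "bridge_weight rho (BN c) (lam \<epsilon> N) ds m \<le>
   exp cb * (16 / rho) * (12 / l1\<^sup>2)\<^sup>2 / (real N * sqrt (real N))"
   by (intro bridge_weight_le[OF rho_pos rho_less _ cb refl ds k pre_C(4)[OF c] b]) (use l1 in auto)
 qed
qed

text \<open>The computed maximum enters through an upper bound, which bounds the acceptance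
  probability from below.\<close>

definition pre_full :: "real \<Rightarrow> real \<Rightarrow> nat \<Rightarrow> pre \<Rightarrow> bool" where
 "pre_full \<epsilon> Cm N c \<longleftrightarrow> pre_ok c (lam \<epsilon> N) \<and> (\<forall>j\<le>2 * N. logfact c ! j = ln (fact j)) \<and>
   logMax c \<le> ln (Cm / (real N * sqrt (real N)))"

definition bridge_body :: "pre \<Rightarrow> nat \<Rightarrow> (unit + triple list) prog" where
 "bridge_body c N = pbind (sample_until M0 B q c N) (attempt c N)"

lemma good_bridge_body: "good q' (bridge_body c N)"
 unfolding bridge_body_def by (intro good_pbind good_sample_until good_attempt)

context
 fixes \<epsilon> Cm cl :: real and N :: nat and c :: pre
 assumes N: "1 \<le> N" and Cm: "0 < Cm" and c: "pre_full \<epsilon> Cm N c"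
  and bound: "\<And>ds m. sum_list ds = N \<Longrightarrow> 1 \<le> length ds \<Longrightarrow> length ds \<le> N \<Longrightarrow>
   bridge_weight rho (BN c) (lam \<epsilon> N) ds m \<le> Cm / (real N * sqrt (real N))"
  and cl: "0 < cl" "cl / (real N * sqrt (real N)) \<le> bridge_sum (N + 2) N 0 0"
begin

lemma pre_full_ok: "pre_ok c (lam \<epsilon> N)"
 using c by (simp add: pre_full_def)

text \<open>Replacing the computed maximum by its upper bound \<open>Cm / W\<close> lowers the
  acceptance probability to \<open>W / Cm * num\<close>; the same bound applied to
  \<open>num\<close> shows that this is at most 1.\<close>

lemma hit_le_attempt:
 assumes ts: "s = sum_list (map triple_size ts)" "1 \<le> length ts" "length ts \<le> N" "N \<le> s"
 shows "ennreal (real N * sqrt (real N) / Cm) * hit c (lam \<epsilon> N) N (s, ts) \<le> val q (attempt c N (s, ts)) success"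
proof (cases "s = N \<and> length ts \<le> 1 + xsum ts")
 case False
 hence "hit c (lam \<epsilon> N) N (s, ts) = 0"
  by (auto simp: hit_def[OF pre_full_ok] hw_def)
 thus ?thesis by simp
next
 case True
 define l K sx M where "l = lam \<epsilon> N" and "K = length ts" and "sx = xsum ts" and "M = 1 + sx - K"
 define W where "W = real N * sqrt (real N)"
 have W: "0 < W" using N by (simp add: W_def)
 have b: "0 < BN c" by (rule pre_C(4)[OF pre_full_ok])
 have KM: "K + M = 1 + sx" "K \<le> 2 * N" "K + M - 1 \<le> 2 * N" "M \<le> 2 * N" "K + M - 1 = sx"
  using True ts sum_fst_le[of ts] by (auto simp: K_def M_def sx_def)
 define Q where "Q = (\<Prod>d\<leftarrow>map triple_size ts. cosh (l * real d))"
 have Q: "0 < Q" unfolding Q_def by (induction ts) auto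
 have lnQ: "(\<Sum>t\<leftarrow>ts. ln (cosh (l * real (triple_size t)))) = ln Q"
  unfolding Q_def
 proof (induction ts)
  case (Cons t ts)
  have "0 < (\<Prod>d\<leftarrow>map triple_size ts. cosh (l * real d))" by (induction ts) auto
  thus ?case using Cons by (simp add: ln_mult)
 qed simp
 define num where "num = BN c ^ K * rho ^ M * fact (K + M - 1) / (fact K * fact M) / Q"
 have num0: "0 < num" unfolding num_def using b rho_pos Q by simp
 have num_le: "num \<le> Cm / W"
  using bound[of "map triple_size ts" M] ts True by (simp add: num_def W_def Q_def l_def K_def bridge_weight_def)
 have tw: "tilt c l ts = BN c ^ K / Q"
  unfolding tilt_def[OF pre_full_ok] Q_def K_def l_def by (induction ts) auto
 have hit: "hit c l N (s, ts) = ennreal num"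
 proof -
  have "hw K sx = rho ^ M * fact sx / (fact K * fact M)" using True by (simp add: hw_def M_def K_def sx_def)
  hence "tilt c l ts * hw K sx = num" unfolding tw num_def KM(5) by (simp add: mult_ac)
  thus ?thesis using True unfolding hit_def[OF pre_full_ok] l_def fst_conv snd_conv K_def sx_def by simp
 qed
 have lnn: "ln num = real K * ln (BN c) + real M * ln rho + ln (fact (K + M - 1)) - ln (fact K) - ln (fact M) - ln Q"
  unfolding num_def using b rho_pos Q
  by (simp add: ln_div ln_mult ln_realpow)
 have "log_ratio c ts K M = ln num - logMax c"
 proof -
  have "lam_val c = l" using pre_full_ok by (simp add: pre_ok_def l_def)
  moreover have "logfact c ! j = ln (fact j)" if "j \<le> 2 * N" for j using c that by (simp add: pre_full_def)
  ultimately show ?thesis unfolding log_ratio_def lnn lnQ[symmetric] using KM by simp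
 qed
 moreover have "logMax c \<le> ln (Cm / W)" using c by (simp add: pre_full_def W_def)
 ultimately have "ln num - ln (Cm / W) \<le> log_ratio c ts K M" by simp
 moreover have "ln num - ln (Cm / W) = ln (W / Cm * num)" using num0 W Cm by (simp add: ln_div ln_mult)
 ultimately have "exp (ln (W / Cm * num)) \<le> exp (log_ratio c ts K M)" by simp
 hence v: "W / Cm * num \<le> exp (log_ratio c ts K M)" using W Cm num0 by simp
 have v1: "W / Cm * num \<le> 1" using num_le W Cm by (simp add: field_simps)
 have v0: "0 \<le> W / Cm * num" using num0 W Cm by simp
 have "ennreal (W / Cm * num) \<le> val q (attempt c N (s, ts)) success"
  by (rule val_attempt_ge[OF v0 v1]) (use v True in \<open>auto simp: K_def M_def sx_def\<close>)
 moreover have "ennreal (W / Cm * num) = ennreal (W / Cm) * ennreal num"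
  by (rule ennreal_mult) (use W Cm num0 in auto)
 ultimately show ?thesis unfolding W_def[symmetric] l_def[symmetric] hit by (simp only:)
qed

text \<open>The weight of the bridges and the bound on the maximum are both of order
  \<open>N^(-3/2)\<close>; the powers cancel and the bound is uniform in \<open>N\<close>.\<close>

lemma bridge_accept: "ennreal (cl / Cm) \<le> val q (bridge_body c N) success"
proof -
 define W where "W = real N * sqrt (real N)"
 have W: "0 < W" using N by (simp add: W_def)
 have "ennreal (cl / Cm) = ennreal (W / Cm) * ennreal (cl / W)" using W Cm cl by (simp add: ennreal_mult[symmetric])
 also have "... \<le> ennreal (W / Cm) * ennreal (bridge_sum (N + 2) N 0 0)"
  using cl(2) unfolding W_def by (intro mult_left_mono ennreal_leI) auto
 also have "... \<le> ennreal (W / Cm) * val q (sample_until M0 B q c N) (hit c (lam \<epsilon> N) N)"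
  by (intro mult_left_mono val_sample_until_lower[OF pre_full_ok N]) simp
 also have "... = val q (sample_until M0 B q c N) (\<lambda>st. ennreal (W / Cm) * hit c (lam \<epsilon> N) N st)"
  by (rule val_cmult[OF good_sample_until, symmetric])
 also have "... \<le> val q (sample_until M0 B q c N) (\<lambda>st. val q (attempt c N st) success)"
  by (rule val_mono_post[OF post_sample_until[OF N]]) (auto simp: W_def walk_end_def intro!: hit_le_attempt)
 also have "... = val q (bridge_body c N) success"
  unfolding bridge_body_def by (rule val_pbind[OF good_sample_until good_attempt, symmetric])
 finally show ?thesis .
qed

lemma mass_bridge_body: "val q (bridge_body c N) (\<lambda>_. 1) = 1"
 unfolding bridge_body_def by (intro mass_pbind good_sample_until good_attempt mass_sample_until[OF pre_full_ok] mass_attempt)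

lemma bridge_split:
 obtains a where "0 \<le> a" "a \<le> 1 - cl / Cm" "a < 1"
  "val q (bridge_body c N) retry = ennreal a"
  "val q (bridge_body c N) success = ennreal (1 - a)"
proof -
 let ?l = "val q (bridge_body c N) retry"
 let ?r = "val q (bridge_body c N) success"
 have "?l + ?r = val q (bridge_body c N) (\<lambda>_. 1)"
  unfolding val_add[OF good_bridge_body, symmetric]
  by (intro arg_cong[of _ _ "val q (bridge_body c N)"] ext) (simp split: sum.split)
 hence s: "?l + ?r = 1" unfolding mass_bridge_body .
 define a b where "a = enn2real ?l" and "b = enn2real ?r"
 have fin: "?l \<le> 1" "?r \<le> 1" by (intro val_le_const; simp split: sum.split)+
 have la: "?l = ennreal a" and rb: "?r = ennreal b"
  unfolding a_def b_def using fin by (auto simp: ennreal_enn2real_if top_unique)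
 have nn: "0 \<le> a" "0 \<le> b" by (auto simp: a_def b_def)
 have ab: "a + b = 1" using s nn unfolding la rb by (simp add: ennreal_plus[symmetric] del: ennreal_plus)
 have "cl / Cm \<le> b" using bridge_accept nn unfolding rb by simp
 moreover have "0 < cl / Cm" using cl Cm by simp
 ultimately show thesis using nn ab la rb by (intro that[of a]) (auto simp: algebra_simps)
qed

lemma mass_bridge: "val q (bridge_sampler M0 B q c N) (\<lambda>_. 1) = 1"
proof -
 obtain a where a: "0 \<le> a" "a < 1"
  "val q (bridge_body c N) retry = ennreal a"
  "val q (bridge_body c N) success = ennreal (1 - a)"
  using bridge_split by blast
 have "val q (loop (\<lambda>_. bridge_body c N) ()) (\<lambda>_. 1) = ennreal ((1 - a) / (1 - a))"
  by (rule val_reject_loop[OF good_bridge_body _ a(3,1,2), where C = 1]) (use a in auto)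
 moreover have "1 - a \<noteq> 0" using a by simp
 ultimately show ?thesis unfolding bridge_sampler_eq bridge_body_def[symmetric]
  by (simp only: divide_self ennreal_1 not_False_eq_True)
qed

lemma cst_bridge:
 "cst q (bridge_sampler M0 B q c N) \<le> ennreal (((real N + 1) * (samplerQ_cost + 5) + 37 + 20 * real N + 1) / (cl / Cm))"
proof -
 obtain a where a: "0 \<le> a" "a < 1" "a \<le> 1 - cl / Cm"
  "val q (bridge_body c N) retry = ennreal a"
  using bridge_split by blast
 define Z where "Z = (real N + 1) * (samplerQ_cost + 5)"
 have Z: "0 \<le> Z" using samplerQ_cost_nonneg by (simp add: Z_def)
 have "cst q (bridge_body c N) \<le> ennreal Z + of_nat (37 + 20 * N)"
  unfolding bridge_body_def
 proof (rule cst_pbind_le_post[OF good_sample_until good_attempt _ post_sample_until[OF N]])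
  show "cst q (sample_until M0 B q c N) \<le> ennreal Z" unfolding Z_def by (rule cst_sample_until[OF pre_full_ok])
  fix st :: "nat \<times> triple list"
  assume "walk_end N st"
  thus "cst q (attempt c N st) \<le> of_nat (37 + 20 * N)"
   by (cases st) (auto simp: walk_end_def simp del: of_nat_add of_nat_mult intro!: cst_attempt)
 qed
 also have "ennreal Z + of_nat (37 + 20 * N) = ennreal (Z + real (37 + 20 * N))"
  unfolding ennreal_of_nat_eq_real_of_nat using Z by (intro ennreal_plus[symmetric]) auto
 finally have b: "cst q (bridge_body c N) \<le> ennreal (Z + real (37 + 20 * N))" .
 have "cst q (loop (\<lambda>_. bridge_body c N) ()) \<le> ennreal ((Z + real (37 + 20 * N) + 1) / (1 - a))"
  by (rule cst_reject_loop[OF good_bridge_body _ a(1,2) b]) (use a Z in auto)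
 also have "... \<le> ennreal ((Z + real (37 + 20 * N) + 1) / (cl / Cm))"
  using a Z cl Cm by (intro ennreal_leI divide_left_mono mult_pos_pos) auto
 finally show ?thesis unfolding bridge_sampler_eq bridge_body_def[symmetric] Z_def by (simp add: add_ac)
qed

end

lemma post_bridge:
 assumes "1 \<le> N"
 shows "post (bridge_sampler M0 B q c N) (\<lambda>out. length out \<le> N + 1 \<and> weights out \<le> N)"
 unfolding bridge_sampler_eq bridge_body_def[symmetric]
proof (rule post_loop[where I = "\<lambda>_. True"])
 show "post (bridge_body c N) (\<lambda>r. case r of Inl s' \<Rightarrow> True | Inr out \<Rightarrow> length out \<le> N + 1 \<and> weights out \<le> N)"
  unfolding bridge_body_def
 proof (rule post_pbind[OF post_sample_until[OF assms]])
  fix st :: "nat \<times> triple list"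
  assume "walk_end N st"
  thus "post (attempt c N st) (\<lambda>r. case r of Inl s' \<Rightarrow> True | Inr out \<Rightarrow> length out \<le> N + 1 \<and> weights out \<le> N)"
   by (cases st) (simp only: walk_end_def fst_conv snd_conv, intro post_attempt, auto simp: proper_def)
 qed
qed simp

end

section \<open>Correctness and cost of the preprocessing\<close>

lemma runs_eval_Phi: "runs (eval_Phi d z) (\<lambda>r. r = Phi z) (40 * (d + 1)\<^sup>2)"
proof -
 have "runs (eval_Phi d z) (\<lambda>r. r = Phi z) ((4 + 22 * d\<^sup>2) + ((1 + (d - 1) * (2 + (4 + d * 6))) + 1) + 0)"
  unfolding eval_Phi_def taylor_Phi_def calc_eq get_eq ret_eq split_beta
  apply (rule runs_pbind[where P = "\<lambda>_. True" and b = 0])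
   apply (rule runs_pbind[OF runs_coeffs _ order_refl], rule runs_pbind[where P = "\<lambda>_. True" and b = 1])
    apply (rule runs_for_loop[where I = "\<lambda>_ _. True" and C = "4 + d * 6", OF TrueI], rule runs_bind_detp[where b = "3 + d * 6"])
     apply (rule runs_pbind[where P = "\<lambda>_. True" and a = "1 + d * (2 + 4)" and b = 2])
      apply (rule runs_for_loop[where I = "\<lambda>_ _. True", OF TrueI])
  by (auto simp: pbind_detp_detp intro!: runs_detp)
 thus ?thesis
 proof (rule runs_mono)
  have "(d - 1) * (2 + (4 + d * 6)) \<le> d * (2 + (4 + d * 6))" by (intro mult_right_mono) auto
  thus "(4 + 22 * d\<^sup>2) + ((1 + (d - 1) * (2 + (4 + d * 6))) + 1) + 0 \<le> 40 * (d + 1)\<^sup>2"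
   by (simp add: power2_eq_square algebra_simps)
 qed
qed

lemma runs_compute_C:
 "runs (compute_C w sg l) (\<lambda>r. r = exp (exp (sg * l) - 1) * Phi (rho * exp (sg * l)) / Phi rho - rho) (8 + 80 * (w + 1)\<^sup>2)"
proof -
 let ?e = "exp (sg * l)"
 have "runs (compute_C w sg l) (\<lambda>r. r = exp (?e - 1) * Phi (rho * ?e) / Phi rho - rho)
  (2 + (1 + (40 * (w + 1)\<^sup>2 + (40 * (w + 1)\<^sup>2 + 5))))"
  unfolding compute_C_def calc_eq
  by (rule runs_bind_detp, rule runs_bind_detp, rule runs_pbind[OF runs_eval_Phi], rule runs_pbind[OF runs_eval_Phi])
    (auto intro!: runs_detp)
 thus ?thesis by (rule runs_mono) auto
qed

lemma runs_compute_lam: "1 \<le> N \<Longrightarrow> runs (compute_lam \<epsilon> N) (\<lambda>l. l = lam \<epsilon> N) 8"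
 unfolding compute_lam_def calc_eq test_less_eq ret_eq
 by (auto simp: pbind_detp_detp lam_def ln_sqrt[symmetric] intro!: runs_detp)

lemma runs_compute_logfact:
 "runs (compute_logfact n) (\<lambda>xs. \<forall>j\<le>n. xs ! j = ln (fact j)) (1 + 7 * n)"
proof -
 define I where "I i xs \<longleftrightarrow> length xs = i \<and> (\<forall>j<i. xs ! j = ln (fact j))" for i and xs :: "real list"
 have "runs (compute_logfact n) (I (1 + n)) (1 + n * (2 + 5))"
  unfolding compute_logfact_def
 proof (rule runs_for_loop)
  show "I 1 [0]" by (simp add: I_def)
  fix j xs assume j: "1 \<le> j" and I: "I j xs"
  have "ln (fact j) = xs ! (j - 1) + ln (real j)"
   using I j by (cases j) (auto simp: I_def ln_mult add.commute)
  hence "I (Suc j) (xs @ [xs ! (j - 1) + ln (real j)])"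
   using I by (auto simp: I_def nth_append less_Suc_eq)
  thus "runs (do { tick 1; x \<leftarrow> get xs (j - 1); y \<leftarrow> calc (V x \<^bold>+ Log (V (real j))); push xs y }) (I (Suc j)) 5"
   by (auto simp: tick_eq get_eq calc_eq push_eq pbind_detp_detp intro!: runs_detp)
 qed
 thus ?thesis by (rule runs_mono) (auto simp: I_def)
qed

context
 fixes l b C :: real and lf :: "real list" and N :: nat
 assumes N: "1 \<le> N" and b: "0 < b" and C: "0 < C" and lf: "\<And>j. j \<le> 2 * N \<Longrightarrow> lf ! j = ln (fact j)"
  and bound: "\<And>ds m. sum_list ds = N \<Longrightarrow> 1 \<le> length ds \<Longrightarrow> length ds \<le> N \<Longrightarrow> bridge_weight rho b l ds m \<le> C"
begin

text \<open>\<open>D_N(k)\<close> belongs to the composition of \<open>N\<close> into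
  \<open>k\<close> parts that are as equal as possible, so each value computed here is the logarithm
  of a weight covered by \<open>bound\<close>.\<close>

lemma runs_log_s:
 assumes k: "1 \<le> k" "k \<le> N" and m: "m \<le> N"
 shows "runs (log_s l b lf N k m) (\<lambda>v. v \<le> ln C) 28"
proof -
 define c r where "c = N div k" and "r = N - k * c"
 have r: "r = N mod k" by (simp add: r_def c_def minus_mult_div_eq_mod)
 have rk: "r < k" "N = k * c + r" using k by (auto simp: r) (simp add: c_def)
 define ds where "ds = replicate (k - r) c @ replicate r (c + 1)"
 have ds: "length ds = k" "sum_list ds = N"
 proof -
  show "length ds = k" using rk by (simp add: ds_def)
  have "sum_list ds = (k - r) * c + r * (c + 1)" by (simp add: ds_def sum_list_replicate)
  also have "... = k * c + r" using rk(1) by (simp add: diff_mult_distrib)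
  finally show "sum_list ds = N" using rk(2) by simp
 qed
 define Q where "Q = (\<Prod>d\<leftarrow>ds. cosh (l * real d))"
 have Q: "Q = cosh (l * real c) ^ (k - r) * cosh (l * (real c + 1)) ^ r" by (simp add: Q_def ds_def add.commute)
 have Qp: "0 < Q" unfolding Q by simp
 have rho0: "0 < rho" using rho_ge by simp
 define num where "num = b ^ k * rho ^ m * fact (k + m - 1) / (fact k * fact m) / Q"
 have "num \<le> C" using bound[of ds m] k unfolding num_def Q_def bridge_weight_def ds by simp
 moreover have "0 < num" unfolding num_def using b rho0 Qp by simp
 ultimately have "ln num \<le> ln C" using C by simp
 moreover have "ln num = real k * ln b + real m * ln rho + ln (fact (k + m - 1)) - ln (fact k) - ln (fact m) - ln Q"
  unfolding num_def using b rho0 Qp by (simp add: ln_div ln_mult ln_realpow)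
 moreover have "ln Q = (real k - real r) * ln (cosh (l * real c)) + real r * ln (cosh (l * (real c + 1)))"
  unfolding Q using rk by (simp add: ln_mult ln_realpow of_nat_diff)
 ultimately have *: "real k * ln b + real m * ln rho + lf ! (k + m - 1) - lf ! k - lf ! m -
   (real k - real r) * ln (cosh (l * real c)) - real r * ln (cosh (l * (real c + 1))) \<le> ln C"
  using k m by (simp add: lf)
 show ?thesis
  unfolding log_s_def Let_def c_def[symmetric] r_def[symmetric] tick_eq get_eq calc_eq
  using * by (auto simp: pbind_detp_detp intro!: runs_detp)
qed

lemma runs_compute_logMax: "runs (compute_logMax l b lf N) (\<lambda>v. v \<le> ln C) (29 + 146 * N)"
proof -
 define f where "f k m best = (if 0 \<le> m \<and> m \<le> int N then do {
   v \<leftarrow> log_s l b lf N k (nat m); better \<leftarrow> test_less (V best) (V v); ret (if better then v else best) }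
  else ret best)" for k m best
 have step: "runs (f k m v) (\<lambda>v. v \<le> ln C) 29" if "1 \<le> k" "k \<le> N" "v \<le> ln C" for m k v
  unfolding f_def using that
  by (auto simp: test_less_eq ret_eq pbind_detp_detp intro!: runs_pbind[OF runs_log_s, where b = 1] runs_detp)
 have each: "runs (for_each ms (\<lambda>m v. pbind (detp () 2) (\<lambda>_. f k m v)) v) (\<lambda>v. v \<le> ln C) (1 + (\<Sum>x\<leftarrow>ms. 2 + 31))"
  if "1 \<le> k" "k \<le> N" "v \<le> ln C" for ms k v
  by (rule runs_for_each[where I = "\<lambda>_ v. v \<le> ln C"], rule that(3), rule runs_bind_detp, rule step[OF that(1,2)]) simp_all
 have "runs (compute_logMax l b lf N) (\<lambda>v. v \<le> ln C) (28 + (1 + N * (2 + 144)))"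
  unfolding compute_logMax_def f_def[symmetric] calc_eq tick_eq
  apply (rule runs_pbind[OF runs_log_s[OF order_refl N le0] _ order_refl])
  apply (rule runs_for_loop[where I = "\<lambda>_ v. v \<le> ln C" and C = 144], assumption)
  apply (rule runs_bind_detp[where b = 140], rule runs_bind_detp[where b = 137], rule runs_mono[OF each])
  by auto
 thus ?thesis by (rule runs_mono) auto
qed

end

lemma (in polya_params) runs_preprocess:
 assumes N: "1 \<le> N" and l: "0 \<le> lam \<epsilon> N" "exp (lam \<epsilon> N) \<le> real M0" and Cm: "0 < Cm"
  and bound: "\<And>c ds m. pre_ok c (lam \<epsilon> N) \<Longrightarrow> sum_list ds = N \<Longrightarrow> 1 \<le> length ds \<Longrightarrow> length ds \<le> N \<Longrightarrow>
   bridge_weight rho (BN c) (lam \<epsilon> N) ds m \<le> Cm / (real N * sqrt (real N))"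
 shows "runs (preprocess \<epsilon> rho_cost w N) (pre_full \<epsilon> Cm N) (rho_cost w + 57 + 160 * (w + 1)\<^sup>2 + 160 * N)"
proof -
 define l where "l = lam \<epsilon> N"
 define cp cm b where "cp = mgf l - rho" and "cm = mgf (- l) - rho" and "b = (cp + cm) / 2"
 have ok: "pre_ok \<lparr>lam_val = l, Cplus = cp, Cminus = cm, BN = b, logfact = lf, logMax = mx\<rparr> l" for lf mx
  unfolding pre_ok_def using l by (simp add: cp_def cm_def b_def l_def lam_eq)
 have b: "0 < b" using pre_C(4)[OF ok] by simp
 have W: "0 < Cm / (real N * sqrt (real N))" using N Cm by simp
 have bd: "bridge_weight rho b l ds m \<le> Cm / (real N * sqrt (real N))"
  if "sum_list ds = N" "1 \<le> length ds" "length ds \<le> N" for ds m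
  using bound[OF ok[unfolded l_def] that] by (simp add: l_def)
 have C1: "runs (compute_C w 1 l) (\<lambda>r. r = cp) (8 + 80 * (w + 1)\<^sup>2)"
  by (rule runs_mono[OF runs_compute_C]) (auto simp: cp_def mgf_def)
 have C2: "runs (compute_C w (- 1) l) (\<lambda>r. r = cm) (8 + 80 * (w + 1)\<^sup>2)"
  by (rule runs_mono[OF runs_compute_C]) (auto simp: cm_def mgf_def)
 have L: "runs (compute_lam \<epsilon> N) (\<lambda>x. x = l) 8" unfolding l_def by (rule runs_compute_lam[OF N])
 have "runs (preprocess \<epsilon> rho_cost w N) (pre_full \<epsilon> Cm N)
  (rho_cost w + (8 + ((8 + 80 * (w + 1)\<^sup>2) + ((8 + 80 * (w + 1)\<^sup>2) + (2 + (1 + ((1 + 7 * (2 * N)) + (29 + 146 * N))))))))"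
  unfolding preprocess_def calc_eq tick_eq
 proof (rule runs_bind_detp, rule runs_pbind[OF L], simp only:, rule runs_pbind[OF C1], simp only:,
   rule runs_pbind[OF C2], simp only:, rule runs_bind_detp, rule runs_bind_detp, rule runs_pbind[OF runs_compute_logfact])
  fix lf :: "real list" assume lf: "\<forall>j\<le>2 * N. lf ! j = ln (fact j)"
  have rb: "rval ((V cp \<^bold>+ V cm) \<^bold>/ V 2) = b" by (simp add: b_def)
  show "runs (compute_logMax l (rval ((V cp \<^bold>+ V cm) \<^bold>/ V 2)) lf N \<bind>
    (\<lambda>mx. ret \<lparr>lam_val = l, Cplus = cp, Cminus = cm, BN = rval ((V cp \<^bold>+ V cm) \<^bold>/ V 2), logfact = lf, logMax = mx\<rparr>))
    (pre_full \<epsilon> Cm N) (29 + 146 * N)"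
   unfolding rb
   by (rule runs_pbind[OF runs_compute_logMax[OF N b W lf[rule_format] bd], where b = 0])
     (auto intro!: runs_ret simp: pre_full_def l_def[symmetric] ok lf)
 qed auto
 thus ?thesis by (rule runs_mono) auto
qed

section \<open>Linear bound for the whole algorithm\<close>

lemma bigo_nat_bound:
 fixes f g :: "nat \<Rightarrow> real"
 assumes "f \<in> O(g)" "\<And>n. 0 \<le> g n"
 shows "\<exists>c\<ge>0. \<exists>d\<ge>0. \<forall>n. f n \<le> c * g n + d"
proof -
 obtain c where c: "0 < c" "eventually (\<lambda>n. norm (f n) \<le> c * norm (g n)) at_top"
  using landau_o.bigE[OF assms(1)] by blast
 then obtain n0 where n0: "\<And>n. n0 \<le> n \<Longrightarrow> \<bar>f n\<bar> \<le> c * g n"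
  using assms(2) unfolding eventually_sequentially by auto
 define d where "d = (\<Sum>n<n0. \<bar>f n\<bar>)"
 have "f n \<le> c * g n + d" for n
 proof (cases "n0 \<le> n")
  case True
  have "0 \<le> d" by (simp add: d_def sum_nonneg)
  thus ?thesis using n0[OF True] by linarith
 next
  case False
  hence "\<bar>f n\<bar> \<le> d" unfolding d_def by (intro member_le_sum) auto
  moreover have "0 \<le> c * g n" using c assms(2) by simp
  ultimately show ?thesis by linarith
 qed
 thus ?thesis using c by (intro exI[of _ c] exI[of _ d] conjI) (auto simp: d_def sum_nonneg)
qed

lemma power_le_fact_exp:
 fixes y :: real
 assumes "0 \<le> y"
 shows "y ^ e \<le> fact e * exp y"
proof -
 have "(\<Sum>n\<in>{e}. y ^ n /\<^sub>R fact n) \<le> (\<Sum>n. y ^ n /\<^sub>R fact n)"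
  by (rule sum_le_suminf[OF summable_exp_generic]) (use assms in auto)
 thus ?thesis by (simp add: exp_def field_simps)
qed

text \<open>For \<open>y = ln n + 1\<close> the power \<open>y ^ e\<close> is at most
  \<open>fact e * exp y\<close>, and \<open>exp y = exp 1 * n\<close> is linear. This absorbs the
  polynomial cost of a working precision of order \<open>ln n\<close>.\<close>

lemma polylog_le_linear:
 fixes f :: "nat \<Rightarrow> real" and prec :: "nat \<Rightarrow> nat"
 assumes f: "f \<in> O(\<lambda>k. real k ^ e)" and prec: "(\<lambda>n. real (prec n)) \<in> O(\<lambda>n. ln (real n))"
 shows "\<exists>C. \<forall>n\<ge>1. f (prec n) \<le> C * real n"
proof -
 obtain c1 d1 where 1: "0 \<le> c1" "0 \<le> d1" "\<And>k. f k \<le> c1 * real k ^ e + d1"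
  using bigo_nat_bound[OF f] by auto
 have "0 \<le> ln (real n)" for n by (cases n) auto
 then obtain c2 d2 where 2: "0 \<le> c2" "0 \<le> d2" "\<And>n. real (prec n) \<le> c2 * ln (real n) + d2"
  using bigo_nat_bound[OF prec] by auto
 define a where "a = c2 + d2"
 have a: "0 \<le> a" using 2 by (simp add: a_def)
 have "f (prec n) \<le> (c1 * a ^ e * fact e * exp 1 + d1) * real n" if n: "1 \<le> n" for n
 proof -
  define y where "y = ln (real n) + 1"
  have y: "1 \<le> y" using n by (simp add: y_def)
  have "real (prec n) \<le> c2 * ln (real n) + d2" by (rule 2)
  also have "... \<le> a * y" using 2 y n by (simp add: a_def y_def algebra_simps)
  finally have "real (prec n) ^ e \<le> (a * y) ^ e" by (intro power_mono) auto
  also have "... \<le> a ^ e * (fact e * exp y)"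
   unfolding power_mult_distrib using y a by (intro mult_left_mono power_le_fact_exp) auto
  also have "exp y = exp 1 * real n" using n by (simp add: y_def exp_add mult.commute)
  finally have "c1 * real (prec n) ^ e \<le> c1 * (a ^ e * (fact e * (exp 1 * real n)))"
   using 1 by (intro mult_left_mono) auto
  moreover have "d1 \<le> d1 * real n" using 1 n by (simp add: mult_le_cancel_left1)
  ultimately show ?thesis using 1(3)[of "prec n"] by (simp add: algebra_simps)
 qed
 thus ?thesis by blast
qed

definition assemble :: "triple list \<Rightarrow> polya prog" where
 "assemble xs = do { s \<leftarrow> first_min xs; tick (length xs); build_tree (drop s xs @ take s xs) }"

lemma runs_assemble: "runs (assemble xs) (\<lambda>_. True) (2 + 11 * length xs + weights xs)"
proof -
 have "weights (drop s xs @ take s xs) = weights xs" for s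
  by (subst (3) append_take_drop_id[of s xs, symmetric]) (simp only: map_append sum_list_append add.commute)
 moreover have "length (drop s xs @ take s xs) = length xs" for s by simp
 ultimately have "runs (build_tree (drop s xs @ take s xs)) (\<lambda>_. True) (1 + 3 * length xs + weights xs)" for s
  using runs_build_tree[of "drop s xs @ take s xs"] by (simp only:)
 hence "runs (assemble xs) (\<lambda>_. True) ((1 + 7 * length xs) + (length xs + (1 + 3 * length xs + weights xs)))"
  unfolding assemble_def tick_eq
  by (intro runs_pbind[OF runs_first_min _ order_refl] runs_bind_detp[OF _ order_refl])
 thus ?thesis by (rule runs_mono) auto
qed

theorem theorem8p3:
  fixes \<epsilon> q :: real and M0 B :: nat and rho_cost prec :: "nat \<Rightarrow> nat"
  assumes eps: "0 < \<epsilon>"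
    and M0: "\<forall>N\<ge>1. exp (lam \<epsilon> N) < real M0" "\<forall>t. 0 < t \<and> t \<le> rho \<longrightarrow> A_gf t < real M0"
    and q: "rho powr (3 / 4) < q" "q < 1"
    and B: "1 \<le> B" "q\<^sup>2 / (rho * (1 - sqrt rho) * (2 * real B) * (1 - q)) < 1"
    and rho_cost: "\<exists>e. (\<lambda>k. real (rho_cost k)) \<in> O(\<lambda>k. real k ^ e)"
    and prec: "(\<lambda>n. real (prec n)) \<in> O(\<lambda>n. ln (real n))"
  shows "(\<forall>n\<ge>2. runtime (polya_sampler M0 B q \<epsilon> rho_cost prec n)
                   \<in> borel_measurable (tape_measure q)) \<and>
    (\<exists>C. \<forall>n\<ge>2. expected_runtime q (polya_sampler M0 B q \<epsilon> rho_cost prec n)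
                   \<le> ennreal (C * real n))"
proof -
 have P: "polya_params q M0 B" by unfold_locales (use q B M0(2) in auto)
 interpret polya_params q M0 B by (rule P)
 have M0': "exp (lam \<epsilon> N) \<le> real M0" if "1 \<le> N" for N using M0(1) that by (auto intro: less_imp_le)
 have lam0: "0 \<le> lam \<epsilon> N" for N using eps lmax by (simp add: lam_eq)
 obtain Cm where Cm: "0 < Cm" and Cm_bound: "\<forall>N\<ge>1. \<forall>c ds m. pre_ok c (lam \<epsilon> N) \<longrightarrow> sum_list ds = N \<longrightarrow> 1 \<le> length ds \<longrightarrow> length ds \<le> N \<longrightarrow>
  bridge_weight rho (BN c) (lam \<epsilon> N) ds m \<le> Cm / (real N * sqrt (real N))"
  using bridge_weight_bound[OF eps M0'[OF order_refl]] by (elim exE conjE) (rule that)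
 obtain cl where cl: "0 < cl" "\<And>N. 1 \<le> N \<Longrightarrow> cl / (real N * sqrt (real N)) \<le> bridge_sum (N + 2) N 0 0"
  using bridge_sum_lower by blast
 obtain e where e: "(\<lambda>k. real (rho_cost k)) \<in> O(\<lambda>k. real k ^ e)" using rho_cost by blast
 obtain C1 where C1: "\<And>n. 1 \<le> n \<Longrightarrow> real (rho_cost (prec n)) \<le> C1 * real n"
  using polylog_le_linear[OF e prec] by blast
 have "(\<lambda>k. (real k + 1)\<^sup>2) \<in> O(\<lambda>k. real k ^ 2)" by real_asymp
 from polylog_le_linear[OF this prec]
 obtain C2 where C2: "\<And>n. 1 \<le> n \<Longrightarrow> (real (prec n) + 1)\<^sup>2 \<le> C2 * real n" by blast
 define S where "S = polya_sampler M0 B q \<epsilon> rho_cost prec"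
 \<comment> \<open>The bracket covers preprocessing, assembly and fixed costs; the quotient is the
   cost of one round of the bridge sampler over the lower bound for its acceptance
   probability.\<close>
 define C where "C = (C1 + 160 * C2 + 300) + (2 * (samplerQ_cost + 5) + 60) / (cl / Cm)"
 have main: "good q (S n) \<and> val q (S n) (\<lambda>_. 1) = 1 \<and> cst q (S n) \<le> ennreal (C * real n)" if n: "2 \<le> n" for n
 proof -
  define N where "N = n - 1"
  have N: "1 \<le> N" "real N + 1 = real n" using n by (auto simp: N_def)
  note bound = Cm_bound[rule_format, OF N(1)]
  obtain c k where pre: "preprocess \<epsilon> rho_cost (prec n) N = detp c k" "pre_full \<epsilon> Cm N c"
   "k \<le> rho_cost (prec n) + 57 + 160 * (prec n + 1)\<^sup>2 + 160 * N"
   using runs_preprocess[OF N(1) lam0 M0'[OF N(1)] Cm bound, of rho_cost "prec n"] unfolding runs_def by blast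
  have ok: "pre_ok c (lam \<epsilon> N)" using pre(2) by (simp add: pre_full_def)
  note br = N(1) Cm pre(2) bound[OF ok] cl(1) cl(2)[OF N(1)]
  have gb: "good q (bridge_sampler M0 B q c N)" for c
   unfolding bridge_sampler_eq bridge_body_def[symmetric] by (intro good_loop good_bridge_body)
  have ga: "good q (assemble xs)" for xs by (rule runs_good[OF runs_assemble])
  define T where "T c = pbind (bridge_sampler M0 B q c N) assemble" for c
  have gT: "good q (T c)" for c unfolding T_def by (intro good_pbind gb ga)
  have S: "S n = pbind (detp () 1) (\<lambda>_. pbind (detp c k) T)"
   unfolding S_def polya_sampler_def T_def assemble_def N_def[symmetric] pre(1)[symmetric] tick_eq Let_def ..
  have g: "good q (S n)" unfolding S by (intro good_pbind good_detp gT)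
  have vT: "val q (T c) (\<lambda>_. 1) = 1"
  proof -
   have "val q (assemble xs) (\<lambda>_. 1) = 1" for xs using runs_assemble[of xs] by (auto simp: runs_def val_detp)
   thus ?thesis unfolding T_def by (intro mass_pbind gb ga mass_bridge[OF br])
  qed
  have v: "val q (S n) (\<lambda>_. 1) = 1"
   unfolding S by (subst val_detp_bind, intro good_pbind good_detp gT, subst val_detp_bind, rule gT, rule vT)
  define Z where "Z = ((real N + 1) * (samplerQ_cost + 5) + 37 + 20 * real N + 1) / (cl / Cm)"
  have Z0: "0 \<le> Z" unfolding Z_def using samplerQ_cost_nonneg Cm cl(1) by simp
  have cT: "cst q (T c) \<le> ennreal Z + of_nat (13 + 12 * N)"
   unfolding T_def
  proof (rule cst_pbind_le_post[OF gb ga cst_bridge[OF br, folded Z_def] post_bridge[OF N(1)]])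
   fix xs :: "triple list" assume xs: "length xs \<le> N + 1 \<and> weights xs \<le> N"
   have "cst q (assemble xs) \<le> of_nat (2 + 11 * length xs + weights xs)"
    by (rule runs_cst[OF runs_assemble])
   also have "... \<le> of_nat (13 + 12 * N)" using xs by (intro of_nat_mono) simp
   finally show "cst q (assemble xs) \<le> of_nat (13 + 12 * N)" .
  qed
  have "cst q (S n) \<le> of_nat 1 + (of_nat k + (ennreal Z + of_nat (13 + 12 * N)))"
   unfolding S
   by (rule order_trans[OF cst_detp_bind], intro good_pbind good_detp gT, rule add_left_mono,
     rule order_trans[OF cst_detp_bind], rule gT, rule add_left_mono, rule cT)
  also have "... = ennreal (real 1 + (real k + (Z + real (13 + 12 * N))))"
  proof -
   have "ennreal a + (ennreal b + (ennreal c + ennreal d)) = ennreal (a + (b + (c + d)))"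
    if "0 \<le> a" "0 \<le> b" "0 \<le> c" "0 \<le> d" for a b c d :: real
    using that by simp
   thus ?thesis unfolding ennreal_of_nat_eq_real_of_nat using Z0 of_nat_0_le_iff by blast
  qed
  also have "... \<le> ennreal (C * real n)"
  proof (rule ennreal_leI)
   have "real k \<le> real (rho_cost (prec n) + 57 + 160 * (prec n + 1)\<^sup>2 + 160 * N)" using pre(3) by (rule of_nat_mono)
   also have "... = real (rho_cost (prec n)) + 57 + 160 * (real (prec n) + 1)\<^sup>2 + 160 * real N" by simp
   also have "... \<le> C1 * real n + 57 + 160 * (C2 * real n) + 160 * real N"
    using C1[of n] C2[of n] n by (intro add_mono mult_left_mono) auto
   finally have k: "real k \<le> C1 * real n + 57 + 160 * (C2 * real n) + 160 * real N" .
   have "Z \<le> ((2 * (samplerQ_cost + 5) + 60) * real n) / (cl / Cm)"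
    unfolding Z_def
   proof (rule divide_right_mono)
    have "0 \<le> samplerQ_cost * real n" using samplerQ_cost_nonneg by simp
    thus "(real N + 1) * (samplerQ_cost + 5) + 37 + 20 * real N + 1 \<le> (2 * (samplerQ_cost + 5) + 60) * real n"
     using N by (simp add: algebra_simps)
   qed (use cl Cm in simp)
   thus "real 1 + (real k + (Z + real (13 + 12 * N))) \<le> C * real n"
    using k N unfolding C_def by (simp add: algebra_simps)
  qed
  finally show ?thesis using g v by blast
 qed
 show ?thesis
 proof (intro conjI exI[of _ C] allI impI)
  fix n :: nat assume "2 \<le> n"
  note m = main[OF this, unfolded S_def]
  show "runtime (polya_sampler M0 B q \<epsilon> rho_cost prec n) \<in> borel_measurable (tape_measure q)"
   by (rule runtime_eq(1)) (use m in blast)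
  show "expected_runtime q (polya_sampler M0 B q \<epsilon> rho_cost prec n) \<le> ennreal (C * real n)"
   using m runtime_eq(2) by metis
 qed
qed

end
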